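(* Let $\eta$ be a Poisson process on a measurable space $(\mathbb{X},\mathcal{X})$ with $\sigma$-finite intensity measure $\lambda$. Let $F$ be a square-integrable Poisson functional of $\eta$ with $DF\in L^2(\mathbb{P}\otimes\lambda)$, $\mathbb{E}[F]=0$ and $\mathbb{E}[F^2]=1$, let $Z\sim\mathcal{N}(0,1)$, and let $\varphi:\mathbb{R}\to\mathbb{R}$ be an arbitrary measurable function with $0\le\varphi\le1$. Define nonnegative quantities $\gamma_1,\gamma_2,\overline{\gamma}_3,\gamma_4,\gamma_5,\gamma_6$ by $$\gamma_1^2=4\int\mathbb{E}\big[(D_{z_1}F)^2(D_{z_2}F)^2\big]^{1/2}\,\mathbb{E}\big[(D^2_{z_1,z_3}F)^2(D^2_{z_2,z_3}F)^2\big]^{1/2}\,\lambda^3(d(z_1,z_2,z_3)),$$ $$\gamma_2^2=\int\mathbb{E}\big[(D^2_{z_1,z_3}F)^2(D^2_{z_2,z_3}F)^2\big]\,\lambda^3(d(z_1,z_2,z_3)),$$ $$\overline{\gamma}_3=2\int\mathbb{E}\big[(D_zF)^2(1-\varphi(D_zF))^2\big]^{1/2}\,\mathbb{E}\big[|D_zF|^2\big]^{1/2}\,\lambda(dz),$$ $$\gamma_4=\Big(\tfrac12(\mathbb{E}F^4)^{1/4}+\tfrac{\sqrt{2\pi}}{8}\Big)\int\mathbb{E}\big[(D_zF)^4\varphi(D_zF)^2\big]^{1/2}\,\mathbb{E}\big[|D_zF|^4\big]^{1/4}\,\lambda(dz),$$ $$\gamma_5=\sqrt{\int\mathbb{E}\big[\varphi(D_zF)^2(D_zF)^4\big]^{1/2}\,\mathbb{E}\big[(D_zF)^4\big]^{1/2}\,\lambda(dz)},$$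 $$\begin{aligned}\gamma_6^2=3\int\Big(&\mathbb{E}\big[(D_{z_2}(\varphi(D_{z_1}F)D_{z_1}F))^4\big]^{1/2}\,\mathbb{E}\big[|D_{z_1}F|^4\big]^{1/2}\\&+\mathbb{E}\big[\varphi(D_{z_1}F)^2(D_{z_1}F)^4\big]^{1/2}\,\mathbb{E}\big[|D^2_{z_2,z_1}F|^4\big]^{1/2}\\&+\mathbb{E}\big[(D_{z_2}(\varphi(D_{z_1}F)D_{z_1}F))^4\big]^{1/2}\,\mathbb{E}\big[|D^2_{z_2,z_1}F|^4\big]^{1/2}\Big)\,\lambda^2(d(z_1,z_2)).\end{aligned}$$ Then $$d_K(F,Z)\le\gamma_1+\gamma_2+\overline{\gamma}_3+\gamma_4+\gamma_5+\gamma_6 .$$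
   Context: $\mathbf{N}$ denotes the space of integer-valued $\sigma$-finite measures on $\mathbb{X}$, with the $\sigma$-algebra generated by the evaluations $\mu\mapsto\mu(A)$, $A\in\mathcal{X}$; $\eta$ is viewed as a random element of $\mathbf{N}$. A real random variable $F$ is a Poisson functional if $F=\phi(\eta)$ a.s. for some measurable $\phi:\mathbf{N}\to\mathbb{R}$. Its Malliavin derivative (difference operator) in direction $z\in\mathbb{X}$ is $D_zF=\phi(\eta+\delta_z)-\phi(\eta)$, and the second-order derivative is $D^2_{z_1,z_2}F=D_{z_1}(D_{z_2}F)=\phi(\eta+\delta_{z_1}+\delta_{z_2})-\phi(\eta+\delta_{z_1})-\phi(\eta+\delta_{z_2})+\phi(\eta)$, where $\delta_z$ is the Dirac measure at $z$. $DF\in L^2(\mathbb{P}\otimes\lambda)$ means that $(\omega,z)\mapsto D_zF(\omega)$ is square integrable with respect to $\mathbb{P}\otimes\lambda$. Notation: $\mathbb{E}[Y]^{r}=(\mathbb{E}[Y])^{r}$, and $\lambda^k$ is the $k$-fold product measure. The Kolmogorov distance is $d_K(F,Z)=\sup_{x\in\mathbb{R}}|\mathbb{P}(F\le x)-\mathbb{P}(Z\le x)|$. *)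

theory Defs
  imports "HOL-Probability.Probability"
begin

definition integer_valued_measure :: "'x measure \<Rightarrow> bool" where
  "integer_valued_measure \<mu> \<longleftrightarrow> (\<forall>A\<in>sets \<mu>. emeasure \<mu> A \<in> \<nat> \<union> {\<infinity>})"

text \<open>The measurable space of integer-valued sigma-finite measures on the measurable space
  underlying \<open>M\<close> (only \<open>sets M\<close> matters), with the sigma-algebra generated by the evaluations;
  built in the same way as \<^const>\<open>subprob_algebra\<close>.\<close>

definition counting_measures :: "'x measure \<Rightarrow> 'x measure measure" where
  "counting_measures M =
    (SUP A \<in> sets M. vimage_algebra
       {\<mu>. sets \<mu> = sets M \<and> sigma_finite_measure \<mu> \<and> integer_valued_measure \<mu>}
       (\<lambda>\<mu>. emeasure \<mu> A) borel)"

text \<open>The Poisson law is written out because \<^const>\<open>poisson_pmf\<close> requires a positive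
  parameter, whereas sets of measure zero are needed here as well. A set of infinite intensity
  carries infinitely many points almost surely.\<close>

definition poisson_process :: "'w measure \<Rightarrow> 'x measure \<Rightarrow> ('w \<Rightarrow> 'x measure) \<Rightarrow> bool" where
  "poisson_process P M \<eta> \<longleftrightarrow>
     \<eta> \<in> P \<rightarrow>\<^sub>M counting_measures M \<and>
     (\<forall>A\<in>sets M. emeasure M A < \<infinity> \<longrightarrow>
        (\<forall>k::nat. measure P {\<omega>\<in>space P. emeasure (\<eta> \<omega>) A = of_nat k} =
           measure M A ^ k / fact k * exp (- measure M A))) \<and>
     (\<forall>A\<in>sets M. emeasure M A = \<infinity> \<longrightarrow> (AE \<omega> in P. emeasure (\<eta> \<omega>) A = \<infinity>)) \<and>
     (\<forall>(n::nat) A. A ` {..<n} \<subseteq> sets M \<and> disjoint_family_on A {..<n} \<longrightarrow>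
        prob_space.indep_vars P (\<lambda>_. borel) (\<lambda>i \<omega>. emeasure (\<eta> \<omega>) (A i)) {..<n})"

text \<open>\<open>poisson_functional_rep P M \<eta> \<phi> F\<close>: the real random variable \<open>F\<close> is a Poisson
  functional with representative \<open>\<phi>\<close>.\<close>

definition poisson_functional_rep ::
  "'w measure \<Rightarrow> 'x measure \<Rightarrow> ('w \<Rightarrow> 'x measure) \<Rightarrow> ('x measure \<Rightarrow> real) \<Rightarrow> ('w \<Rightarrow> real) \<Rightarrow> bool" where
  "poisson_functional_rep P M \<eta> \<phi> F \<longleftrightarrow>
     F \<in> borel_measurable P \<and> \<phi> \<in> borel_measurable (counting_measures M) \<and>
     (AE \<omega> in P. F \<omega> = \<phi> (\<eta> \<omega>))"

definition add_point :: "'x measure \<Rightarrow> 'x \<Rightarrow> 'x measure" where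
  "add_point \<mu> z =
     measure_of (space \<mu>) (sets \<mu>) (\<lambda>A. emeasure \<mu> A + emeasure (return \<mu> z) A)"

text \<open>The difference operator acts on representatives: for \<open>F = \<phi>(\<eta>)\<close>, the derivative
  \<open>D\<^sub>z F\<close> is the random variable \<open>\<lambda>\<omega>. diff_op z \<phi> (\<eta> \<omega>)\<close>.\<close>

definition diff_op :: "'x \<Rightarrow> ('x measure \<Rightarrow> real) \<Rightarrow> 'x measure \<Rightarrow> real" where
  "diff_op z \<phi> \<mu> = \<phi> (add_point \<mu> z) - \<phi> \<mu>"

definition diff2_op :: "'x \<Rightarrow> 'x \<Rightarrow> ('x measure \<Rightarrow> real) \<Rightarrow> 'x measure \<Rightarrow> real" where
  "diff2_op z1 z2 \<phi> = diff_op z1 (diff_op z2 \<phi>)"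

text \<open>Expectations of nonnegative variables and their roots may be infinite, so they live in
  \<^typ>\<open>ennreal\<close>, with the measure-theoretic convention \<open>0 * \<infinity> = 0\<close>. The power
  \<open>epowr\<close> is only meant for exponents \<open>r > 0\<close>.\<close>

definition nn_expect :: "'w measure \<Rightarrow> ('w \<Rightarrow> real) \<Rightarrow> ennreal" where
  "nn_expect P Y = (\<integral>\<^sup>+\<omega>. ennreal (Y \<omega>) \<partial>P)"

definition epowr :: "ennreal \<Rightarrow> real \<Rightarrow> ennreal" where
  "epowr x r = (if x = \<infinity> then \<infinity> else ennreal (enn2real x powr r))"

definition gamma1 :: "'w measure \<Rightarrow> 'x measure \<Rightarrow> ('w \<Rightarrow> 'x measure) \<Rightarrow> ('x measure \<Rightarrow> real) \<Rightarrow> ennreal" where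
  "gamma1 P M \<eta> \<phi> = epowr
     (4 * (\<integral>\<^sup>+(z1, z2, z3).
        epowr (nn_expect P (\<lambda>\<omega>. (diff_op z1 \<phi> (\<eta> \<omega>))^2 * (diff_op z2 \<phi> (\<eta> \<omega>))^2)) (1/2) *
        epowr (nn_expect P (\<lambda>\<omega>. (diff2_op z1 z3 \<phi> (\<eta> \<omega>))^2 * (diff2_op z2 z3 \<phi> (\<eta> \<omega>))^2)) (1/2)
      \<partial>(M \<Otimes>\<^sub>M M \<Otimes>\<^sub>M M))) (1/2)"

definition gamma2 :: "'w measure \<Rightarrow> 'x measure \<Rightarrow> ('w \<Rightarrow> 'x measure) \<Rightarrow> ('x measure \<Rightarrow> real) \<Rightarrow> ennreal" where
  "gamma2 P M \<eta> \<phi> = epowr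
     (\<integral>\<^sup>+(z1, z2, z3).
        nn_expect P (\<lambda>\<omega>. (diff2_op z1 z3 \<phi> (\<eta> \<omega>))^2 * (diff2_op z2 z3 \<phi> (\<eta> \<omega>))^2)
      \<partial>(M \<Otimes>\<^sub>M M \<Otimes>\<^sub>M M)) (1/2)"

text \<open>In the remaining quantities, \<open>u\<close> is the cut-off function.\<close>

definition gamma3_bar ::
  "'w measure \<Rightarrow> 'x measure \<Rightarrow> ('w \<Rightarrow> 'x measure) \<Rightarrow> ('x measure \<Rightarrow> real) \<Rightarrow> (real \<Rightarrow> real) \<Rightarrow> ennreal" where
  "gamma3_bar P M \<eta> \<phi> u =
     2 * (\<integral>\<^sup>+z.
        epowr (nn_expect P (\<lambda>\<omega>. (diff_op z \<phi> (\<eta> \<omega>))^2 * (1 - u (diff_op z \<phi> (\<eta> \<omega>)))^2)) (1/2) *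
        epowr (nn_expect P (\<lambda>\<omega>. \<bar>diff_op z \<phi> (\<eta> \<omega>)\<bar>^2)) (1/2)
      \<partial>M)"

definition gamma4 ::
  "'w measure \<Rightarrow> 'x measure \<Rightarrow> ('w \<Rightarrow> 'x measure) \<Rightarrow> ('x measure \<Rightarrow> real) \<Rightarrow> ('w \<Rightarrow> real) \<Rightarrow>
   (real \<Rightarrow> real) \<Rightarrow> ennreal" where
  "gamma4 P M \<eta> \<phi> F u =
     (ennreal (1/2) * epowr (nn_expect P (\<lambda>\<omega>. (F \<omega>)^4)) (1/4) + ennreal (sqrt (2 * pi) / 8)) *
     (\<integral>\<^sup>+z.
        epowr (nn_expect P (\<lambda>\<omega>. (diff_op z \<phi> (\<eta> \<omega>))^4 * (u (diff_op z \<phi> (\<eta> \<omega>)))^2)) (1/2) *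
        epowr (nn_expect P (\<lambda>\<omega>. \<bar>diff_op z \<phi> (\<eta> \<omega>)\<bar>^4)) (1/4)
      \<partial>M)"

definition gamma5 ::
  "'w measure \<Rightarrow> 'x measure \<Rightarrow> ('w \<Rightarrow> 'x measure) \<Rightarrow> ('x measure \<Rightarrow> real) \<Rightarrow> (real \<Rightarrow> real) \<Rightarrow> ennreal" where
  "gamma5 P M \<eta> \<phi> u = epowr
     (\<integral>\<^sup>+z.
        epowr (nn_expect P (\<lambda>\<omega>. (u (diff_op z \<phi> (\<eta> \<omega>)))^2 * (diff_op z \<phi> (\<eta> \<omega>))^4)) (1/2) *
        epowr (nn_expect P (\<lambda>\<omega>. (diff_op z \<phi> (\<eta> \<omega>))^4)) (1/2)
      \<partial>M) (1/2)"

definition gamma6 ::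
  "'w measure \<Rightarrow> 'x measure \<Rightarrow> ('w \<Rightarrow> 'x measure) \<Rightarrow> ('x measure \<Rightarrow> real) \<Rightarrow> (real \<Rightarrow> real) \<Rightarrow> ennreal" where
  "gamma6 P M \<eta> \<phi> u = epowr
     (3 * (\<integral>\<^sup>+(z1, z2).
        (let cut = (\<lambda>\<mu>. u (diff_op z1 \<phi> \<mu>) * diff_op z1 \<phi> \<mu>) in
          epowr (nn_expect P (\<lambda>\<omega>. (diff_op z2 cut (\<eta> \<omega>))^4)) (1/2) *
          epowr (nn_expect P (\<lambda>\<omega>. \<bar>diff_op z1 \<phi> (\<eta> \<omega>)\<bar>^4)) (1/2)
        + epowr (nn_expect P (\<lambda>\<omega>. (u (diff_op z1 \<phi> (\<eta> \<omega>)))^2 * (diff_op z1 \<phi> (\<eta> \<omega>))^4)) (1/2) *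
          epowr (nn_expect P (\<lambda>\<omega>. \<bar>diff2_op z2 z1 \<phi> (\<eta> \<omega>)\<bar>^4)) (1/2)
        + epowr (nn_expect P (\<lambda>\<omega>. (diff_op z2 cut (\<eta> \<omega>))^4)) (1/2) *
          epowr (nn_expect P (\<lambda>\<omega>. \<bar>diff2_op z2 z1 \<phi> (\<eta> \<omega>)\<bar>^4)) (1/2))
      \<partial>(M \<Otimes>\<^sub>M M))) (1/2)"

text \<open>The two random variables may live on different probability spaces.\<close>

definition kolmogorov_dist ::
  "'w measure \<Rightarrow> ('w \<Rightarrow> real) \<Rightarrow> 'v measure \<Rightarrow> ('v \<Rightarrow> real) \<Rightarrow> real" where
  "kolmogorov_dist P F Q Z =
     (SUP x::real. \<bar>measure P {\<omega>\<in>space P. F \<omega> \<le> x} - measure Q {\<omega>\<in>space Q. Z \<omega> \<le> x}\<bar>)"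

end

theory Submission
 imports Defs "HOL-Real_Asymp.Real_Asymp"
begin

text \<open>For each \<open>x\<close> Stein's equation has the bounded solution \<open>stein_f x\<close> with derivative \<open>stein_g x\<close>, and
 \<open>P (F \<le> x) - std_cdf x\<close> is the expectation of \<open>stein_g x F - F * stein_f x F\<close>. This difference has to be
 bounded uniformly in \<open>x\<close>.

 Let first the intensity \<open>L\<close> be finite, so that the process is a random list. The covariance of \<open>F\<close> and \<open>G\<close> is
 the integral over \<open>s\<close> from \<open>0\<close> to \<open>1\<close> of \<open>gamma_form F G s\<close>, the expectation of the integral over \<open>z\<close> of
 \<open>D\<^sub>z F (Y) * D\<^sub>z G (X)\<close>, where \<open>X\<close> and \<open>Y\<close> are Poisson processes with intensity \<open>L\<close> that have a part of intensity
 \<open>s L\<close> in common and are independent otherwise (\<open>covariance_bound\<close>). The pair is a single Poisson process with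
 the marks \<open>Both\<close>, \<open>First\<close> and \<open>Second\<close>, so that every estimate for functionals of one process also applies to
 functionals of the pair; this takes the place of the inverse Ornstein-Uhlenbeck generator and of Mehler's formula.

 The formula is used for \<open>G = a * F - stein_f x F\<close>, where \<open>a\<close> is the mean of \<open>stein_g x F\<close>. Expanding \<open>stein_f x\<close> at
 \<open>F\<close> splits \<open>D\<^sub>z G\<close> into \<open>(a - stein_g x F) * D\<^sub>z F\<close> and the remainder of the expansion.
 \<^item> In the first part only the fluctuation of \<open>carre\<close>, the integral of \<open>D\<^sub>z F (Y) * D\<^sub>z F (X)\<close>, enters, because
  \<open>a - stein_g x F\<close> is centred and bounded. The Poincare inequality for the marked process bounds it by the
  integrated squares of its differences, and these by the first two quantities (\<open>energy_carre_le_gamma\<close>).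
 \<^item> In the remainder the increments are split by the cut-off. Where it vanishes, the Lipschitz bound gives the
  third quantity. Where it does not, the quadratic part of the remainder gives the fourth.
 \<^item> The derivative of \<open>stein_f x\<close> jumps at \<open>x\<close>, which leaves \<open>D\<^sub>z F\<close> times the difference of the indicator of
  \<open>{x <..}\<close> at \<open>F\<close>. As this product is nonnegative, its weighted integral is the pairing of a kernel with the gradient
  of an indicator, hence an expectation of the Skorohod integral of the kernel, whose second moment gives the
  last two quantities (\<open>skorohod_estimate\<close>, \<open>remainder56\<close>).

 For general intensity let \<open>E k\<close> be sets of finite measure that increase to the space. Replacing the
 points inside \<open>E k\<close> by an independent Poisson process preserves the law (\<open>resampling\<close>), so that the finite
 case applies with the points outside \<open>E k\<close> as a parameter. All quantities then only decrease, because they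
 are integrals over \<open>E k\<close> of the same moments. Conditionally on the parameter the functional no longer has mean
 \<open>0\<close> and variance \<open>1\<close>, but the error vanishes as \<open>k\<close> tends to infinity, because the conditional expectation of an
 integrable functional given the points outside \<open>E k\<close> converges to its expectation (\<open>zero_one_law\<close>).\<close>

text \<open>Iterated integrals are the bulk of the formulas. \<open>NINT\<close> is the notation \<open>LINT\<close> for
 nonnegative integrals; \<open>rt\<close> is the square root,
 and the other abbreviations keep the formulas on one line.\<close>

syntax "_NINT" :: "pttrn => 'a measure => ennreal => ennreal" ("(NINT (1_)/|(_)./ _)" [0, 61, 60] 60)
translations "NINT x|M. f" == "CONST nn_integral M (%x. f)"
notation pair_measure (infixr "><" 80)
abbreviation bmeas where "bmeas M \<equiv> borel_measurable M"
notation measurable (infixr "->M" 60)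
abbreviation "CM \<equiv> counting_measures"
abbreviation "nnE \<equiv> nn_expect"
abbreviation "rt x \<equiv> epowr x (1/2)"
lemmas Bcong = Bochner_Integration.integral_cong[OF refl]
lemmas Bbound = Bochner_Integration.integrable_bound
lemmas Bdiff = Bochner_Integration.integral_diff
lemmas Bidiff = Bochner_Integration.integrable_diff
lemmas Biadd = Bochner_Integration.integrable_add
lemmas Badd = Bochner_Integration.integral_add
lemmas Bnonneg = Bochner_Integration.integral_nonneg
abbreviation "eabs x \<equiv> ennreal \<bar>x\<bar>"

section \<open>Extended nonnegative integrals\<close>

lemma suminf_swap_ennreal:
 fixes a :: "nat => nat => ennreal"
 shows "(\<Sum>i. \<Sum>j. a i j) = (\<Sum>j. \<Sum>i. a i j)"
proof -
 have "(\<Sum>i. \<Sum>j. a i j) = (NINT i|count_space UNIV. (\<Sum>j. a i j))"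
  by (simp add: nn_integral_count_space_nat)
 also have "... = (\<Sum>j. NINT i|count_space UNIV. a i j)"
  by (rule nn_integral_suminf) simp
 finally show ?thesis by (simp add: nn_integral_count_space_nat)
qed

text \<open>The Cauchy product, for the convolution of two Poisson weights.\<close>

lemma suminf_antidiagonal_ennreal:
 fixes a :: "nat => nat => ennreal"
 shows "(\<Sum>n. \<Sum>j\<le>n. a j (n - j)) = (\<Sum>i. \<Sum>j. a i j)"
proof -
 have "(\<Sum>n. \<Sum>j\<le>n. a j (n - j)) = (\<Sum>n. \<Sum>j. if j <= n then a j (n - j) else 0)"
 proof (rule suminf_cong)
  fix n
  have "(\<Sum>j. if j <= n then a j (n - j) else 0) = (\<Sum>j\<in>{..n}. if j <= n then a j (n - j) else 0)"
   by (rule suminf_finite) auto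
  then show "(\<Sum>j\<le>n. a j (n - j)) = (\<Sum>j. if j <= n then a j (n - j) else 0)"
   by simp
 qed
 also have "... = (\<Sum>j. \<Sum>n. if j <= n then a j (n - j) else 0)"
  by (rule suminf_swap_ennreal)
 also have "... = (\<Sum>j. \<Sum>k. a j k)"
 proof (rule suminf_cong)
  fix j
  have "(\<Sum>n. if j <= n then a j (n - j) else 0)
    = (\<Sum>n. if j <= n + j then a j (n + j - j) else 0) + (\<Sum>n<j. if j <= n then a j (n - j) else 0)"
   by (rule suminf_offset) simp
  then show "(\<Sum>n. if j <= n then a j (n - j) else 0) = (\<Sum>k. a j k)" by simp
 qed
 finally show ?thesis .
qed

lemma epowr_half_mult_self: "rt x * rt x = x"
proof (cases x)
 case (real r)
 then show ?thesis
  by (auto simp: epowr_def ennreal_mult[symmetric] powr_add[symmetric])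
qed (simp add: epowr_def ennreal_top_mult)

lemma epowr_half_power2: "(rt x)^2 = x"
 by (simp add: power2_eq_square epowr_half_mult_self)

lemma epowr_ennreal: "0 <= a ==> epowr (ennreal a) r = ennreal (a powr r)"
 by (simp add: epowr_def)

lemma epowr_half_square: "rt (x * x) = x"
proof (cases x)
 case (real r)
 then show ?thesis
  by (auto simp: epowr_ennreal ennreal_mult[symmetric] powr_half_sqrt)
qed (simp add: epowr_def ennreal_top_mult)

lemma epowr_half_power2': "rt (x^2) = x"
 by (simp add: power2_eq_square epowr_half_square)

lemma epowr_mono: "x <= y ==> 0 <= r ==> epowr x r <= epowr y r"
proof (cases y)
 case (real b)
 assume *: "x <= y" "0 <= r"
 with real obtain a where a: "x = ennreal a" "0 <= a" "a <= b"
  by (cases x) (auto simp: top_unique)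
 with real * show ?thesis by (auto simp: epowr_ennreal intro!: ennreal_leI powr_mono2)
qed (simp add: epowr_def)

lemma epowr_0 [simp]: "epowr 0 r = 0"
 by (simp add: epowr_def)

lemma epowr_mult:
 assumes "0 < r" shows "epowr (x * y) r = epowr x r * epowr y r"
proof -
 have *: "epowr (\<infinity> * z) r = \<infinity> * epowr z r" for z :: ennreal
 proof (cases "z = 0")
  case False
  then have "\<infinity> * z = \<infinity>" by (simp add: ennreal_top_mult)
  moreover have "epowr z r \<noteq> 0"
   using False by (cases z) (auto simp: epowr_def)
  ultimately show ?thesis by (simp add: epowr_def ennreal_top_mult)
 qed simp
 show ?thesis
 proof (cases "x = \<infinity> \<or> y = \<infinity>")
  case True
  then show ?thesis
   using *[of x] *[of y] by (auto simp: mult.commute epowr_def)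
 next
  case False
  then obtain a b where "x = ennreal a" "y = ennreal b" "0 <= a" "0 <= b"
   by (cases x; cases y) auto
  then show ?thesis by (simp add: epowr_ennreal ennreal_mult[symmetric] powr_mult)
 qed
qed

lemma epowr_quarter: "epowr x (1/4) = rt (rt x)"
 by (cases x) (auto simp: epowr_ennreal powr_powr, simp add: epowr_def)

lemma epowr_half_le_iff: "rt x <= y \<longleftrightarrow> x <= y^2"
proof
 assume "rt x <= y"
 then have "(rt x)^2 <= y^2" by (intro power_mono) auto
 then show "x <= y^2" by (simp add: epowr_half_power2)
next
 assume "x <= y^2"
 then have "rt x <= rt (y^2)" by (intro epowr_mono) auto
 then show "rt x <= y" by (simp add: epowr_half_power2')
qed

lemma epowr_half_add_le: "rt (x + y) <= rt x + rt y"
 unfolding epowr_half_le_iff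
 by (simp add: power2_sum epowr_half_power2 add_increasing2)

lemma epowr_half_4: "rt (4 * x) = 2 * rt x"
 using epowr_half_square[of 2] by (simp add: epowr_mult)

lemma epowr_measurable [measurable]:
 "(%x. epowr x r) : bmeas borel"
 unfolding epowr_def by measurable

lemma nn_integral_Cauchy_Schwarz:
 assumes [measurable]: "f : bmeas M" "g : bmeas M"
 shows "(NINT x|M. f x * g x) <= rt (NINT x|M. (f x)^2) * rt (NINT x|M. (g x)^2)"
proof -
 have "rt ((NINT x|M. f x * g x)^2) <= rt ((NINT x|M. (f x)^2) * (NINT x|M. (g x)^2))"
  by (intro epowr_mono Cauchy_Schwarz_nn_integral) auto
 then show ?thesis by (simp add: epowr_half_power2' epowr_mult)
qed

lemma nn_integral_Minkowski:
 assumes [measurable]: "f : bmeas M" "g : bmeas M"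
 shows "rt (NINT x|M. (f x + g x)^2)
    <= rt (NINT x|M. (f x)^2) + rt (NINT x|M. (g x)^2)"
proof -
 have "(NINT x|M. (f x + g x)^2) = (NINT x|M. (f x)^2) + (NINT x|M. (g x)^2) + 2 * (NINT x|M. f x * g x)"
  by (simp add: power2_sum nn_integral_add nn_integral_cmult mult.assoc)
 also have "... <= (rt (NINT x|M. (f x)^2) + rt (NINT x|M. (g x)^2))^2"
  using mult_left_mono[OF nn_integral_Cauchy_Schwarz[OF assms], of 2]
  by (simp add: power2_sum epowr_half_power2 mult.assoc)
 finally show ?thesis by (simp add: epowr_half_le_iff)
qed

text \<open>Jensen's inequality for the square root.\<close>

lemma (in prob_space) nn_integral_le_sqrt:
 assumes [measurable]: "f : bmeas M"
 shows "(NINT x|M. f x) <= rt (NINT x|M. (f x)^2)"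
 using nn_integral_Cauchy_Schwarz[of f M "%_. 1"]
 by (simp add: emeasure_space_1 epowr_ennreal[of 1, simplified])

section \<open>The Stein equation for half-lines\<close>

definition std_cdf where
 "std_cdf x = measure std_normal_distribution {..x}"

abbreviation "phi \<equiv> std_normal_density"

lemma phi_pos: "0 < phi x" by (simp add: normal_density_pos)

lemma phi_eq: "phi x = exp (- (x^2) / 2) / sqrt (2 * pi)"
 by (simp add: std_normal_density_def)

lemma phi_minus: "phi (- x) = phi x" by (simp add: phi_eq)

lemma DERIV_phi: "(phi has_real_derivative - x * phi x) (at x)"
proof -
 have "((%x. exp (- (x^2) / 2)) has_real_derivative - x * exp (- (x^2) / 2)) (at x)"
  by (auto intro!: derivative_eq_intros)
 from DERIV_cdivide[OF this, of "sqrt (2 * pi)"] show ?thesis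
  by (simp add: phi_eq [abs_def])
qed

lemma phi_antimono: "0 <= x ==> x <= y ==> phi y <= phi x"
 by (auto simp: phi_eq intro!: divide_right_mono power_mono)

lemma std_cdf_eq_cdf: "std_cdf = cdf std_normal_distribution"
 by (auto simp: std_cdf_def cdf_def)

lemma std_cdf_nonneg: "0 <= std_cdf x" by (simp add: std_cdf_def)

lemma std_cdf_le_1: "std_cdf x <= 1"
 unfolding std_cdf_def using prob_space.prob_le_1[OF prob_space_normal_density[of 1 0]] by simp

lemma std_cdf_mono: "x <= y ==> std_cdf x <= std_cdf y"
 unfolding std_cdf_eq_cdf
 by (intro finite_borel_measure.cdf_nondecreasing real_distribution.finite_borel_measure_M real_dist_normal_dist)

lemma std_cdf_at_top: "(std_cdf \<longlongrightarrow> 1) at_top"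
 unfolding std_cdf_eq_cdf by (rule real_distribution.cdf_lim_at_top_prob[OF real_dist_normal_dist])

lemma emeasure_std_normal: "A : sets borel ==> emeasure std_normal_distribution A = (NINT x|lborel. ennreal (phi x) * indicator A x)"
 by (subst emeasure_density) auto

lemma std_cdf_diff:
 assumes "x <= y"
 shows "std_cdf y - std_cdf x = integral {x..y} phi"
proof -
 interpret real_distribution std_normal_distribution by (rule real_dist_normal_dist)
 have cont: "continuous_on {x..y} phi"
  unfolding phi_eq [abs_def] by (intro continuous_intros) auto
 have diff: "std_cdf y - std_cdf x = measure std_normal_distribution {x<..y}"
 proof -
  have "measure std_normal_distribution {..y} = measure std_normal_distribution ({..x} \<union> {x<..y})"
   using assms by (simp add: ivl_disj_un)
  also have "... = measure std_normal_distribution {..x} + measure std_normal_distribution {x<..y}"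
   by (rule finite_measure_Union) auto
  finally show ?thesis by (simp add: std_cdf_def)
 qed
 have "emeasure std_normal_distribution {x<..y} = (NINT t|lborel. ennreal (phi t) * indicator {x..y} t)"
 proof -
  have "AE t in lborel. t \<noteq> x" by (rule AE_lborel_singleton)
  then show ?thesis
   by (subst emeasure_std_normal) (auto intro!: nn_integral_cong_AE split: split_indicator)
 qed
 also have "... = ennreal (integral {x..y} phi)"
  by (rule nn_integral_has_integral_lebesgue'[OF _ integrable_integral[OF integrable_continuous_interval[OF cont]]])
    (simp add: less_imp_le[OF phi_pos])
 finally have "measure std_normal_distribution {x<..y} = enn2real (ennreal (integral {x..y} phi))"
  by (simp add: measure_def)
 then show ?thesis
  using diff
  by (simp add: integral_nonneg integrable_continuous_interval[OF cont] less_imp_le[OF phi_pos])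
qed

lemma DERIV_std_cdf: "(std_cdf has_real_derivative phi x) (at x)"
proof -
 have cont: "continuous_on {x - 1..x + 1} phi"
  unfolding phi_eq [abs_def] by (intro continuous_intros) auto
 have "((%y. integral {x - 1..y} phi) has_real_derivative phi x) (at x within {x - 1..x + 1})"
  by (rule integral_has_real_derivative[OF cont]) auto
 then have "((%y. std_cdf (x - 1) + integral {x - 1..y} phi) has_real_derivative phi x) (at x within {x - 1<..<x + 1})"
  by (auto intro!: derivative_eq_intros elim!: DERIV_subset)
 then have "(std_cdf has_real_derivative phi x) (at x within {x - 1<..<x + 1})"
 proof (rule has_field_derivative_transform_within[where d = 1])
  fix y assume "y : {x - 1<..<x + 1}" "dist y x < 1"
  then show "std_cdf (x - 1) + integral {x - 1..y} phi = std_cdf y"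
   using std_cdf_diff[of "x - 1" y] by auto
 qed auto
 then show ?thesis by (subst (asm) at_within_open) auto
qed

lemma std_cdf_minus: "std_cdf (- x) = 1 - std_cdf x"
proof -
 interpret real_distribution std_normal_distribution by (rule real_dist_normal_dist)
 have "emeasure std_normal_distribution {..- x} = (NINT t|lborel. ennreal (phi t) * indicator {..-x} t)"
  by (simp add: emeasure_std_normal)
 also have "... = (NINT t|lborel. ennreal (phi (- t)) * indicator {..-x} (- t))"
  using nn_integral_real_affine[of "%t. ennreal (phi t) * indicator {..-x} t" "-1" 0] by simp
 also have "... = (NINT t|lborel. ennreal (phi t) * indicator {x<..} t)"
 proof -
  have "AE t in lborel. t \<noteq> x" by (rule AE_lborel_singleton)
  then show ?thesis
   by (auto intro!: nn_integral_cong_AE simp: phi_minus split: split_indicator)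
 qed
 also have "... = emeasure std_normal_distribution {x<..}"
  by (simp add: emeasure_std_normal)
 finally have "std_cdf (- x) = measure std_normal_distribution {x<..}"
  by (simp add: std_cdf_def measure_def)
 also have "{x<..} = space std_normal_distribution - {..x}" by auto
 also have "measure std_normal_distribution ... = 1 - std_cdf x"
  unfolding std_cdf_def by (rule prob_compl) auto
 finally show ?thesis .
qed

text \<open>Mills' inequality: both sides vanish at infinity, and the difference \<open>phi w / w - (1 - std_cdf w)\<close>
 has derivative \<open>- phi w / w^2\<close>.\<close>

lemma Mills_pos:
 assumes "0 <= w" shows "w * (1 - std_cdf w) <= phi w"
proof (cases "w = 0")
 case False
 with assms have w: "0 < w" by simp
 have "0 < phi w / w - (1 - std_cdf w)"
 proof (rule DERIV_neg_imp_decreasing_at_top[where f = "%w. phi w / w - (1 - std_cdf w)"])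
  fix x assume "w <= x"
  with w have x: "0 < x" by simp
  have "((%w. phi w / w - (1 - std_cdf w)) has_real_derivative - phi x / x^2) (at x)"
   using x by (auto intro!: derivative_eq_intros DERIV_phi DERIV_std_cdf simp: field_simps power2_eq_square)
  moreover have "- phi x / x^2 < 0" using x phi_pos[of x] by simp
  ultimately show "\<exists>y. ((%w. phi w / w - (1 - std_cdf w)) has_real_derivative y) (at x) \<and> y < 0" by blast
 next
  have "((%w. phi w / w) \<longlongrightarrow> 0) at_top" unfolding phi_eq [abs_def] by real_asymp
  from tendsto_diff[OF this tendsto_diff[OF tendsto_const[of 1] std_cdf_at_top]]
  show "((%w. phi w / w - (1 - std_cdf w)) \<longlongrightarrow> 0) at_top" by simp
 qed
 with w show ?thesis by (simp add: field_simps)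
qed (simp add: less_imp_le[OF phi_pos])

lemma Mills_neg: "w <= 0 ==> - w * std_cdf w <= phi w"
 using Mills_pos[of "- w"] by (simp add: std_cdf_minus phi_minus)

lemma std_cdf_0: "std_cdf 0 = 1/2"
 using std_cdf_minus[of 0] by simp

text \<open>On the half-line the cdf is concave, so its chord slopes \<open>(std_cdf w - 1/2) / w\<close> decrease; hence
 \<open>exp (- (w^2) / 2) / 4 - std_cdf w * (1 - std_cdf w)\<close> first increases and then decreases to \<open>0\<close>.\<close>

lemma std_cdf_product_le_pos:
 assumes "0 <= w" shows "std_cdf w * (1 - std_cdf w) <= exp (- (w^2) / 2) / 4"
proof -
 define b where "b = (%w. 2 * std_cdf w - 1 - w * sqrt (2 * pi) / 4)"
 define q where "q = (%w. exp (- (w^2) / 2) / 4 - std_cdf w * (1 - std_cdf w))"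
 have q: "(q has_real_derivative phi x * b x) (at x)" for x
 proof -
  have "q = (%w. sqrt (2 * pi) / 4 * phi w - std_cdf w * (1 - std_cdf w))"
   by (simp add: q_def phi_eq)
  then show ?thesis
   by (auto intro!: derivative_eq_intros DERIV_std_cdf DERIV_phi simp: b_def algebra_simps)
 qed
 have slope: "v * b w \<ge> w * b v" if wv: "0 < w" "w < v" for w v
 proof -
  obtain \<xi> where \<xi>: "0 < \<xi>" "\<xi> < w" "std_cdf w - std_cdf 0 = (w - 0) * phi \<xi>"
   using MVT2[OF wv(1), of std_cdf phi] DERIV_std_cdf by blast
  obtain \<zeta> where \<zeta>: "w < \<zeta>" "\<zeta> < v" "std_cdf v - std_cdf w = (v - w) * phi \<zeta>"
   using MVT2[OF wv(2), of std_cdf phi] DERIV_std_cdf by blast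
  have "w * (std_cdf v - std_cdf w) = (v - w) * w * phi \<zeta>" using \<zeta> by simp
  also have "... <= (v - w) * w * phi \<xi>"
   using wv \<xi> \<zeta> by (intro mult_left_mono phi_antimono) auto
  also have "... = (v - w) * (std_cdf w - 1/2)" using \<xi> by (simp add: std_cdf_0)
  finally have "w * (std_cdf v - std_cdf w) <= (v - w) * (std_cdf w - 1/2)" .
  then show ?thesis by (simp add: b_def field_simps)
 qed
 show ?thesis
 proof (cases "w = 0")
  case False
  with assms have w: "0 < w" by simp
  have "0 <= q w"
  proof (cases "0 <= b w")
   case True
   have "q 0 <= q w"
   proof (rule DERIV_nonneg_imp_increasing_open[OF assms])
    fix x assume x: "0 < x" "x < w"
    have "0 <= x * b w" using x True by simp
    also have "... <= w * b x" using slope[OF x] by simp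
    finally have "0 <= b x" using w by (simp add: zero_le_mult_iff)
    then show "\<exists>y. (q has_real_derivative y) (at x) \<and> 0 <= y"
     using q phi_pos[of x] by (intro exI[of _ "phi x * b x"]) auto
   qed (auto intro!: continuous_at_imp_continuous_on DERIV_isCont[OF q])
   then show ?thesis by (simp add: q_def std_cdf_0)
  next
   case False
   have "0 < q w"
   proof (rule DERIV_neg_imp_decreasing_at_top[where f = q])
    fix x assume x: "w <= x"
    have "b x < 0"
    proof (cases "x = w")
     case c: False
     have "w * b x <= x * b w" using slope[of w x] w x c by simp
     also have "... < 0" using False x w by (intro mult_pos_neg) auto
     finally show ?thesis using w by (simp add: mult_less_0_iff)
    qed (use False in simp)
    then show "\<exists>y. (q has_real_derivative y) (at x) \<and> y < 0"
     using q phi_pos[of x] by (intro exI[of _ "phi x * b x"]) (auto simp: mult_less_0_iff)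
   next
    have "((%w. exp (- (w^2) / 2) / 4) \<longlongrightarrow> (0::real)) at_top" by real_asymp
    from tendsto_diff[OF this tendsto_mult[OF std_cdf_at_top tendsto_diff[OF tendsto_const[of 1] std_cdf_at_top]]]
    show "(q \<longlongrightarrow> 0) at_top" by (simp add: q_def)
   qed
   then show ?thesis by simp
  qed
  then show ?thesis by (simp add: q_def)
 qed (simp add: std_cdf_0)
qed

lemma std_cdf_product_le: "std_cdf w * (1 - std_cdf w) <= exp (- (w^2) / 2) / 4"
 using std_cdf_product_le_pos[of w] std_cdf_product_le_pos[of "- w"]
 by (cases "0 <= w") (auto simp: std_cdf_minus mult.commute)

text \<open>\<open>stein_f x w\<close> is the integral of the centred indicator of \<open>{..x}\<close> against the Gaussian density over \<open>{..w}\<close>, divided by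
 the density at \<open>w\<close>; both branches are this integral in closed form.\<close>

definition stein_f where
 "stein_f x w = (if w <= x then std_cdf w * (1 - std_cdf x) else std_cdf x * (1 - std_cdf w)) / phi w"

text \<open>The derivative of \<open>stein_f x\<close>, completed at the kink \<open>x\<close> by the Stein equation.\<close>

definition stein_g where
 "stein_g x w = w * stein_f x w + (if w <= x then 1 else 0) - std_cdf x"

definition stein_bound :: real where "stein_bound = sqrt (2 * pi) / 4"

lemma stein_f_nonneg: "0 <= stein_f x w"
 using phi_pos[of w] by (auto simp: stein_f_def std_cdf_nonneg std_cdf_le_1 less_imp_le)

lemma stein_f_le: "stein_f x w <= stein_bound"
proof -
 have "(if w <= x then std_cdf w * (1 - std_cdf x) else std_cdf x * (1 - std_cdf w)) <= std_cdf w * (1 - std_cdf w)"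
  by (auto intro!: mult_left_mono mult_right_mono std_cdf_mono simp: std_cdf_nonneg std_cdf_le_1)
 also have "... <= exp (- (w^2) / 2) / 4" by (rule std_cdf_product_le)
 also have "... = stein_bound * phi w" by (simp add: phi_eq stein_bound_def)
 finally show ?thesis using phi_pos[of w] by (simp add: stein_f_def field_simps)
qed

text \<open>Below \<open>x\<close> the derivative is \<open>(1 - std_cdf x) * (1 + C)\<close>, above it \<open>- std_cdf x * (1 - D)\<close>, with \<open>C\<close> and \<open>D\<close> the
 lower and upper tail at \<open>w\<close>, multiplied by \<open>w / phi w\<close>. Mills' inequality bounds these on one half-line; on the other half-line replacing \<open>std_cdf x\<close>
 by \<open>std_cdf w\<close> removes the unbounded factor, since \<open>(1 - A) * C = A * D\<close>.\<close>

lemma abs_stein_g_le: "\<bar>stein_g x w\<bar> <= 1"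
proof -
 define A B C D where "A = std_cdf w" and "B = std_cdf x" and "C = w * std_cdf w / phi w" and "D = w * (1 - std_cdf w) / phi w"
 note p = phi_pos[of w]
 have AB: "0 <= A" "A <= 1" "0 <= B" "B <= 1" by (auto simp: A_def B_def std_cdf_nonneg std_cdf_le_1)
 have D: "0 <= w ==> 0 <= D \<and> D <= 1 \<and> 0 <= C"
  using Mills_pos[of w] p AB by (simp add: C_def D_def A_def)
 have C: "w <= 0 ==> -1 <= C \<and> C <= 0 \<and> D <= 0"
  using Mills_neg[of w] p AB
  by (simp add: C_def D_def A_def mult_nonpos_nonneg divide_nonpos_nonneg pos_le_divide_eq)
 have CD: "(1 - A) * C = A * D" by (simp add: A_def C_def D_def)
 show ?thesis
 proof (cases "w <= x")
  case True
  then have g: "stein_g x w = (1 - B) * (1 + C)"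
   using p by (simp add: stein_g_def stein_f_def A_def B_def C_def field_simps)
  have "A <= B" using True by (simp add: A_def B_def std_cdf_mono)
  show ?thesis
  proof (cases "0 <= w")
   case True
   have "(1 - B) * (1 + C) <= (1 - A) * (1 + C)"
    using \<open>A <= B\<close> D[OF True] by (intro mult_right_mono) auto
   also have "... = (1 - A) + A * D" using CD by (simp add: algebra_simps)
   also have "... <= (1 - A) + A * 1" using AB D[OF True] by (intro add_mono mult_left_mono) auto
   finally show ?thesis using g AB D[OF True] by simp
  next
   case False
   then have "0 <= 1 + C" "1 + C <= 1" using C by auto
   then have "(1 - B) * (1 + C) <= 1 * 1" using AB by (intro mult_mono) auto
   with g AB \<open>0 <= 1 + C\<close> show ?thesis by simp
  qed
 next
  case F: False
  then have g: "- stein_g x w = B * (1 - D)"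
   using p by (simp add: stein_g_def stein_f_def A_def B_def D_def field_simps)
  have "B <= A" using F by (simp add: A_def B_def std_cdf_mono)
  have "\<bar>- stein_g x w\<bar> <= 1"
  proof (cases "w <= 0")
   case True
   have "B * (1 - D) <= A * (1 - D)"
    using \<open>B <= A\<close> C[OF True] by (intro mult_right_mono) auto
   also have "... = A + (1 - A) * (- C)" using CD by (simp add: algebra_simps)
   also have "... <= A + (1 - A) * 1" using AB C[OF True] by (intro add_mono mult_left_mono) auto
   finally show ?thesis unfolding g using AB C[OF True] by simp
  next
   case False
   then have "0 <= 1 - D" "1 - D <= 1" using D by auto
   then have "B * (1 - D) <= 1 * 1" using AB by (intro mult_mono) auto
   with AB \<open>0 <= 1 - D\<close> show ?thesis unfolding g by simp
  qed
  then show ?thesis by simp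
 qed
qed

lemma DERIV_stein_f:
 assumes "w \<noteq> x" shows "(stein_f x has_real_derivative stein_g x w) (at w)"
proof (cases "w < x")
 case True
 have "((%w. std_cdf w * (1 - std_cdf x) / phi w) has_real_derivative stein_g x w) (at w)"
  using True phi_pos[of w]
  by (auto intro!: derivative_eq_intros DERIV_phi DERIV_std_cdf simp: stein_g_def stein_f_def)
    (simp add: field_simps power2_eq_square)
 then show ?thesis
  by (rule has_field_derivative_transform_within_open[where S = "{..<x}"])
    (insert True, auto simp: stein_f_def)
next
 case False
 with assms have "x < w" by simp
 have "((%w. std_cdf x * (1 - std_cdf w) / phi w) has_real_derivative stein_g x w) (at w)"
  using \<open>x < w\<close> phi_pos[of w]
  by (auto intro!: derivative_eq_intros DERIV_phi DERIV_std_cdf simp: stein_g_def stein_f_def)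
    (simp add: field_simps power2_eq_square)
 then show ?thesis
  by (rule has_field_derivative_transform_within_open[where S = "{x<..}"])
    (insert \<open>x < w\<close>, auto simp: stein_f_def)
qed

lemma continuous_stein_f: "continuous_on A (stein_f x)"
proof -
 have *: "continuous_on A std_cdf" "continuous_on A phi" for A
  by (auto intro!: continuous_at_imp_continuous_on DERIV_isCont[OF DERIV_std_cdf] DERIV_isCont[OF DERIV_phi])
 have "continuous_on ({..x} \<union> {x..}) (%w. if w <= x then std_cdf w * (1 - std_cdf x) else std_cdf x * (1 - std_cdf w))"
  by (rule continuous_on_If) (auto intro!: continuous_intros * simp: algebra_simps)
 then have "continuous_on UNIV (%w. if w <= x then std_cdf w * (1 - std_cdf x) else std_cdf x * (1 - std_cdf w))"
  by (rule continuous_on_subset) auto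
 then have "continuous_on UNIV (stein_f x)"
  unfolding stein_f_def [abs_def] using phi_pos by (intro continuous_on_divide *) (auto simp: less_imp_neq[symmetric])
 then show ?thesis by (rule continuous_on_subset) auto
qed

lemma stein_f_measurable [measurable]: "stein_f x : bmeas borel"
 by (rule borel_measurable_continuous_onI[OF continuous_stein_f])

lemma stein_g_measurable [measurable]: "stein_g x : bmeas borel"
 unfolding stein_g_def [abs_def] by measurable

lemma stein_g_has_integral:
 assumes "a <= b" shows "(stein_g x has_integral stein_f x b - stein_f x a) {a..b}"
 by (rule fundamental_theorem_of_calculus_interior_strong[where S = "{x}"])
   (insert assms DERIV_stein_f, auto simp: has_real_derivative_iff_has_vector_derivative[symmetric] continuous_stein_f)

lemma stein_f_Lipschitz: "\<bar>stein_f x b - stein_f x a\<bar> <= \<bar>b - a\<bar>"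
proof -
 have *: "\<bar>stein_f x b - stein_f x a\<bar> <= b - a" if "a <= b" for a b
  using has_integral_bound_real[OF _ finite.emptyI stein_g_has_integral[OF that, of x], of 1] abs_stein_g_le that by auto
 show ?thesis using *[of a b] *[of b a] by (cases "a <= b") auto
qed

text \<open>The increment of \<open>w * stein_f x w\<close> gives the first term. The indicator only changes between \<open>a\<close> and \<open>t\<close>,
 hence between \<open>a\<close> and \<open>b\<close>; the point \<open>b\<close> is kept because it is the endpoint of the later integration.\<close>

lemma stein_g_increment:
 assumes t: "(a <= t \<and> t <= b) \<or> (b <= t \<and> t <= a)"
 shows "\<bar>stein_g x t - stein_g x a\<bar> <= (\<bar>a\<bar> + stein_bound) * \<bar>t - a\<bar> + \<bar>of_bool (x < b) - of_bool (x < a)\<bar>"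
proof -
 have "\<bar>t * stein_f x t - a * stein_f x a\<bar> = \<bar>a * (stein_f x t - stein_f x a) + (t - a) * stein_f x t\<bar>"
  by (simp add: algebra_simps)
 also have "... <= \<bar>a\<bar> * \<bar>stein_f x t - stein_f x a\<bar> + \<bar>t - a\<bar> * \<bar>stein_f x t\<bar>"
  by (metis abs_mult abs_triangle_ineq)
 also have "... <= \<bar>a\<bar> * \<bar>t - a\<bar> + \<bar>t - a\<bar> * stein_bound"
  using stein_f_Lipschitz[of x t a] stein_f_nonneg[of x t] stein_f_le[of x t]
  by (intro add_mono mult_left_mono) auto
 finally have "\<bar>t * stein_f x t - a * stein_f x a\<bar> <= (\<bar>a\<bar> + stein_bound) * \<bar>t - a\<bar>"
  by (simp add: algebra_simps)
 moreover have "\<bar>(if t <= x then 1 else 0) - (if a <= x then 1 else 0)\<bar> <= \<bar>of_bool (x < b) - of_bool (x < a) :: real\<bar>"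
  using t by auto
 ultimately show ?thesis unfolding stein_g_def by linarith
qed

text \<open>The first-order Taylor remainder. The quadratic part comes from \<open>w * stein_f x w\<close>, which is locally
 Lipschitz; the jump of the derivative at \<open>x\<close> only contributes if \<open>x\<close> lies between the two points.\<close>

lemma stein_remainder:
 "\<bar>stein_f x (a + d) - stein_f x a - stein_g x a * d\<bar>
  <= (\<bar>a\<bar> + stein_bound) * d^2 / 2 + d * (of_bool (x < a + d) - of_bool (x < a))"
proof (cases "0 <= d")
 case True
 define c J where "c = \<bar>a\<bar> + stein_bound" and "J = \<bar>of_bool (x < a + d) - of_bool (x < a) :: real\<bar>"
 have 1: "((%t. stein_g x t - stein_g x a) has_integral (stein_f x (a + d) - stein_f x a) - stein_g x a * d) {a..a + d}"
  using has_integral_diff[OF stein_g_has_integral[of a "a + d" x] has_integral_const_real[of "stein_g x a" a "a + d"]] True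
  by (simp add: mult.commute)
 have "((%t. c * (t - a)^2 / 2 + J * t) has_real_derivative c * (t - a) + J) (at t within {a..a + d})" for t
  by (auto intro!: derivative_eq_intros simp: field_simps)
 then have 2: "((%t. c * (t - a) + J) has_integral c * d^2 / 2 + d * J) {a..a + d}"
  by (intro has_integral_eq_rhs[OF fundamental_theorem_of_calculus[where f = "%t. c * (t - a)^2 / 2 + J * t"]])
    (insert True, auto simp: has_real_derivative_iff_has_vector_derivative[symmetric] algebra_simps)
 have "norm ((stein_f x (a + d) - stein_f x a) - stein_g x a * d) <= c * d^2 / 2 + d * J"
  unfolding integral_unique[OF 1, symmetric] integral_unique[OF 2, symmetric]
 proof (rule integral_norm_bound_integral)
  fix t assume "t : {a..a + d}"
  then show "norm (stein_g x t - stein_g x a) <= c * (t - a) + J"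
   using stein_g_increment[of a t "a + d" x] by (auto simp: c_def J_def)
 qed (use 1 2 in auto)
 then show ?thesis using True by (auto simp: c_def J_def split: if_splits)
next
 case False
 define c J where "c = \<bar>a\<bar> + stein_bound" and "J = \<bar>of_bool (x < a + d) - of_bool (x < a) :: real\<bar>"
 have 1: "((%t. stein_g x t - stein_g x a) has_integral (stein_f x a - stein_f x (a + d)) - stein_g x a * (- d)) {a + d..a}"
  using has_integral_diff[OF stein_g_has_integral[of "a + d" a x] has_integral_const_real[of "stein_g x a" "a + d" a]] False
  by (simp add: mult.commute)
 have "((%t. - c * (a - t)^2 / 2 + J * t) has_real_derivative c * (a - t) + J) (at t within {a + d..a})" for t
  by (auto intro!: derivative_eq_intros simp: field_simps)
 then have 2: "((%t. c * (a - t) + J) has_integral c * d^2 / 2 - d * J) {a + d..a}"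
  by (intro has_integral_eq_rhs[OF fundamental_theorem_of_calculus[where f = "%t. - c * (a - t)^2 / 2 + J * t"]])
    (insert False, auto simp: has_real_derivative_iff_has_vector_derivative[symmetric] algebra_simps)
 have "norm ((stein_f x a - stein_f x (a + d)) - stein_g x a * (- d)) <= c * d^2 / 2 - d * J"
  unfolding integral_unique[OF 1, symmetric] integral_unique[OF 2, symmetric]
 proof (rule integral_norm_bound_integral)
  fix t assume "t : {a + d..a}"
  then show "norm (stein_g x t - stein_g x a) <= c * (a - t) + J"
   using stein_g_increment[of a t "a + d" x] by (auto simp: c_def J_def)
 qed (use 1 2 in auto)
 moreover have "norm ((stein_f x a - stein_f x (a + d)) - stein_g x a * (- d)) =
   \<bar>stein_f x (a + d) - stein_f x a - stein_g x a * d\<bar>"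
  unfolding real_norm_def
  by (subst abs_minus_commute) (simp add: algebra_simps)
 ultimately show ?thesis using False by (auto simp: c_def J_def split: if_splits)
qed

lemma stein_remainder_linear:
 "\<bar>stein_f x (a + d) - stein_f x a - stein_g x a * d\<bar> <= 2 * \<bar>d\<bar>"
proof -
 have "\<bar>stein_g x a * d\<bar> <= 1 * \<bar>d\<bar>"
  unfolding abs_mult using abs_stein_g_le by (intro mult_right_mono) auto
 with stein_f_Lipschitz[of x "a + d" a] show ?thesis by simp
qed

section \<open>The measurable space of finite lists\<close>

text \<open>A finite configuration is a list of its points, forgetting the order later; unlike multisets, lists have an
 evident sigma-algebra, generated by the boxes.\<close>

definition seqs :: "'z measure => 'z list measure" where
 "seqs Z = sigma (lists (space Z)) {listset As |As. set As \<subseteq> sets Z}"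

lemma listset_subset_lists: "set As \<subseteq> sets Z ==> listset As \<subseteq> lists (space Z)"
proof (induction As)
 case (Cons A As)
 then have "A \<subseteq> space Z" "listset As \<subseteq> lists (space Z)" by (auto simp: sets.sets_into_space)
 then show ?case by (fastforce simp: set_Cons_def)
qed simp

lemma space_seqs: "space (seqs Z) = lists (space Z)"
 unfolding seqs_def by (rule space_measure_of) (use listset_subset_lists in blast)

lemma sets_seqs:
 "sets (seqs Z) = sigma_sets (lists (space Z)) {listset As |As. set As \<subseteq> sets Z}"
 unfolding seqs_def by (rule sets_measure_of) (use listset_subset_lists in blast)

lemma listset_in_sets: "set As \<subseteq> sets Z ==> listset As : sets (seqs Z)"
 unfolding sets_seqs by blast

lemma Nil_in_space [measurable, simp]: "[] : space (seqs Z)"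
 by (simp add: space_seqs)

lemma Nil_in_sets [measurable, simp]: "{[]} : sets (seqs Z)"
 using listset_in_sets[of "[]" Z] by simp

lemma Cons_in_space [simp]: "x # xs : space (seqs Z) \<longleftrightarrow> x : space Z \<and> xs : space (seqs Z)"
 by (simp add: space_seqs)

lemma measurable_Cons_pair: "(%(x, xs). x # xs) : Z >< seqs Z ->M seqs Z"
proof (rule measurable_sigma_sets[OF sets_seqs])
 show "{listset As |As. set As \<subseteq> sets Z} \<subseteq> Pow (lists (space Z))"
  using listset_subset_lists by blast
 show "(%(x, xs). x # xs) : space (Z >< seqs Z) \<rightarrow> lists (space Z)"
  by (auto simp: space_pair_measure space_seqs)
 fix A assume "A : {listset As |As. set As \<subseteq> sets Z}"
 then obtain As where A: "A = listset As" "set As \<subseteq> sets Z" by auto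
 show "(%(x, xs). x # xs) -` A \<inter> space (Z >< seqs Z) : sets (Z >< seqs Z)"
 proof (cases As)
  case Nil
  then have "(%(x, xs). x # xs) -` A \<inter> space (Z >< seqs Z) = {}" using A by auto
  then show ?thesis by simp
 next
  case (Cons B Bs)
  then have "(%(x, xs). x # xs) -` A \<inter> space (Z >< seqs Z) = B \<times> listset Bs"
   using A listset_subset_lists[of Bs Z]
   by (auto simp: space_pair_measure space_seqs set_Cons_def dest: sets.sets_into_space)
  then show ?thesis using A Cons by (auto intro!: pair_measureI listset_in_sets)
 qed
qed

lemma measurable_Cons [measurable (raw)]:
 assumes "f : B ->M Z" "g : B ->M seqs Z"
 shows "(%b. f b # g b) : B ->M seqs Z"
 using measurable_compose[OF measurable_Pair[OF assms] measurable_Cons_pair] by simp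

lemma length_eq_in_sets: "{xs : space (seqs Z). length xs = n} : sets (seqs Z)"
proof -
 have "{xs : lists (space Z). length xs = n} = listset (replicate n (space Z))"
 proof (induction n)
  case (Suc n)
  have "{xs : lists (space Z). length xs = Suc n} = set_Cons (space Z) {xs : lists (space Z). length xs = n}"
   by (auto simp: set_Cons_def length_Suc_conv)
  with Suc show ?case by simp
 qed auto
 moreover have "listset (replicate n (space Z)) : sets (seqs Z)"
  by (rule listset_in_sets) (auto simp: set_replicate_conv_if)
 ultimately show ?thesis by (simp add: space_seqs)
qed

lemma measurable_tl: "tl : seqs Z ->M seqs Z"
proof (rule measurable_sigma_sets[OF sets_seqs])
 show "{listset As |As. set As \<subseteq> sets Z} \<subseteq> Pow (lists (space Z))"
  using listset_subset_lists by blast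
 show "tl : space (seqs Z) \<rightarrow> lists (space Z)"
 proof
  fix xs assume "xs : space (seqs Z)"
  then show "tl xs : lists (space Z)" by (cases xs) (auto simp: space_seqs)
 qed
 fix A assume "A : {listset As |As. set As \<subseteq> sets Z}"
 then obtain As where A: "A = listset As" "set As \<subseteq> sets Z" by auto
 have "tl -` A \<inter> space (seqs Z) = (if [] : A then {[]} else {}) \<union> listset (space Z # As)"
 proof -
  have "xs : tl -` A \<inter> space (seqs Z) \<longleftrightarrow>
    xs : (if [] : A then {[]} else {}) \<union> listset (space Z # As)" for xs
   using A listset_subset_lists[of As Z] by (cases xs) (auto simp: set_Cons_def space_seqs)
  then show ?thesis by blast
 qed
 moreover have "listset (space Z # As) : sets (seqs Z)"
  using A by (intro listset_in_sets) auto
 moreover have "(if [] : A then {[]} else {}) : sets (seqs Z)" by simp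
 ultimately show "tl -` A \<inter> space (seqs Z) : sets (seqs Z)" by (simp only: sets.Un)
qed

lemma measurable_hd: "hd : restrict_space (seqs Z) (- {[]}) ->M Z"
proof (rule measurableI)
 let ?R = "(restrict_space (seqs Z) (- {[]}))"
 show "hd xs : space Z" if "xs : space ?R" for xs
  using that by (cases xs) (auto simp: space_restrict_space)
 fix A assume A: "A : sets Z"
 have "hd -` A \<inter> space ?R = (%(x, xs). x # xs) ` (A \<times> space (seqs Z))"
 proof -
  have "xs : hd -` A \<inter> space ?R \<longleftrightarrow>
    xs : (%(x, xs). x # xs) ` (A \<times> space (seqs Z))" for xs
   using sets.sets_into_space[OF A] by (cases xs) (auto simp: space_restrict_space)
  then show ?thesis by blast
 qed
 also have "... = (\<Union>n. listset (A # replicate n (space Z)))"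
 proof -
  have "xs : lists (space Z) \<longleftrightarrow> xs : (\<Union>n. listset (replicate n (space Z)))" for xs
  proof (induction xs)
   case Nil
   show ?case by (auto intro: exI[of _ 0])
  next
   case (Cons x xs)
   show ?case
   proof
    assume "x # xs : lists (space Z)"
    with Cons obtain n where "x : space Z" "xs : listset (replicate n (space Z))" by auto
    then have "x # xs : listset (replicate (Suc n) (space Z))" by (auto simp: set_Cons_def)
    then show "x # xs : (\<Union>n. listset (replicate n (space Z)))" by blast
   next
    assume "x # xs : (\<Union>n. listset (replicate n (space Z)))"
    then obtain n where n: "x # xs : listset (replicate n (space Z))" by blast
    have "set (replicate n (space Z)) \<subseteq> sets Z" by (auto simp: set_replicate_conv_if)
    then show "x # xs : lists (space Z)" using n by (rule subsetD[OF listset_subset_lists])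
   qed
  qed
  then show ?thesis by (fastforce simp: set_Cons_def space_seqs)
 qed
 also have "... : sets (seqs Z)"
  by (intro sets.countable_UN)
    (insert A, auto simp del: listset.simps intro!: listset_in_sets simp: set_replicate_conv_if split: if_splits)
 finally show "hd -` A \<inter> space ?R : sets ?R"
  by (subst sets_restrict_space_iff) (auto simp: space_restrict_space)
qed

lemma measurable_case_list [measurable (raw)]:
 assumes xs[measurable]: "xs : B ->M seqs Z" and f[measurable]: "f : B ->M A"
  and g[measurable]: "(%(b, y, ys). g b y ys) : B >< Z >< seqs Z ->M A"
 shows "(%b. case xs b of [] => f b | y # ys => g b y ys) : B ->M A"
proof (rule measurable_piecewise_restrict[of "{{b. xs b = []}, {b. xs b \<noteq> []}}"])
 have 1: "{b : space B. xs b = []} : sets B"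
  using measurable_sets[OF xs Nil_in_sets] by (simp add: vimage_def Int_def conj_commute)
 moreover have "{b. xs b \<noteq> []} \<inter> space B = space B - {b : space B. xs b = []}" by auto
 ultimately show "\<Omega> \<inter> space B : sets B" if "\<Omega> : {{b. xs b = []}, {b. xs b \<noteq> []}}" for \<Omega>
  using that by (auto simp: Int_def conj_commute)
 fix \<Omega> assume "\<Omega> : {{b. xs b = []}, {b. xs b \<noteq> []}}"
 then consider "\<Omega> = {b. xs b = []}" | "\<Omega> = {b. xs b \<noteq> []}" by auto
 then show "(%b. case xs b of [] => f b | y # ys => g b y ys) : restrict_space B \<Omega> ->M A"
 proof cases
  case 1
  have "f : restrict_space B \<Omega> ->M A" by (rule measurable_restrict_space1[OF f])
  then show ?thesis
   by (subst measurable_cong[where g = f]) (auto simp: 1 space_restrict_space)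
 next
  case 2
  have "(%b. hd (xs b)) : restrict_space B \<Omega> ->M Z"
   by (rule measurable_compose[OF _ measurable_hd], rule measurable_restrict_space3[OF xs]) (auto simp: 2)
  moreover have "(%b. tl (xs b)) : restrict_space B \<Omega> ->M seqs Z"
   by (intro measurable_restrict_space1 measurable_compose[OF xs measurable_tl])
  moreover have "(%b. b) : restrict_space B \<Omega> ->M B"
   by (rule measurable_restrict_space1) simp
  ultimately have "(%b. (b, hd (xs b), tl (xs b))) : restrict_space B \<Omega> ->M B >< Z >< seqs Z"
   by (intro measurable_Pair)
  from measurable_compose[OF this g]
  have "(%b. g b (hd (xs b)) (tl (xs b))) : restrict_space B \<Omega> ->M A" by simp
  then show ?thesis
   by (subst measurable_cong[where g = "%b. g b (hd (xs b)) (tl (xs b))"])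
     (auto simp: 2 space_restrict_space split: list.split)
 qed
qed auto

text \<open>On the lists of length \<open>n\<close> the recursion is an \<open>n\<close>-fold composition.\<close>

lemma measurable_rec_list:
 assumes xs: "xs : B ->M seqs Z" and f: "f : B ->M A"
  and g: "(%(b, y, ys, a). g b y ys a) : B >< Z >< seqs Z >< A ->M A"
 shows "(%b. rec_list (f b) (g b) (xs b)) : B ->M A"
proof (rule measurable_piecewise_restrict[of "range (%n. {b. length (xs b) = n})"])
 have len: "{b : space B. length (ys b) = n} : sets B" if ys: "ys : B ->M seqs Z" for n ys
  using measurable_sets[OF ys length_eq_in_sets[of Z n]] measurable_space[OF ys]
  by (simp add: vimage_def Int_def conj_commute cong: conj_cong)
 then show "\<Omega> \<inter> space B : sets B" if "\<Omega> : range (%n. {b. length (xs b) = n})" for \<Omega>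
  using that xs by (auto simp: Int_def conj_commute)
 fix \<Omega> assume "\<Omega> : range (%n. {b. length (xs b) = n})"
 then obtain n where \<Omega>: "\<Omega> = {b. length (xs b) = n}" by auto
 show "(%b. rec_list (f b) (g b) (xs b)) : restrict_space B \<Omega> ->M A"
  unfolding \<Omega> using xs
 proof (induction n arbitrary: xs)
  case 0
  have "f : restrict_space B {b. length (xs b) = 0} ->M A" by (rule measurable_restrict_space1[OF f])
  then show ?case by (subst measurable_cong[where g = f]) (auto simp: space_restrict_space)
 next
  case (Suc n)
  let ?R = "restrict_space B {b. length (xs b) = Suc n}"
  have tl: "(%b. tl (xs b)) : B ->M seqs Z"
   by (rule measurable_compose[OF Suc.prems measurable_tl])
  have "(%b. hd (xs b)) : ?R ->M Z"
   by (rule measurable_compose[OF _ measurable_hd], rule measurable_restrict_space3[OF Suc.prems]) auto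
  moreover have "(%b. tl (xs b)) : ?R ->M seqs Z"
   by (intro measurable_restrict_space1 tl)
  moreover have "(%b. b) : ?R ->M B"
   by (rule measurable_restrict_space1) simp
  moreover have "(%b. rec_list (f b) (g b) (tl (xs b))) : ?R ->M A"
   by (rule measurable_restrict_mono[OF Suc.IH[OF tl]]) auto
  ultimately have "(%b. (b, hd (xs b), tl (xs b), rec_list (f b) (g b) (tl (xs b))))
    : ?R ->M B >< Z >< seqs Z >< A"
   by (intro measurable_Pair)
  from measurable_compose[OF this g]
  have *: "(%b. g b (hd (xs b)) (tl (xs b)) (rec_list (f b) (g b) (tl (xs b)))) : ?R ->M A" by simp
  have "rec_list (f b) (g b) (xs b) = g b (hd (xs b)) (tl (xs b)) (rec_list (f b) (g b) (tl (xs b)))"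
   if "b : space ?R" for b
   using that by (cases "xs b") (auto simp: space_restrict_space)
  then show ?case by (subst measurable_cong) (use * in auto)
 qed
qed auto

lemma measurable_append [measurable (raw)]:
 assumes [measurable]: "f : B ->M seqs Z" "g : B ->M seqs Z"
 shows "(%b. f b @ g b) : B ->M seqs Z"
proof -
 have "xs @ ys = rec_list ys (%y _ a. y # a) xs" for xs ys :: "'b list" by (induction xs) auto
 then show ?thesis by (simp only:) (rule measurable_rec_list[where Z = Z], auto)
qed

lemma measurable_map_list [measurable (raw)]:
 assumes [measurable]: "f : B ->M seqs Z" "h : Z ->M Y"
 shows "(%b. map h (f b)) : B ->M seqs Y"
proof -
 have "map h xs = rec_list [] (%y _ a. h y # a) xs" for xs by (induction xs) auto
 then show ?thesis by (simp only:) (rule measurable_rec_list[where Z = Z], auto)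
qed

lemma measurable_filter_list [measurable (raw)]:
 assumes [measurable]: "f : B ->M seqs Z" "Measurable.pred Z Q"
 shows "(%b. filter Q (f b)) : B ->M seqs Z"
proof -
 have "filter Q xs = rec_list [] (%y _ a. if Q y then y # a else a) xs" for xs by (induction xs) auto
 then show ?thesis by (simp only:) (rule measurable_rec_list[where Z = Z], auto)
qed

lemma measurable_length [measurable]: "length : seqs Z ->M count_space UNIV"
proof -
 have eq: "length = (%xs :: 'a list. rec_list 0 (%y _ a. Suc a) xs)"
 proof
  show "length xs = rec_list 0 (%y _ a. Suc a) xs" for xs :: "'a list" by (induction xs) auto
 qed
 show ?thesis unfolding eq by (rule measurable_rec_list[where Z = Z]) auto
qed

section \<open>Summing over the points of a configuration\<close>

text \<open>Functionals of a configuration are functions of a multiset, so that they are symmetric by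
 construction, but their measurability refers to lists.\<close>

definition campbell_sum :: "('z => 'z multiset => 'c::comm_monoid_add) => 'z multiset => 'c" where
 "campbell_sum \<Phi> m = (\<Sum>x\<in>#m. \<Phi> x (m - {#x#}))"

lemma campbell_sum_empty [simp]: "campbell_sum \<Phi> {#} = 0"
 by (simp add: campbell_sum_def)

lemma campbell_sum_add_mset:
 "campbell_sum \<Phi> (add_mset y m) = \<Phi> y m + campbell_sum (%x m'. \<Phi> x (add_mset y m')) m"
proof -
 have "image_mset (%x. \<Phi> x (add_mset y m - {#x#})) m = image_mset (%x. \<Phi> x (add_mset y (m - {#x#}))) m"
 proof (rule image_mset_cong)
  fix x assume "x \<in># m"
  from multi_member_split[OF this] obtain m' where m: "m = add_mset x m'" ..
  have "add_mset y m = add_mset x (add_mset y m')" unfolding m by (rule add_mset_commute)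
  then have "add_mset y m - {#x#} = add_mset y m'" by (simp only: add_mset_remove_trivial)
  moreover have "m - {#x#} = m'" unfolding m by (rule add_mset_remove_trivial)
  ultimately show "\<Phi> x (add_mset y m - {#x#}) = \<Phi> x (add_mset y (m - {#x#}))" by (simp only:)
 qed
 then show ?thesis
  unfolding campbell_sum_def image_mset_add_mset add_mset_remove_trivial by (simp only: sum_mset.add_mset)
qed

lemma measurable_campbell_sum:
 fixes \<Phi> :: "'b => 'z => 'z multiset => 'c::{second_countable_topology, topological_comm_monoid_add}"
 assumes \<Phi>: "(%(b, x, xs). \<Phi> b x (mset xs)) : bmeas (B >< Z >< seqs Z)"
 shows "(%(b, xs). campbell_sum (\<Phi> b) (mset xs)) : bmeas (B >< seqs Z)"
proof -
 define A where "A = (%(b, pre, xs). campbell_sum (%x m. \<Phi> b x (mset pre + m)) (mset xs))"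
 \<comment> \<open>The recursion peels off the head of the list and stores it in the prefix; \<open>R n\<close> is its \<open>n\<close>-step unfolding.\<close>
 define \<Psi> where "\<Psi> = (%(b, x, xs). \<Phi> b x (mset xs))"
 have [measurable]: "\<Psi> : bmeas (B >< Z >< seqs Z)"
  unfolding \<Psi>_def by (rule \<Phi>)
 define step where "step = (%R t. case snd (snd t) of [] => 0
   | y # ys => \<Psi> (fst t, y, fst (snd t) @ ys) + R (fst t, y # fst (snd t), ys))"
 define R where "R n = (step ^^ n) (%_. 0)" for n
 have R_Suc: "R (Suc n) = step (R n)" for n by (simp add: R_def)
 have step: "step R' : bmeas (B >< seqs Z >< seqs Z)"
  if [measurable]: "R' : bmeas (B >< seqs Z >< seqs Z)" for R'
  unfolding step_def by (rule measurable_case_list[where Z = Z]; measurable)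
 have R: "R n : bmeas (B >< seqs Z >< seqs Z)" for n
  by (induction n) (simp add: R_def, simp only: R_Suc step)
 have R_A: "R n (b, pre, xs) = A (b, pre, xs)" if "length xs <= n" for n b pre xs
  using that
 proof (induction n arbitrary: pre xs)
  case 0
  then have "xs = []" by simp
  then show ?case unfolding A_def R_def by simp
 next
  case (Suc n)
  show ?case
  proof (cases xs)
   case Nil
   then show ?thesis unfolding A_def R_Suc step_def by simp
  next
   case (Cons y ys)
   then have "R n (b, y # pre, ys) = A (b, y # pre, ys)" using Suc by simp
   then show ?thesis
    unfolding Cons R_Suc by (simp add: step_def \<Psi>_def A_def campbell_sum_add_mset)
  qed
 qed
 have "(%p. R (length (snd p)) (fst p, [], snd p)) : bmeas (B >< seqs Z)"
 proof (rule measurable_compose_countable[where f = "%n p. R n (fst p, [], snd p)" and g = "%p. length (snd p)"])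
  show "(%p. R n (fst p, [], snd p)) : bmeas (B >< seqs Z)" for n
   by (rule measurable_compose[OF _ R]) measurable
 qed measurable
 moreover have "R (length (snd p)) (fst p, [], snd p) = (case p of (b, xs) => campbell_sum (\<Phi> b) (mset xs))" for p
  by (cases p) (simp add: R_A, simp add: A_def)
 ultimately show ?thesis by (simp only:)
qed

section \<open>The Poisson process of a finite intensity measure\<close>

primrec lpow :: "'z measure => nat => 'z list measure" where
 "lpow L 0 = return (seqs L) []"
| "lpow L (Suc n) = distr (L >< lpow L n) (seqs L) (%(x, xs). x # xs)"

lemma sets_lpow [simp, measurable_cong]: "sets (lpow L n) = sets (seqs L)"
 by (cases n) simp_all

lemma space_lpow [simp]: "space (lpow L n) = space (seqs L)"
 by (rule sets_eq_imp_space_eq) simp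

lemma finite_lpow:
 assumes "finite_measure L" shows "finite_measure (lpow L n)"
proof (induction n)
 case 0
 show ?case
  by (auto intro!: prob_space.finite_measure prob_space_return)
next
 case (Suc n)
 interpret L: finite_measure L by fact
 interpret N: finite_measure "lpow L n" by fact
 interpret P: finite_measure "L >< lpow L n"
  by (rule finite_measure_pair_measure) unfold_locales
 show ?case
  unfolding lpow.simps by (rule P.finite_measure_distr) measurable
qed

lemma sigma_finite_lpow: "finite_measure L ==> sigma_finite_measure (lpow L n)"
 using finite_lpow finite_measure.axioms(1) by blast

lemma nn_integral_lpow_0:
 "f : bmeas (seqs L) ==> (NINT xs|lpow L 0. f xs) = f []"
 by (simp add: nn_integral_return)

lemma nn_integral_lpow_Suc:
 assumes L: "finite_measure L" and f[measurable]: "f : bmeas (seqs L)"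
 shows "(NINT xs|lpow L (Suc n). f xs) = (NINT x|L. NINT xs|lpow L n. f (x # xs))"
proof -
 have "(NINT xs|lpow L (Suc n). f xs) = (NINT p|(L >< lpow L n). f (fst p # snd p))"
  by (simp add: nn_integral_distr split_beta)
 also have "... = (NINT x|L. NINT xs|lpow L n. f (x # xs))"
  by (subst sigma_finite_measure.nn_integral_fst[OF sigma_finite_lpow[OF L], symmetric]) simp_all
 finally show ?thesis .
qed

lemma emeasure_lpow:
 assumes L: "finite_measure L"
 shows "emeasure (lpow L n) (space (seqs L)) = (emeasure L (space L))^n"
proof (induction n)
 case (Suc n)
 have "emeasure (lpow L (Suc n)) (space (seqs L)) = (NINT xs|lpow L (Suc n). 1)"
  by (subst nn_integral_const) (simp del: lpow.simps)
 also have "... = (NINT x|L. emeasure (lpow L n) (space (seqs L)))"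
  by (subst nn_integral_lpow_Suc[OF L]) simp_all
 finally show ?case using Suc by (simp add: mult.commute)
qed simp

definition poisson_weight where
 "poisson_weight L n = ennreal (exp (- measure L (space L)) / fact n)"

text \<open>The law of the points of a Poisson process with finite intensity \<open>L\<close>: a Poisson number of independent points.\<close>

definition Poi where
 "Poi L = measure_of (space (seqs L)) (sets (seqs L))
   (%A. \<Sum>n. poisson_weight L n * emeasure (lpow L n) A)"

lemma sets_Poi [simp, measurable_cong]: "sets (Poi L) = sets (seqs L)"
 by (simp add: Poi_def sets.sets_measure_of_eq)

lemma space_Poi [simp]: "space (Poi L) = space (seqs L)"
 by (rule sets_eq_imp_space_eq) simp

lemma emeasure_Poi:
 assumes "A : sets (seqs L)"
 shows "emeasure (Poi L) A = (\<Sum>n. poisson_weight L n * emeasure (lpow L n) A)"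
proof (rule emeasure_measure_of[OF Poi_def])
 show "sets (seqs L) \<subseteq> Pow (space (seqs L))" by (rule sets.space_closed)
 show "A : sets (Poi L)" using assms by simp
 show "positive (sets (Poi L)) (%A. \<Sum>n. poisson_weight L n * emeasure (lpow L n) A)"
  by (simp add: positive_def)
 show "countably_additive (sets (Poi L)) (%A. \<Sum>n. poisson_weight L n * emeasure (lpow L n) A)"
 proof (rule countably_additiveI)
  fix A :: "nat => 'a list set"
  assume A: "range A \<subseteq> sets (Poi L)" "disjoint_family A"
  have "(\<Sum>i. \<Sum>n. poisson_weight L n * emeasure (lpow L n) (A i))
    = (\<Sum>n. \<Sum>i. poisson_weight L n * emeasure (lpow L n) (A i))"
   by (rule suminf_swap_ennreal)
  also have "... = (\<Sum>n. poisson_weight L n * emeasure (lpow L n) (\<Union>i. A i))"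
   using A by (simp add: suminf_emeasure)
  finally show "(\<Sum>i. \<Sum>n. poisson_weight L n * emeasure (lpow L n) (A i))
    = (\<Sum>n. poisson_weight L n * emeasure (lpow L n) (\<Union> (range A)))" .
 qed
qed

lemma nn_integral_Poi:
 assumes "f : bmeas (seqs L)"
 shows "(NINT xs|Poi L. f xs) = (\<Sum>n. poisson_weight L n * (NINT xs|lpow L n. f xs))"
 using assms
proof (induction rule: borel_measurable_induct)
 case (cong f g)
 have "(NINT xs|Poi L. f xs) = (NINT xs|Poi L. g xs)"
  by (rule nn_integral_cong) (use cong in simp)
 moreover have "(NINT xs|lpow L n. f xs) = (NINT xs|lpow L n. g xs)" for n
  by (rule nn_integral_cong) (use cong in simp)
 ultimately show ?case using cong by simp
next
 case (set A)
 then show ?case by (simp add: emeasure_Poi)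
next
 case (mult u c)
 then show ?case
  by (simp add: nn_integral_cmult mult.left_commute[of _ c] del: nn_integral_indicator)
next
 case (add u v)
 then show ?case by (simp add: nn_integral_add distrib_left suminf_add)
next
 case (seq U)
 have inc: "incseq (%i. poisson_weight L n * (NINT xs|lpow L n. U i xs))" for n
  using seq(3) by (intro incseq_SucI mult_left_mono nn_integral_mono) (auto simp: incseq_Suc_iff le_fun_def)
 have "(NINT xs|Poi L. (SUP i. U i) xs) = (SUP i. NINT xs|Poi L. U i xs)"
  unfolding SUP_apply by (rule nn_integral_monotone_convergence_SUP) (insert seq, auto simp: measurable_def)
 also have "... = (SUP i. \<Sum>n. poisson_weight L n * (NINT xs|lpow L n. U i xs))"
  using seq by simp
 also have "... = (\<Sum>n. SUP i. poisson_weight L n * (NINT xs|lpow L n. U i xs))"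
  by (rule ennreal_suminf_SUP_eq[OF inc, symmetric])
 also have "... = (\<Sum>n. poisson_weight L n * (NINT xs|lpow L n. (SUP i. U i) xs))"
 proof (rule suminf_cong)
  fix n
  have "(NINT xs|lpow L n. (SUP i. U i) xs) = (SUP i. NINT xs|lpow L n. U i xs)"
   unfolding SUP_apply by (rule nn_integral_monotone_convergence_SUP) (insert seq, auto simp: measurable_def)
  then show "(SUP i. poisson_weight L n * (NINT xs|lpow L n. U i xs))
    = poisson_weight L n * (NINT xs|lpow L n. (SUP i. U i) xs)"
   by (simp add: SUP_mult_left_ennreal)
 qed
 finally show ?case .
qed

lemma prob_space_Poi:
 assumes "finite_measure L" shows "prob_space (Poi L)"
proof
 interpret finite_measure L by fact
 let ?c = "measure L (space L)"
 have "emeasure (Poi L) (space (Poi L)) = (\<Sum>n. poisson_weight L n * (ennreal ?c)^n)"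
  by (simp add: emeasure_Poi emeasure_lpow[OF assms] emeasure_eq_measure)
 also have "... = (\<Sum>n. ennreal (exp (- ?c) * (?c^n /\<^sub>R fact n)))"
  by (rule suminf_cong) (simp add: poisson_weight_def ennreal_power ennreal_mult[symmetric] field_simps)
 also have "... = ennreal (exp (- ?c) * exp ?c)"
 proof (rule suminf_ennreal_eq)
  show "(%n. exp (- ?c) * (?c^n /\<^sub>R fact n)) sums (exp (- ?c) * exp ?c)"
   by (rule sums_mult[OF exp_converges])
 qed simp
 finally show "emeasure (Poi L) (space (Poi L)) = 1"
  by (simp add: exp_minus)
qed

section \<open>Superposition and marking\<close>

text \<open>The recursion of the binomial coefficients, for sums over the ways in which \<open>n\<close> points are distributed
 between two groups.\<close>

lemma pascal_recursion:
 fixes U :: "nat => nat => nat => ennreal"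
 assumes "\<And>n i j. U (Suc n) i j = U n (Suc i) j + U n i (Suc j)"
 shows "U n i j = (\<Sum>k\<le>n. of_nat (n choose k) * U 0 (i + k) (j + n - k))"
proof (induction n arbitrary: i j)
 case (Suc n)
 define a where "a k = U 0 (i + k) (j + Suc n - k)" for k
 have "U n i (Suc j) = (\<Sum>k\<le>n. of_nat (n choose k) * a k)"
  unfolding Suc a_def by (intro sum.cong) auto
 also have "... = (\<Sum>k\<le>Suc n. of_nat (n choose k) * a k)" by simp
 also have "... = a 0 + (\<Sum>k\<le>n. of_nat (n choose Suc k) * a (Suc k))"
  by (subst sum.atMost_Suc_shift) simp
 finally have 1: "U n i (Suc j) = a 0 + (\<Sum>k\<le>n. of_nat (n choose Suc k) * a (Suc k))" .
 have 2: "U n (Suc i) j = (\<Sum>k\<le>n. of_nat (n choose k) * a (Suc k))"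
  unfolding Suc a_def by (intro sum.cong) auto
 have "(\<Sum>k\<le>Suc n. of_nat (Suc n choose k) * a k) = a 0 + (\<Sum>k\<le>n. of_nat (Suc n choose Suc k) * a (Suc k))"
  by (subst sum.atMost_Suc_shift) simp
 also have "... = U n (Suc i) j + U n i (Suc j)"
  by (simp add: 1 2 algebra_simps sum.distrib)
 finally show ?case using assms[of n i j] by (simp add: a_def)
qed simp

text \<open>The intensity measure \<open>L\<close> is the sum of the images of \<open>L1\<close> and \<open>L2\<close>. Superposition of independent processes,
 and splitting according to a mark, are both instances.\<close>

locale intensity_sum =
 fixes L :: "'z measure" and L1 :: "'a measure" and L2 :: "'b measure" and i1 :: "'a => 'z" and i2 :: "'b => 'z"
 assumes fin: "finite_measure L" "finite_measure L1" "finite_measure L2"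
  and i1[measurable]: "i1 : L1 ->M L" and i2[measurable]: "i2 : L2 ->M L"
  and nn_integral_sum: "\<And>f. f : bmeas L ==>
   (NINT z|L. f z) = (NINT x|L1. f (i1 x)) + (NINT y|L2. f (i2 y))"
begin

lemma mass_sum: "measure L (space L) = measure L1 (space L1) + measure L2 (space L2)"
proof -
 have "emeasure L (space L) = emeasure L1 (space L1) + emeasure L2 (space L2)"
  using nn_integral_sum[of "%_. 1"] by simp
 then show ?thesis
  using fin by (simp add: finite_measure.emeasure_eq_measure ennreal_plus[symmetric] del: ennreal_plus)
qed

lemma lpow_sum:
 fixes G :: "'z multiset => ennreal"
 assumes G: "(%xs. G (mset xs)) : bmeas (seqs L)"
 shows "(NINT xs|lpow L n. G (mset xs)) = (\<Sum>k\<le>n. of_nat (n choose k) *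
  (NINT ys|lpow L1 k. NINT zs|lpow L2 (n - k). G (image_mset i1 (mset ys) + image_mset i2 (mset zs))))"
proof -
 interpret L: finite_measure L by (rule fin)
 interpret L1: finite_measure L1 by (rule fin)
 interpret L2: finite_measure L2 by (rule fin)
 define H where "H = (%xs. G (mset xs))"
 have [measurable]: "H : bmeas (seqs L)" unfolding H_def by (rule G)
 have H_cong: "H xs = H ys" if "mset xs = mset ys" for xs ys using that by (simp add: H_def)
 define U where "U n i j = (NINT xs|lpow L n. NINT ys|lpow L1 i. NINT zs|lpow L2 j. H (xs @ map i1 ys @ map i2 zs))"
  for n i j
 have U: "U (Suc n) i j = U n (Suc i) j + U n i (Suc j)" for n i j
 proof -
  interpret N: finite_measure "lpow L n" by (rule finite_lpow[OF fin(1)])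
  interpret I: finite_measure "lpow L1 i" by (rule finite_lpow[OF fin(2)])
  interpret J: finite_measure "lpow L2 j" by (rule finite_lpow[OF fin(3)])
  interpret I': finite_measure "lpow L1 (Suc i)" by (rule finite_lpow[OF fin(2)])
  interpret J': finite_measure "lpow L2 (Suc j)" by (rule finite_lpow[OF fin(3)])
  interpret L1N: pair_sigma_finite L1 "lpow L n" by unfold_locales
  interpret L2N: pair_sigma_finite L2 "lpow L n" by unfold_locales
  interpret L2I: pair_sigma_finite L2 "lpow L1 i" by unfold_locales
  have "U (Suc n) i j = (NINT x|L. NINT xs|lpow L n. NINT ys|lpow L1 i. NINT zs|lpow L2 j. H (x # xs @ map i1 ys @ map i2 zs))"
   unfolding U_def by (subst nn_integral_lpow_Suc[OF fin(1)]) (simp_all del: lpow.simps)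
  also have "... = (NINT x|L1. NINT xs|lpow L n. NINT ys|lpow L1 i. NINT zs|lpow L2 j. H (i1 x # xs @ map i1 ys @ map i2 zs))
   + (NINT x|L2. NINT xs|lpow L n. NINT ys|lpow L1 i. NINT zs|lpow L2 j. H (i2 x # xs @ map i1 ys @ map i2 zs))"
   by (rule nn_integral_sum) measurable
  also have "(NINT x|L1. NINT xs|lpow L n. NINT ys|lpow L1 i. NINT zs|lpow L2 j. H (i1 x # xs @ map i1 ys @ map i2 zs))
   = (NINT x|L1. NINT xs|lpow L n. NINT ys|lpow L1 i. NINT zs|lpow L2 j. H (xs @ map i1 (x # ys) @ map i2 zs))"
   by (intro nn_integral_cong H_cong) simp
  also have "... = (NINT xs|lpow L n. NINT x|L1. NINT ys|lpow L1 i. NINT zs|lpow L2 j. H (xs @ map i1 (x # ys) @ map i2 zs))"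
   by (rule L1N.Fubini'[symmetric]) measurable
  also have "... = U n (Suc i) j"
   unfolding U_def by (intro nn_integral_cong) (subst nn_integral_lpow_Suc[OF fin(2)], simp_all del: lpow.simps)
  also have "(NINT x|L2. NINT xs|lpow L n. NINT ys|lpow L1 i. NINT zs|lpow L2 j. H (i2 x # xs @ map i1 ys @ map i2 zs))
   = (NINT x|L2. NINT xs|lpow L n. NINT ys|lpow L1 i. NINT zs|lpow L2 j. H (xs @ map i1 ys @ map i2 (x # zs)))"
   by (intro nn_integral_cong H_cong) simp
  also have "... = (NINT xs|lpow L n. NINT x|L2. NINT ys|lpow L1 i. NINT zs|lpow L2 j. H (xs @ map i1 ys @ map i2 (x # zs)))"
   by (rule L2N.Fubini'[symmetric]) measurable
  also have "... = (NINT xs|lpow L n. NINT ys|lpow L1 i. NINT x|L2. NINT zs|lpow L2 j. H (xs @ map i1 ys @ map i2 (x # zs)))"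
   by (intro nn_integral_cong L2I.Fubini'[symmetric]) measurable
  also have "... = U n i (Suc j)"
   unfolding U_def by (intro nn_integral_cong) (subst nn_integral_lpow_Suc[OF fin(3)], simp_all del: lpow.simps)
  finally show ?thesis .
 qed
 have U0: "U 0 i j = (NINT ys|lpow L1 i. NINT zs|lpow L2 j. G (image_mset i1 (mset ys) + image_mset i2 (mset zs)))" for i j
 proof -
  interpret I: finite_measure "lpow L1 i" by (rule finite_lpow[OF fin(2)])
  interpret J: finite_measure "lpow L2 j" by (rule finite_lpow[OF fin(3)])
  have "U 0 i j = (NINT ys|lpow L1 i. NINT zs|lpow L2 j. H ([] @ map i1 ys @ map i2 zs))"
   unfolding U_def by (subst nn_integral_lpow_0) (simp_all del: lpow.simps)
  then show ?thesis by (simp add: H_def)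
 qed
 have "(NINT xs|lpow L n. G (mset xs)) = U n 0 0"
  unfolding U_def H_def[symmetric]
 proof (rule nn_integral_cong)
  fix xs assume "xs : space (lpow L n)"
  then have [measurable]: "xs : space (seqs L)" by simp
  interpret J: finite_measure "lpow L2 0" by (rule finite_lpow[OF fin(3)])
  have "(NINT ys|lpow L1 0. NINT zs|lpow L2 0. H (xs @ map i1 ys @ map i2 zs))
    = (NINT zs|lpow L2 0. H (xs @ map i1 [] @ map i2 zs))"
   by (rule nn_integral_lpow_0) measurable
  also have "... = H (xs @ map i1 [] @ map i2 [])"
   by (rule nn_integral_lpow_0) measurable
  finally show "H (xs) = (NINT ys|lpow L1 0. NINT zs|lpow L2 0. H (xs @ map i1 ys @ map i2 zs))"
   by (simp del: lpow.simps)
 qed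
 also have "... = (\<Sum>k\<le>n. of_nat (n choose k) * U 0 (0 + k) (0 + n - k))"
  by (rule pascal_recursion[where U = U, OF U])
 finally show ?thesis by (simp add: U0)
qed

text \<open>A list from \<open>L\<close> whose points belong to the two groups in any order has the same multiset as a list from \<open>L1\<close>
 followed by one from \<open>L2\<close>; the binomial coefficient counts the orders and turns the Poisson weight of \<open>L\<close> into
 the product of the two weights.\<close>

lemma nn_integral_poisson_sum:
 fixes G :: "'z multiset => ennreal"
 assumes G: "(%xs. G (mset xs)) : bmeas (seqs L)"
 shows "(NINT xs|Poi L. G (mset xs)) =
  (NINT ys|Poi L1. NINT zs|Poi L2. G (image_mset i1 (mset ys) + image_mset i2 (mset zs)))"
proof -
 define H where "H = (%xs. G (mset xs))"
 have H[measurable]: "H : bmeas (seqs L)" unfolding H_def by (rule G)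
 define T where "T k l = (NINT ys|lpow L1 k. NINT zs|lpow L2 l. H (map i1 ys @ map i2 zs))" for k l
 let ?I = "%ys. (\<Sum>l. poisson_weight L2 l * (NINT zs|lpow L2 l. H (map i1 ys @ map i2 zs)))"
 have w: "poisson_weight L n * of_nat (n choose k) = poisson_weight L1 k * poisson_weight L2 (n - k)"
  if "k <= n" for n k
  using that
  by (simp add: poisson_weight_def mass_sum ennreal_of_nat_eq_real_of_nat ennreal_mult[symmetric]
    binomial_fact exp_add exp_diff exp_minus field_simps)
 have "(NINT xs|Poi L. G (mset xs)) = (\<Sum>n. poisson_weight L n * (\<Sum>k\<le>n. of_nat (n choose k) * T k (n - k)))"
  unfolding nn_integral_Poi[OF G] lpow_sum[OF G] T_def by (simp add: H_def)
 also have "... = (\<Sum>n. \<Sum>k\<le>n. poisson_weight L1 k * poisson_weight L2 (n - k) * T k (n - k))"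
  by (intro suminf_cong, unfold sum_distrib_left, intro sum.cong refl) (simp add: w mult.assoc[symmetric])
 also have "... = (\<Sum>k. \<Sum>l. poisson_weight L1 k * poisson_weight L2 l * T k l)"
  by (rule suminf_antidiagonal_ennreal[of "%k l. poisson_weight L1 k * poisson_weight L2 l * T k l"])
 also have "... = (\<Sum>k. poisson_weight L1 k * (NINT ys|lpow L1 k. ?I ys))"
 proof (rule suminf_cong)
  fix k
  have m: "(%ys. NINT zs|lpow L2 l. H (map i1 ys @ map i2 zs)) : bmeas (lpow L1 k)" for l
  proof -
   interpret J: finite_measure "lpow L2 l" by (rule finite_lpow[OF fin(3)])
   show ?thesis by measurable
  qed
  have "(NINT ys|lpow L1 k. ?I ys)
    = (\<Sum>l. poisson_weight L2 l * T k l)"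
   unfolding T_def using m by (subst nn_integral_suminf) (simp_all add: nn_integral_cmult del: lpow.simps)
  then show "(\<Sum>l. poisson_weight L1 k * poisson_weight L2 l * T k l) = poisson_weight L1 k * (NINT ys|lpow L1 k. ?I ys)"
   by (simp add: mult.assoc)
 qed
 also have "... = (\<Sum>k. poisson_weight L1 k * (NINT ys|lpow L1 k. (NINT zs|Poi L2. H (map i1 ys @ map i2 zs))))"
 proof (intro suminf_cong arg_cong2[where f = "(*)"] nn_integral_cong refl)
  fix k ys assume "ys : space (lpow L1 k)"
  then have [measurable]: "(%_. ys) : seqs L2 ->M seqs L1" by simp
  show "?I ys = (NINT zs|Poi L2. H (map i1 ys @ map i2 zs))"
   by (rule nn_integral_Poi[symmetric]) measurable
 qed
 also have "... = (NINT ys|Poi L1. (NINT zs|Poi L2. H (map i1 ys @ map i2 zs)))"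
 proof (rule nn_integral_Poi[symmetric])
  interpret J: prob_space "Poi L2" by (rule prob_space_Poi[OF fin(3)])
  show "(%ys. NINT zs|Poi L2. H (map i1 ys @ map i2 zs)) : bmeas (seqs L1)"
   by measurable
 qed
 finally show ?thesis by (simp add: H_def)
qed

end

section \<open>The Mecke formula\<close>

lemma measurable_campbell_sum_mset:
 fixes \<Phi> :: "'z => 'z multiset => 'c::{second_countable_topology, topological_comm_monoid_add}"
 assumes "(%(x, xs). \<Phi> x (mset xs)) : bmeas (Z >< seqs Z)"
 shows "(%xs. campbell_sum \<Phi> (mset xs)) : bmeas (seqs Z)"
proof -
 define \<Psi> where "\<Psi> = (%(x, xs). \<Phi> x (mset xs))"
 have [measurable]: "\<Psi> : bmeas (Z >< seqs Z)" unfolding \<Psi>_def by (rule assms)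
 have "(%(b::unit, x, xs). \<Psi> (x, xs)) : bmeas (count_space UNIV >< Z >< seqs Z)"
  by measurable
 then have "(%(b::unit, x, xs). \<Phi> x (mset xs)) : bmeas (count_space UNIV >< Z >< seqs Z)"
  by (simp only: \<Psi>_def prod.case)
 from measurable_compose[OF measurable_Pair1' measurable_campbell_sum[OF this], of "()"]
 show ?thesis by (simp only: prod.case space_count_space UNIV_I)
qed

text \<open>Each of the \<open>n + 1\<close> points plays the role of the distinguished point once.\<close>

lemma lpow_Mecke:
 fixes \<Phi> :: "'z => 'z multiset => ennreal"
 assumes L: "finite_measure L" and \<Phi>: "(%(x, xs). \<Phi> x (mset xs)) : bmeas (L >< seqs L)"
 shows "(NINT xs|lpow L (Suc n). campbell_sum \<Phi> (mset xs)) =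
  of_nat (Suc n) * (NINT xs|lpow L n. NINT x|L. \<Phi> x (mset xs))"
 using \<Phi>
proof (induction n arbitrary: \<Phi>)
 interpret L: finite_measure L by fact
 note meas = measurable_campbell_sum_mset
 {
  case 0
  define \<Psi> where "\<Psi> = (%(x, xs). \<Phi> x (mset xs))"
  have [measurable]: "\<Psi> : bmeas (L >< seqs L)" unfolding \<Psi>_def by (rule 0)
  have "(NINT xs|lpow L (Suc 0). campbell_sum \<Phi> (mset xs)) = (NINT x|L. NINT xs|lpow L 0. campbell_sum \<Phi> (mset (x # xs)))"
   by (rule nn_integral_lpow_Suc[OF L meas[OF 0]])
  also have "... = (NINT x|L. campbell_sum \<Phi> {#x#})"
  proof (rule nn_integral_cong)
   fix x assume x: "x : space L"
   have "(%xs. campbell_sum \<Phi> (mset (x # xs))) : bmeas (seqs L)"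
    by (rule measurable_compose[OF _ meas[OF 0]]) (use x in measurable)
   from nn_integral_lpow_0[OF this]
   show "(NINT xs|lpow L 0. campbell_sum \<Phi> (mset (x # xs))) = campbell_sum \<Phi> {#x#}" by simp
  qed
  also have "... = (NINT x|L. \<Psi> (x, []))"
   by (simp add: \<Psi>_def campbell_sum_add_mset[where m = "{#}", simplified])
  also have "... = (NINT xs|lpow L 0. NINT x|L. \<Psi> (x, xs))"
   by (rule nn_integral_lpow_0[symmetric]) measurable
  finally show ?case by (simp add: \<Psi>_def del: lpow.simps)
 next
  case (Suc n)
  define \<Psi> where "\<Psi> = (%(x, xs). \<Phi> x (mset xs))"
  have [measurable]: "\<Psi> : bmeas (L >< seqs L)" unfolding \<Psi>_def by (rule Suc)
  let ?I = "(NINT xs|lpow L (Suc n). NINT x|L. \<Psi> (x, xs))"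
  interpret N: finite_measure "lpow L n" by (rule finite_lpow[OF L])
  interpret N': finite_measure "lpow L (Suc n)" by (rule finite_lpow[OF L])
  interpret LL: pair_sigma_finite L L by unfold_locales
  interpret LN: pair_sigma_finite L "lpow L n" by unfold_locales
  interpret LN': pair_sigma_finite L "lpow L (Suc n)" by unfold_locales
  have \<Phi>y: "(%(x, xs). \<Phi> x (add_mset y (mset xs))) : bmeas (L >< seqs L)" if [measurable]: "y : space L" for y
  proof -
   have "(%(x, xs). \<Psi> (x, y # xs)) : bmeas (L >< seqs L)" by measurable
   then show ?thesis by (simp only: \<Psi>_def prod.case mset.simps)
  qed
  have "(NINT xs|lpow L (Suc (Suc n)). campbell_sum \<Phi> (mset xs)) = (NINT y|L. NINT xs|lpow L (Suc n). campbell_sum \<Phi> (mset (y # xs)))"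
   by (rule nn_integral_lpow_Suc[OF L meas[OF Suc.prems]])
  also have "... = (NINT y|L. (NINT xs|lpow L (Suc n). \<Psi> (y, xs)) + of_nat (Suc n) * (NINT xs|lpow L n. NINT x|L. \<Psi> (x, y # xs)))"
  proof (rule nn_integral_cong)
   fix y assume y[measurable]: "y : space L"
   have 1: "(%xs. campbell_sum (%x m. \<Phi> x (add_mset y m)) (mset xs)) : bmeas (seqs L)"
    by (rule meas[OF \<Phi>y[OF y]])
   have "(NINT xs|lpow L (Suc n). campbell_sum \<Phi> (mset (y # xs))) =
     (NINT xs|lpow L (Suc n). \<Psi> (y, xs) + campbell_sum (%x m. \<Phi> x (add_mset y m)) (mset xs))"
    by (simp only: mset.simps campbell_sum_add_mset \<Psi>_def split_beta fst_conv snd_conv)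
   also have "... = (NINT xs|lpow L (Suc n). \<Psi> (y, xs)) + (NINT xs|lpow L (Suc n). campbell_sum (%x m. \<Phi> x (add_mset y m)) (mset xs))"
   proof (rule nn_integral_add)
    show "(%xs. \<Psi> (y, xs)) : bmeas (lpow L (Suc n))" by measurable
    show "(%xs. campbell_sum (%x m. \<Phi> x (add_mset y m)) (mset xs)) : bmeas (lpow L (Suc n))"
     using 1 by (simp only: measurable_cong_sets[OF sets_lpow refl])
   qed
   finally show "(NINT xs|lpow L (Suc n). campbell_sum \<Phi> (mset (y # xs))) = (NINT xs|lpow L (Suc n). \<Psi> (y, xs)) + of_nat (Suc n) * (NINT xs|lpow L n. NINT x|L. \<Psi> (x, y # xs))"
    unfolding Suc.IH[OF \<Phi>y[OF y]] by (simp only: \<Psi>_def split_beta fst_conv snd_conv mset.simps)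
  qed
  also have "... = (NINT y|L. NINT xs|lpow L (Suc n). \<Psi> (y, xs)) + of_nat (Suc n) * (NINT y|L. NINT xs|lpow L n. NINT x|L. \<Psi> (x, y # xs))"
   by (subst nn_integral_add, measurable) (subst nn_integral_cmult, measurable)
  also have "(NINT y|L. NINT xs|lpow L n. NINT x|L. \<Psi> (x, y # xs)) = ?I"
   by (rule nn_integral_lpow_Suc[OF L, symmetric]) measurable
  also have "(NINT y|L. NINT xs|lpow L (Suc n). \<Psi> (y, xs)) = ?I"
   by (rule LN'.Fubini'[symmetric]) measurable
  also have "?I + of_nat (Suc n) * ?I
    = of_nat (Suc (Suc n)) * ?I"
   by (simp add: distrib_right del: lpow.simps)
  finally show ?case by (simp only: \<Psi>_def split_beta fst_conv snd_conv)
 }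
qed

text \<open>The factor \<open>n + 1\<close> is absorbed by the ratio of consecutive Poisson weights, which shifts the sum by one.\<close>

theorem poisson_Mecke:
 fixes \<Phi> :: "'z => 'z multiset => ennreal"
 assumes L: "finite_measure L" and \<Phi>: "(%(x, xs). \<Phi> x (mset xs)) : bmeas (L >< seqs L)"
 shows "(NINT xs|Poi L. campbell_sum \<Phi> (mset xs)) = (NINT xs|Poi L. NINT x|L. \<Phi> x (mset xs))"
proof -
 interpret L: finite_measure L by fact
 define \<Psi> where "\<Psi> = (%(x, xs). \<Phi> x (mset xs))"
 have [measurable]: "\<Psi> : bmeas (L >< seqs L)" unfolding \<Psi>_def by (rule \<Phi>)
 note meas = measurable_campbell_sum_mset[OF \<Phi>]
 let ?a = "%n. poisson_weight L n * (NINT xs|lpow L n. campbell_sum \<Phi> (mset xs))"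
 have "(NINT xs|lpow L 0. campbell_sum \<Phi> (mset xs)) = 0"
  using nn_integral_lpow_0[OF meas] by simp
 then have "(\<Sum>n. ?a n) = (\<Sum>n. ?a (Suc n))"
  using suminf_offset[of ?a 1] by simp
 also have "... = (\<Sum>n. poisson_weight L n * (NINT xs|lpow L n. NINT x|L. \<Psi> (x, xs)))"
 proof (rule suminf_cong)
  fix n
  have "poisson_weight L (Suc n) * of_nat (Suc n) = poisson_weight L n"
   unfolding poisson_weight_def
   by (simp add: ennreal_of_nat_eq_real_of_nat ennreal_mult[symmetric] field_simps del: of_nat_Suc)
  then show "?a (Suc n) = poisson_weight L n * (NINT xs|lpow L n. NINT x|L. \<Psi> (x, xs))"
   unfolding lpow_Mecke[OF L \<Phi>] mult.assoc[symmetric] by (simp only: \<Psi>_def split_beta fst_conv snd_conv)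
 qed
 also have "... = (NINT xs|Poi L. NINT x|L. \<Psi> (x, xs))"
  by (rule nn_integral_Poi[symmetric]) measurable
 finally show ?thesis
  unfolding nn_integral_Poi[OF meas] by (simp only: \<Psi>_def split_beta fst_conv snd_conv)
qed

section \<open>Permutation invariant functionals\<close>

definition perm_inv where
 "perm_inv f \<longleftrightarrow> (\<forall>xs ys. mset xs = mset ys \<longrightarrow> f xs = f ys)"

lemma perm_invD: "perm_inv f ==> mset xs = mset ys ==> f xs = f ys"
 unfolding perm_inv_def by blast

lemma perm_invI: "(\<And>xs ys. mset xs = mset ys ==> f xs = f ys) ==> perm_inv f"
 unfolding perm_inv_def by blast

lemma perm_inv_comp: "perm_inv f ==> perm_inv (%xs. h (f xs))"
 by (rule perm_invI, drule (1) perm_invD, simp only:)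

lemma perm_inv_append: "perm_inv f ==> perm_inv (%xs. f (ys @ xs))"
 by (rule perm_invI, erule perm_invD) (simp only: mset_append)

text \<open>For an invariant function the choice of the list is irrelevant.\<close>

definition of_mset where
 "of_mset f m = f (SOME xs. mset xs = m)"

lemma of_mset_mset: "perm_inv f ==> of_mset f (mset xs) = f xs"
 unfolding of_mset_def by (rule perm_invD) (auto intro: someI[of "%ys. mset ys = mset xs"])

text \<open>Equality of all nonnegative integrals means equality of laws, and transfers to real integrals.\<close>

lemma integral_cong_law:
 fixes f :: "'a => real" and g :: "'b => real"
 assumes [measurable]: "f : bmeas A" "g : bmeas B"
  and eq: "\<And>h::real => ennreal. h : bmeas borel ==> (NINT x|A. h (f x)) = (NINT y|B. h (g y))"
 shows "integral\<^sup>L A f = integral\<^sup>L B g" "integrable A f \<longleftrightarrow> integrable B g"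
proof -
 have "distr A borel f = distr B borel g"
 proof (rule measure_eqI)
  fix X :: "real set" assume "X : sets (distr A borel f)"
  then have X: "X : sets borel" by simp
  show "emeasure (distr A borel f) X = emeasure (distr B borel g) X"
   using eq[of "indicator X"] X
   by (simp add: nn_integral_indicator[symmetric] nn_integral_distr del: nn_integral_indicator)
 qed simp
 moreover have "integral\<^sup>L A f = integral\<^sup>L (distr A borel f) (%x. x)" "integral\<^sup>L B g = integral\<^sup>L (distr B borel g) (%x. x)"
  by (simp_all add: integral_distr)
 moreover have "integrable A f \<longleftrightarrow> integrable (distr A borel f) (%x. x)" "integrable B g \<longleftrightarrow> integrable (distr B borel g) (%x. x)"
  by (simp_all add: integrable_distr_eq)
 ultimately show "integral\<^sup>L A f = integral\<^sup>L B g" "integrable A f \<longleftrightarrow> integrable B g" by simp_all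
qed

lemma (in intensity_sum) nn_integral_poisson_sum_list:
 fixes f :: "'z list => ennreal"
 assumes "f : bmeas (seqs L)" "perm_inv f"
 shows "(NINT xs|Poi L. f xs) = (NINT ys|Poi L1. NINT zs|Poi L2. f (map i1 ys @ map i2 zs))"
proof -
 have eq: "(%xs. of_mset f (mset xs)) = f" using of_mset_mset[OF assms(2)] by (rule ext)
 have "(NINT xs|Poi L. of_mset f (mset xs))
   = (NINT ys|Poi L1. NINT zs|Poi L2. of_mset f (mset (map i1 ys @ map i2 zs)))"
  using nn_integral_poisson_sum[of "of_mset f", unfolded eq, OF assms(1)] by (simp only: eq mset_map mset_append)
 then show ?thesis by (simp only: of_mset_mset[OF assms(2)])
qed

lemma (in finite_measure) integrable_bounded:
 fixes f :: "'a => real"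
 assumes "f : bmeas M" "\<And>x. x : space M ==> \<bar>f x\<bar> <= C"
 shows "integrable M f"
 by (rule integrable_const_bound[of _ C]) (use assms in auto)

lemma (in prob_space) abs_integral_le_bound:
 fixes f :: "'a => real"
 assumes "f : bmeas M" "\<And>x. x : space M ==> \<bar>f x\<bar> <= C"
 shows "\<bar>(LINT x|M. f x)\<bar> <= C"
proof -
 have "\<bar>(LINT x|M. f x)\<bar> <= (LINT x|M. \<bar>f x\<bar>)" by (rule integral_abs_bound)
 also have "... <= (LINT x|M. C)"
  using assms by (intro integral_mono integrable_abs integrable_const integrable_bounded[where C = C])
 finally show ?thesis by (simp add: prob_space)
qed

lemma (in intensity_sum) integral_poisson_sum_bounded:
 fixes f :: "'z list => real"
 assumes f[measurable]: "f : bmeas (seqs L)" and inv: "perm_inv f" and C: "\<And>xs. \<bar>f xs\<bar> <= C"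
 shows "(LINT xs|Poi L. f xs) = (LINT ys|Poi L1. LINT zs|Poi L2. f (map i1 ys @ map i2 zs))"
proof -
 interpret P1: prob_space "Poi L1" by (rule prob_space_Poi[OF fin(2)])
 interpret P2: prob_space "Poi L2" by (rule prob_space_Poi[OF fin(3)])
 interpret P: pair_prob_space "Poi L1" "Poi L2" ..
 have "(LINT xs|Poi L. f xs) = (LINT p|(Poi L1 >< Poi L2). f (map i1 (fst p) @ map i2 (snd p)))"
 proof (rule integral_cong_law)
  fix h :: "real => ennreal" assume [measurable]: "h : bmeas borel"
  have "(NINT xs|Poi L. h (f xs)) = (NINT ys|Poi L1. NINT zs|Poi L2. h (f (map i1 ys @ map i2 zs)))"
   by (rule nn_integral_poisson_sum_list) (measurable, rule perm_inv_comp[OF inv])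
  also have "... = (NINT p|(Poi L1 >< Poi L2). h (f (map i1 (fst p) @ map i2 (snd p))))"
   by (subst P2.nn_integral_fst[symmetric]) simp_all
  finally show "(NINT xs|Poi L. h (f xs)) = (NINT p|(Poi L1 >< Poi L2). h (f (map i1 (fst p) @ map i2 (snd p))))" .
 qed measurable
 also have "... = (LINT ys|Poi L1. LINT zs|Poi L2. f (map i1 ys @ map i2 zs))"
  by (subst P.integral_fst'[symmetric]) (auto intro!: P.integrable_bounded[where C = C] C)
 finally show ?thesis .
qed

section \<open>The growth semigroup\<close>

definition scaled where
 "scaled L t = density L (%_. ennreal t)"

lemma seqs_scaled [simp]: "seqs (scaled L t) = seqs L"
 by (simp add: seqs_def scaled_def)

lemma sets_scaled [simp, measurable_cong]: "sets (scaled L t) = sets L"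
 by (simp add: scaled_def)

lemma space_scaled [simp]: "space (scaled L t) = space L"
 by (simp add: scaled_def)

lemma scaled_1 [simp]: "scaled L 1 = L"
 by (simp add: scaled_def density_1)

lemma nn_integral_scaled: "f : bmeas L ==> (NINT x|scaled L t. f x) = ennreal t * (NINT x|L. f x)"
 by (simp add: scaled_def nn_integral_density nn_integral_cmult)

lemma integral_scaled: "0 <= t ==> f : bmeas L ==> (LINT x|scaled L t. f x) = t * (LINT x|L. f x :: real)"
 by (simp add: scaled_def integral_density)

lemma emeasure_scaled_space: "emeasure (scaled L t) (space L) = ennreal t * emeasure L (space L)"
proof -
 have "(NINT x|scaled L t. 1) = ennreal t * (NINT x|L. 1)" by (rule nn_integral_scaled) simp
 then show ?thesis by (simp only: nn_integral_const space_scaled mult_1)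
qed

lemma finite_scaled:
 assumes "finite_measure L" shows "finite_measure (scaled L t)"
proof
 interpret finite_measure L by fact
 show "emeasure (scaled L t) (space (scaled L t)) \<noteq> \<infinity>"
  using emeasure_finite[of "space L"] by (simp add: emeasure_scaled_space ennreal_mult_eq_top_iff)
qed

lemma measure_scaled: "0 <= t ==> measure (scaled L t) (space L) = t * measure L (space L)"
 unfolding measure_def by (simp only: emeasure_scaled_space enn2real_mult enn2real_ennreal)

lemma intensity_sum_scaled:
 assumes "finite_measure L" "0 <= s" "0 <= t"
 shows "intensity_sum (scaled L (s + t)) (scaled L s) (scaled L t) (%x. x) (%x. x)"
 using assms by (auto intro!: intensity_sum.intro finite_scaled simp: nn_integral_scaled ennreal_plus distrib_right
   cong: measurable_cong_sets)

abbreviation "pois L t \<equiv> Poi (scaled L t)"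

lemma sets_pois [measurable_cong]: "sets (pois L t) = sets (seqs L)"
 by simp

lemma prob_space_pois: "finite_measure L ==> prob_space (pois L t)"
 by (intro prob_space_Poi finite_scaled)

text \<open>The second-order errors of the first two Poisson weights, for total mass \<open>y\<close>.\<close>

lemma exp_minus_bounds:
 fixes y :: real assumes "0 <= y"
 shows "0 <= exp (- y) - 1 + y" "exp (- y) - 1 + y <= y^2" "1 - exp (- y) * (1 + y) <= y^2" "1 - exp (- y) <= y"
proof -
 have lb: "1 - y <= exp (- y)" using exp_ge_add_one_self[of "- y"] by simp
 then show "0 <= exp (- y) - 1 + y" "1 - exp (- y) <= y" by simp_all
 have "exp (- y) * (1 + y) <= 1"
  using exp_ge_add_one_self[of y] by (simp add: exp_minus field_simps)
 also have "1 <= (1 - y + y^2) * (1 + y)"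
  using assms by (simp add: algebra_simps power2_eq_square)
 finally have "exp (- y) <= 1 - y + y^2"
  using assms by (simp add: mult_le_cancel_right)
 then show "exp (- y) - 1 + y <= y^2" by simp
 have "(1 - y) * (1 + y) <= exp (- y) * (1 + y)"
  using lb assms by (intro mult_right_mono) auto
 then show "1 - exp (- y) * (1 + y) <= y^2" by (simp add: algebra_simps power2_eq_square)
qed

text \<open>To first order in the total mass, a Poisson configuration has at most one point. For a nonnegative function
 the contribution of two or more points is at most that of the constant bound, which is known from the total mass \<open>1\<close>.\<close>

lemma poisson_small_mass_nonneg:
 fixes f :: "'z list => real"
 assumes L: "finite_measure L" and [measurable]: "f : bmeas (seqs L)"
  and f: "\<And>xs. 0 <= f xs" "\<And>xs. f xs <= K"
 shows "\<bar>(LINT xs|Poi L. f xs) - f [] - (LINT z|L. (f [z] - f []))\<bar> <= 2 * K * (measure L (space L))^2"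
proof -
 interpret L: finite_measure L by fact
 interpret P: prob_space "Poi L" by (rule prob_space_Poi[OF L])
 define y where "y = measure L (space L)"
 have y: "0 <= y" by (simp add: y_def)
 have K: "0 <= K" using f[of "[]"] by simp
 have intL: "integrable L (%z. f [z])"
  by (rule L.integrable_bounded[where C = K]) (use f in auto)
 define J where "J = (LINT z|L. f [z])"
 have J: "0 <= J" "J <= K * y"
 proof -
  show "0 <= J" unfolding J_def using f by (intro integral_nonneg_AE) auto
  have "J <= (LINT z|L. K)" unfolding J_def using f intL by (intro integral_mono) auto
  then show "J <= K * y" by (simp add: y_def mult.commute)
 qed
 define a where "a n = poisson_weight L n * (NINT xs|lpow L n. ennreal (f xs))" for n
 define b where "b n = poisson_weight L n * (NINT xs|lpow L n. ennreal K)" for n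
 have sa: "(\<Sum>n. a n) = ennreal (LINT xs|Poi L. f xs)"
  unfolding a_def using f
  by (subst nn_integral_Poi[symmetric])
    (auto intro!: nn_integral_eq_integral P.integrable_bounded[where C = K])
 have sb: "(\<Sum>n. b n) = ennreal K"
  unfolding b_def by (subst nn_integral_Poi[symmetric]) (use P.emeasure_space_1 in auto)
 have a01: "a 0 = ennreal (exp (- y) * f [])" "a 1 = ennreal (exp (- y) * J)"
 proof -
  show "a 0 = ennreal (exp (- y) * f [])"
   unfolding a_def using f by (subst nn_integral_lpow_0) (auto simp: poisson_weight_def y_def ennreal_mult)
  have "(NINT xs|lpow L (Suc 0). ennreal (f xs)) = (NINT z|L. NINT xs|lpow L 0. ennreal (f (z # xs)))"
   by (rule nn_integral_lpow_Suc[OF L]) measurable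
  also have "... = (NINT z|L. ennreal (f [z]))"
   by (intro nn_integral_cong, subst nn_integral_lpow_0) auto
  also have "... = ennreal J"
   unfolding J_def using f intL by (intro nn_integral_eq_integral) auto
  finally show "a 1 = ennreal (exp (- y) * J)"
   using J by (simp add: a_def poisson_weight_def y_def ennreal_mult del: lpow.simps)
 qed
 have b01: "b 0 = ennreal (exp (- y) * K)" "b 1 = ennreal (exp (- y) * (K * y))"
  using K y emeasure_lpow[OF L, of 0] emeasure_lpow[OF L, of 1]
  by (simp_all add: b_def poisson_weight_def y_def L.emeasure_eq_measure ennreal_mult[symmetric] del: lpow.simps)
 have ab: "(\<Sum>n. a (n + 2)) <= (\<Sum>n. b (n + 2))"
  unfolding a_def b_def using f by (intro suminf_le mult_left_mono nn_integral_mono ennreal_leI) auto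
 have split: "(\<Sum>n. c n) = (\<Sum>n. c (n + 2)) + (c 0 + c 1)" for c :: "nat => ennreal"
  using suminf_offset[of c 2] by (simp add: numeral_2_eq_2 add.assoc)
 obtain r where r: "(\<Sum>n. a (n + 2)) = ennreal r" "0 <= r"
  using split[of a] sa by (cases "\<Sum>n. a (n + 2)") auto
 obtain r' where r': "(\<Sum>n. b (n + 2)) = ennreal r'" "0 <= r'"
  using split[of b] sb by (cases "\<Sum>n. b (n + 2)") auto
 have rr: "r <= r'" using ab r r' by simp
 have X: "(LINT xs|Poi L. f xs) = r + (exp (- y) * f [] + exp (- y) * J)"
 proof -
  have "ennreal (LINT xs|Poi L. f xs) = ennreal (r + (exp (- y) * f [] + exp (- y) * J))"
   using split[of a] f J r by (simp add: sa a01[simplified] ennreal_plus[symmetric] del: ennreal_plus)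
  moreover have "0 <= (LINT xs|Poi L. f xs)" by (rule Bnonneg) (rule f)
  moreover have "0 <= r + (exp (- y) * f [] + exp (- y) * J)" using r(2) f(1)[of "[]"] J(1) by simp
  ultimately show ?thesis by (simp only: ennreal_inj)
 qed
 have Y: "K = r' + (exp (- y) * K + exp (- y) * (K * y))"
 proof -
  have "ennreal K = ennreal (r' + (exp (- y) * K + exp (- y) * (K * y)))"
   using split[of b] K y r' by (simp add: sb b01[simplified] ennreal_plus[symmetric] del: ennreal_plus)
  moreover have "0 <= r' + (exp (- y) * K + exp (- y) * (K * y))" using r'(2) K y by simp
  ultimately show ?thesis using K by (simp only: ennreal_inj)
 qed
 then have "r' = K * (1 - exp (- y) * (1 + y))" by (simp add: algebra_simps)
 also have "... <= K * y^2" using K exp_minus_bounds(3)[OF y] by (intro mult_left_mono) auto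
 finally have r2: "r <= K * y^2" using rr by simp
 have I: "(LINT z|L. (f [z] - f [])) = J - y * f []"
  using intL by (simp add: J_def y_def Bdiff)
 have e1: "0 <= (exp (- y) - 1 + y) * f []" "(exp (- y) - 1 + y) * f [] <= y^2 * K"
  using exp_minus_bounds(1,2)[OF y] f[of "[]"] by (simp_all add: mult_mono)
 have e2: "0 <= (1 - exp (- y)) * J" "(1 - exp (- y)) * J <= y * (K * y)"
  using exp_minus_bounds(4)[OF y] J y by (simp, intro mult_mono) auto
 have "(LINT xs|Poi L. f xs) - f [] - (LINT z|L. (f [z] - f []))
   = (exp (- y) - 1 + y) * f [] - (1 - exp (- y)) * J + r"
  unfolding X I by (simp add: algebra_simps)
 moreover have "y^2 * K = K * y^2" "y * (K * y) = K * y^2" by (simp_all add: power2_eq_square)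
 ultimately have "\<bar>(LINT xs|Poi L. f xs) - f [] - (LINT z|L. (f [z] - f []))\<bar> <= 2 * (K * y^2)"
  using e1 e2 r(2) r2 by linarith
 then show ?thesis by (simp add: y_def mult.assoc)
qed

lemma poisson_small_mass:
 fixes f :: "'z list => real"
 assumes L: "finite_measure L" and [measurable]: "f : bmeas (seqs L)" and C: "\<And>xs. \<bar>f xs\<bar> <= C"
 shows "\<bar>(LINT xs|Poi L. f xs) - f [] - (LINT z|L. (f [z] - f []))\<bar> <= 4 * C * (measure L (space L))^2"
proof -
 interpret P: prob_space "Poi L" by (rule prob_space_Poi[OF L])
 have "\<bar>(LINT xs|Poi L. (f xs + C)) - (f [] + C) - (LINT z|L. ((f [z] + C) - (f [] + C)))\<bar> <= 2 * (2 * C) * (measure L (space L))^2"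
 proof (rule poisson_small_mass_nonneg[OF L])
  show "0 <= f xs + C" "f xs + C <= 2 * C" for xs using C[of xs] by auto
 qed measurable
 moreover have "(LINT xs|Poi L. (f xs + C)) = (LINT xs|Poi L. f xs) + C"
  by (subst Badd) (auto intro!: P.integrable_bounded[where C = C] C simp: P.prob_space[simplified])
 ultimately show ?thesis by (simp add: algebra_simps)
qed

text \<open>The semigroup that adds independent points at rate \<open>L\<close>; its generator is the integral of the difference operator.\<close>

definition growth :: "'z measure => real => ('z list => real) => 'z list => real" where
 "growth L t f xs = (LINT ys|pois L t. f (xs @ ys))"

lemma growth_measurable [measurable]:
 assumes "finite_measure L" and [measurable]: "f : bmeas (seqs L)"
 shows "growth L t f : bmeas (seqs L)"
proof -
 interpret P: prob_space "pois L t" by (rule prob_space_pois) fact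
 show ?thesis unfolding growth_def [abs_def] by measurable
qed

lemma growth_invariant:
 assumes f: "perm_inv f" shows "perm_inv (growth L t f)"
proof (rule perm_invI)
 fix xs xs' :: "'a list" assume "mset xs = mset xs'"
 then have "f (xs @ ys) = f (xs' @ ys)" for ys by (intro perm_invD[OF f]) simp
 then show "growth L t f xs = growth L t f xs'" by (simp add: growth_def)
qed

lemma growth_bound:
 assumes L: "finite_measure L" and C: "\<And>xs. \<bar>f xs\<bar> <= C"
 shows "\<bar>growth L t f xs\<bar> <= C"
proof (cases "(%ys. f (xs @ ys)) : bmeas (pois L t)")
 case True
 interpret P: prob_space "pois L t" by (rule prob_space_pois) fact
 show ?thesis unfolding growth_def by (rule P.abs_integral_le_bound[OF True C])
next
 case False
 then have "growth L t f xs = 0"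
  unfolding growth_def by (intro not_integrable_integral_eq) (auto dest: borel_measurable_integrable)
 then show ?thesis using C[of "[]"] by simp
qed

lemma growth_add:
 assumes L: "finite_measure L" and f[measurable]: "f : bmeas (seqs L)" and inv: "perm_inv f"
  and C: "\<And>xs. \<bar>f xs\<bar> <= C" and st: "0 <= s" "0 <= t" and xs[measurable]: "xs : space (seqs L)"
 shows "growth L (s + t) f xs = growth L s (growth L t f) xs"
proof -
 interpret intensity_sum "scaled L (s + t)" "scaled L s" "scaled L t" "%x. x" "%x. x"
  by (rule intensity_sum_scaled[OF L st])
 have "growth L (s + t) f xs = (LINT ys|pois L s. LINT zs|pois L t. f (xs @ (map (%x. x) ys @ map (%x. x) zs)))"
  unfolding growth_def
  by (rule integral_poisson_sum_bounded[OF _ perm_inv_append[OF inv] C]) simp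
 then show ?thesis by (simp add: growth_def)
qed

lemma growth_small_time:
 assumes L: "finite_measure L" and f[measurable]: "f : bmeas (seqs L)" and inv: "perm_inv f"
  and C: "\<And>xs. \<bar>f xs\<bar> <= C" and t: "0 <= t" and xs[measurable]: "xs : space (seqs L)"
 shows "\<bar>growth L t f xs - f xs - t * (LINT z|L. (f (z # xs) - f xs))\<bar> <= 4 * C * (t * measure L (space L))^2"
proof -
 have "\<bar>(LINT ys|pois L t. f (xs @ ys)) - f (xs @ []) - (LINT z|scaled L t. (f (xs @ [z]) - f (xs @ [])))\<bar>
   <= 4 * C * (measure (scaled L t) (space (scaled L t)))^2"
  by (rule poisson_small_mass[OF finite_scaled[OF L] _ C]) simp
 moreover have "f (xs @ [z]) = f (z # xs)" for z by (rule perm_invD[OF inv]) simp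
 ultimately show ?thesis
  using t by (simp add: growth_def measure_scaled integral_scaled)
qed

lemma growth_0:
 assumes L: "finite_measure L" and f[measurable]: "f : bmeas (seqs L)" and inv: "perm_inv f"
  and C: "\<And>xs. \<bar>f xs\<bar> <= C" and xs: "xs : space (seqs L)"
 shows "growth L 0 f xs = f xs"
 using growth_small_time[OF L f inv C order_refl xs] by simp

definition increment_const where
 "increment_const C c = (12 * C^2 + (2 * C + 4 * C * c)^2 + 8 * C * (2 * C + 4 * C * c)) * c^2"

text \<open>The discrepancy between the semigroup and multiplication is, to first order in time, the carre du champ
 of the two functions. All errors are quadratic in \<open>t * measure L (space L)\<close>, uniformly in the configuration;
 this uniformity is what allows the increments to be summed along a partition of the unit interval.\<close>

lemma growth_mult:
 assumes L: "finite_measure L" and t: "0 <= t" "t <= 1"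
  and f[measurable]: "f : bmeas (seqs L)" and f_inv: "perm_inv f" and f_C: "\<And>xs. \<bar>f xs\<bar> <= C"
  and g[measurable]: "g : bmeas (seqs L)" and g_inv: "perm_inv g" and g_C: "\<And>xs. \<bar>g xs\<bar> <= C"
  and xs[measurable]: "xs : space (seqs L)"
 shows "\<bar>growth L t (%xs. f xs * g xs) xs - growth L t f xs * growth L t g xs
   - t * (LINT z|L. (growth L t f (z # xs) - growth L t f xs) * (growth L t g (z # xs) - growth L t g xs))\<bar>
  <= increment_const C (measure L (space L)) * t^2"
proof -
 interpret L: finite_measure L by fact
 define c where "c = measure L (space L)"
 define y where "y = t * c"
 have c: "0 <= c" by (simp add: c_def)
 have y: "0 <= y" "y <= c" using t c by (auto simp: y_def mult_left_le_one_le)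
 have C: "0 <= C" using f_C[of "[]"] by simp
 define M where "M = 2 * C + 4 * C * c"
 have M: "0 <= M" using C c by (simp add: M_def)
 have int1: "integrable L (%z. h (z # xs) - h xs)" "\<bar>(LINT z|L. (h (z # xs) - h xs))\<bar> <= 2 * K * c"
  if [measurable]: "h : bmeas (seqs L)" and K: "\<And>xs. \<bar>h xs\<bar> <= K" and xs[measurable]: "xs : space (seqs L)" for h K xs
 proof -
  have D: "\<bar>h (z # xs) - h xs\<bar> <= 2 * K" for z using K[of "z # xs"] K[of xs] by linarith
  show int: "integrable L (%z. h (z # xs) - h xs)"
   by (rule L.integrable_bounded[OF _ D]) measurable
  have "\<bar>(LINT z|L. (h (z # xs) - h xs))\<bar> <= (LINT z|L. \<bar>h (z # xs) - h xs\<bar>)" by (rule integral_abs_bound)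
  also have "... <= (LINT z|L. 2 * K)" by (intro integral_mono integrable_abs int integrable_const D) simp
  finally show "\<bar>(LINT z|L. (h (z # xs) - h xs))\<bar> <= 2 * K * c" by (simp add: c_def mult_ac)
 qed
 have dev: "\<bar>growth L t h xs - h xs\<bar> <= y * M"
  if h: "h : bmeas (seqs L)" "perm_inv h" "\<And>xs. \<bar>h xs\<bar> <= C" and xs: "xs : space (seqs L)" for h xs
 proof -
  have "\<bar>t * (LINT z|L. (h (z # xs) - h xs))\<bar> <= t * (2 * C * c)"
   unfolding abs_mult using int1(2)[OF h(1,3) xs] t by (simp add: mult_left_mono)
  moreover have "4 * C * y^2 <= y * (4 * C * c)"
  proof -
   have "C * (y * y) <= C * (c * y)" using y C by (intro mult_left_mono mult_right_mono) auto
   then show ?thesis by (simp add: power2_eq_square mult_ac)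
  qed
  moreover have "t * (2 * C * c) + y * (4 * C * c) = y * M" by (simp add: y_def M_def algebra_simps)
  moreover have "\<bar>growth L t h xs - h xs\<bar> <= 4 * C * y^2 + \<bar>t * (LINT z|L. (h (z # xs) - h xs))\<bar>"
   using growth_small_time[OF L h t(1) xs] unfolding c_def[symmetric] y_def[symmetric] by linarith
  ultimately show ?thesis by linarith
 qed
 let ?d = "%h z. h (z # xs) - h xs"
 define u v where "u = growth L t f" and "v = growth L t g"
 have u[measurable]: "u : bmeas (seqs L)" and v[measurable]: "v : bmeas (seqs L)"
  unfolding u_def v_def by (rule growth_measurable[OF L f] growth_measurable[OF L g])+
 have uv: "\<bar>u xs\<bar> <= C" "\<bar>v xs\<bar> <= C" for xs
  unfolding u_def v_def by (rule growth_bound[OF L f_C] growth_bound[OF L g_C])+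
 have fg_C: "\<bar>f xs * g xs\<bar> <= C^2" for xs
  unfolding abs_mult power2_eq_square by (intro mult_mono f_C g_C) (use C in auto)
 have fg_inv: "perm_inv (%xs. f xs * g xs)"
  by (rule perm_invI, frule perm_invD[OF f_inv], drule perm_invD[OF g_inv], simp only:)
 define a b q where "a = (LINT z|L. ?d f z)" and "b = (LINT z|L. ?d g z)"
  and "q = (LINT z|L. (f (z # xs) * g (z # xs) - f xs * g xs))"
 define \<Gamma> \<Gamma>' where "\<Gamma> = (LINT z|L. ?d f z * ?d g z)"
  and "\<Gamma>' = (LINT z|L. ?d u z * ?d v z)"
 have D2: "\<bar>h (z # xs) - h xs\<bar> <= 2 * C" if "\<And>xs. \<bar>h xs\<bar> <= C" for h z
  using that[of "z # xs"] that[of xs] by linarith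
 have prod_bound: "\<bar>?d h z * ?d k z\<bar> <= (2 * C) * (2 * C)"
  if "\<And>xs. \<bar>h xs\<bar> <= C" "\<And>xs. \<bar>k xs\<bar> <= C" for h k z
  unfolding abs_mult by (intro mult_mono D2 that) (use C in auto)
 have int\<Gamma>: "integrable L (%z. ?d h z * ?d k z)"
  if [measurable]: "h : bmeas (seqs L)" "k : bmeas (seqs L)"
  and "\<And>xs. \<bar>h xs\<bar> <= C" "\<And>xs. \<bar>k xs\<bar> <= C" for h k
  by (rule L.integrable_bounded[OF _ prod_bound[OF that(3,4)]]) measurable
 have q: "q = f xs * b + g xs * a + \<Gamma>"
 proof -
  have "q = (LINT z|L. f xs * ?d g z + g xs * ?d f z + ?d f z * ?d g z)"
   unfolding q_def by (intro Bochner_Integration.integral_cong) (auto simp: algebra_simps)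
  also have "... = f xs * b + g xs * a + \<Gamma>"
   unfolding a_def b_def \<Gamma>_def using int1(1)[OF f f_C xs] int1(1)[OF g g_C xs] int\<Gamma>[OF f g f_C g_C]
   by (simp only: Badd Biadd integrable_mult_right integral_mult_right_zero)
  finally show ?thesis .
 qed
 define e0 where "e0 = growth L t (%xs. f xs * g xs) xs - f xs * g xs - t * q"
 define e1 where "e1 = u xs - f xs - t * a"
 define e2 where "e2 = v xs - g xs - t * b"
 have e: "\<bar>e0\<bar> <= 4 * C^2 * y^2" "\<bar>e1\<bar> <= 4 * C * y^2" "\<bar>e2\<bar> <= 4 * C * y^2"
  using growth_small_time[OF L _ fg_inv fg_C t(1) xs] growth_small_time[OF L f f_inv f_C t(1) xs]
   growth_small_time[OF L g g_inv g_C t(1) xs]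
  by (simp_all add: e0_def e1_def e2_def q_def a_def b_def u_def v_def c_def y_def)
 have dev_u: "\<bar>u xs - f xs\<bar> <= y * M" and dev_v: "\<bar>v xs - g xs\<bar> <= y * M" if "xs : space (seqs L)" for xs
  unfolding u_def v_def by (rule dev[OF f f_inv f_C that] dev[OF g g_inv g_C that])+
 \<comment> \<open>The error of the product of the semigroups against the semigroup of the product, written with first-order errors.\<close>
 have main: "growth L t (%xs. f xs * g xs) xs - u xs * v xs
   = t * \<Gamma> + e0 - f xs * e2 - g xs * e1 - (u xs - f xs) * (v xs - g xs)"
  unfolding e0_def e1_def e2_def q by (simp add: algebra_simps)
 have t1: "\<bar>f xs * e2\<bar> <= C * (4 * C * y^2)" "\<bar>g xs * e1\<bar> <= C * (4 * C * y^2)"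
  "\<bar>(u xs - f xs) * (v xs - g xs)\<bar> <= (y * M) * (y * M)"
  unfolding abs_mult by (intro mult_mono f_C g_C e dev_u dev_v xs; use C y M in simp)+
 \<comment> \<open>Replacing the functions by their images under the semigroup changes the carre du champ by a term of order \<open>y\<close>.\<close>
 have t2: "\<bar>t * \<Gamma> - t * \<Gamma>'\<bar> <= t * (8 * C * M * y * c)"
 proof -
  have "\<bar>\<Gamma> - \<Gamma>'\<bar> = \<bar>(LINT z|L. (?d f z * ?d g z - ?d u z * ?d v z))\<bar>"
   unfolding \<Gamma>_def \<Gamma>'_def by (simp only: Bdiff[OF int\<Gamma>[OF f g f_C g_C] int\<Gamma>[OF u v uv]])
  also have "... <= (LINT z|L. \<bar>?d f z * ?d g z - ?d u z * ?d v z\<bar>)"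
   by (rule integral_abs_bound)
  also have "... <= (LINT z|L. 8 * C * M * y)"
  proof (rule integral_mono[OF integrable_abs[OF Bidiff[OF int\<Gamma>[OF f g f_C g_C] int\<Gamma>[OF u v uv]]] L.integrable_const])
   fix z assume z: "z : space L"
   have z': "z # xs : space (seqs L)" using z xs by simp
   have du: "\<bar>?d f z - ?d u z\<bar> <= 2 * (y * M)"
    using dev_u[OF z'] dev_u[OF xs] by linarith
   have dv: "\<bar>?d g z - ?d v z\<bar> <= 2 * (y * M)"
    using dev_v[OF z'] dev_v[OF xs] by linarith
   have eq: "?d f z * ?d g z - ?d u z * ?d v z
    = (?d f z - ?d u z) * ?d g z + ?d u z * (?d g z - ?d v z)"
    for z by (simp only: left_diff_distrib right_diff_distrib)
   have "\<bar>?d f z * ?d g z - ?d u z * ?d v z\<bar> <= \<bar>?d f z - ?d u z\<bar> * \<bar>g (z # xs) - g xs\<bar> + \<bar>u (z # xs) - u xs\<bar> * \<bar>?d g z - ?d v z\<bar>"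
    unfolding eq by (rule order_trans[OF abs_triangle_ineq]) (simp only: abs_mult order_refl)
   also have "... <= 2 * (y * M) * (2 * C) + 2 * C * (2 * (y * M))"
    by (rule add_mono[OF mult_mono[OF du D2[OF g_C]] mult_mono[OF D2[OF uv(1)] dv]]) (use C y M in auto)
   also have "... = 8 * C * M * y" by simp
   finally show "\<bar>?d f z * ?d g z - ?d u z * ?d v z\<bar> <= 8 * C * M * y" .
  qed
  also have "... = 8 * C * M * y * c" unfolding c_def by simp
  finally have "t * \<bar>\<Gamma> - \<Gamma>'\<bar> <= t * (8 * C * M * y * c)" using t(1) by (rule mult_left_mono)
  moreover have "\<bar>t * \<Gamma> - t * \<Gamma>'\<bar> = t * \<bar>\<Gamma> - \<Gamma>'\<bar>"
   unfolding right_diff_distrib[symmetric] abs_mult abs_of_nonneg[OF t(1)] ..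
  ultimately show ?thesis by (simp only:)
 qed
 have "\<bar>growth L t (%xs. f xs * g xs) xs - u xs * v xs - t * \<Gamma>'\<bar>
   <= 4 * C^2 * y^2 + C * (4 * C * y^2) + C * (4 * C * y^2) + (y * M) * (y * M) + t * (8 * C * M * y * c)"
 proof -
  have abs5: "\<bar>a + b + c + d + e\<bar> <= \<bar>b\<bar> + \<bar>c\<bar> + \<bar>d\<bar> + \<bar>e\<bar> + \<bar>a\<bar>" for a b c d e :: real by linarith
  have eq: "growth L t (%xs. f xs * g xs) xs - u xs * v xs - t * \<Gamma>'
    = (t * \<Gamma> - t * \<Gamma>') + e0 + (- (f xs * e2)) + (- (g xs * e1)) + (- ((u xs - f xs) * (v xs - g xs)))"
   unfolding main by simp
  show ?thesis
   unfolding eq by (rule order_trans[OF abs5], unfold abs_minus_cancel) (intro add_mono e(1) t1 t2)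
 qed
 also have "... = (12 * C^2 + M^2 + 8 * C * M) * c^2 * t^2"
  by (simp add: y_def power2_eq_square algebra_simps)
 also have "... = increment_const C c * t^2"
  by (simp add: increment_const_def M_def)
 finally show ?thesis by (simp add: u_def v_def \<Gamma>'_def c_def)
qed

text \<open>A mean value inequality: along the partition into \<open>n\<close> equal pieces the quadratic errors add up to \<open>K / n\<close>. The
 slope \<open>\<gamma>\<close> enters only through its bound, so that it may depend on \<open>s\<close> arbitrarily.\<close>

lemma telescoping_bound:
 fixes h \<gamma> :: "real => real"
 assumes h: "\<And>s t. 0 <= s ==> 0 < t ==> s + t <= 1 ==> \<bar>h (s + t) - h s - t * \<gamma> s\<bar> <= K * t^2"
  and \<gamma>: "\<And>s. 0 <= s ==> s <= 1 ==> \<bar>\<gamma> s\<bar> <= B"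
 shows "\<bar>h 1 - h 0\<bar> <= B"
proof -
 have "\<bar>h 1 - h 0\<bar> <= B + K / real (Suc n)" for n
 proof -
  define d where "d = 1 / real (Suc n)"
  have d: "0 < d" by (simp add: d_def)
  have "\<bar>h (real i * d) - h 0\<bar> <= real i * (d * B + K * d^2)" if "i <= Suc n" for i
   using that
  proof (induction i)
   case (Suc i)
   have 1: "real i * d + d <= 1" using Suc.prems by (simp add: d_def field_simps)
   have 2: "\<bar>d * \<gamma> (real i * d)\<bar> <= d * B"
    unfolding abs_mult using \<gamma>[of "real i * d"] 1 d by (simp add: mult_left_mono)
   have "\<bar>h (real i * d + d) - h (real i * d)\<bar> <= d * B + K * d^2"
    using h[of "real i * d" d] 1 2 d by simp
   moreover have "real (Suc i) * d = real i * d + d" by (simp add: algebra_simps)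
   moreover have "real (Suc i) * (d * B + K * d^2) = real i * (d * B + K * d^2) + (d * B + K * d^2)" by (simp add: algebra_simps)
   ultimately show ?case using Suc by simp
  qed simp
  from this[of "Suc n"] have "\<bar>h (real (Suc n) * d) - h 0\<bar> <= real (Suc n) * (d * B + K * d^2)" by simp
  moreover have n1: "real (Suc n) * d = 1" by (simp add: d_def)
  moreover have "real (Suc n) * (d * B + K * d^2) = (real (Suc n) * d) * B + K * (real (Suc n) * d) * d"
   by (simp add: algebra_simps power2_eq_square)
  ultimately show ?thesis by (simp add: d_def del: of_nat_Suc)
 qed
 moreover have "(%n. B + K / real (Suc n)) \<longlonglongrightarrow> B + 0"
  by (intro tendsto_add tendsto_const LIMSEQ_Suc lim_const_over_n)
 ultimately show ?thesis by (intro LIMSEQ_le_const[of _ B]) auto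
qed

section \<open>Marked configurations\<close>

text \<open>The three marks realise a pair of dependent Poisson processes: points with mark \<open>Both\<close> belong to both
 members of the pair, the others only to one.\<close>

datatype mark = Both | First | Second

definition mark_weight where
 "mark_weight s k = (if k = Both then s else 1 - s)"

definition marked where
 "marked L s K = L >< density (count_space K) (%k. ennreal (mark_weight s k))"

lemma sets_marked [simp, measurable_cong]: "sets (marked L s K) = sets (L >< count_space K)"
 unfolding marked_def by (intro sets_pair_measure_cong) simp_all

lemma space_marked: "space (marked L s K) = space L \<times> K"
 by (simp add: marked_def space_pair_measure)

lemma finite_mark_weight:
 assumes "finite K"
 shows "finite_measure (density (count_space K) (%k. ennreal (mark_weight s k)))"
proof
 show "emeasure (density (count_space K) (%k. ennreal (mark_weight s k))) (space (density (count_space K) (%k. ennreal (mark_weight s k)))) \<noteq> \<infinity>"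
  using assms by (simp add: emeasure_density nn_integral_count_space_finite ennreal_mult_eq_top_iff)
qed

lemma finite_marked: "finite_measure L ==> finite K ==> finite_measure (marked L s K)"
 unfolding marked_def by (intro finite_measure_pair_measure finite_mark_weight)

lemma nn_integral_marked:
 assumes K: "finite K" and [measurable]: "f : bmeas (L >< count_space K)"
 shows "(NINT p|marked L s K. f p) = (NINT x|L. (\<Sum>k\<in>K. ennreal (mark_weight s k) * f (x, k)))"
proof -
 let ?D = "density (count_space K) (%k. ennreal (mark_weight s k))"
 interpret D: finite_measure ?D by (rule finite_mark_weight[OF K])
 have "(NINT p|marked L s K. f p) = (NINT x|L. NINT k|?D. f (x, k))"
  unfolding marked_def
  by (rule D.nn_integral_fst[symmetric]) (simp cong: measurable_cong_sets sets_pair_measure_cong)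
 also have "... = (NINT x|L. (\<Sum>k\<in>K. ennreal (mark_weight s k) * f (x, k)))"
  by (intro nn_integral_cong) (simp add: nn_integral_density nn_integral_count_space_finite K)
 finally show ?thesis .
qed

abbreviation "marks \<equiv> {Both, First, Second}"

lemma measurable_mark [measurable]: "k : K ==> (%x. (x, k)) : L ->M marked L s K"
 by measurable

text \<open>The marked intensity is split into the common points and the rest, then the rest into the two members.\<close>

lemma intensity_sum_marked_0:
 assumes L: "finite_measure L" and s: "0 <= s" "s <= 1"
 shows "intensity_sum (marked L s marks) (scaled L s) (marked L s {First, Second}) (%x. (x, Both)) (%p. p)"
proof (rule intensity_sum.intro)
 show "finite_measure (marked L s marks)" "finite_measure (marked L s {First, Second})" "finite_measure (scaled L s)"
  by (intro finite_marked finite_scaled L; simp)+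
 show "(%x. (x, Both)) : scaled L s ->M marked L s marks" by measurable
 show id: "(%p. p) : marked L s {First, Second} ->M marked L s marks"
 proof -
  have "(%p. (fst p, snd p)) : L >< count_space {First, Second} ->M L >< count_space marks"
   by (intro measurable_Pair measurable_fst measurable_compose[OF measurable_snd]) simp
  then show ?thesis by (simp cong: measurable_cong_sets)
 qed
 fix f :: "_ => ennreal" assume f[measurable]: "f : bmeas (marked L s marks)"
 have f': "f : bmeas (L >< count_space marks)" using f by (simp cong: measurable_cong_sets)
 have f12: "f : bmeas (L >< count_space {First, Second})"
  using measurable_compose[OF id f] by (simp cong: measurable_cong_sets)
 have m: "(%x. f (x, k)) : bmeas L" if "k : marks" for k
  by (rule measurable_compose[OF measurable_mark[OF that] f])
 show "integral\<^sup>N (marked L s marks) f = (NINT x|scaled L s. f (x, Both)) + (NINT p|marked L s {First, Second}. f p)"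
  using m[of Both] m[of First] m[of Second]
  by (simp add: nn_integral_marked[OF _ f'] nn_integral_marked[OF _ f12] nn_integral_scaled mark_weight_def
    nn_integral_add nn_integral_cmult)
qed

lemma intensity_sum_marked_12:
 assumes L: "finite_measure L" and s: "0 <= s" "s <= 1"
 shows "intensity_sum (marked L s {First, Second}) (scaled L (1 - s)) (scaled L (1 - s)) (%x. (x, First)) (%x. (x, Second))"
proof (rule intensity_sum.intro)
 show "finite_measure (marked L s {First, Second})" "finite_measure (scaled L (1 - s))" "finite_measure (scaled L (1 - s))"
  by (intro finite_marked finite_scaled L; simp)+
 show "(%x. (x, First)) : scaled L (1 - s) ->M marked L s {First, Second}" "(%x. (x, Second)) : scaled L (1 - s) ->M marked L s {First, Second}"
  by measurable
 fix f :: "_ => ennreal" assume f[measurable]: "f : bmeas (marked L s {First, Second})"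
 have f': "f : bmeas (L >< count_space {First, Second})" using f by (simp cong: measurable_cong_sets)
 have m: "(%x. f (x, k)) : bmeas L" if "k : {First, Second}" for k
  by (rule measurable_compose[OF measurable_mark[OF that] f])
 show "integral\<^sup>N (marked L s {First, Second}) f = (NINT x|scaled L (1 - s). f (x, First)) + (NINT x|scaled L (1 - s). f (x, Second))"
  using m[of First] m[of Second]
  by (simp add: nn_integral_marked[OF _ f'] nn_integral_scaled mark_weight_def nn_integral_add nn_integral_cmult)
qed

text \<open>The two members of the pair.\<close>

definition proj1 where
 "proj1 zs = map fst (filter (%p. snd p \<noteq> Second) zs)"

definition proj2 where
 "proj2 zs = map fst (filter (%p. snd p \<noteq> First) zs)"

lemma proj_append [simp]: "proj1 (xs @ ys) = proj1 xs @ proj1 ys" "proj2 (xs @ ys) = proj2 xs @ proj2 ys"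
 by (simp_all add: proj1_def proj2_def)

lemma proj_map_mark [simp]:
 "proj1 (map (%x. (x, Both)) xs) = xs" "proj1 (map (%x. (x, First)) xs) = xs" "proj1 (map (%x. (x, Second)) xs) = []"
 "proj2 (map (%x. (x, Both)) xs) = xs" "proj2 (map (%x. (x, First)) xs) = []" "proj2 (map (%x. (x, Second)) xs) = xs"
 by (induction xs; simp add: proj1_def proj2_def)+

lemma proj_Cons:
 "proj1 ((x, k) # zs) = (if k \<noteq> Second then x # proj1 zs else proj1 zs)"
 "proj2 ((x, k) # zs) = (if k \<noteq> First then x # proj2 zs else proj2 zs)"
 by (simp_all add: proj1_def proj2_def)

lemma mset_proj_cong:
 assumes "mset xs = mset ys" shows "mset (proj1 xs) = mset (proj1 ys)" "mset (proj2 xs) = mset (proj2 ys)"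
 unfolding proj1_def proj2_def mset_map mset_filter assms by simp_all

lemma measurable_proj [measurable]:
 "proj1 : seqs (marked L s K) ->M seqs L" "proj2 : seqs (marked L s K) ->M seqs L"
 unfolding proj1_def [abs_def] proj2_def [abs_def] by measurable

abbreviation "pair_lists L s \<equiv> Poi (marked L s marks)"

lemma prob_space_pair_lists: "finite_measure L ==> prob_space (pair_lists L s)"
 by (intro prob_space_Poi finite_marked) simp_all

lemma nn_integral_pair_lists:
 fixes f :: "('x \<times> mark) list => ennreal"
 assumes L: "finite_measure L" and s: "0 <= s" "s <= 1"
  and [measurable]: "f : bmeas (seqs (marked L s marks))" and inv: "perm_inv f"
 shows "(NINT zs|pair_lists L s. f zs) = (NINT as|pois L s. NINT bs|pois L (1 - s). NINT cs|pois L (1 - s). f (map (%x. (x, Both)) as @ map (%x. (x, First)) bs @ map (%x. (x, Second)) cs))"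
proof -
 let ?m = "%as ws. (map (%x. (x, Both)) as @ map (%p. p) ws)"
 interpret A: intensity_sum "marked L s marks" "scaled L s" "marked L s {First, Second}" "%x. (x, Both)" "%p. p"
  by (rule intensity_sum_marked_0[OF L s])
 interpret B: intensity_sum "marked L s {First, Second}" "scaled L (1 - s)" "scaled L (1 - s)" "%x. (x, First)" "%x. (x, Second)"
  by (rule intensity_sum_marked_12[OF L s])
 have "(NINT zs|pair_lists L s. f zs) = (NINT as|pois L s. NINT ws|Poi (marked L s {First, Second}). f (?m as ws))"
  by (rule A.nn_integral_poisson_sum_list[OF _ inv]) fact
 also have "... = (NINT as|pois L s. NINT bs|pois L (1 - s). NINT cs|pois L (1 - s). f (map (%x. (x, Both)) as @ map (%p. p) (map (%x. (x, First)) bs @ map (%x. (x, Second)) cs)))"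
 proof (rule nn_integral_cong)
  fix as assume "as : space (pois L s)"
  then have [measurable]: "as : space (seqs (scaled L s))" by simp
  have "map (%x. (x, Both)) as : space (seqs (marked L s marks))"
   using \<open>as : space (pois L s)\<close> by (auto simp: space_seqs space_marked)
  then have [measurable]: "(%_. map (%x. (x, Both)) as) : seqs (marked L s {First, Second}) ->M seqs (marked L s marks)" by simp
  have [measurable]: "(%ws. map (%p. p) ws) : seqs (marked L s {First, Second}) ->M seqs (marked L s marks)"
   by (rule measurable_map_list[OF _ A.i2]) simp
  show "(NINT ws|Poi (marked L s {First, Second}). f (?m as ws)) = (NINT bs|pois L (1 - s). NINT cs|pois L (1 - s). f (map (%x. (x, Both)) as @ map (%p. p) (map (%x. (x, First)) bs @ map (%x. (x, Second)) cs)))"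
  proof (rule B.nn_integral_poisson_sum_list)
   show "(%ws. f (?m as ws)) : bmeas (seqs (marked L s {First, Second}))"
    by measurable
   show "perm_inv (%ws. f (?m as ws))"
    using perm_inv_append[OF inv] by simp
  qed
 qed
 finally show ?thesis by simp
qed

text \<open>Each member of the pair is a Poisson process with the original intensity, since the weights of its two
 marks are \<open>s\<close> and \<open>1 - s\<close>.\<close>

lemma nn_integral_proj:
 fixes f :: "'x list => ennreal"
 assumes L: "finite_measure L" and s: "0 <= s" "s <= 1"
  and [measurable]: "f : bmeas (seqs L)" and inv: "perm_inv f"
 shows "(NINT zs|pair_lists L s. f (proj1 zs)) = (NINT xs|Poi L. f xs)"
  and "(NINT zs|pair_lists L s. f (proj2 zs)) = (NINT xs|Poi L. f xs)"
proof -
 have s': "0 <= 1 - s" using s by simp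
 interpret S: intensity_sum "scaled L (s + (1 - s))" "scaled L s" "scaled L (1 - s)" "%x. x" "%x. x"
  by (rule intensity_sum_scaled[OF L s(1) s'])
 interpret P: prob_space "pois L (1 - s)" by (rule prob_space_pois[OF L])
 have eq: "(NINT xs|Poi L. f xs) = (NINT as|pois L s. NINT bs|pois L (1 - s). f (as @ bs))"
  using S.nn_integral_poisson_sum_list[of f] inv by simp
 have inv': "perm_inv (%zs. f (proj1 zs))" "perm_inv (%zs. f (proj2 zs))"
  by (auto intro!: perm_invI perm_invD[OF inv] mset_proj_cong)
 show "(NINT zs|pair_lists L s. f (proj1 zs)) = (NINT xs|Poi L. f xs)"
  unfolding eq by (subst nn_integral_pair_lists[OF L s _ inv'(1)]) (simp_all add: P.emeasure_space_1[simplified])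
 show "(NINT zs|pair_lists L s. f (proj2 zs)) = (NINT xs|Poi L. f xs)"
  unfolding eq by (subst nn_integral_pair_lists[OF L s _ inv'(2)]) (simp_all add: P.emeasure_space_1[simplified])
qed

section \<open>Functionals of a configuration and the difference operator\<close>

text \<open>The first component is a parameter; it will carry the points that are not resampled.\<close>

definition functional :: "'r measure => 'x measure => ('r * 'x list => 'c::topological_space) => bool" where
 "functional R L F \<longleftrightarrow> F : bmeas (R >< seqs L) \<and> (\<forall>r. perm_inv (%xs. F (r, xs)))"

lemma functional_meas: "functional R L F ==> F : bmeas (R >< seqs L)"
 by (simp only: functional_def)

lemma functional_invariant: "functional R L F ==> perm_inv (%xs. F (r, xs))"
 unfolding functional_def by blast

lemma functionalI:
 assumes "F : bmeas (R >< seqs L)" "\<And>r xs ys. mset xs = mset ys ==> F (r, xs) = F (r, ys)"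
 shows "functional R L F"
 unfolding functional_def
proof (intro conjI allI perm_invI)
 show "F : bmeas (R >< seqs L)" by (rule assms(1))
 show "F (r, xs) = F (r, ys)" if "mset xs = mset ys" for r xs ys using that by (rule assms(2))
qed

lemma functionalD: "functional R L F ==> mset xs = mset ys ==> F (r, xs) = F (r, ys)"
 by (drule functional_invariant) (erule perm_invD)

definition dif :: "('r * 'x list => real) => 'x => 'r * 'x list => real" where
 "dif F z p = F (fst p, z # snd p) - F p"

lemma dif_measurable [measurable]:
 assumes [measurable]: "F : bmeas (R >< seqs L)"
  and [measurable]: "g : N ->M L" "h : N ->M R >< seqs L"
 shows "(%w. dif F (g w) (h w)) : bmeas N"
 unfolding dif_def by measurable

lemma dif_invariant: "functional R L F ==> mset xs = mset ys ==> dif F z (r, xs) = dif F z (r, ys)"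
 unfolding dif_def fst_conv snd_conv
 by (intro arg_cong2[where f = "(-)"]; erule functionalD) simp_all

text \<open>A parameter together with an independent Poisson process.\<close>

definition Psp where
 "Psp R L = R >< Poi L"

lemma sets_Psp [simp, measurable_cong]: "sets (Psp R L) = sets (R >< seqs L)"
 unfolding Psp_def by (intro sets_pair_measure_cong) simp_all

lemma space_Psp: "space (Psp R L) = space R \<times> space (seqs L)"
 by (simp add: Psp_def space_pair_measure)

lemma prob_space_Psp:
 assumes "prob_space R" "finite_measure L" shows "prob_space (Psp R L)"
proof -
 interpret R: prob_space R by fact
 interpret N: prob_space "Poi L" by (rule prob_space_Poi) fact
 interpret Q: pair_prob_space R "Poi L" ..
 show ?thesis unfolding Psp_def by unfold_locales
qed

lemma nn_integral_Psp:
 assumes "finite_measure L" and [measurable]: "f : bmeas (R >< seqs L)"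
 shows "(NINT p|Psp R L. f p) = (NINT r|R. NINT xs|Poi L. f (r, xs))"
proof -
 interpret P: prob_space "Poi L" by (rule prob_space_Poi) fact
 show ?thesis unfolding Psp_def by (rule P.nn_integral_fst[symmetric]) measurable
qed

lemma (in prob_space) integral_fst_bounded:
 fixes f :: "'b * 'a => real"
 assumes "finite_measure N" "f : bmeas (N >< M)" "\<And>p. \<bar>f p\<bar> <= C"
 shows "(LINT p|(N >< M). f p) = (LINT x|N. LINT y|M. f (x, y))"
proof -
 interpret N: finite_measure N by fact
 interpret P: pair_sigma_finite N M by unfold_locales
 interpret Q: finite_measure "N >< M" by (intro finite_measure_pair_measure) unfold_locales
 show ?thesis by (rule P.integral_fst'[symmetric]) (intro Q.integrable_bounded[where C = C] assms)
qed

lemma Fubini_bounded: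
 fixes f :: "'a * 'b => real"
 assumes "finite_measure M1" "finite_measure M2" and [measurable]: "f : bmeas (M1 >< M2)" and C: "\<And>p. \<bar>f p\<bar> <= C"
 shows "(LINT x|M1. LINT y|M2. f (x, y)) = (LINT y|M2. LINT x|M1. f (x, y))"
proof -
 interpret M1: finite_measure M1 by fact
 interpret M2: finite_measure M2 by fact
 interpret P: pair_sigma_finite M1 M2 by unfold_locales
 interpret Q: finite_measure "M1 >< M2" by (intro finite_measure_pair_measure) unfold_locales
 have "integrable (M1 >< M2) (%(x, y). f (x, y))"
  by (rule Q.integrable_bounded[where C = C]) (use C in auto)
 from P.Fubini_integral[OF this] show ?thesis by simp
qed

text \<open>A parameter together with an independent pair of Poisson processes with common part of intensity \<open>s L\<close>.\<close>

definition Qsp where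
 "Qsp R L s = Psp R (marked L s marks)"

lemma sets_Qsp [simp, measurable_cong]: "sets (Qsp R L s) = sets (R >< seqs (marked L s marks))"
 by (simp add: Qsp_def)

definition first where "first p = (fst p, proj1 (snd p))"
definition second where "second p = (fst p, proj2 (snd p))"

lemma measurable_first_second [measurable]:
 "first : R >< seqs (marked L s K) ->M R >< seqs L"
 "second : R >< seqs (marked L s K) ->M R >< seqs L"
 unfolding first_def [abs_def] second_def [abs_def] by measurable

lemma first_Pair: "first (r, zs) = (r, proj1 zs)" and second_Pair: "second (r, zs) = (r, proj2 zs)"
 by (simp_all add: first_def second_def)

lemma prob_space_Qsp: "prob_space R ==> finite_measure L ==> prob_space (Qsp R L s)"
 unfolding Qsp_def by (intro prob_space_Psp finite_marked) simp_all

lemma nn_integral_first_second: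
 fixes f :: "'r * 'x list => ennreal"
 assumes L: "finite_measure L" and s: "0 <= s" "s <= 1" and f: "functional R L f"
 shows "(NINT p|Qsp R L s. f (first p)) = (NINT p|Psp R L. f p)"
  and "(NINT p|Qsp R L s. f (second p)) = (NINT p|Psp R L. f p)"
proof -
 note f_meas[measurable] = functional_meas[OF f]
 have fr: "(%xs. f (r, xs)) : bmeas (seqs L)" if "r : space R" for r
  using that by measurable
 have fin: "finite_measure (marked L s marks)" by (intro finite_marked L) simp
 show "(NINT p|Qsp R L s. f (first p)) = (NINT p|Psp R L. f p)"
  unfolding Qsp_def nn_integral_Psp[OF L f_meas]
  by (subst nn_integral_Psp[OF fin], measurable)
    (intro nn_integral_cong, simp only: first_Pair nn_integral_proj(1)[OF L s fr functional_invariant[OF f]])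
 show "(NINT p|Qsp R L s. f (second p)) = (NINT p|Psp R L. f p)"
  unfolding Qsp_def nn_integral_Psp[OF L f_meas]
  by (subst nn_integral_Psp[OF fin], measurable)
    (intro nn_integral_cong, simp only: second_Pair nn_integral_proj(2)[OF L s fr functional_invariant[OF f]])
qed

lemma integral_pair_lists_bounded:
 fixes f :: "('x \<times> mark) list => real"
 assumes L: "finite_measure L" and s: "0 <= s" "s <= 1"
  and [measurable]: "f : bmeas (seqs (marked L s marks))" and inv: "perm_inv f"
  and C: "\<And>xs. \<bar>f xs\<bar> <= C"
 shows "(LINT zs|pair_lists L s. f zs) = (LINT as|pois L s. LINT bs|pois L (1 - s). LINT cs|pois L (1 - s). f (map (%x. (x, Both)) as @ map (%x. (x, First)) bs @ map (%x. (x, Second)) cs))"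
proof -
 let ?m = "%as ws. (map (%x. (x, Both)) as @ map (%p. p) ws)"
 interpret A: intensity_sum "marked L s marks" "scaled L s" "marked L s {First, Second}" "%x. (x, Both)" "%p. p"
  by (rule intensity_sum_marked_0[OF L s])
 interpret B: intensity_sum "marked L s {First, Second}" "scaled L (1 - s)" "scaled L (1 - s)" "%x. (x, First)" "%x. (x, Second)"
  by (rule intensity_sum_marked_12[OF L s])
 have "(LINT zs|pair_lists L s. f zs) = (LINT as|pois L s. LINT ws|Poi (marked L s {First, Second}). f (?m as ws))"
  by (rule A.integral_poisson_sum_bounded[OF _ inv C]) fact
 also have "... = (LINT as|pois L s. LINT bs|pois L (1 - s). LINT cs|pois L (1 - s). f (map (%x. (x, Both)) as @ map (%p. p) (map (%x. (x, First)) bs @ map (%x. (x, Second)) cs)))"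
 proof (rule Bcong)
  fix as assume "as : space (pois L s)"
  then have "map (%x. (x, Both)) as : space (seqs (marked L s marks))"
   by (auto simp: space_seqs space_marked)
  then have [measurable]: "(%_. map (%x. (x, Both)) as) : seqs (marked L s {First, Second}) ->M seqs (marked L s marks)" by simp
  have [measurable]: "(%ws. map (%p. p) ws) : seqs (marked L s {First, Second}) ->M seqs (marked L s marks)"
   by (rule measurable_map_list[OF _ A.i2]) simp
  show "(LINT ws|Poi (marked L s {First, Second}). f (?m as ws)) = (LINT bs|pois L (1 - s). LINT cs|pois L (1 - s). f (map (%x. (x, Both)) as @ map (%p. p) (map (%x. (x, First)) bs @ map (%x. (x, Second)) cs)))"
  proof (rule B.integral_poisson_sum_bounded)
   show "(%ws. f (?m as ws)) : bmeas (seqs (marked L s {First, Second}))"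
    by measurable
   show "perm_inv (%ws. f (?m as ws))"
    using perm_inv_append[OF inv] by simp
  qed (rule C)
 qed
 finally show ?thesis by simp
qed

section \<open>The covariance formula\<close>

text \<open>The covariance of two functionals, given the parameter, is the integral over \<open>s\<close> from \<open>0\<close> to \<open>1\<close> of
 \<open>gamma_form R L F G s\<close>. Only the resulting bound is stated, which avoids the measurability of \<open>gamma_form\<close> in \<open>s\<close>.\<close>

definition gamma_form :: "'r measure => 'x measure => ('r * 'x list => real) => ('r * 'x list => real) => real => real" where
 "gamma_form R L F G s = (LINT p|Qsp R L s. (LINT z|L. dif F z (second p) * dif G z (first p)))"

abbreviation "growth_dif L t F r z xs \<equiv> growth L t (%ys. F (r, ys)) (z # xs) - growth L t (%ys. F (r, ys)) xs"

text \<open>Given the common points, the private points of the two members are independent. Integrating them out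
 turns each difference into a difference of the semigroup, evaluated at the common points.\<close>

lemma gamma_form_iterated:
 assumes R: "prob_space R" and L: "finite_measure L" and s: "0 <= s" "s <= 1"
  and F: "functional R L F" and G: "functional R L G" and F_C: "\<And>p. \<bar>F p\<bar> <= C" and G_C: "\<And>p. \<bar>G p\<bar> <= C"
 shows "gamma_form R L F G s = (LINT r|R. LINT xs|pois L s. LINT z|L. growth_dif L (1 - s) F r z xs *
   growth_dif L (1 - s) G r z xs)"
proof -
 interpret R: prob_space R by fact
 interpret L: finite_measure L by fact
 interpret Q: prob_space "pois L (1 - s)" by (rule prob_space_pois[OF L])
 interpret K: prob_space "pair_lists L s" by (rule prob_space_pair_lists[OF L])
 note F_meas[measurable] = functional_meas[OF F]
 note G_meas[measurable] = functional_meas[OF G]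
 have C: "0 <= C" using F_C[of undefined] by simp
 have dF: "\<bar>dif F z p\<bar> <= 2 * C" for z p
  using F_C[of "(fst p, z # snd p)"] F_C[of p] unfolding dif_def by linarith
 have dG: "\<bar>dif G z p\<bar> <= 2 * C" for z p
  using G_C[of "(fst p, z # snd p)"] G_C[of p] unfolding dif_def by linarith
 have dFG: "\<bar>dif F z p * dif G z q\<bar> <= 2 * C * (2 * C)" for z p q
  unfolding abs_mult by (rule mult_mono[OF dF dG]) (use C in auto)
 have \<Theta>_bound: "\<bar>(LINT z|L. dif F z p * dif G z q)\<bar> <= 2 * C * (2 * C) * measure L (space L)" for p q
 proof (cases "integrable L (%z. dif F z p * dif G z q)")
  case True
  have "\<bar>(LINT z|L. dif F z p * dif G z q)\<bar> <= (LINT z|L. \<bar>dif F z p * dif G z q\<bar>)" by (rule integral_abs_bound)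
  also have "... <= (LINT z|L. 2 * C * (2 * C))"
   by (rule integral_mono[OF integrable_abs[OF True] L.integrable_const dFG])
  finally show ?thesis by (simp add: mult_ac)
 next
  case False
  then show ?thesis using C by (simp add: not_integrable_integral_eq)
 qed
 have "gamma_form R L F G s = (LINT r|R. LINT zs|pair_lists L s. (LINT z|L. dif F z (second (r, zs)) * dif G z (first (r, zs))))"
  unfolding gamma_form_def Qsp_def Psp_def
  by (rule K.integral_fst_bounded[OF R.finite_measure_axioms _ \<Theta>_bound]) measurable
 also have "... = (LINT r|R. LINT xs|pois L s. LINT z|L. growth_dif L (1 - s) F r z xs *
   growth_dif L (1 - s) G r z xs)"
 proof (rule Bcong)
  fix r assume r[measurable]: "r : space R"
  let ?j = "%zs. (LINT z|L. dif F z (second (r, zs)) * dif G z (first (r, zs)))"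
  let ?i = "%as bs cs. (LINT z|L. dif F z (r, as @ cs) * dif G z (r, as @ bs))"
  have inv: "perm_inv (%zs. LINT z|L. dif F z (second (r, zs)) * dif G z (first (r, zs)))"
  proof (rule perm_invI)
   fix xs ys :: "('b \<times> mark) list" assume "mset xs = mset ys"
   then have "dif F z (second (r, xs)) = dif F z (second (r, ys))" "dif G z (first (r, xs)) = dif G z (first (r, ys))" for z
    unfolding first_Pair second_Pair by (intro dif_invariant[OF F] dif_invariant[OF G] mset_proj_cong; simp)+
   then show "(LINT z|L. dif F z (second (r, xs)) * dif G z (first (r, xs))) = (LINT z|L. dif F z (second (r, ys)) * dif G z (first (r, ys)))"
    by simp
  qed
  have "(LINT zs|pair_lists L s. ?j zs) =
   (LINT as|pois L s. LINT bs|pois L (1 - s). LINT cs|pois L (1 - s). ?i as bs cs)"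
   by (subst integral_pair_lists_bounded[OF L s _ inv \<Theta>_bound]) (measurable, simp add: first_Pair second_Pair)
  also have "... = (LINT xs|pois L s. LINT z|L. growth_dif L (1 - s) F r z xs *
   growth_dif L (1 - s) G r z xs)"
  proof (rule Bcong)
   fix as assume "as : space (pois L s)"
   then have as[measurable]: "as : space (seqs L)" by simp
   define a where "a z = (LINT cs|pois L (1 - s). dif F z (r, as @ cs))" for z
   define b where "b z = (LINT cs|pois L (1 - s). dif G z (r, as @ cs))" for z
   have [measurable]: "a : bmeas L" "b : bmeas L"
    unfolding a_def b_def by measurable
   have a_growth: "a z = growth L (1 - s) (%ys. F (r, ys)) (z # as) - growth L (1 - s) (%ys. F (r, ys)) as"
    and b_growth: "b z = growth L (1 - s) (%ys. G (r, ys)) (z # as) - growth L (1 - s) (%ys. G (r, ys)) as"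
    if [measurable]: "z : space L" for z
    unfolding a_def b_def growth_def dif_def fst_conv snd_conv append_Cons
    by (intro Bdiff Q.integrable_bounded[where C = C] F_C G_C; measurable)+
   have a_C: "\<bar>a z\<bar> <= 2 * C" for z
    unfolding a_def
   proof (cases "(%cs. dif F z (r, as @ cs)) : bmeas (pois L (1 - s))")
    case True
    then show "\<bar>(LINT cs|pois L (1 - s). dif F z (r, as @ cs))\<bar> <= 2 * C" by (rule Q.abs_integral_le_bound[OF _ dF])
   next
    case False
    then have "(LINT cs|pois L (1 - s). dif F z (r, as @ cs)) = 0"
     by (intro not_integrable_integral_eq) (auto dest: borel_measurable_integrable)
    then show "\<bar>(LINT cs|pois L (1 - s). dif F z (r, as @ cs))\<bar> <= 2 * C" using C by simp
   qed
   have "(LINT bs|pois L (1 - s). LINT cs|pois L (1 - s). ?i as bs cs)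
     = (LINT bs|pois L (1 - s). LINT z|L. a z * dif G z (r, as @ bs))"
   proof (rule Bcong)
    fix bs assume "bs : space (pois L (1 - s))"
    then have [measurable]: "bs : space (seqs L)" by simp
    have "(LINT cs|pois L (1 - s). ?i as bs cs)
      = (LINT z|L. (LINT cs|pois L (1 - s). dif F z (r, as @ cs) * dif G z (r, as @ bs)))"
     using Fubini_bounded[OF Q.finite_measure_axioms L, of "%(cs, z). dif F z (r, as @ cs) * dif G z (r, as @ bs)" "2 * C * (2 * C)"] dFG
     by (simp add: split_beta)
    then show "(LINT cs|pois L (1 - s). ?i as bs cs) = (LINT z|L. a z * dif G z (r, as @ bs))"
     by (simp add: a_def)
   qed
   also have "... = (LINT z|L. LINT bs|pois L (1 - s). a z * dif G z (r, as @ bs))"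
   proof -
    have "\<bar>a z * dif G z (r, as @ bs)\<bar> <= 2 * C * (2 * C)" for z bs
     unfolding abs_mult by (rule mult_mono[OF a_C dG]) (use C in auto)
    then show ?thesis
     using Fubini_bounded[OF Q.finite_measure_axioms L, of "%(bs, z). a z * dif G z (r, as @ bs)" "2 * C * (2 * C)"]
     by (simp add: split_beta)
   qed
   also have "... = (LINT z|L. a z * b z)" by (simp add: b_def)
   also have "... = (LINT z|L. growth_dif L (1 - s) F r z as *
    growth_dif L (1 - s) G r z as)"
    by (rule Bcong) (simp only: a_growth b_growth)
   finally show "(LINT bs|pois L (1 - s). LINT cs|pois L (1 - s). ?i as bs cs) = ..." .
  qed
  finally show "(LINT zs|pair_lists L s. ?j zs) = (LINT xs|pois L s. LINT z|L. growth_dif L (1 - s) F r z xs *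
   growth_dif L (1 - s) G r z xs)" .
 qed
 finally show ?thesis .
qed

lemma growth_measurable_param [measurable]:
 assumes "finite_measure L" and [measurable]: "F : bmeas (R >< seqs L)" "f : N ->M R" "g : N ->M seqs L"
 shows "(%w. growth L t (%ys. F (f w, ys)) (g w)) : bmeas N"
proof -
 interpret P: prob_space "pois L t" by (rule prob_space_pois) fact
 show ?thesis unfolding growth_def by measurable
qed

text \<open>Let \<open>h s\<close> be the expectation, over a process of intensity \<open>s L\<close>, of the product of the semigroups at time
 \<open>1 - s\<close> applied to \<open>F\<close> and \<open>G\<close>. Given the parameter, it interpolates between the product of the means at \<open>0\<close> and the
 mean of the product at \<open>1\<close>, and its slope at \<open>s\<close> is \<open>gamma_form R L F G s\<close>: the first-order terms of adding points of
 intensity \<open>t L\<close> cancel except for the carre du champ of \<open>growth_mult\<close>.\<close>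

lemma covariance_bound_bounded:
 fixes F G :: "'r * 'x list => real"
 assumes R: "prob_space R" and L: "finite_measure L"
  and F: "functional R L F" and G: "functional R L G" and F_C: "\<And>p. \<bar>F p\<bar> <= C" and G_C: "\<And>p. \<bar>G p\<bar> <= C"
  and B: "\<And>s. 0 <= s ==> s <= 1 ==> \<bar>gamma_form R L F G s\<bar> <= B"
 shows "\<bar>(LINT p|Psp R L. F p * G p)
   - (LINT r|R. (LINT xs|Poi L. F (r, xs)) * (LINT xs|Poi L. G (r, xs)))\<bar> <= B"
proof -
 interpret R: prob_space R by fact
 interpret L: finite_measure L by fact
 interpret P: prob_space "Poi L" by (rule prob_space_Poi[OF L])
 note F_meas[measurable] = functional_meas[OF F]
 note G_meas[measurable] = functional_meas[OF G]
 note [measurable] = growth_measurable_param[OF L]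
 have C: "0 <= C" using F_C[of undefined] by simp
 define u where "u t r = growth L t (%ys. F (r, ys))" for t r
 define v where "v t r = growth L t (%ys. G (r, ys))" for t r
 have Fr: "(%ys. F (r, ys)) : bmeas (seqs L)" "perm_inv (%ys. F (r, ys))" "\<And>ys. \<bar>F (r, ys)\<bar> <= C"
  and Gr: "(%ys. G (r, ys)) : bmeas (seqs L)" "perm_inv (%ys. G (r, ys))" "\<And>ys. \<bar>G (r, ys)\<bar> <= C"
  if [measurable]: "r : space R" for r
 proof -
  show "(%ys. F (r, ys)) : bmeas (seqs L)" "(%ys. G (r, ys)) : bmeas (seqs L)" by measurable
  show "perm_inv (%ys. F (r, ys))" "perm_inv (%ys. G (r, ys))" by (rule functional_invariant[OF F] functional_invariant[OF G])+
  show "\<bar>F (r, ys)\<bar> <= C" "\<bar>G (r, ys)\<bar> <= C" for ys by (rule F_C G_C)+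
 qed
 have u: "u t r : bmeas (seqs L)" "perm_inv (u t r)" "\<And>ys. \<bar>u t r ys\<bar> <= C"
  and v: "v t r : bmeas (seqs L)" "perm_inv (v t r)" "\<And>ys. \<bar>v t r ys\<bar> <= C"
  if "r : space R" for r t
  unfolding u_def v_def using Fr[OF that] Gr[OF that]
  by (auto intro!: growth_measurable L growth_invariant growth_bound)
 have uv: "(%xs. u t r xs * v t r xs) : bmeas (seqs L)" "perm_inv (%xs. u t r xs * v t r xs)"
  "\<And>ys. \<bar>u t r ys * v t r ys\<bar> <= C * C" if "r : space R" for r t
 proof -
  show "(%xs. u t r xs * v t r xs) : bmeas (seqs L)"
   by (rule borel_measurable_times[OF u(1)[OF that] v(1)[OF that]])
  show "perm_inv (%xs. u t r xs * v t r xs)"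
   by (rule perm_invI, frule perm_invD[OF u(2)[OF that, of t]], drule perm_invD[OF v(2)[OF that, of t]], simp only:)
  show "\<bar>u t r ys * v t r ys\<bar> <= C * C" for ys
   unfolding abs_mult by (rule mult_mono[OF u(3)[OF that] v(3)[OF that]]) (use C in auto)
 qed
 define h0 where "h0 s r = growth L s (%xs. u (1 - s) r xs * v (1 - s) r xs) []" for s r
 define g0 where "g0 s r = (LINT xs|pois L s. LINT z|L. (u (1 - s) r (z # xs) - u (1 - s) r xs) * (v (1 - s) r (z # xs) - v (1 - s) r xs))" for s r
 define h where "h s = (LINT r|R. h0 s r)" for s
 define K where "K = increment_const C (measure L (space L))"
 have meas_h[measurable]: "h0 s : bmeas R" for s
 proof -
  interpret S: prob_space "pois L s" by (rule prob_space_pois[OF L])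
  show ?thesis unfolding h0_def [abs_def] u_def v_def by (subst growth_def) measurable
 qed
 have meas_g[measurable]: "g0 s : bmeas R" for s
 proof -
  interpret S: prob_space "pois L s" by (rule prob_space_pois[OF L])
  show ?thesis unfolding g0_def [abs_def] u_def v_def by measurable
 qed
 have bound_h: "\<bar>h0 s r\<bar> <= C * C" if "r : space R" for s r
  unfolding h0_def by (rule growth_bound[OF L uv(3)[OF that]])
 have "\<bar>h (s + t) - h s - t * gamma_form R L F G s\<bar> <= K * t^2" if s: "0 <= s" and t: "0 < t" and st: "s + t <= 1" for s t
 proof -
  interpret S: prob_space "pois L s" by (rule prob_space_pois[OF L])
  have s1: "0 <= 1 - s - t" "t + (1 - s - t) = 1 - s" "0 <= t" "t <= 1" "1 - (s + t) = 1 - s - t" using s t st by auto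
  have step: "\<bar>h0 (s + t) r - h0 s r - t * g0 s r\<bar> <= K * t^2" if r: "r : space R" for r
  proof -
   define u' v' where "u' = u (1 - s - t) r" and "v' = v (1 - s - t) r"
   let ?w = "(%xs. u' xs * v' xs)"
   note u' = u[OF r, of "1 - s - t", folded u'_def] and v' = v[OF r, of "1 - s - t", folded v'_def]
   note uv' = uv[OF r, of "1 - s - t", folded u'_def v'_def]
   have ueq: "u (1 - s) r xs = growth L t u' xs" and veq: "v (1 - s) r xs = growth L t v' xs" if "xs : space (seqs L)" for xs
    using growth_add[OF L Fr[OF r] s1(3) s1(1) that] growth_add[OF L Gr[OF r] s1(3) s1(1) that]
    by (simp_all add: s1(2) u_def v_def u'_def v'_def)
   define w where "w xs = growth L t ?w xs - growth L t u' xs * growth L t v' xs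
    - t * (LINT z|L. (growth L t u' (z # xs) - growth L t u' xs) * (growth L t v' (z # xs) - growth L t v' xs))" for xs
   have w: "\<bar>w xs\<bar> <= K * t^2" if "xs : space (seqs L)" for xs
    unfolding w_def K_def by (rule growth_mult[OF L s1(3,4) u' v' that])
   have m[measurable]: "growth L t ?w : bmeas (seqs L)"
    "growth L t u' : bmeas (seqs L)" "growth L t v' : bmeas (seqs L)"
    by (rule growth_measurable[OF L uv'(1)] growth_measurable[OF L u'(1)] growth_measurable[OF L v'(1)])+
   have i1: "integrable (pois L s) (growth L t ?w)"
    by (rule S.integrable_bounded[where C = "C * C"]) (simp, rule growth_bound[OF L uv'(3)])
   have b2: "\<bar>growth L t u' xs * growth L t v' xs\<bar> <= C * C" for xs
    unfolding abs_mult by (rule mult_mono[OF growth_bound[OF L u'(3)] growth_bound[OF L v'(3)]]) (use C in auto)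
   have i2: "integrable (pois L s) (%xs. growth L t u' xs * growth L t v' xs)"
    by (rule S.integrable_bounded[OF _ b2]) simp
   have mw: "w : bmeas (seqs L)" unfolding w_def [abs_def] by measurable
   have i3: "integrable (pois L s) w"
    by (rule S.integrable_bounded[where C = "K * t^2"]) (use mw w in simp_all)
   have i4: "integrable (pois L s) (%xs. (growth L t ?w xs - growth L t u' xs * growth L t v' xs) - w xs)"
    by (intro Bidiff i1 i2 i3)
   have h1: "h0 (s + t) r = (LINT xs|pois L s. growth L t ?w xs)"
   proof -
    have "h0 (s + t) r = growth L (s + t) ?w []"
     by (simp only: h0_def u'_def v'_def s1(5))
    also have "... = growth L s (growth L t ?w) []"
     by (rule growth_add[OF L uv' s s1(3) Nil_in_space])
    finally show ?thesis by (simp add: growth_def[of L s])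
   qed
   have h2: "h0 s r = (LINT xs|pois L s. growth L t u' xs * growth L t v' xs)"
    unfolding h0_def growth_def[of L s]
    by (intro Bcong) (simp add: ueq veq)
   have g2: "g0 s r = (LINT xs|pois L s. LINT z|L. (growth L t u' (z # xs) - growth L t u' xs) * (growth L t v' (z # xs) - growth L t v' xs))"
    unfolding g0_def
    by (intro Bcong) (simp add: ueq veq)
   have "t * g0 s r = (LINT xs|pois L s. (growth L t ?w xs - growth L t u' xs * growth L t v' xs) - w xs)"
    unfolding g2 by (simp add: w_def)
   also have "... = h0 (s + t) r - h0 s r - (LINT xs|pois L s. w xs)"
    unfolding h1 h2 using i1 i2 i3
    by (simp only: Bdiff Bidiff)
   finally have "h0 (s + t) r - h0 s r - t * g0 s r = (LINT xs|pois L s. w xs)" by simp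
   moreover have "\<bar>(LINT xs|pois L s. w xs)\<bar> <= K * t^2"
    by (rule S.abs_integral_le_bound) (use mw w in simp_all)
   ultimately show ?thesis by simp
  qed
  have g0_bound: "\<bar>g0 s r\<bar> <= (2 * (C * C) + K * t^2) / t" if "r : space R" for r
  proof -
   have "\<bar>t * g0 s r\<bar> <= 2 * (C * C) + K * t^2"
    using step[OF that] bound_h[OF that, of s] bound_h[OF that, of "s + t"] by linarith
   then show ?thesis using t by (simp add: abs_mult field_simps)
  qed
  have ig: "integrable R (g0 s)" by (rule R.integrable_bounded[OF _ g0_bound]) simp_all
  have ih: "integrable R (h0 s)" for s by (rule R.integrable_bounded[OF _ bound_h]) simp_all
  have "gamma_form R L F G s = (LINT r|R. g0 s r)"
   unfolding g0_def u_def v_def using st t by (intro gamma_form_iterated[OF R L s _ F G F_C G_C]) simp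
  then have "h (s + t) - h s - t * gamma_form R L F G s = (LINT r|R. h0 (s + t) r - h0 s r - t * g0 s r)"
   unfolding h_def using ig ih[of s] ih[of "s + t"] by simp
  also have "\<bar>(LINT r|R. h0 (s + t) r - h0 s r - t * g0 s r)\<bar> <= K * t^2"
   by (rule R.abs_integral_le_bound[OF _ step]) simp
  finally show ?thesis .
 qed
 from telescoping_bound[of h "gamma_form R L F G", OF this B] have "\<bar>h 1 - h 0\<bar> <= B" by simp
 moreover have "h 1 = (LINT p|Psp R L. F p * G p)"
 proof -
  have b: "\<bar>F p * G p\<bar> <= C * C" for p
   unfolding abs_mult by (rule mult_mono[OF F_C G_C]) (use C in auto)
  have "h 1 = (LINT r|R. LINT xs|Poi L. F (r, xs) * G (r, xs))"
   unfolding h_def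
  proof (rule Bcong)
   fix r assume r: "r : space R"
   have "h0 1 r = (LINT xs|Poi L. u 0 r xs * v 0 r xs)" by (simp add: h0_def growth_def[of L 1])
   also have "... = (LINT xs|Poi L. F (r, xs) * G (r, xs))"
    by (rule Bcong) (simp add: u_def v_def growth_0[OF L Fr[OF r]] growth_0[OF L Gr[OF r]])
   finally show "h0 1 r = (LINT xs|Poi L. F (r, xs) * G (r, xs))" .
  qed
  also have "... = (LINT p|Psp R L. F p * G p)"
   unfolding Psp_def by (rule P.integral_fst_bounded[OF R.finite_measure_axioms _ b, symmetric]) measurable
  finally show ?thesis .
 qed
 moreover have "h 0 = (LINT r|R. (LINT xs|Poi L. F (r, xs)) * (LINT xs|Poi L. G (r, xs)))"
  unfolding h_def
 proof (rule Bcong)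
  fix r assume r: "r : space R"
  have "h0 0 r = u 1 r [] * v 1 r []"
   unfolding h0_def diff_zero by (rule growth_0[OF L uv[OF r] Nil_in_space])
  then show "h0 0 r = (LINT xs|Poi L. F (r, xs)) * (LINT xs|Poi L. G (r, xs))"
   by (simp add: u_def v_def growth_def)
 qed
 ultimately show ?thesis by simp
qed

section \<open>Square-integrable functionals\<close>

definition trunc_at where
 "trunc_at n x = max (- real n) (min (real n) x)"

lemma trunc_at_le: "\<bar>trunc_at n x\<bar> <= real n" and trunc_at_le_self: "\<bar>trunc_at n x\<bar> <= \<bar>x\<bar>"
 and trunc_at_Lipschitz: "\<bar>trunc_at n x - trunc_at n y\<bar> <= \<bar>x - y\<bar>"
 unfolding trunc_at_def max_def min_def by (simp_all split: if_split) linarith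

lemma trunc_at_measurable [measurable]: "trunc_at n : bmeas borel"
 unfolding trunc_at_def [abs_def] by measurable

lemma tendsto_trunc_at: "(%n. trunc_at n x) \<longlonglongrightarrow> x"
proof (rule tendsto_eventually)
 obtain N :: nat where N: "\<bar>x\<bar> <= real N" using real_arch_simple by blast
 show "eventually (%n. trunc_at n x = x) sequentially"
  using eventually_ge_at_top[of N]
 proof eventually_elim
  case (elim n)
  then have "\<bar>x\<bar> <= real n" using N by linarith
  then have "x <= real n" "- real n <= x" by linarith+
  then show ?case by (simp add: trunc_at_def)
 qed
qed

lemma functional_comp:
 assumes F: "functional R L F" and [measurable]: "h : bmeas borel"
 shows "functional R L (%p. h (F p))"
proof (rule functionalI)
 note [measurable] = functional_meas[OF F]
 show "(%p. h (F p)) : bmeas (R >< seqs L)" by measurable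
 show "h (F (r, xs)) = h (F (r, ys))" if "mset xs = mset ys" for r xs ys
  by (simp only: functionalD[OF F that])
qed

lemma functional_diff:
 fixes F G :: "'r * 'x list => real"
 assumes F: "functional R L F" and G: "functional R L G" shows "functional R L (%p. F p - G p)"
proof (rule functionalI)
 note [measurable] = functional_meas[OF F] functional_meas[OF G]
 show "(%p. F p - G p) : bmeas (R >< seqs L)" by measurable
 fix r and xs ys :: "'x list" assume "mset xs = mset ys"
 then show "F (r, xs) - G (r, xs) = F (r, ys) - G (r, ys)"
  by (simp only: functionalD[OF F, of xs ys r] functionalD[OF G, of xs ys r])
qed

definition energy where
 "energy R L F = (NINT p|Psp R L. NINT z|L. ennreal ((dif F z p)^2))"

lemma nn_integral_Cauchy_Schwarz_iterated:
 fixes f g :: "'a => 'b => ennreal"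
 assumes "sigma_finite_measure B" and f: "(%(a, b). f a b) : bmeas (A >< B)"
  and g: "(%(a, b). g a b) : bmeas (A >< B)"
 shows "(NINT a|A. NINT b|B. f a b * g a b) \<le>
   rt (NINT a|A. NINT b|B. (f a b)^2) * rt (NINT a|A. NINT b|B. (g a b)^2)"
proof -
 interpret sigma_finite_measure B by fact
 define f' g' where "f' = (%(a, b). f a b)" and "g' = (%(a, b). g a b)"
 have [measurable]: "f' : bmeas (A >< B)" "g' : bmeas (A >< B)"
  unfolding f'_def g'_def by (rule f g)+
 have "(NINT a|A. NINT b|B. f' (a, b) * g' (a, b)) \<le>
   rt (NINT a|A. NINT b|B. (f' (a, b))^2) * rt (NINT a|A. NINT b|B. (g' (a, b))^2)"
  using nn_integral_Cauchy_Schwarz[of f' "A >< B" g']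
  by (simp add: nn_integral_fst[symmetric])
 then show ?thesis by (simp only: f'_def g'_def prod.case)
qed

text \<open>Fatou's lemma for a uniform bound on the integrals.\<close>

lemma nn_integral_le_of_AE_tendsto:
 fixes f :: "nat => 'a => real"
 assumes [measurable]: "\<And>n. f n : bmeas M"
  and lim: "AE x in M. (%n. f n x) \<longlonglongrightarrow> g x" and le: "\<And>n. (NINT x|M. ennreal (f n x)) <= c"
 shows "(NINT x|M. ennreal (g x)) <= c"
proof -
 have "(NINT x|M. ennreal (g x)) = (NINT x|M. liminf (%n. ennreal (f n x)))"
 proof (rule nn_integral_cong_AE)
  from lim show "AE x in M. ennreal (g x) = liminf (%n. ennreal (f n x))"
  proof eventually_elim
   case (elim x)
   show ?case
    by (rule lim_imp_Liminf[symmetric]) (simp, rule tendsto_ennrealI, rule elim)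
  qed
 qed
 also have "... <= liminf (%n. NINT x|M. ennreal (f n x))" by (rule nn_integral_liminf) measurable
 also have "... <= limsup (%n. NINT x|M. ennreal (f n x))" by (rule Liminf_le_Limsup) simp
 also have "... <= c" by (rule Limsup_bounded) (simp add: le)
 finally show ?thesis .
qed

context
 fixes R :: "'r measure" and L :: "'x measure"
 assumes R: "prob_space R" and L: "finite_measure L"
begin

interpretation R: prob_space R by (rule R)
interpretation L: finite_measure L by (rule L)
interpretation P: prob_space "Poi L" by (rule prob_space_Poi[OF L])
interpretation \<Omega>: prob_space "Psp R L" by (rule prob_space_Psp[OF R L])

lemma energy_eq:
 assumes F: "functional R L F"
 shows "energy R L F = (NINT x|(Psp R L >< L). ennreal ((dif F (snd x) (fst x))^2))"
proof -
 note [measurable] = functional_meas[OF F]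
 show ?thesis unfolding energy_def by (subst L.nn_integral_fst[symmetric]) simp_all
qed

lemma energy_first_second:
 assumes s: "0 <= s" "s <= 1" and F: "functional R L F"
 shows "(NINT p|Qsp R L s. NINT z|L. ennreal ((dif F z (first p))^2)) = energy R L F"
  and "(NINT p|Qsp R L s. NINT z|L. ennreal ((dif F z (second p))^2)) = energy R L F"
proof -
 note [measurable] = functional_meas[OF F]
 have "functional R L (%p. NINT z|L. ennreal ((dif F z p)^2))"
 proof (rule functionalI)
  show "(%p. NINT z|L. ennreal ((dif F z p)^2)) : bmeas (R >< seqs L)" by measurable
  fix r and xs ys :: "'x list" assume "mset xs = mset ys"
  then show "(NINT z|L. ennreal ((dif F z (r, xs))^2)) = (NINT z|L. ennreal ((dif F z (r, ys))^2))"
   by (simp only: dif_invariant[OF F, of xs ys])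
 qed
 from nn_integral_first_second[OF L s this]
 show "(NINT p|Qsp R L s. NINT z|L. ennreal ((dif F z (first p))^2)) = energy R L F"
  and "(NINT p|Qsp R L s. NINT z|L. ennreal ((dif F z (second p))^2)) = energy R L F"
  by (simp_all only: energy_def)
qed

text \<open>Cauchy-Schwarz, and each member of the pair alone has the law of the process. The bound does not depend on \<open>s\<close>.\<close>

lemma gamma_integrand_le:
 assumes s: "0 <= s" "s <= 1" and F: "functional R L F" and G: "functional R L G"
 shows "(NINT p|Qsp R L s. NINT z|L. eabs (dif F z (second p) * dif G z (first p)))
  <= rt (energy R L F) * rt (energy R L G)"
proof -
 note [measurable] = functional_meas[OF F] functional_meas[OF G]
 have "(NINT p|Qsp R L s. NINT z|L. eabs (dif F z (second p)) * eabs (dif G z (first p)))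
  <= rt (NINT p|Qsp R L s. NINT z|L. (eabs (dif F z (second p)))^2) *
   rt (NINT p|Qsp R L s. NINT z|L. (eabs (dif G z (first p)))^2)"
  by (rule nn_integral_Cauchy_Schwarz_iterated) (unfold_locales, measurable)
 then show ?thesis
  by (simp add: ennreal_power energy_first_second[OF s F] energy_first_second[OF s G] ennreal_mult abs_mult)
qed

lemma integrable_gamma:
 assumes s: "0 <= s" "s <= 1" and F: "functional R L F" and G: "functional R L G"
  and fin: "energy R L F < \<infinity>" "energy R L G < \<infinity>"
 shows "integrable (Qsp R L s >< L) (%(p, z). dif F z (second p) * dif G z (first p))"
  and "gamma_form R L F G s = (LINT (p, z)|(Qsp R L s >< L). dif F z (second p) * dif G z (first p))"
proof -
 interpret K: prob_space "Qsp R L s" by (rule prob_space_Qsp[OF R L])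
 interpret KL: pair_sigma_finite "Qsp R L s" L by unfold_locales
 note [measurable] = functional_meas[OF F] functional_meas[OF G]
 show int: "integrable (Qsp R L s >< L) (%(p, z). dif F z (second p) * dif G z (first p))"
 proof (rule integrableI_bounded)
  show "(%(p, z). dif F z (second p) * dif G z (first p)) : bmeas (Qsp R L s >< L)" by measurable
  have "(NINT x|(Qsp R L s >< L). ennreal (norm (case x of (p, z) => dif F z (second p) * dif G z (first p))))
    = (NINT p|Qsp R L s. NINT z|L. eabs (dif F z (second p) * dif G z (first p)))"
   by (subst L.nn_integral_fst[symmetric]) (simp_all add: split_beta)
  also have "... <= rt (energy R L F) * rt (energy R L G)" by (rule gamma_integrand_le[OF s F G])
  also have "... < \<infinity>" using fin by (auto simp: epowr_def ennreal_mult_less_top less_top)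
  finally show "(NINT x|(Qsp R L s >< L). ennreal (norm (case x of (p, z) => dif F z (second p) * dif G z (first p)))) < \<infinity>" .
 qed
 show "gamma_form R L F G s = (LINT (p, z)|(Qsp R L s >< L). dif F z (second p) * dif G z (first p))"
  unfolding gamma_form_def using KL.integral_fst'[OF int] by simp
qed

lemma gamma_form_le:
 assumes s: "0 <= s" "s <= 1" and F: "functional R L F" and G: "functional R L G"
  and fin: "energy R L F < \<infinity>" "energy R L G < \<infinity>"
 shows "\<bar>gamma_form R L F G s\<bar> <= sqrt (enn2real (energy R L F)) * sqrt (enn2real (energy R L G))"
proof -
 note [measurable] = functional_meas[OF F] functional_meas[OF G]
 have "eabs (gamma_form R L F G s) <= (NINT x|(Qsp R L s >< L). ennreal (norm (case x of (p, z) => dif F z (second p) * dif G z (first p))))"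
  unfolding integrable_gamma(2)[OF assms] real_norm_def[symmetric]
  by (rule integral_norm_bound_ennreal[OF integrable_gamma(1)[OF assms]])
 also have "... = (NINT p|Qsp R L s. NINT z|L. eabs (dif F z (second p) * dif G z (first p)))"
  by (subst L.nn_integral_fst[symmetric]) (simp_all add: split_beta)
 also have "... <= rt (energy R L F) * rt (energy R L G)" by (rule gamma_integrand_le[OF s F G])
 also have "... = ennreal (sqrt (enn2real (energy R L F)) * sqrt (enn2real (energy R L G)))"
  using fin by (auto simp: epowr_def powr_half_sqrt ennreal_mult)
 finally show ?thesis by (simp add: ennreal_le_iff)
qed

lemma dif_minus: "dif (%p. F p - G p) z q = dif F z q - dif G z q"
 by (simp add: dif_def)

lemma energy_finite_mono:
 assumes "energy R L F < \<infinity>" and "\<And>z p. \<bar>dif G z p\<bar> <= K * \<bar>dif F z p\<bar>"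
  and F: "functional R L F" and G: "functional R L G"
 shows "energy R L G < \<infinity>"
proof -
 note [measurable] = functional_meas[OF F] functional_meas[OF G]
 have "(dif G z p)^2 <= K^2 * (dif F z p)^2" for z p
  using power_mono[OF assms(2)[of z p] abs_ge_zero, of 2] by (simp add: power_mult_distrib)
 then have "energy R L G <= (NINT x|(Psp R L >< L). ennreal (K^2) * ennreal ((dif F (snd x) (fst x))^2))"
  unfolding energy_eq[OF G] by (intro nn_integral_mono) (simp add: ennreal_mult[symmetric] ennreal_leI)
 also have "... = ennreal (K^2) * energy R L F"
  unfolding energy_eq[OF F] by (rule nn_integral_cmult) measurable
 also have "... < \<infinity>" using assms(1) by (simp add: ennreal_mult_less_top)
 finally show ?thesis .
qed

lemma energy_trunc_at_tendsto:
 assumes F: "functional R L F" and fin: "energy R L F < \<infinity>"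
 shows "(%n. enn2real (energy R L (%p. trunc_at n (F p) - F p))) \<longlonglongrightarrow> 0"
proof -
 let ?d = "%n x. (dif (%p. trunc_at n (F p) - F p) (snd x) (fst x))"
 note [measurable] = functional_meas[OF F]
 have bound: "\<bar>dif (%p. trunc_at n (F p) - F p) z p\<bar> <= 2 * \<bar>dif F z p\<bar>" for n z p
 proof -
  have aux: "\<bar>a - c - (b - d)\<bar> <= 2 * \<bar>c - d\<bar>" if "\<bar>a - b\<bar> <= \<bar>c - d\<bar>" for a b c d :: real
   using that by (auto simp: abs_if split: if_splits)
  show ?thesis unfolding dif_def fst_conv snd_conv by (rule aux[OF trunc_at_Lipschitz])
 qed
 have "(%n. NINT x|(Psp R L >< L). ennreal (?d n x^2)) \<longlonglongrightarrow> (NINT x|(Psp R L >< L). 0)"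
 proof (rule nn_integral_dominated_convergence[where w = "%x. ennreal (4 * (dif F (snd x) (fst x))^2)"])
  have "(NINT x|(Psp R L >< L). ennreal (4 * (dif F (snd x) (fst x))^2)) = ennreal 4 * energy R L F"
   unfolding energy_eq[OF F]
   by (subst nn_integral_cmult[symmetric]) (measurable, intro nn_integral_cong, simp add: ennreal_mult)
  then show "(NINT x|(Psp R L >< L). ennreal (4 * (dif F (snd x) (fst x))^2)) < \<infinity>"
   using fin by (simp add: ennreal_mult_less_top)
  show "AE x in Psp R L >< L. ennreal (?d n x^2) <= ennreal (4 * (dif F (snd x) (fst x))^2)" for n
   using power_mono[OF bound abs_ge_zero, of _ _ _ 2] by (intro AE_I2 ennreal_leI) (simp add: power_mult_distrib)
  show "AE x in Psp R L >< L. (%n. ennreal (?d n x^2)) \<longlonglongrightarrow> 0"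
  proof (rule AE_I2)
   fix x :: "('r * 'x list) * 'x"
   have "(%n. ?d n x^2) \<longlonglongrightarrow> ((F (fst (fst x), snd x # snd (fst x)) - F (fst (fst x), snd x # snd (fst x))) - (F (fst x) - F (fst x)))^2"
    unfolding dif_def by (intro tendsto_intros tendsto_trunc_at)
   then show "(%n. ennreal (?d n x^2)) \<longlonglongrightarrow> 0"
    by (intro tendsto_ennrealI[where x = 0, simplified]) simp
  qed
 qed measurable
 then have "(%n. energy R L (%p. trunc_at n (F p) - F p)) \<longlonglongrightarrow> 0"
  unfolding energy_eq[OF functional_diff[OF functional_comp[OF F trunc_at_measurable] F]] by simp
 from tendsto_enn2real[OF this[unfolded ennreal_0[symmetric]]] show ?thesis by simp
qed

text \<open>Truncation extends the bound to square-integrable functionals with finite energy, because the energies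
 of the truncation errors tend to zero and control \<open>gamma_form\<close> uniformly in \<open>s\<close>.\<close>

lemma covariance_bound:
 fixes F G :: "'r * 'x list => real"
 assumes F: "functional R L F" and G: "functional R L G"
  and F2: "integrable (Psp R L) (%p. (F p)^2)" and G2: "integrable (Psp R L) (%p. (G p)^2)"
  and eF: "energy R L F < \<infinity>" and eG: "energy R L G < \<infinity>"
  and B: "\<And>s. 0 <= s ==> s <= 1 ==> \<bar>gamma_form R L F G s\<bar> <= B"
 shows "\<bar>(LINT p|Psp R L. F p * G p)
   - (LINT r|R. (LINT xs|Poi L. F (r, xs)) * (LINT xs|Poi L. G (r, xs)))\<bar> <= B"
proof -
 interpret RP: pair_sigma_finite R "Poi L" by unfold_locales
 note [measurable] = functional_meas[OF F] functional_meas[OF G]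
 define Fn where "Fn n p = trunc_at n (F p)" for n p
 define Gn where "Gn n p = trunc_at n (G p)" for n p
 let ?dF = "%n. (%p. Fn n p - F p)"
 let ?dG = "%n. (%p. Gn n p - G p)"
 have Fn: "functional R L (Fn n)" and Gn: "functional R L (Gn n)" for n
  unfolding Fn_def [abs_def] Gn_def [abs_def] by (rule functional_comp[OF F trunc_at_measurable] functional_comp[OF G trunc_at_measurable])+
 have dFn: "functional R L (?dF n)" and dGn: "functional R L (?dG n)" for n
  by (rule functional_diff[OF Fn F] functional_diff[OF Gn G])+
 note [measurable] = functional_meas[OF Fn] functional_meas[OF Gn]
 have eFn: "energy R L (Fn n) < \<infinity>" and eGn: "energy R L (Gn n) < \<infinity>"
  and edF: "energy R L (?dF n) < \<infinity>" and edG: "energy R L (?dG n) < \<infinity>" for n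
 proof -
  have 1: "\<bar>dif (Fn n) z p\<bar> <= 1 * \<bar>dif F z p\<bar>" "\<bar>dif (Gn n) z p\<bar> <= 1 * \<bar>dif G z p\<bar>" for z p
   by (simp_all add: dif_def Fn_def Gn_def trunc_at_Lipschitz)
  have 2: "\<bar>dif (?dF n) z p\<bar> <= 2 * \<bar>dif F z p\<bar>" "\<bar>dif (?dG n) z p\<bar> <= 2 * \<bar>dif G z p\<bar>" for z p
   using 1[of z p] unfolding dif_minus by linarith+
  show "energy R L (Fn n) < \<infinity>" by (rule energy_finite_mono[OF eF 1(1) F Fn])
  show "energy R L (Gn n) < \<infinity>" by (rule energy_finite_mono[OF eG 1(2) G Gn])
  show "energy R L (?dF n) < \<infinity>" by (rule energy_finite_mono[OF eF 2(1) F dFn])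
  show "energy R L (?dG n) < \<infinity>" by (rule energy_finite_mono[OF eG 2(2) G dGn])
 qed
 define \<epsilon> where "\<epsilon> n = sqrt (enn2real (energy R L (?dF n))) * (sqrt (enn2real (energy R L G)) + sqrt (enn2real (energy R L (?dG n))))
   + sqrt (enn2real (energy R L F)) * sqrt (enn2real (energy R L (?dG n)))" for n
 have "\<epsilon> \<longlonglongrightarrow> sqrt 0 * (sqrt (enn2real (energy R L G)) + sqrt 0) + sqrt (enn2real (energy R L F)) * sqrt 0"
  unfolding \<epsilon>_def [abs_def] Fn_def Gn_def
  by (intro tendsto_add tendsto_mult tendsto_real_sqrt tendsto_const energy_trunc_at_tendsto F G eF eG)
 then have \<epsilon>: "\<epsilon> \<longlonglongrightarrow> 0" by simp
 define Cov where "Cov F G = (LINT p|Psp R L. F p * G p)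
   - (LINT r|R. (LINT xs|Poi L. F (r, xs)) * (LINT xs|Poi L. G (r, xs)))" for F G :: "'r * 'x list => real"
 have bound: "\<bar>Cov (Fn n) (Gn n)\<bar> <= B + \<epsilon> n" for n
  unfolding Cov_def
 proof (rule covariance_bound_bounded[OF R L Fn Gn])
  show "\<bar>Fn n p\<bar> <= real n" "\<bar>Gn n p\<bar> <= real n" for p by (simp_all add: Fn_def Gn_def trunc_at_le)
  fix s :: real assume s: "0 <= s" "s <= 1"
  have split: "gamma_form R L (Fn n) (Gn n) s = gamma_form R L F G s
    + (gamma_form R L (?dF n) G s + gamma_form R L (?dF n) (?dG n) s
    + gamma_form R L F (?dG n) s)"
  proof -
   have "(%(p, z). dif (Fn n) z (second p) * dif (Gn n) z (first p)) =
    (%q. (case q of (p, z) => dif F z (second p) * dif G z (first p)) +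
    ((case q of (p, z) => dif (?dF n) z (second p) * dif G z (first p)) +
     (case q of (p, z) => dif (?dF n) z (second p) * dif (?dG n) z (first p)) +
     (case q of (p, z) => dif F z (second p) * dif (?dG n) z (first p))))"
    unfolding dif_minus by (auto simp: fun_eq_iff algebra_simps)
   then show ?thesis
    unfolding integrable_gamma(2)[OF s Fn Gn eFn eGn] integrable_gamma(2)[OF s F G eF eG]
     integrable_gamma(2)[OF s dFn G edF eG] integrable_gamma(2)[OF s dFn dGn edF edG] integrable_gamma(2)[OF s F dGn eF edG]
    by (simp only: Badd Biadd integrable_gamma(1)[OF s F G eF eG]
     integrable_gamma(1)[OF s dFn G edF eG] integrable_gamma(1)[OF s dFn dGn edF edG] integrable_gamma(1)[OF s F dGn eF edG])
  qed
  have "\<bar>gamma_form R L (Fn n) (Gn n) s\<bar> <= \<bar>gamma_form R L F G s\<bar>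
    + (\<bar>gamma_form R L (?dF n) G s\<bar> + \<bar>gamma_form R L (?dF n) (?dG n) s\<bar>
    + \<bar>gamma_form R L F (?dG n) s\<bar>)"
   unfolding split by linarith
  also have "... <= B + (sqrt (enn2real (energy R L (?dF n))) * sqrt (enn2real (energy R L G))
   + sqrt (enn2real (energy R L (?dF n))) * sqrt (enn2real (energy R L (?dG n)))
   + sqrt (enn2real (energy R L F)) * sqrt (enn2real (energy R L (?dG n))))"
   by (intro add_mono B s gamma_form_le F G dFn dGn eF eG edF edG)
  also have "... = B + \<epsilon> n" by (simp add: \<epsilon>_def algebra_simps)
  finally show "\<bar>gamma_form R L (Fn n) (Gn n) s\<bar> <= B + \<epsilon> n" .
 qed
 have mult_le: "\<bar>a * b\<bar> <= c^2 + d^2" if "\<bar>a\<bar> <= c" "\<bar>b\<bar> <= d" for a b c d :: real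
 proof -
  have "\<bar>a * b\<bar> <= c * d" unfolding abs_mult using that by (intro mult_mono) auto
  also have "... <= c^2 + d^2" using sum_squares_bound[of c d] zero_le_power2[of c] zero_le_power2[of d] by linarith
  finally show ?thesis .
 qed
 have AEF: "AE r in R. integrable (Poi L) (%xs. (F (r, xs))^2)"
  and AEG: "AE r in R. integrable (Poi L) (%xs. (G (r, xs))^2)"
  using RP.AE_integrable_fst'[OF F2[unfolded Psp_def]] RP.AE_integrable_fst'[OF G2[unfolded Psp_def]] by simp_all
 have lim1: "(%n. LINT p|Psp R L. Fn n p * Gn n p) \<longlonglongrightarrow> (LINT p|Psp R L. F p * G p)"
 proof (rule integral_dominated_convergence[where w = "%p. (F p)^2 + (G p)^2"])
  show "AE p in Psp R L. (%n. Fn n p * Gn n p) \<longlonglongrightarrow> F p * G p"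
   unfolding Fn_def Gn_def by (intro AE_I2 tendsto_mult tendsto_trunc_at)
  show "AE p in Psp R L. norm (Fn n p * Gn n p) <= (F p)^2 + (G p)^2" for n
   unfolding Fn_def Gn_def real_norm_def
   using mult_le[OF trunc_at_le_self trunc_at_le_self, of n "F _" n "G _"] by (intro AE_I2) (simp only: power2_abs)
 qed (use F2 G2 in auto)
 have lim2: "(%n. LINT r|R. (LINT xs|Poi L. Fn n (r, xs)) * (LINT xs|Poi L. Gn n (r, xs)))
  \<longlonglongrightarrow> (LINT r|R. (LINT xs|Poi L. F (r, xs)) * (LINT xs|Poi L. G (r, xs)))"
 proof (rule integral_dominated_convergence[where w = "%r. (LINT xs|Poi L. (F (r, xs))^2) + (LINT xs|Poi L. (G (r, xs))^2)"])
  show "integrable R (%r. (LINT xs|Poi L. (F (r, xs))^2) + (LINT xs|Poi L. (G (r, xs))^2))"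
   using RP.integrable_fst'[OF F2[unfolded Psp_def]] RP.integrable_fst'[OF G2[unfolded Psp_def]]
   by (rule Biadd)
  have key: "(%n. LINT xs|Poi L. trunc_at n (f xs)) \<longlonglongrightarrow> (LINT xs|Poi L. f xs)"
   "\<And>n. (LINT xs|Poi L. trunc_at n (f xs))^2 <= (LINT xs|Poi L. (f xs)^2)"
   if [measurable]: "f : bmeas (seqs L)" and f2: "integrable (Poi L) (%xs. (f xs)^2)" for f :: "'x list => real"
  proof -
   have f1: "integrable (Poi L) f"
    by (rule P.square_integrable_imp_integrable[OF _ f2]) simp
   show "(%n. LINT xs|Poi L. trunc_at n (f xs)) \<longlonglongrightarrow> (LINT xs|Poi L. f xs)"
    by (rule integral_dominated_convergence[where w = "%xs. \<bar>f xs\<bar>"])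
      (insert f1 trunc_at_le_self, auto intro!: tendsto_trunc_at)
   fix n
   have i1: "integrable (Poi L) (%xs. trunc_at n (f xs))"
    by (rule P.integrable_bounded[where C = "real n"]) (auto simp: trunc_at_le)
   have c2: "(trunc_at n (f xs))^2 <= (f xs)^2" for xs
    using power_mono[OF trunc_at_le_self[of n "f xs"], of 2] by simp
   have i2: "integrable (Poi L) (%xs. (trunc_at n (f xs))^2)"
    by (rule Bbound[OF f2]) (use c2 in auto)
   have "0 <= P.variance (%xs. trunc_at n (f xs))" by (rule P.variance_positive)
   then have "(LINT xs|Poi L. trunc_at n (f xs))^2 <= (LINT xs|Poi L. (trunc_at n (f xs))^2)"
    by (simp add: P.variance_eq[OF i1 i2])
   also have "... <= (LINT xs|Poi L. (f xs)^2)" by (intro integral_mono i2 f2 c2)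
   finally show "(LINT xs|Poi L. trunc_at n (f xs))^2 <= (LINT xs|Poi L. (f xs)^2)" .
  qed
  have Fr: "(%xs. F (r, xs)) : bmeas (seqs L)" and Gr: "(%xs. G (r, xs)) : bmeas (seqs L)" if [measurable]: "r : space R" for r
   by measurable
  show "AE r in R. (%n. (LINT xs|Poi L. Fn n (r, xs)) * (LINT xs|Poi L. Gn n (r, xs)))
    \<longlonglongrightarrow> (LINT xs|Poi L. F (r, xs)) * (LINT xs|Poi L. G (r, xs))"
   using AEF AEG AE_space
  proof eventually_elim
   case (elim r)
   then show ?case unfolding Fn_def Gn_def by (intro tendsto_mult key(1) Fr Gr)
  qed
  show "AE r in R. norm ((LINT xs|Poi L. Fn n (r, xs)) * (LINT xs|Poi L. Gn n (r, xs)))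
    <= (LINT xs|Poi L. (F (r, xs))^2) + (LINT xs|Poi L. (G (r, xs))^2)" for n
   using AEF AEG AE_space
  proof eventually_elim
   case (elim r)
   define a b where "a = (LINT xs|Poi L. Fn n (r, xs))" and "b = (LINT xs|Poi L. Gn n (r, xs))"
   have "a^2 <= (LINT xs|Poi L. (F (r, xs))^2)" "b^2 <= (LINT xs|Poi L. (G (r, xs))^2)"
    unfolding a_def b_def Fn_def Gn_def using key(2)[OF Fr[OF elim(3)] elim(1), of n] key(2)[OF Gr[OF elim(3)] elim(2), of n] by simp_all
   moreover have "\<bar>a * b\<bar> <= a^2 + b^2" using mult_le[of a "\<bar>a\<bar>" b "\<bar>b\<bar>"] by simp
   ultimately show ?case unfolding a_def[symmetric] b_def[symmetric] real_norm_def by linarith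
  qed
 qed measurable
 have "(%n. \<bar>Cov (Fn n) (Gn n)\<bar>) \<longlonglongrightarrow> \<bar>Cov F G\<bar>"
  unfolding Cov_def by (intro tendsto_rabs tendsto_diff lim1 lim2)
 moreover have "(%n. B + \<epsilon> n) \<longlonglongrightarrow> B + 0" by (intro tendsto_add tendsto_const \<epsilon>)
 ultimately have "\<bar>Cov F G\<bar> <= B + 0" by (rule LIMSEQ_le) (use bound in auto)
 then show ?thesis by (simp add: Cov_def)
qed

section \<open>The Poincare inequality\<close>

text \<open>The conditional variance is the covariance of \<open>W\<close> with itself, so that \<open>covariance_bound_bounded\<close> applies with the
 energy as bound for \<open>gamma_form\<close>.\<close>

lemma poincare_bounded:
 fixes W :: "'r * 'x list => real"
 assumes W: "functional R L W" and C: "\<And>p. \<bar>W p\<bar> <= C"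
 shows "(NINT p|Psp R L. eabs (W p - (LINT xs|Poi L. W (fst p, xs)))) <= rt (energy R L W)"
proof (cases "energy R L W = \<infinity>")
 case True
 then show ?thesis by (simp add: epowr_def)
next
 case False
 then have fin: "energy R L W < \<infinity>" by (simp add: less_top)
 note [measurable] = functional_meas[OF W]
 define e where "e = enn2real (energy R L W)"
 let ?w = "%r. (LINT xs|Poi L. (W (r, xs))^2)"
 have C0: "0 <= C" using C[of undefined] by simp
 define m where "m r = (LINT xs|Poi L. W (r, xs))" for r
 have [measurable]: "m : bmeas R" unfolding m_def [abs_def] by measurable
 have mC: "\<bar>m r\<bar> <= C" if [measurable]: "r : space R" for r
  unfolding m_def by (rule P.abs_integral_le_bound[OF _ C]) measurable
 have cov: "\<bar>(LINT p|Psp R L. W p * W p) - (LINT r|R. m r * m r)\<bar> <= e"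
  unfolding m_def
 proof (rule covariance_bound_bounded[OF R L W W C C])
  fix s :: real assume "0 <= s" "s <= 1"
  from gamma_form_le[OF this W W fin fin] show "\<bar>gamma_form R L W W s\<bar> <= e" by (simp add: e_def)
 qed
 have W2: "\<bar>(W p)^2\<bar> <= C^2" for p using power_mono[OF C abs_ge_zero, of p 2] by simp
 have b: "\<bar>?w r\<bar> <= C^2" if [measurable]: "r : space R" for r
  by (rule P.abs_integral_le_bound[OF _ W2]) measurable
 have m2: "\<bar>(m r)^2\<bar> <= C^2" if "r : space R" for r using power_mono[OF mC[OF that] abs_ge_zero, of 2] by simp
 have var: "(LINT xs|Poi L. (W (r, xs) - m r)^2) = ?w r - (m r)^2" if [measurable]: "r : space R" for r
 proof -
  have i1: "integrable (Poi L) (%xs. W (r, xs))" by (rule P.integrable_bounded[OF _ C]) measurable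
  have i2: "integrable (Poi L) (%xs. (W (r, xs))^2)" by (rule P.integrable_bounded[OF _ W2]) measurable
  show ?thesis using P.variance_eq[OF i1 i2] by (simp add: m_def)
 qed
 have "(NINT p|Psp R L. ennreal ((W p - m (fst p))^2)) = (NINT r|R. NINT xs|Poi L. ennreal ((W (r, xs) - m r)^2))"
  by (subst nn_integral_Psp[OF L]) simp_all
 also have "... = (NINT r|R. ennreal (?w r - (m r)^2))"
 proof (rule nn_integral_cong)
  fix r assume r[measurable]: "r : space R"
  have "\<bar>(W (r, xs) - m r)^2\<bar> <= (2 * C)^2" for xs
   using power_mono[of "\<bar>W (r, xs) - m r\<bar>" "2 * C" 2] C[of "(r, xs)"] mC[OF r] by simp
  then have "integrable (Poi L) (%xs. (W (r, xs) - m r)^2)"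
   by (rule P.integrable_bounded[rotated]) measurable
  then show "(NINT xs|Poi L. ennreal ((W (r, xs) - m r)^2)) = ennreal (?w r - (m r)^2)"
   by (subst nn_integral_eq_integral) (simp_all add: var r)
 qed
 also have "... = ennreal (LINT r|R. ?w r - (m r)^2)"
 proof (rule nn_integral_eq_integral)
  show "integrable R (%r. ?w r - (m r)^2)"
   by (intro Bidiff R.integrable_bounded[OF _ b] R.integrable_bounded[OF _ m2]) measurable
  show "AE r in R. 0 <= ?w r - (m r)^2"
  proof (rule AE_I2)
   fix r assume r: "r : space R"
   have "0 <= (LINT xs|Poi L. (W (r, xs) - m r)^2)" by (rule Bnonneg) simp
   then show "0 <= ?w r - (m r)^2" by (simp only: var[OF r])
  qed
 qed
 also have "(LINT r|R. ?w r - (m r)^2) = (LINT p|Psp R L. W p * W p) - (LINT r|R. m r * m r)"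
 proof -
  have "(LINT p|Psp R L. (W p)^2) = (LINT r|R. LINT xs|Poi L. (W (r, xs))^2)"
   unfolding Psp_def by (rule P.integral_fst_bounded[OF R.finite_measure_axioms _ W2]) measurable
  then show ?thesis
   by (subst Bdiff[OF R.integrable_bounded[OF _ b] R.integrable_bounded[OF _ m2]]) (simp_all add: power2_eq_square)
 qed
 also have "ennreal ... <= ennreal e" using cov by (intro ennreal_leI) simp
 also have "ennreal e = energy R L W" using fin by (simp add: e_def)
 finally have sq: "(NINT p|Psp R L. (eabs (W p - m (fst p)))^2) <= energy R L W" by (simp add: ennreal_power)
 have "(NINT p|Psp R L. eabs (W p - m (fst p))) <= rt (NINT p|Psp R L. (eabs (W p - m (fst p)))^2)"
  by (rule \<Omega>.nn_integral_le_sqrt) measurable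
 also have "... <= rt (energy R L W)" by (intro epowr_mono sq) simp
 finally show ?thesis by (simp only: m_def)
qed

text \<open>Truncation decreases the energy, and Fatou's lemma removes it. Measuring the fluctuation in \<open>L1\<close> requires only
 integrability of \<open>W\<close>, while the energy may be infinite.\<close>

theorem poincare:
 fixes W :: "'r * 'x list => real"
 assumes W: "functional R L W" and int: "integrable (Psp R L) W"
 shows "(NINT p|Psp R L. eabs (W p - (LINT xs|Poi L. W (fst p, xs)))) <= rt (energy R L W)"
proof (rule nn_integral_le_of_AE_tendsto)
 interpret RP: pair_sigma_finite R "Poi L" by unfold_locales
 note [measurable] = functional_meas[OF W]
 let ?f = "%n p. \<bar>trunc_at n (W p) - (LINT xs|Poi L. trunc_at n (W (fst p, xs)))\<bar>"
 show "?f n : bmeas (Psp R L)" for n by measurable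
 have ae: "AE r in R. integrable (Poi L) (%xs. W (r, xs))"
  using RP.AE_integrable_fst'[OF int[unfolded Psp_def]] by simp
 have "Measurable.pred (R >< Poi L) (%p. integrable (Poi L) (%xs. W (fst p, xs)))" by measurable
 then have "{p : space (R >< Poi L). integrable (Poi L) (%xs. W (fst p, xs))} : sets (R >< Poi L)"
  by (simp only: pred_def)
 moreover from ae have "AE r in R. AE ys in Poi L. integrable (Poi L) (%xs. W (fst (r, ys), xs))"
  unfolding fst_conv by eventually_elim (rule AE_I2)
 ultimately have "AE p in Psp R L. integrable (Poi L) (%xs. W (fst p, xs))"
  unfolding Psp_def by (rule RP.AE_pair_measure)
 then show "AE p in Psp R L. (%n. ?f n p) \<longlonglongrightarrow> \<bar>W p - (LINT xs|Poi L. W (fst p, xs))\<bar>"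
 proof eventually_elim
  case (elim p)
  have "(%n. LINT xs|Poi L. trunc_at n (W (fst p, xs))) \<longlonglongrightarrow> (LINT xs|Poi L. W (fst p, xs))"
   using borel_measurable_integrable[OF elim]
   by (intro integral_dominated_convergence[where w = "%xs. \<bar>W (fst p, xs)\<bar>"])
     (insert elim trunc_at_le_self, auto intro!: tendsto_trunc_at)
  then show ?case by (intro tendsto_rabs tendsto_diff tendsto_trunc_at)
 qed
 show "(NINT p|Psp R L. ennreal (?f n p)) <= rt (energy R L W)" for n
 proof -
  have "(NINT p|Psp R L. ennreal (?f n p)) <= rt (energy R L (%p. trunc_at n (W p)))"
   by (rule poincare_bounded[OF functional_comp[OF W trunc_at_measurable] trunc_at_le])
  also have "... <= rt (energy R L W)"
  proof (intro epowr_mono)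
   have "(dif (%p. trunc_at n (W p)) z p)^2 <= (dif W z p)^2" for z p
    using power_mono[OF trunc_at_Lipschitz abs_ge_zero, of n "W (fst p, z # snd p)" "W p" 2] by (simp add: dif_def)
   then show "energy R L (%p. trunc_at n (W p)) <= energy R L W"
    unfolding energy_def by (intro nn_integral_mono ennreal_leI)
  qed simp
  finally show ?thesis .
 qed
qed

end

section \<open>The Skorohod integral\<close>

definition kernel_inv where
 "kernel_inv f \<longleftrightarrow> (\<forall>x. perm_inv (%ys. f (x, ys)))"

lemma kernel_invI: "(\<And>x xs ys. mset xs = mset ys ==> f (x, xs) = f (x, ys)) ==> kernel_inv f"
 unfolding kernel_inv_def by (intro allI perm_invI)

lemma kernel_invD: "kernel_inv f ==> mset xs = mset ys ==> f (x, xs) = f (x, ys)"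
 unfolding kernel_inv_def by (erule allE[of _ x]) (erule perm_invD)

lemma kernel_inv_comp: "kernel_inv f ==> kernel_inv (%p. F (f p))"
 by (rule kernel_invI, rule arg_cong[of _ _ F], erule kernel_invD)

lemma kernel_inv_comp2:
 "kernel_inv f ==> kernel_inv g ==> kernel_inv (%p. F (f p) (g p))"
 by (rule kernel_invI, rule arg_cong2[of _ _ _ _ F]; erule kernel_invD)

text \<open>Kernels are functions of a point and the list of the remaining points. The sum over the points of a list of
 an invariant kernel is a Campbell sum, and obeys the simple recursion \<open>point_sum_Cons\<close>.\<close>

definition point_sum :: "('z * 'z list => 'c::comm_monoid_add) => 'z list => 'c" where
 "point_sum f xs = campbell_sum (%x. of_mset (%ys. f (x, ys))) (mset xs)"

definition shift_kernel :: "'z => ('z * 'z list => 'c) => 'z * 'z list => 'c" where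
 "shift_kernel z f p = f (fst p, z # snd p)"

definition dif_kernel :: "'z => ('z * 'z list => real) => 'z * 'z list => real" where
 "dif_kernel y v p = v (fst p, y # snd p) - v p"

lemma of_mset_kernel: "kernel_inv f ==> of_mset (%ys. f (x, ys)) (mset xs) = f (x, xs)"
 unfolding kernel_inv_def by (rule of_mset_mset) (erule spec)

lemma shift_kernel_inv: "kernel_inv f ==> kernel_inv (shift_kernel z f)"
 unfolding shift_kernel_def by (rule kernel_invI, unfold fst_conv snd_conv, erule kernel_invD) simp

lemma point_sum_Nil [simp]: "point_sum f [] = 0"
 by (simp add: point_sum_def)

lemma point_sum_Cons:
 fixes f :: "'z * 'z list => 'c::comm_monoid_add"
 assumes f: "kernel_inv f"
 shows "point_sum f (z # xs) = f (z, xs) + point_sum (shift_kernel z f) xs"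
proof -
 have "(%x m. of_mset (%ys. f (x, ys)) (add_mset z m)) = (%x. of_mset (%ys. shift_kernel z f (x, ys)))"
 proof (intro ext)
  fix x :: 'z and m :: "'z multiset"
  obtain ws where "mset ws = m" using ex_mset[of m] by (elim exE)
  then have m: "m = mset ws" by (rule sym)
  show "of_mset (%ys. f (x, ys)) (add_mset z m) = of_mset (%ys. shift_kernel z f (x, ys)) m"
   using of_mset_kernel[OF f, of x "z # ws"] of_mset_kernel[OF shift_kernel_inv[OF f], of z x ws]
   by (simp add: m shift_kernel_def)
 qed
 then show ?thesis
  unfolding point_sum_def mset.simps campbell_sum_add_mset of_mset_kernel[OF f] by (simp only:)
qed

lemma point_sum_invariant: "perm_inv (point_sum f)"
 by (rule perm_invI) (simp only: point_sum_def)

lemma measurable_point_sum_param: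
 fixes f :: "'b * 'z * 'z list => 'c::{second_countable_topology, topological_comm_monoid_add}"
 assumes f: "f : bmeas (B >< Z >< seqs Z)" and inv: "\<And>b. kernel_inv (%p. f (b, p))"
 shows "(%(b, xs). point_sum (%p. f (b, p)) xs) : bmeas (B >< seqs Z)"
proof -
 have eq: "(%(b, x, xs). f (b, x, xs)) = f" by (rule ext) (simp add: split_beta)
 have "(%(b, x, xs). of_mset (%ys. f (b, x, ys)) (mset xs)) : bmeas (B >< Z >< seqs Z)"
  using f by (simp only: of_mset_kernel[OF inv] eq)
 from measurable_campbell_sum[OF this] show ?thesis by (simp only: point_sum_def)
qed

lemma measurable_point_sum:
 fixes f :: "'z * 'z list => 'c::{second_countable_topology, topological_comm_monoid_add}"
 assumes f: "f : bmeas (Z >< seqs Z)" and inv: "kernel_inv f"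
 shows "point_sum f : bmeas (seqs Z)"
proof -
 have "(%(x, xs). of_mset (%ys. f (x, ys)) (mset xs)) : bmeas (Z >< seqs Z)"
  using f by (simp only: of_mset_kernel[OF inv] case_prod_eta)
 from measurable_campbell_sum_mset[OF this] show ?thesis by (simp only: point_sum_def [abs_def])
qed

text \<open>A factor depending on the whole configuration can be taken out of the sum.\<close>

lemma point_sum_mult:
 fixes f :: "'z * 'z list => real"
 assumes "kernel_inv f" "perm_inv G"
 shows "point_sum (%p. f p * G (fst p # snd p)) xs = point_sum f xs * G xs"
 using assms
proof (induction xs arbitrary: f G)
 case (Cons z xs)
 have inv: "kernel_inv (%p. f p * G (fst p # snd p))"
 proof (rule kernel_invI)
  fix x xs ys assume m: "mset xs = mset (ys :: 'z list)"
  have "G (x # xs) = G (x # ys)" by (rule perm_invD[OF Cons.prems(2)]) (simp add: m)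
  then show "f (x, xs) * G (fst (x, xs) # snd (x, xs)) = f (x, ys) * G (fst (x, ys) # snd (x, ys))"
   unfolding fst_conv snd_conv kernel_invD[OF Cons.prems(1) m] by (simp only:)
 qed
 have G: "G (x # z # ys) = G (z # x # ys)" for x ys by (rule perm_invD[OF Cons.prems(2)]) (simp add: add_mset_commute)
 have inv': "perm_inv (%ys. G (z # ys))"
  by (rule perm_invI, rule perm_invD[OF Cons.prems(2)]) simp
 have "point_sum (%p. f p * G (fst p # snd p)) (z # xs)
   = f (z, xs) * G (z # xs) + point_sum (%p. shift_kernel z f p * G (z # fst p # snd p)) xs"
  unfolding point_sum_Cons[OF inv] by (simp add: shift_kernel_def [abs_def] G)
 also have "... = f (z, xs) * G (z # xs) + point_sum (shift_kernel z f) xs * G (z # xs)"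
  using Cons.IH[OF shift_kernel_inv[OF Cons.prems(1)] inv'] by simp
 finally show ?case unfolding point_sum_Cons[OF Cons.prems(1)] by (simp add: algebra_simps)
qed simp

lemma point_sum_diff:
 fixes f g :: "'z * 'z list => real"
 assumes "kernel_inv f" "kernel_inv g"
 shows "point_sum (%p. f p - g p) xs = point_sum f xs - point_sum g xs"
 using assms
proof (induction xs arbitrary: f g)
 case (Cons z xs)
 have inv: "kernel_inv (%p. f p - g p)"
  by (rule kernel_inv_comp2[OF Cons.prems])
 have "shift_kernel z (%p. f p - g p) = (%p. shift_kernel z f p - shift_kernel z g p)"
  by (simp add: shift_kernel_def fun_eq_iff)
 then show ?case
  using Cons.IH[OF shift_kernel_inv[OF Cons.prems(1)] shift_kernel_inv[OF Cons.prems(2)]]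
  unfolding point_sum_Cons[OF inv] point_sum_Cons[OF Cons.prems(1)] point_sum_Cons[OF Cons.prems(2)] by simp
qed simp

lemma point_sum_nonneg_ennreal:
 fixes f :: "'z * 'z list => real"
 assumes "kernel_inv f" "\<And>p. 0 <= f p"
 shows "0 <= point_sum f xs \<and> ennreal (point_sum f xs) = point_sum (%p. ennreal (f p)) xs"
 using assms
proof (induction xs arbitrary: f)
 case (Cons z xs)
 have inv: "kernel_inv (%p. ennreal (f p))"
  by (rule kernel_inv_comp[OF Cons.prems(1)])
 have sh: "shift_kernel z (%p. ennreal (f p)) = (%p. ennreal (shift_kernel z f p))"
  by (simp add: shift_kernel_def fun_eq_iff)
 have "0 <= point_sum (shift_kernel z f) xs \<and> ennreal (point_sum (shift_kernel z f) xs) = point_sum (%p. ennreal (shift_kernel z f p)) xs"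
  by (rule Cons.IH[OF shift_kernel_inv[OF Cons.prems(1)]]) (simp add: shift_kernel_def Cons.prems(2))
 then show ?case
  unfolding point_sum_Cons[OF inv] point_sum_Cons[OF Cons.prems(1)] sh using Cons.prems(2) by (simp add: ennreal_plus)
qed simp

lemma point_sum_const: "point_sum (%p. c) (xs :: 'z list) = c * real (length xs)"
proof (induction xs)
 case (Cons z xs)
 have "kernel_inv (%p :: 'z * 'z list. c)" by (rule kernel_invI) simp
 moreover have "shift_kernel z (%p. c) = (%p. c)" by (simp add: shift_kernel_def fun_eq_iff)
 ultimately show ?case using Cons by (simp add: point_sum_Cons algebra_simps)
qed simp

lemma point_sum_bound:
 fixes f :: "'z * 'z list => real"
 assumes "kernel_inv f" "\<And>p. \<bar>f p\<bar> <= C"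
 shows "\<bar>point_sum f xs\<bar> <= C * real (length xs)"
 using assms
proof (induction xs arbitrary: f)
 case (Cons z xs)
 have "\<bar>point_sum (shift_kernel z f) xs\<bar> <= C * real (length xs)"
  by (rule Cons.IH[OF shift_kernel_inv[OF Cons.prems(1)]]) (simp add: shift_kernel_def Cons.prems(2))
 then show ?case
  unfolding point_sum_Cons[OF Cons.prems(1)] using Cons.prems(2)[of "(z, xs)"] by (simp add: algebra_simps)
qed simp

lemma nn_integral_point_sum:
 assumes L: "finite_measure L" and f: "f : bmeas (L >< seqs L)" and inv: "kernel_inv f"
 shows "(NINT xs|Poi L. point_sum f xs) = (NINT xs|Poi L. NINT x|L. f (x, xs))"
proof -
 have "(%(x, xs). of_mset (%ys. f (x, ys)) (mset xs)) : bmeas (L >< seqs L)"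
  using f by (simp only: of_mset_kernel[OF inv] case_prod_eta)
 from poisson_Mecke[OF L this] show ?thesis by (simp only: point_sum_def of_mset_kernel[OF inv])
qed

text \<open>Adding an intensity-distributed point produces a law with a density with respect to the original law: by
 Mecke's formula the density is the number of points, up to normalization. Hence null sets are preserved.\<close>

lemma AE_add_point:
 assumes L: "finite_measure L" and Q: "Measurable.pred (seqs L) Q" and inv: "perm_inv Q"
  and AE: "AE xs in Poi L. Q xs"
 shows "AE xs in Poi L. AE z in L. Q (z # xs)"
proof -
 interpret L: finite_measure L by fact
 interpret P: prob_space "Poi L" by (rule prob_space_Poi[OF L])
 note [measurable] = Q
 have pm: "(%p. indicator {ys. \<not> Q ys} (fst p # snd p) :: ennreal) : bmeas (L >< seqs L)"
  by measurable
 have inv1: "kernel_inv (%p. 1 :: real)" by (rule kernel_invI) simp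
 define G where "G = (%xs. indicat_real {ys. \<not> Q ys} xs)"
 let ?g = "(%p. ennreal (G (fst p # snd p)))"
 have Ginv: "perm_inv G" unfolding G_def indicator_def by (rule perm_inv_comp) (rule perm_invI, drule perm_invD[OF inv], simp only: mem_Collect_eq)
 have kinv: "kernel_inv (%p. G (fst p # snd p))"
  by (rule kernel_invI, unfold fst_conv snd_conv, rule perm_invD[OF Ginv]) simp
 have kinv': "kernel_inv ?g"
  by (rule kernel_inv_comp[OF kinv])
 have [measurable]: "G : bmeas (seqs L)" unfolding G_def by measurable
 have "(NINT xs|Poi L. NINT z|L. ennreal (G (z # xs))) = (NINT xs|Poi L. point_sum ?g xs)"
  by (subst nn_integral_point_sum[OF L _ kinv']) simp_all
 also have "... = (NINT xs|Poi L. ennreal (real (length xs) * G xs))"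
 proof (rule nn_integral_cong)
  fix xs
  have "point_sum ?g xs = ennreal (point_sum (%p. 1 * G (fst p # snd p)) xs)"
   using point_sum_nonneg_ennreal[OF kinv, of xs] by (simp add: G_def)
  also have "... = ennreal (real (length xs) * G xs)"
   unfolding point_sum_mult[OF inv1 Ginv] point_sum_const by simp
  finally show "point_sum ?g xs = ennreal (real (length xs) * G xs)" .
 qed
 also have "... = (NINT xs|Poi L. 0)"
  using AE by (intro nn_integral_cong_AE) (auto simp: G_def)
 finally have "(NINT xs|Poi L. NINT z|L. ennreal (G (z # xs))) = 0" by simp
 then have "AE xs in Poi L. (NINT z|L. ennreal (G (z # xs))) = 0"
  by (subst (asm) nn_integral_0_iff_AE) auto
 moreover have "AE xs in Poi L. xs : space (seqs L)" using AE_space[of "Poi L"] by simp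
 ultimately show ?thesis
 proof eventually_elim
  case (elim xs)
  then have [measurable]: "xs : space (seqs L)" by simp
  from elim have "AE z in L. ennreal (G (z # xs)) = 0"
   by (subst (asm) nn_integral_0_iff_AE) auto
  then show ?case by eventually_elim (auto simp: G_def indicator_def split: if_splits)
 qed
qed

context
 fixes L :: "'z measure"
 assumes L: "finite_measure L"
begin

interpretation L: finite_measure L by (rule L)
interpretation P: prob_space "Poi L" by (rule prob_space_Poi[OF L])
interpretation PL: pair_sigma_finite "Poi L" L by unfold_locales
interpretation PLF: finite_measure "Poi L >< L" by (intro finite_measure_pair_measure) unfold_locales

lemma integrable_fst_comp:
 assumes "integrable (Poi L) f" shows "integrable (Poi L >< L) (%p. f (fst p) :: real)"
proof (rule integrableI_bounded)
 have [measurable]: "f : bmeas (Poi L)" using assms by auto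
 show "(%p. f (fst p)) : bmeas (Poi L >< L)" by measurable
 have "(NINT p|(Poi L >< L). ennreal (norm (f (fst p)))) = (NINT xs|Poi L. ennreal (norm (f xs)) * emeasure L (space L))"
  by (subst L.nn_integral_fst[symmetric]) simp_all
 also have "... = (NINT xs|Poi L. ennreal (norm (f xs))) * emeasure L (space L)"
  by (rule nn_integral_multc) simp
 also have "... < \<infinity>"
 proof -
  have "(NINT xs|Poi L. ennreal (norm (f xs))) < top"
   using assms unfolding integrable_iff_bounded by simp
  moreover have "emeasure L (space L) < top" using L.emeasure_finite[of "space L"] by (simp add: less_top[symmetric])
  ultimately show ?thesis by (simp only: ennreal_mult_less_top infinity_ennreal_def simp_thms)
 qed
 finally show "(NINT p|(Poi L >< L). ennreal (norm (f (fst p)))) < \<infinity>" .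
qed

lemma Mecke_nonneg:
 fixes f :: "'z * 'z list => real"
 assumes f[measurable]: "f : bmeas (L >< seqs L)" and inv: "kernel_inv f" and nn: "\<And>p. 0 <= f p"
  and int: "integrable (Poi L >< L) (%(xs, z). f (z, xs))"
 shows "integrable (Poi L) (point_sum f)"
  and "(LINT xs|Poi L. point_sum f xs) = (LINT (xs, z)|(Poi L >< L). f (z, xs))"
proof -
 have [measurable]: "point_sum f : bmeas (seqs L)" by (rule measurable_point_sum[OF f inv])
 have inv': "kernel_inv (%p. ennreal (f p))" by (rule kernel_inv_comp[OF inv])
 have "(NINT xs|Poi L. ennreal (point_sum f xs)) = (NINT xs|Poi L. NINT x|L. ennreal (f (x, xs)))"
  using point_sum_nonneg_ennreal[OF inv nn] nn_integral_point_sum[OF L _ inv'] by simp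
 also have "... = (NINT p|(Poi L >< L). ennreal (case p of (xs, z) => f (z, xs)))"
  by (subst L.nn_integral_fst[symmetric]) simp_all
 also have "... = ennreal (LINT p|(Poi L >< L). (case p of (xs, z) => f (z, xs)))"
  by (rule nn_integral_eq_integral[OF int]) (simp add: nn split_beta)
 finally have eq: "(NINT xs|Poi L. ennreal (point_sum f xs)) = ennreal (LINT p|(Poi L >< L). (case p of (xs, z) => f (z, xs)))" .
 have nonneg: "0 <= point_sum f xs" for xs using point_sum_nonneg_ennreal[OF inv nn] by blast
 show i: "integrable (Poi L) (point_sum f)"
  by (rule integrableI_nonneg) (use eq nonneg in simp_all)
 have "0 <= (LINT p|(Poi L >< L). (case p of (xs, z) => f (z, xs)))"
  by (rule Bnonneg) (simp add: nn split_beta)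
 then show "(LINT xs|Poi L. point_sum f xs) = (LINT (xs, z)|(Poi L >< L). f (z, xs))"
  using eq nn_integral_eq_integral[OF i] nonneg by (simp add: integral_nonneg_AE)
qed

lemma Mecke_real:
 fixes f :: "'z * 'z list => real"
 assumes f[measurable]: "f : bmeas (L >< seqs L)" and inv: "kernel_inv f"
  and int: "integrable (Poi L >< L) (%(xs, z). f (z, xs))"
 shows "integrable (Poi L) (point_sum f)"
  and "(LINT xs|Poi L. point_sum f xs) = (LINT (xs, z)|(Poi L >< L). f (z, xs))"
proof -
 define f1 where "f1 = (%p. max 0 (f p))"
 define f2 where "f2 = (%p. max 0 (- f p))"
 have m[measurable]: "f1 : bmeas (L >< seqs L)" "f2 : bmeas (L >< seqs L)"
  unfolding f1_def f2_def by measurable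
 have i: "kernel_inv f1" "kernel_inv f2"
  unfolding f1_def f2_def by (rule kernel_inv_comp[OF inv])+
 have n: "0 <= f1 p" "0 <= f2 p" for p by (simp_all add: f1_def f2_def)
 have int12: "integrable (Poi L >< L) (%(xs, z). f1 (z, xs))" "integrable (Poi L >< L) (%(xs, z). f2 (z, xs))"
  by (rule Bbound[OF int]; simp add: f1_def f2_def split_beta)+
 have f: "f = (%p. f1 p - f2 p)" by (auto simp: f1_def f2_def fun_eq_iff)
 have ps: "point_sum f xs = point_sum f1 xs - point_sum f2 xs" for xs
  unfolding f by (rule point_sum_diff[OF i])
 note M1 = Mecke_nonneg[OF m(1) i(1) n(1) int12(1)] and M2 = Mecke_nonneg[OF m(2) i(2) n(2) int12(2)]
 show "integrable (Poi L) (point_sum f)"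
  unfolding ps [abs_def] by (rule Bidiff[OF M1(1) M2(1)])
 have "(LINT xs|Poi L. point_sum f xs) = (LINT (xs, z)|(Poi L >< L). f1 (z, xs)) - (LINT (xs, z)|(Poi L >< L). f2 (z, xs))"
  unfolding ps using M1 M2 by simp
 also have "... = (LINT p|(Poi L >< L). (case p of (xs, z) => f1 (z, xs)) - (case p of (xs, z) => f2 (z, xs)))"
  by (rule Bdiff[OF int12, symmetric])
 finally show "(LINT xs|Poi L. point_sum f xs) = (LINT (xs, z)|(Poi L >< L). f (z, xs))"
  unfolding f by (simp add: split_def)
qed

text \<open>Mecke's formula for the kernel \<open>length\<close>, whose sum over the points is the square of the number of points.\<close>

lemma integrable_length_squared: "integrable (Poi L) (%xs. (real (length xs))^2)"
proof -
 have inv1: "kernel_inv (%p :: 'z * 'z list. 1 :: real)" by (rule kernel_invI) simp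
 have "integrable (Poi L) (point_sum (%p :: 'z * 'z list. 1 :: real))"
  by (rule Mecke_real(1)[OF _ inv1]) (simp_all add: split_def)
 then have i1: "integrable (Poi L) (%xs. real (length xs))" by (simp add: point_sum_const [where c = 1, abs_def])
 have Ginv: "perm_inv (%xs :: 'z list. real (length xs))"
  by (rule perm_invI, rule arg_cong[of _ _ real], erule mset_eq_length)
 have inv2: "kernel_inv (%p :: 'z * 'z list. 1 * real (length (fst p # snd p)))"
 proof (rule kernel_invI)
  fix x and xs ys :: "'z list" assume "mset xs = mset ys"
  then have "length xs = length ys" by (rule mset_eq_length)
  then show "1 * real (length (fst (x, xs) # snd (x, xs))) = 1 * real (length (fst (x, ys) # snd (x, ys)))" by simp
 qed
 have "integrable (Poi L >< L) (%p. real (length (fst p)) + 1)"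
  by (rule integrable_fst_comp[of "%xs. real (length xs) + 1"]) (use i1 in simp)
 then have "integrable (Poi L) (point_sum (%p. 1 * real (length (fst p # snd p))))"
  by (intro Mecke_real[OF _ inv2]) (simp_all add: split_def add.commute)
 then show ?thesis
  unfolding point_sum_mult[OF inv1 Ginv, abs_def] by (simp only: point_sum_const mult_1 power2_eq_square)
qed

lemma integrable_length: "integrable (Poi L) (%xs. real (length xs))"
 by (rule P.square_integrable_imp_integrable[OF _ integrable_length_squared]) simp

text \<open>The pathwise formula for the Skorohod integral of a kernel, available since the intensity is finite.\<close>

definition skorohod :: "('z * 'z list => real) => 'z list => real" where
 "skorohod v xs = point_sum v xs - (LINT z|L. v (z, xs))"

lemma abs_integral_le_mass:
 assumes C: "\<And>z. \<bar>f z\<bar> <= C" shows "\<bar>(LINT z|L. f z)\<bar> <= C * measure L (space L)"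
proof (cases "integrable L f")
 case True
 have "\<bar>(LINT z|L. f z)\<bar> <= (LINT z|L. \<bar>f z\<bar>)" by (rule integral_abs_bound)
 also have "... <= (LINT z|L. C)" by (rule integral_mono[OF integrable_abs[OF True] L.integrable_const C])
 finally show ?thesis by (simp add: mult.commute)
next
 case False
 have "0 <= C" using C[of undefined] by simp
 with False show ?thesis by (simp add: not_integrable_integral_eq)
qed

context
 fixes v :: "'z * 'z list => real" and C :: real
 assumes v[measurable]: "v : bmeas (L >< seqs L)" and inv: "kernel_inv v" and C: "\<And>p. \<bar>v p\<bar> <= C"
begin

lemma skorohod_measurable: "skorohod v : bmeas (seqs L)"
proof -
 note [measurable] = measurable_point_sum[OF v inv]
 show ?thesis unfolding skorohod_def [abs_def] by measurable
qed

lemma skorohod_invariant: "perm_inv (skorohod v)"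
proof (rule perm_invI)
 fix xs ys :: "'z list" assume m: "mset xs = mset ys"
 show "skorohod v xs = skorohod v ys"
  unfolding skorohod_def perm_invD[OF point_sum_invariant m] by (simp only: kernel_invD[OF inv m])
qed

lemma skorohod_bound: "\<bar>skorohod v xs\<bar> <= C * (1 + measure L (space L)) * (1 + real (length xs))"
proof -
 have C0: "0 <= C" using C[of undefined] by simp
 have "\<bar>skorohod v xs\<bar> <= C * real (length xs) + C * measure L (space L)"
  unfolding skorohod_def using point_sum_bound[OF inv C, of xs] abs_integral_le_mass[of "%z. v (z, xs)" C, OF C] by linarith
 also have "... <= C * (1 + measure L (space L)) * (1 + real (length xs))"
  using C0 by (simp add: algebra_simps)
 finally show ?thesis .
qed

text \<open>Integration by parts: the Skorohod integral is the adjoint of the difference operator, by Mecke's formula for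
 the product of the kernel with \<open>G\<close>. The linear growth of \<open>G\<close> admits Skorohod integrals themselves.\<close>

lemma skorohod_duality:
 assumes G[measurable]: "G : bmeas (seqs L)" and G_inv: "perm_inv G"
  and K: "\<And>xs. \<bar>G xs\<bar> <= K * (1 + real (length xs))"
 shows "(LINT xs|Poi L. skorohod v xs * G xs) = (LINT (xs, z)|(Poi L >< L). v (z, xs) * (G (z # xs) - G xs))"
  and "integrable (Poi L >< L) (%(xs, z). v (z, xs) * (G (z # xs) - G xs))"
proof -
 let ?k = "%p. (K * (2 + real (length (fst p))))"
 have C0: "0 <= C" using C[of undefined] by simp
 have K0: "0 <= K" using K[of "[]"] by simp
 have dom: "integrable (Poi L >< L) (%p. C * ?k p)"
  by (rule integrable_fst_comp[of "%xs. C * (K * (2 + real (length xs)))"]) (use integrable_length in simp)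
 have int1: "integrable (Poi L >< L) (%(xs, z). v (z, xs) * G (z # xs))"
 proof (rule Bbound[OF dom])
  show "(%(xs, z). v (z, xs) * G (z # xs)) : bmeas (Poi L >< L)" by measurable
  show "AE p in Poi L >< L. norm (case p of (xs, z) => v (z, xs) * G (z # xs)) <= norm (C * ?k p)"
  proof (rule AE_I2)
   fix p :: "'z list * 'z"
   have "\<bar>v (snd p, fst p)\<bar> * \<bar>G (snd p # fst p)\<bar> <= C * ?k p"
    using K[of "snd p # fst p"] by (intro mult_mono C) (use C0 in simp_all)
   then show "norm (case p of (xs, z) => v (z, xs) * G (z # xs)) <= norm (C * ?k p)"
    using C0 K0 by (simp add: split_beta abs_mult)
  qed
 qed
 have int2: "integrable (Poi L >< L) (%(xs, z). v (z, xs) * G xs)"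
 proof (rule Bbound[OF dom])
  show "(%(xs, z). v (z, xs) * G xs) : bmeas (Poi L >< L)" by measurable
  show "AE p in Poi L >< L. norm (case p of (xs, z) => v (z, xs) * G xs) <= norm (C * ?k p)"
  proof (rule AE_I2)
   fix p :: "'z list * 'z"
   have "K * (1 + real (length (fst p))) <= K * (2 + real (length (fst p)))" using K0 by (intro mult_left_mono) auto
   then have "\<bar>v (snd p, fst p)\<bar> * \<bar>G (fst p)\<bar> <= C * ?k p"
    using K[of "fst p"] by (intro mult_mono C) (use C0 in simp_all)
   then show "norm (case p of (xs, z) => v (z, xs) * G xs) <= norm (C * ?k p)"
    using C0 K0 by (simp add: split_beta abs_mult)
  qed
 qed
 have kinv: "kernel_inv (%p. v p * G (fst p # snd p))"
 proof (rule kernel_invI)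
  fix x and xs ys :: "'z list" assume m: "mset xs = mset ys"
  have "G (x # xs) = G (x # ys)" by (rule perm_invD[OF G_inv]) (simp add: m)
  then show "v (x, xs) * G (fst (x, xs) # snd (x, xs)) = v (x, ys) * G (fst (x, ys) # snd (x, ys))"
   unfolding fst_conv snd_conv kernel_invD[OF inv m] by (simp only:)
 qed
 have m1: "integrable (Poi L) (%xs. point_sum v xs * G xs)"
  "(LINT xs|Poi L. point_sum v xs * G xs) = (LINT (xs, z)|(Poi L >< L). v (z, xs) * G (z # xs))"
  using Mecke_real[OF _ kinv] int1 by (simp_all add: point_sum_mult[OF inv G_inv, abs_def] split_def)
 have m2: "integrable (Poi L) (%xs. (LINT z|L. v (z, xs)) * G xs)"
  "(LINT xs|Poi L. (LINT z|L. v (z, xs)) * G xs) = (LINT (xs, z)|(Poi L >< L). v (z, xs) * G xs)"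
  using PL.integrable_fst'[OF int2] PL.integral_fst'[OF int2] by simp_all
 show "integrable (Poi L >< L) (%(xs, z). v (z, xs) * (G (z # xs) - G xs))"
  using Bidiff[OF int1 int2] by (simp add: split_def algebra_simps)
 have "(LINT xs|Poi L. skorohod v xs * G xs) = (LINT xs|Poi L. point_sum v xs * G xs - (LINT z|L. v (z, xs)) * G xs)"
  by (simp add: skorohod_def algebra_simps)
 also have "... = (LINT (xs, z)|(Poi L >< L). v (z, xs) * G (z # xs)) - (LINT (xs, z)|(Poi L >< L). v (z, xs) * G xs)"
  unfolding m1(2)[symmetric] m2(2)[symmetric] by (rule Bdiff[OF m1(1) m2(1)])
 also have "... = (LINT p|(Poi L >< L). (case p of (xs, z) => v (z, xs) * G (z # xs)) - (case p of (xs, z) => v (z, xs) * G xs))"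
  by (rule Bdiff[OF int1 int2, symmetric])
 finally show "(LINT xs|Poi L. skorohod v xs * G xs) = (LINT (xs, z)|(Poi L >< L). v (z, xs) * (G (z # xs) - G xs))"
  by (simp add: split_def algebra_simps)
qed

end

text \<open>The isometry: applying the duality to \<open>G = skorohod v\<close> gives the square of the kernel and a Skorohod integral of its
 difference, and applying it once more gives a cross term, which is symmetric in the two added points and bounded
 by the arithmetic-geometric mean inequality.\<close>

lemma skorohod_second_moment:
 fixes v :: "'z * 'z list => real"
 assumes v[measurable]: "v : bmeas (L >< seqs L)" and inv: "kernel_inv v" and C: "\<And>p. \<bar>v p\<bar> <= C"
 shows "(LINT xs|Poi L. (skorohod v xs)^2) \<le>
  (LINT xs|Poi L. LINT z|L. (v (z, xs))^2) + (LINT xs|Poi L. LINT z|L. LINT y|L. (dif_kernel y v (z, xs))^2)"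
  and "integrable (Poi L) (%xs. (skorohod v xs)^2)"
proof -
 define \<delta> where "\<delta> = skorohod v"
 have C0: "0 <= C" using C[of undefined] by simp
 note \<delta>m[measurable] = skorohod_measurable[OF v inv C, folded \<delta>_def]
 note \<delta>i = skorohod_invariant[OF v inv C, folded \<delta>_def]
 note \<delta>b = skorohod_bound[OF v inv C, folded \<delta>_def]
 define K where "K = C * (1 + measure L (space L))"
 have K0: "0 <= K" using C0 by (simp add: K_def)
 have len1: "integrable (Poi L) (%xs. (1 + real (length xs))^2)"
  using integrable_length integrable_length_squared by (simp add: power2_sum)
 show "integrable (Poi L) (%xs. (skorohod v xs)^2)"
  unfolding \<delta>_def[symmetric]
 proof (rule Bbound)
  show "integrable (Poi L) (%xs. K^2 * (1 + real (length xs))^2)" using len1 by simp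
  show "AE xs in Poi L. norm ((\<delta> xs)^2) <= norm (K^2 * (1 + real (length xs))^2)"
   using power_mono[OF \<delta>b abs_ge_zero, of _ 2] by (intro AE_I2) (simp add: K_def power_mult_distrib)
 qed simp
 have DCz: "\<bar>dif_kernel z v p\<bar> <= 2 * C" for z p
  using C[of "(fst p, z # snd p)"] C[of p] unfolding dif_kernel_def by linarith
 have b: "\<bar>dif_kernel z v p * dif_kernel y v q\<bar> <= 2 * C * (2 * C)" for z y p q
  unfolding abs_mult by (rule mult_mono[OF DCz DCz]) (use C0 in auto)
 have Dm: "dif_kernel z v : bmeas (L >< seqs L)" if [measurable]: "z : space L" for z
  unfolding dif_kernel_def [abs_def] by measurable
 have Dm2[measurable]: "(%w. dif_kernel (f w) v (g w)) : bmeas N"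
  if [measurable]: "f : N ->M L" "g : N ->M L >< seqs L" for f g and N :: "'n measure"
  unfolding dif_kernel_def by measurable
 have Di: "kernel_inv (dif_kernel z v)" for z
 proof (rule kernel_invI)
  fix x and xs ys :: "'z list" assume m: "mset xs = mset ys"
  then have m': "mset (z # xs) = mset (z # ys)" by simp
  show "dif_kernel z v (x, xs) = dif_kernel z v (x, ys)"
   unfolding dif_kernel_def fst_conv snd_conv kernel_invD[OF inv m] kernel_invD[OF inv m'] ..
 qed
 have step: "\<delta> (z # xs) - \<delta> xs = v (z, xs) + skorohod (dif_kernel z v) xs"
  if [measurable]: "z : space L" "xs : space (seqs L)" for z xs
 proof -
  have "point_sum (dif_kernel z v) xs = point_sum (shift_kernel z v) xs - point_sum v xs"
   unfolding point_sum_diff[OF shift_kernel_inv[OF inv] inv, symmetric] dif_kernel_def [abs_def] shift_kernel_def ..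
  moreover have "(LINT y|L. dif_kernel z v (y, xs)) = (LINT y|L. v (y, z # xs)) - (LINT y|L. v (y, xs))"
   unfolding dif_kernel_def fst_conv snd_conv
   by (intro Bdiff L.integrable_bounded[where C = C] C) measurable
  ultimately show ?thesis
   unfolding \<delta>_def skorohod_def point_sum_Cons[OF inv] by linarith
 qed
 define w where "w = (%z xs. v (z, xs) * skorohod (dif_kernel z v) xs)"
 have wm[measurable]: "(%(xs, z). w z xs) : bmeas (Poi L >< L)"
 proof -
  have "(%(b, xs). point_sum (%p. dif_kernel b v p) xs) : bmeas (L >< seqs L)"
  proof (rule measurable_point_sum_param[where f = "%(b, p). dif_kernel b v p", unfolded prod.case])
   show "(%(b, p). dif_kernel b v p) : bmeas (L >< L >< seqs L)" by measurable
  qed (rule Di)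
  from measurable_compose[OF measurable_pair_swap' this]
  have [measurable]: "(%q. point_sum (dif_kernel (snd q) v) (fst q)) : bmeas (seqs L >< L)"
   by (simp add: split_beta)
  have "(%q. w (snd q) (fst q)) : bmeas (seqs L >< L)"
   unfolding w_def skorohod_def by measurable
  then show ?thesis by (simp add: split_beta cong: measurable_cong_sets)
 qed
 have int_v2: "integrable (Poi L >< L) (%(xs, z). v (z, xs) * v (z, xs))"
 proof (rule PLF.integrable_bounded[where C = "C * C"])
  show "\<bar>case p of (xs, z) => v (z, xs) * v (z, xs)\<bar> <= C * C" for p
   unfolding split_beta abs_mult by (rule mult_mono[OF C C]) (use C0 in auto)
 qed measurable
 have int_w: "integrable (Poi L >< L) (%(xs, z). w z xs)"
 proof (rule Bbound)
  define K' where "K' = C * (2 * C * (1 + measure L (space L)))"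
  have K': "0 <= K'" using C0 by (simp add: K'_def)
  show "integrable (Poi L >< L) (%p. K' * (1 + real (length (fst p))))"
   by (rule integrable_fst_comp[of "%xs. K' * (1 + real (length xs))"]) (use integrable_length in simp)
  show "AE p in Poi L >< L. norm (case p of (xs, z) => w z xs) <= norm (K' * (1 + real (length (fst p))))"
  proof (rule AE_I2)
   fix p assume "p : space (Poi L >< L)"
   then have z: "snd p : space L" by (auto simp: space_pair_measure)
   have "\<bar>v (snd p, fst p)\<bar> * \<bar>skorohod (dif_kernel (snd p) v) (fst p)\<bar> <= C * (2 * C * (1 + measure L (space L)) * (1 + real (length (fst p))))"
    by (rule mult_mono[OF C skorohod_bound[OF Dm[OF z] Di DCz]]) (use C0 in auto)
   then show "norm (case p of (xs, z) => w z xs) <= norm (K' * (1 + real (length (fst p))))"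
    using K' by (simp add: split_beta w_def abs_mult K'_def mult.assoc)
  qed
 qed (rule wm)
 have "(LINT xs|Poi L. (\<delta> xs)^2) = (LINT (xs, z)|(Poi L >< L). v (z, xs) * (\<delta> (z # xs) - \<delta> xs))"
  using skorohod_duality(1)[OF v inv C \<delta>m \<delta>i \<delta>b] by (simp add: \<delta>_def power2_eq_square)
 also have "... = (LINT p|(Poi L >< L). (case p of (xs, z) => v (z, xs) * v (z, xs)) + (case p of (xs, z) => w z xs))"
 proof (rule Bcong)
  fix p assume "p : space (Poi L >< L)"
  then have "snd p : space L" "fst p : space (seqs L)" by (auto simp: space_pair_measure)
  from step[OF this] show "(case p of (xs, z) => v (z, xs) * (\<delta> (z # xs) - \<delta> xs)) = (case p of (xs, z) => v (z, xs) * v (z, xs)) + (case p of (xs, z) => w z xs)"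
   by (simp only: split_def w_def distrib_left)
 qed
 also have "... = (LINT (xs, z)|(Poi L >< L). v (z, xs) * v (z, xs)) + (LINT (xs, z)|(Poi L >< L). w z xs)"
  by (rule Badd[OF int_v2 int_w])
 also have "(LINT (xs, z)|(Poi L >< L). v (z, xs) * v (z, xs)) = (LINT xs|Poi L. LINT z|L. (v (z, xs))^2)"
  using PL.integral_fst'[OF int_v2] by (simp add: power2_eq_square)
 also have "(LINT (xs, z)|(Poi L >< L). w z xs) = (LINT z|L. LINT xs|Poi L. w z xs)"
  using PL.integral_snd[OF int_w] by simp
 also have "... = (LINT z|L. LINT xs|Poi L. LINT y|L. dif_kernel z v (y, xs) * dif_kernel y v (z, xs))"
 proof (rule Bcong)
  fix z assume z[measurable]: "z : space L"
  have Gm: "(%xs. v (z, xs)) : bmeas (seqs L)" by measurable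
  have Gi: "perm_inv (%xs. v (z, xs))" by (rule perm_invI) (rule kernel_invD[OF inv])
  have Gb: "\<bar>v (z, xs)\<bar> <= C * (1 + real (length xs))" for xs
  proof -
   have "C * 1 <= C * (1 + real (length xs))" using C0 by (intro mult_left_mono) auto
   then show ?thesis using C[of "(z, xs)"] by linarith
  qed
  have d: "(LINT xs|Poi L. skorohod (dif_kernel z v) xs * v (z, xs)) = (LINT (xs, y)|(Poi L >< L). dif_kernel z v (y, xs) * (v (z, y # xs) - v (z, xs)))"
   "integrable (Poi L >< L) (%(xs, y). dif_kernel z v (y, xs) * (v (z, y # xs) - v (z, xs)))"
   by (rule skorohod_duality[OF Dm[OF z] Di DCz Gm Gi Gb])+
  have "(LINT xs|Poi L. w z xs) = (LINT (xs, y)|(Poi L >< L). dif_kernel z v (y, xs) * (v (z, y # xs) - v (z, xs)))"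
   unfolding d(1)[symmetric] w_def by (simp only: mult.commute)
  also have "... = (LINT xs|Poi L. LINT y|L. dif_kernel z v (y, xs) * (v (z, y # xs) - v (z, xs)))"
   using PL.integral_fst'[OF d(2)] by simp
  finally show "(LINT xs|Poi L. w z xs) = (LINT xs|Poi L. LINT y|L. dif_kernel z v (y, xs) * dif_kernel y v (z, xs))"
   by (simp add: dif_kernel_def)
 qed
 also have "... = (LINT xs|Poi L. LINT z|L. LINT y|L. dif_kernel z v (y, xs) * dif_kernel y v (z, xs))"
 proof -
  have "\<bar>(LINT y|L. dif_kernel z v (y, xs) * dif_kernel y v (z, xs))\<bar> <= 2 * C * (2 * C) * measure L (space L)" for z xs
   by (rule abs_integral_le_mass[OF b])
  then show ?thesis
   using Fubini_bounded[OF L P.finite_measure_axioms, of "%(z, xs). LINT y|L. dif_kernel z v (y, xs) * dif_kernel y v (z, xs)" "2 * C * (2 * C) * measure L (space L)"]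
   by (simp only: split_def fst_conv snd_conv) measurable
 qed
 also have "... <= (LINT xs|Poi L. LINT z|L. LINT y|L. (dif_kernel y v (z, xs))^2)"
 proof (rule integral_mono)
  have b2: "\<bar>(dif_kernel y v q)^2\<bar> <= 2 * C * (2 * C)" for y q
   using b[of y q y q] by (simp add: power2_eq_square)
  have B: "\<bar>(LINT z|L. LINT y|L. f z y)\<bar> <= 2 * C * (2 * C) * measure L (space L) * measure L (space L)"
   if "\<And>z y. \<bar>f z y\<bar> <= 2 * C * (2 * C)" for f :: "'z => 'z => real"
   by (rule abs_integral_le_mass[OF abs_integral_le_mass[OF that]])
  show "integrable (Poi L) (%xs. LINT z|L. LINT y|L. dif_kernel z v (y, xs) * dif_kernel y v (z, xs))"
   by (rule P.integrable_bounded[OF _ B[OF b]]) measurable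
  show "integrable (Poi L) (%xs. LINT z|L. LINT y|L. (dif_kernel y v (z, xs))^2)"
   by (rule P.integrable_bounded[OF _ B[OF b2]]) measurable
  fix xs assume "xs : space (Poi L)"
  then have [measurable]: "xs : space (seqs L)" by simp
  define a where "a = (%(z, y). dif_kernel y v (z, xs))"
  have [measurable]: "a : bmeas (L >< L)" unfolding a_def by measurable
  have ab: "\<bar>a p\<bar> <= 2 * C" for p by (simp add: a_def split_beta DCz)
  have ab2: "\<bar>(a p)^2\<bar> <= (2 * C)^2" for p using power_mono[OF ab abs_ge_zero, of p 2] by simp
  have ab3: "\<bar>a p * a q\<bar> <= 2 * C * (2 * C)" for p q unfolding abs_mult by (rule mult_mono[OF ab ab]) (use C0 in auto)
  interpret LL: pair_sigma_finite L L by unfold_locales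
  interpret LLF: finite_measure "L >< L" by (intro finite_measure_pair_measure) unfold_locales
  have ia3: "integrable (L >< L) (%p. a (snd p, fst p) * a p)" by (rule LLF.integrable_bounded[OF _ ab3]) measurable
  have ia2: "integrable (L >< L) (%p. (a p)^2)" and ia2': "integrable (L >< L) (%p. (a (snd p, fst p))^2)"
   by (rule LLF.integrable_bounded[OF _ ab2], measurable)+
  have "(LINT z|L. LINT y|L. a (y, z) * a (z, y)) = (LINT p|(L >< L). a (snd p, fst p) * a p)"
   using LL.integral_fst'[OF ia3] by simp
  also have "... <= (LINT p|(L >< L). ((a (snd p, fst p))^2 + (a p)^2) / 2)"
  proof (rule integral_mono)
   show "integrable (L >< L) (%p. a (snd p, fst p) * a p)" by (rule ia3)
   show "integrable (L >< L) (%p. ((a (snd p, fst p))^2 + (a p)^2) / 2)" using ia2 ia2' by simp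
   show "a (snd p, fst p) * a p <= ((a (snd p, fst p))^2 + (a p)^2) / 2" for p
    using sum_squares_bound[of "a (snd p, fst p)" "a p"] by simp
  qed
  also have "... = ((LINT p|(L >< L). (a (snd p, fst p))^2) + (LINT p|(L >< L). (a p)^2)) / 2"
   using ia2 ia2' by simp
  also have "(LINT p|(L >< L). (a (snd p, fst p))^2) = (LINT p|(L >< L). (a p)^2)"
   using LL.integral_product_swap[of "%p. (a p)^2"] by (simp add: split_def)
  also have "((LINT p|(L >< L). (a p)^2) + (LINT p|(L >< L). (a p)^2)) / 2 = (LINT z|L. LINT y|L. (a (z, y))^2)"
   using LL.integral_fst'[OF ia2] by simp
  finally show "(LINT z|L. LINT y|L. dif_kernel z v (y, xs) * dif_kernel y v (z, xs)) <= (LINT z|L. LINT y|L. (dif_kernel y v (z, xs))^2)"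
   by (simp add: a_def)
 qed
 finally show "(LINT xs|Poi L. (skorohod v xs)^2) \<le>
  (LINT xs|Poi L. LINT z|L. (v (z, xs))^2) + (LINT xs|Poi L. LINT z|L. LINT y|L. (dif_kernel y v (z, xs))^2)"
  by (simp add: \<delta>_def)
qed

text \<open>By duality the left-hand side is the squared expectation of \<open>skorohod v * h\<close>.\<close>

lemma skorohod_estimate_bounded:
 fixes v :: "'z * 'z list => real"
 assumes v[measurable]: "v : bmeas (L >< seqs L)" and inv: "kernel_inv v" and C: "\<And>p. \<bar>v p\<bar> <= C"
  and h[measurable]: "h : bmeas (seqs L)" and h_inv: "perm_inv h" and h1: "\<And>xs. \<bar>h xs\<bar> <= 1"
 shows "(LINT (xs, z)|(Poi L >< L). v (z, xs) * (h (z # xs) - h xs))^2 \<le>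
  (LINT xs|Poi L. LINT z|L. (v (z, xs))^2) + (LINT xs|Poi L. LINT z|L. LINT y|L. (dif_kernel y v (z, xs))^2)"
proof -
 note [measurable] = skorohod_measurable[OF v inv C]
 note i2 = skorohod_second_moment(2)[OF v inv C]
 have i1: "integrable (Poi L) (skorohod v)" by (rule P.square_integrable_imp_integrable[OF _ i2]) simp
 have i1': "integrable (Poi L) (%xs. \<bar>skorohod v xs\<bar>)" using i1 by (rule integrable_abs)
 have i2': "integrable (Poi L) (%xs. \<bar>skorohod v xs\<bar>^2)" using i2 by simp
 have hb: "\<bar>h xs\<bar> <= 1 * (1 + real (length xs))" for xs using h1[of xs] by simp
 have "\<bar>(LINT xs|Poi L. skorohod v xs * h xs)\<bar> <= (LINT xs|Poi L. \<bar>skorohod v xs * h xs\<bar>)" by (rule integral_abs_bound)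
 also have "... <= (LINT xs|Poi L. \<bar>skorohod v xs\<bar>)"
 proof (rule integral_mono_AE')
  show "AE xs in Poi L. \<bar>skorohod v xs * h xs\<bar> <= \<bar>skorohod v xs\<bar>"
   using h1 by (intro AE_I2) (simp add: abs_mult mult_left_le)
 qed (use i1' in auto)
 finally have "(LINT xs|Poi L. skorohod v xs * h xs)^2 <= (LINT xs|Poi L. \<bar>skorohod v xs\<bar>)^2"
  by (metis abs_ge_zero power2_abs power_mono)
 also have "... <= (LINT xs|Poi L. \<bar>skorohod v xs\<bar>^2)"
  using P.variance_positive[of "%xs. \<bar>skorohod v xs\<bar>"] P.variance_eq[OF i1' i2'] by simp
 also have "... <= (LINT xs|Poi L. LINT z|L. (v (z, xs))^2) + (LINT xs|Poi L. LINT z|L. LINT y|L. (dif_kernel y v (z, xs))^2)"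
  using skorohod_second_moment(1)[OF v inv C] by simp
 finally show ?thesis
  unfolding skorohod_duality(1)[OF v inv C h h_inv hb] .
qed

end

lemma (in finite_measure) ennreal_integral_bounded:
 assumes [measurable]: "f : bmeas M" and f: "\<And>x. x : space M ==> 0 <= f x \<and> f x <= (C :: real)"
 shows "ennreal (LINT x|M. f x) = (NINT x|M. ennreal (f x))"
proof -
 have "integrable M f" by (rule integrable_bounded[where C = C]) (use f in auto)
 from nn_integral_eq_integral[OF this] show ?thesis using f by (auto intro!: AE_I2)
qed

text \<open>The bounded case is averaged over the parameter. Truncating the kernel decreases the right-hand side, and
 dominated convergence recovers the left-hand side.\<close>

theorem skorohod_estimate:
 fixes v :: "'z * 'r * 'z list => real" and H :: "'r * 'z list => real"
 assumes R: "prob_space R" and L: "finite_measure L"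
  and H: "functional R L H" and H1: "\<And>p. \<bar>H p\<bar> <= 1"
  and v[measurable]: "v : bmeas (L >< R >< seqs L)"
  and inv: "\<And>z r. perm_inv (%xs. v (z, r, xs))"
  and int: "integrable (Psp R L >< L) (%(p, z). v (z, p))"
 shows "eabs ((LINT (p, z)|(Psp R L >< L). v (z, p) * dif H z p)) \<le>
  rt ((NINT p|Psp R L. NINT z|L. ennreal ((v (z, p))^2))
   + (NINT p|Psp R L. NINT z|L. NINT y|L. ennreal ((dif (%q. v (z, q)) y p)^2)))"
proof -
 interpret R: prob_space R by fact
 interpret L: finite_measure L by fact
 interpret P: prob_space "Poi L" by (rule prob_space_Poi[OF L])
 interpret \<Omega>: prob_space "Psp R L" by (rule prob_space_Psp[OF R L])
 interpret \<Omega>L: pair_sigma_finite "Psp R L" L by unfold_locales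
 interpret PL: pair_sigma_finite "Poi L" L by unfold_locales
 interpret PLF: finite_measure "Poi L >< L" by (intro finite_measure_pair_measure) unfold_locales
 interpret \<Omega>LF: finite_measure "Psp R L >< L" by (intro finite_measure_pair_measure) unfold_locales
 note Hm[measurable] = functional_meas[OF H]
 have dif2: "\<bar>dif H z p\<bar> <= 2" for z p
  using H1[of p] H1[of "(fst p, z # snd p)"] unfolding dif_def by linarith
 define E where "E w = (NINT p|Psp R L. NINT z|L. ennreal ((w (z, p))^2))
   + (NINT p|Psp R L. NINT z|L. NINT y|L. ennreal ((dif (%q. w (z, q)) y p)^2))" for w
 have bounded: "eabs ((LINT (p, z)|(Psp R L >< L). w (z, p) * dif H z p)) <= rt (E w)"
  if w[measurable]: "w : bmeas (L >< R >< seqs L)"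
   and winv: "\<And>z r. perm_inv (%xs. w (z, r, xs))" and wC: "\<And>p. \<bar>w p\<bar> <= C" for w and C :: real
 proof -
  define I where "I = (%r. LINT (xs, z)|(Poi L >< L). w (z, r, xs) * dif H z (r, xs))"
  let ?d = "%z y r xs. (dif (%q. w (z, q)) y (r, xs))"
  define A where "A = (%r. LINT xs|Poi L. LINT z|L. (w (z, r, xs))^2)"
  define D where "D = (%r. LINT xs|Poi L. LINT z|L. LINT y|L. ?d z y r xs^2)"
  have C0: "0 <= C" using wC[of undefined] by simp
  have b: "\<bar>w p * dif H z q\<bar> <= C * 2" for p z q
   unfolding abs_mult by (rule mult_mono[OF wC dif2]) (use C0 in auto)
  have w2: "0 <= (w p)^2 \<and> (w p)^2 <= C^2" for p using power_mono[OF wC abs_ge_zero, of p 2] by simp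
  have dw: "\<bar>dif (%q. w (z, q)) y p\<bar> <= 2 * C" for z y p
   using wC[of "(z, p)"] wC[of "(z, fst p, y # snd p)"] unfolding dif_def by linarith
  have dw2: "0 <= (dif (%q. w (z, q)) y p)^2 \<and> (dif (%q. w (z, q)) y p)^2 <= (2 * C)^2" for z y p
   using power_mono[OF dw abs_ge_zero, of z y p 2] by simp
  have [measurable]: "(%x. dif (%q. w (f x, q)) (g x) (h x)) : bmeas N"
   if [measurable]: "f : N ->M L" "g : N ->M L" "h : N ->M R >< seqs L" for f g h and N :: "'n measure"
   unfolding dif_def by measurable
  have Im[measurable]: "I : bmeas R" unfolding I_def split_def by measurable
  have mass: "0 <= (LINT z|L. f z) \<and> (LINT z|L. f z) <= K * measure L (space L)"
   if "\<And>z. 0 <= f z \<and> f z <= K" for f K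
   using abs_integral_le_mass[OF L, of f K] Bnonneg[of L f] that by (auto simp: abs_le_iff)
  have est: "(eabs (I r))^2 <= (NINT xs|Poi L. NINT z|L. ennreal ((w (z, r, xs))^2))
   + (NINT xs|Poi L. NINT z|L. NINT y|L. ennreal (?d z y r xs^2))"
   if r[measurable]: "r : space R" for r
  proof -
   have "(I r)^2 <= A r + D r"
   proof -
    have m: "(%(z, xs). w (z, r, xs)) : bmeas (L >< seqs L)" by measurable
    have i: "kernel_inv (%(z, xs). w (z, r, xs))"
     by (rule kernel_invI, unfold prod.case, rule perm_invD[OF winv])
    have h: "(%xs. H (r, xs)) : bmeas (seqs L)" by measurable
    have hi: "perm_inv (%xs. H (r, xs))" by (rule functional_invariant[OF H])
    have c: "\<bar>case p of (z, xs) => w (z, r, xs)\<bar> <= C" for p unfolding split_def by (rule wC)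
    from skorohod_estimate_bounded[OF L m i c h hi H1] show ?thesis
     by (simp only: I_def A_def D_def dif_def dif_kernel_def prod.case fst_conv snd_conv split_def)
   qed
   then have "(eabs (I r))^2 <= ennreal (A r + D r)" by (simp add: ennreal_power ennreal_leI)
   also have "... = ennreal (A r) + ennreal (D r)"
    by (rule ennreal_plus) (auto simp: A_def D_def intro!: Bnonneg)
   also have "ennreal (A r) = (NINT xs|Poi L. ennreal (LINT z|L. (w (z, r, xs))^2))"
    unfolding A_def by (rule P.ennreal_integral_bounded[OF _ mass[OF w2]]) measurable
   also have "... = (NINT xs|Poi L. NINT z|L. ennreal ((w (z, r, xs))^2))"
    by (intro nn_integral_cong L.ennreal_integral_bounded[OF _ w2]) simp
   also have "ennreal (D r) = (NINT xs|Poi L. ennreal (LINT z|L. LINT y|L. ?d z y r xs^2))"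
    unfolding D_def by (rule P.ennreal_integral_bounded[OF _ mass[OF mass[OF dw2]]]) measurable
   also have "... = (NINT xs|Poi L. NINT z|L. ennreal (LINT y|L. ?d z y r xs^2))"
    by (intro nn_integral_cong L.ennreal_integral_bounded[OF _ mass[OF dw2]]) simp
   also have "... = (NINT xs|Poi L. NINT z|L. NINT y|L. ennreal (?d z y r xs^2))"
    by (intro nn_integral_cong L.ennreal_integral_bounded[OF _ dw2]) simp
   finally show ?thesis .
  qed
  have "(LINT (p, z)|(Psp R L >< L). w (z, p) * dif H z p) = (LINT p|Psp R L. LINT z|L. w (z, p) * dif H z p)"
  proof -
   have "integrable (Psp R L >< L) (%(p, z). w (z, p) * dif H z p)"
    by (rule \<Omega>LF.integrable_bounded[where C = "C * 2"]) (measurable, use b in \<open>simp add: split_def\<close>)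
   from \<Omega>L.integral_fst'[OF this] show ?thesis by simp
  qed
  also have "... = (LINT r|R. LINT xs|Poi L. LINT z|L. w (z, r, xs) * dif H z (r, xs))"
   unfolding Psp_def
   by (rule P.integral_fst_bounded[OF R.finite_measure_axioms _ abs_integral_le_mass[OF L b]]) measurable
  also have "... = (LINT r|R. I r)"
  proof (rule Bcong)
   fix r assume r[measurable]: "r : space R"
   have "integrable (Poi L >< L) (%(xs, z). w (z, r, xs) * dif H z (r, xs))"
    by (rule PLF.integrable_bounded[where C = "C * 2"]) (measurable, use b in \<open>simp add: split_def\<close>)
   from PL.integral_fst'[OF this] show "(LINT xs|Poi L. LINT z|L. w (z, r, xs) * dif H z (r, xs)) = I r"
    by (simp add: I_def)
  qed
  finally have "eabs ((LINT (p, z)|(Psp R L >< L). w (z, p) * dif H z p)) = eabs ((LINT r|R. I r))" by simp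
  also have "... <= (NINT r|R. eabs (I r))"
  proof (cases "integrable R I")
   case True
   have "eabs ((LINT r|R. I r)) <= ennreal (LINT r|R. \<bar>I r\<bar>)" by (intro ennreal_leI integral_abs_bound)
   also have "... = (NINT r|R. eabs (I r))" using True by (intro nn_integral_eq_integral[symmetric]) auto
   finally show ?thesis .
  qed (simp add: not_integrable_integral_eq)
  also have "... <= rt (NINT r|R. (eabs (I r))^2)" by (rule R.nn_integral_le_sqrt) measurable
  also have "... <= rt (E w)"
  proof (rule epowr_mono)
   have "(NINT r|R. (eabs (I r))^2) <= (NINT r|R. (NINT xs|Poi L. NINT z|L. ennreal ((w (z, r, xs))^2))
    + (NINT xs|Poi L. NINT z|L. NINT y|L. ennreal (?d z y r xs^2)))"
    by (intro nn_integral_mono est)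
   also have "... = (NINT r|R. NINT xs|Poi L. NINT z|L. ennreal ((w (z, r, xs))^2))
    + (NINT r|R. NINT xs|Poi L. NINT z|L. NINT y|L. ennreal (?d z y r xs^2))"
    by (rule nn_integral_add) measurable
   also have "... = E w"
    unfolding E_def by (intro arg_cong2[where f = "(+)"] nn_integral_Psp[OF L, symmetric]) measurable
   finally show "(NINT r|R. (eabs (I r))^2) <= E w" .
  qed simp
  finally show ?thesis .
 qed
 have tr: "eabs ((LINT (p, z)|(Psp R L >< L). trunc_at n (v (z, p)) * dif H z p)) <= rt (E v)" for n
 proof -
  have "eabs ((LINT (p, z)|(Psp R L >< L). trunc_at n (v (z, p)) * dif H z p)) <= rt (E (%q. trunc_at n (v q)))"
   by (rule bounded[OF _ perm_inv_comp[OF inv] trunc_at_le]) measurable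
  also have "... <= rt (E v)"
  proof (rule epowr_mono)
   have "(trunc_at n x)^2 <= x^2" for x using power_mono[OF trunc_at_le_self abs_ge_zero, of n x 2] by simp
   moreover have "(dif (%q. trunc_at n (v (z, q))) y p)^2 <= (dif (%q. v (z, q)) y p)^2" for z y p
    using power_mono[OF trunc_at_Lipschitz abs_ge_zero, of n "v (z, fst p, y # snd p)" "v (z, p)" 2] by (simp add: dif_def)
   ultimately show "E (%q. trunc_at n (v q)) <= E v"
    unfolding E_def by (intro add_mono nn_integral_mono ennreal_leI)
  qed simp
  finally show ?thesis .
 qed
 have "(%n. LINT x|(Psp R L >< L). trunc_at n (v (snd x, fst x)) * dif H (snd x) (fst x))
  \<longlonglongrightarrow> (LINT x|(Psp R L >< L). v (snd x, fst x) * dif H (snd x) (fst x))"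
 proof (rule integral_dominated_convergence)
  show "integrable (Psp R L >< L) (%x. \<bar>v (snd x, fst x)\<bar> * 2)"
   using int by (simp add: split_def)
  show "AE x in Psp R L >< L. norm (trunc_at n (v (snd x, fst x)) * dif H (snd x) (fst x)) <= \<bar>v (snd x, fst x)\<bar> * 2" for n
   unfolding real_norm_def abs_mult by (intro AE_I2 mult_mono trunc_at_le_self dif2) auto
  show "AE x in Psp R L >< L. (%n. trunc_at n (v (snd x, fst x)) * dif H (snd x) (fst x)) \<longlonglongrightarrow> v (snd x, fst x) * dif H (snd x) (fst x)"
   by (intro AE_I2 tendsto_intros tendsto_trunc_at)
 qed measurable
 then have "(%n. eabs ((LINT (p, z)|(Psp R L >< L). trunc_at n (v (z, p)) * dif H z p)))
  \<longlonglongrightarrow> eabs ((LINT (p, z)|(Psp R L >< L). v (z, p) * dif H z p))"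
  unfolding split_def by (intro tendsto_ennrealI tendsto_rabs)
 then show ?thesis
  unfolding E_def[symmetric] by (rule LIMSEQ_le_const2) (use tr in blast)
qed

section \<open>The second-order Poincare terms\<close>

lemma dif2_measurable [measurable]:
 assumes [measurable]: "F : bmeas (R >< seqs L)"
  and [measurable]: "f : N ->M L" "g : N ->M L" "h : N ->M R >< seqs L"
 shows "(%w. dif (dif F (f w)) (g w) (h w)) : bmeas N"
 unfolding dif_def[of "dif F _"] by measurable

lemma dif_functional: "functional R L F ==> z : space L ==> functional R L (dif F z)"
proof (rule functionalI)
 assume F: "functional R L F" and [measurable]: "z : space L"
 note [measurable] = functional_meas[OF F]
 show "dif F z : bmeas (R >< seqs L)" by measurable
 show "dif F z (r, xs) = dif F z (r, ys)" if "mset xs = mset ys" for r xs ys by (rule dif_invariant[OF F that])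
qed

lemma dif_commute:
 assumes "functional R L F" shows "dif (dif F y) z p = dif (dif F z) y p"
proof -
 have "F (fst p, y # z # snd p) = F (fst p, z # y # snd p)"
  by (rule functionalD[OF assms]) (simp add: add_mset_commute)
 then show ?thesis by (simp add: dif_def)
qed

lemma functional_comp2:
 fixes F G :: "'r * 'x list => real" and h :: "real => real => real"
 assumes F: "functional R L F" and G: "functional R L G" and [measurable]: "(%(a, b). h a b) : bmeas (borel >< borel)"
 shows "functional R L (%p. h (F p) (G p))"
proof (rule functionalI)
 note [measurable] = functional_meas[OF F] functional_meas[OF G]
 show "(%p. h (F p) (G p)) : bmeas (R >< seqs L)" by measurable
 fix r and xs ys :: "'x list" assume m: "mset xs = mset ys"
 show "h (F (r, xs)) (G (r, xs)) = h (F (r, ys)) (G (r, ys))"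
  by (rule arg_cong2[where f = h]) (rule functionalD[OF F m] functionalD[OF G m])+
qed

lemma nnE_first_second:
 assumes L: "finite_measure L" and s: "0 <= s" "s <= 1" and T: "functional R L T"
 shows "nnE (Qsp R L s) (%p. T (first p)) = nnE (Psp R L) T"
  and "nnE (Qsp R L s) (%p. T (second p)) = nnE (Psp R L) T"
proof -
 have "functional R L (%p. ennreal (T p))"
 proof (rule functionalI)
  note [measurable] = functional_meas[OF T]
  show "(%p. ennreal (T p)) : bmeas (R >< seqs L)" by measurable
 qed (rule arg_cong[of _ _ ennreal], rule functionalD[OF T])
 from nn_integral_first_second[OF L s this]
 show "nnE (Qsp R L s) (%p. T (first p)) = nnE (Psp R L) T"
  and "nnE (Qsp R L s) (%p. T (second p)) = nnE (Psp R L) T"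
  by (simp_all only: nn_expect_def)
qed

lemma nnE_Cauchy_Schwarz:
 assumes [measurable]: "f : bmeas N" "g : bmeas N"
 shows "(NINT p|N. eabs (f p * g p)) <= rt (nnE N (%p. (f p)^2)) * rt (nnE N (%p. (g p)^2))"
 using nn_integral_Cauchy_Schwarz[of "%p. eabs (f p)" N "%p. eabs (g p)"]
 by (simp add: nn_expect_def ennreal_power abs_mult ennreal_mult)

text \<open>The square of the integral is written as a double integral, and Cauchy-Schwarz is applied under the double
 integral. This is where the quantities with two points \<open>z1\<close> and \<open>z2\<close> come from.\<close>

lemma square_of_integral_le:
 fixes f h :: "'z * 'z * 'p => real"
 assumes L: "sigma_finite_measure L" and N: "sigma_finite_measure N"
  and f[measurable]: "f : bmeas (L >< L >< N)"
  and h[measurable]: "h : bmeas (L >< L >< N)"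
 shows "(NINT p|N. NINT y|L. (NINT z|L. eabs (f (z, y, p) * h (z, y, p)))^2)
  <= (NINT z1|L. NINT z2|L. NINT y|L. rt (nnE N (%p. (f (z1, y, p))^2 * (f (z2, y, p))^2)) *
     rt (nnE N (%p. (h (z1, y, p))^2 * (h (z2, y, p))^2)))"
proof -
 interpret L: sigma_finite_measure L by fact
 interpret N: sigma_finite_measure N by fact
 interpret LL: pair_sigma_finite L L by unfold_locales
 interpret LN: pair_sigma_finite L N by unfold_locales
 define k where "k q = eabs (f q * h q)" for q
 have k[measurable]: "k : bmeas (L >< L >< N)" unfolding k_def by measurable
 have "(NINT p|N. NINT y|L. (NINT z|L. k (z, y, p))^2) = (NINT p|N. NINT y|L. NINT z1|L. NINT z2|L. k (z1, y, p) * k (z2, y, p))"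
 proof (intro nn_integral_cong)
  fix p y assume [measurable]: "p : space N" "y : space L"
  have [measurable]: "(%z. k (z, y, p)) : bmeas L" by measurable
  show "(NINT z|L. k (z, y, p))^2 = (NINT z1|L. NINT z2|L. k (z1, y, p) * k (z2, y, p))"
   by (simp add: nn_integral_cmult nn_integral_multc power2_eq_square)
 qed
 also have "... = (NINT y|L. NINT p|N. NINT z1|L. NINT z2|L. k (z1, y, p) * k (z2, y, p))"
  by (rule LN.Fubini') measurable
 also have "... = (NINT y|L. NINT z1|L. NINT p|N. NINT z2|L. k (z1, y, p) * k (z2, y, p))"
  by (intro nn_integral_cong LN.Fubini') measurable
 also have "... = (NINT z1|L. NINT y|L. NINT p|N. NINT z2|L. k (z1, y, p) * k (z2, y, p))"
  by (rule LL.Fubini') measurable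
 also have "... = (NINT z1|L. NINT y|L. NINT z2|L. NINT p|N. k (z1, y, p) * k (z2, y, p))"
  by (intro nn_integral_cong LN.Fubini') measurable
 also have "... = (NINT z1|L. NINT z2|L. NINT y|L. NINT p|N. k (z1, y, p) * k (z2, y, p))"
  by (intro nn_integral_cong LL.Fubini') measurable
 also have "... <= (NINT z1|L. NINT z2|L. NINT y|L. rt (nnE N (%p. (f (z1, y, p))^2 * (f (z2, y, p))^2)) *
     rt (nnE N (%p. (h (z1, y, p))^2 * (h (z2, y, p))^2)))"
 proof (intro nn_integral_mono)
  fix z1 z2 y assume [measurable]: "z1 : space L" "z2 : space L" "y : space L"
  have "(NINT p|N. k (z1, y, p) * k (z2, y, p)) = (NINT p|N. eabs ((f (z1, y, p) * f (z2, y, p)) * (h (z1, y, p) * h (z2, y, p))))"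
   by (intro nn_integral_cong) (simp add: k_def ennreal_mult[symmetric] abs_mult mult_ac)
  also have "... <= rt (nnE N (%p. (f (z1, y, p) * f (z2, y, p))^2)) * rt (nnE N (%p. (h (z1, y, p) * h (z2, y, p))^2))"
   by (rule nnE_Cauchy_Schwarz) measurable
  finally show "(NINT p|N. k (z1, y, p) * k (z2, y, p)) <= rt (nnE N (%p. (f (z1, y, p))^2 * (f (z2, y, p))^2)) *
     rt (nnE N (%p. (h (z1, y, p))^2 * (h (z2, y, p))^2))"
   by (simp only: power_mult_distrib)
 qed
 finally show ?thesis by (simp only: k_def)
qed

definition list_gamma1 where
 "list_gamma1 R L F = rt (4 * (NINT z1|L. NINT z2|L. NINT z3|L. rt (nnE (Psp R L) (%p. (dif F z1 p)^2 * (dif F z2 p)^2)) *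
   rt (nnE (Psp R L) (%p. (dif (dif F z3) z1 p)^2 * (dif (dif F z3) z2 p)^2))))"

definition list_gamma2 where
 "list_gamma2 R L F = rt (NINT z1|L. NINT z2|L. NINT z3|L. nnE (Psp R L) (%p. (dif (dif F z3) z1 p)^2 * (dif (dif F z3) z2 p)^2))"

context
 fixes R :: "'r measure" and L :: "'x measure" and F :: "'r * 'x list => real" and s :: real
 assumes R: "prob_space R" and L: "finite_measure L" and F: "functional R L F" and s: "0 <= s" "s <= 1"
  and eF: "energy R L F < \<infinity>"
begin

interpretation L: finite_measure L by (rule L)
interpretation R: prob_space R by (rule R)
interpretation K: prob_space "Qsp R L s" by (rule prob_space_Qsp[OF R L])
interpretation KL: pair_sigma_finite "Qsp R L s" L by unfold_locales
interpretation PL: prob_space "pair_lists L s" by (rule prob_space_pair_lists[OF L])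
interpretation RPL: pair_sigma_finite R "pair_lists L s" by unfold_locales

lemmas F_meas [measurable] = functional_meas[OF F]

lemma finite_all_marked: "finite_measure (marked L s marks)"
 by (intro finite_marked L) simp

interpretation A: finite_measure "marked L s marks" by (rule finite_all_marked)

lemma nn_integral_all_marks:
 assumes "f : bmeas (L >< count_space marks)"
 shows "(NINT \<zeta>|marked L s marks. f \<zeta>) =
  (NINT x|L. ennreal s * f (x, Both) + ennreal (1 - s) * f (x, First) + ennreal (1 - s) * f (x, Second))"
 by (subst nn_integral_marked[OF _ assms]) (simp_all add: mark_weight_def add_ac)

text \<open>The random quantity whose fluctuation governs the first two terms of the bound: the integrand of
 \<open>gamma_form\<close> before taking expectations.\<close>

definition carre where "carre p = (LINT z|L. dif F z (second p) * dif F z (first p))"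

lemma carre_functional: "functional R (marked L s marks) carre"
proof (rule functionalI)
 show "carre : bmeas (R >< seqs (marked L s marks))" unfolding carre_def [abs_def] by measurable
 fix r and xs ys :: "('x \<times> mark) list" assume "mset xs = mset ys"
 note m = mset_proj_cong[OF this]
 show "carre (r, xs) = carre (r, ys)"
  unfolding carre_def first_Pair second_Pair
  by (intro Bcong arg_cong2[where f = "(*)"] dif_invariant[OF F] m)
qed

lemma dif_carre_measurable [measurable]:
 assumes "f : N ->M marked L s marks" "g : N ->M R >< seqs (marked L s marks)"
 shows "(%w. dif carre (f w) (g w)) : bmeas N"
 by (rule dif_measurable[OF functional_meas[OF carre_functional] assms])

lemma integrable_carre_kernel: "integrable (Qsp R L s >< L) (%(p, z). dif F z (second p) * dif F z (first p))"
 by (rule integrable_gamma(1)[OF R L s F F eF eF])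

lemma integrable_carre: "integrable (Qsp R L s) carre"
 using KL.integrable_fst'[OF integrable_carre_kernel] by (simp add: carre_def [abs_def])

lemma dif_first_Cons: "dif F z (first (r, (y, k) # zs)) = dif F z (first (r, zs)) + (if k \<noteq> Second then dif (dif F z) y (first (r, zs)) else 0)"
 by (simp add: first_Pair proj_Cons dif_def[of "dif F z"])

lemma dif_second_Cons: "dif F z (second (r, (y, k) # zs)) = dif F z (second (r, zs)) + (if k \<noteq> First then dif (dif F z) y (second (r, zs)) else 0)"
 by (simp add: second_Pair proj_Cons dif_def[of "dif F z"])

definition cross1 where "cross1 y p = (NINT z|L. eabs (dif F z (first p) * dif (dif F z) y (second p)))"
definition cross2 where "cross2 y p = (NINT z|L. eabs (dif F z (second p) * dif (dif F z) y (first p)))"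
definition cross3 where "cross3 y p = (NINT z|L. eabs (dif (dif F z) y (first p) * dif (dif F z) y (second p)))"

lemma cross_measurable [measurable]:
 assumes [measurable]: "f : N ->M L" "g : N ->M R >< seqs (marked L s marks)"
 shows "(%w. cross1 (f w) (g w)) : bmeas N" "(%w. cross2 (f w) (g w)) : bmeas N"
  "(%w. cross3 (f w) (g w)) : bmeas N"
 unfolding cross1_def cross2_def cross3_def by measurable

text \<open>Adding a point with mark \<open>k\<close> changes \<open>D\<^sub>z F\<close> at the members that contain it, by the second-order difference. The change
 of the product has two cross terms and one term with two second-order differences.\<close>

lemma dif_carre_le:
 assumes r: "r : space R" and zs: "zs : space (seqs (marked L s marks))" and y: "y : space L" and k: "k : marks"
  and i0: "integrable L (%z. dif F z (second (r, zs)) * dif F z (first (r, zs)))"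
  and i1: "integrable L (%z. dif F z (second (r, (y, k) # zs)) * dif F z (first (r, (y, k) # zs)))"
 shows "eabs (dif carre (y, k) (r, zs)) <= (if k \<noteq> First then cross1 y (r, zs) else 0)
  + (if k \<noteq> Second then cross2 y (r, zs) else 0) + (if k = Both then cross3 y (r, zs) else 0)"
proof -
 note [measurable] = r zs y
 define dX where "dX z = (if k \<noteq> Second then dif (dif F z) y (first (r, zs)) else 0)" for z
 define dY where "dY z = (if k \<noteq> First then dif (dif F z) y (second (r, zs)) else 0)" for z
 have [measurable]: "dX : bmeas L" "dY : bmeas L"
  unfolding dX_def [abs_def] dY_def [abs_def] by measurable
 let ?X = "%z. dif F z (first (r, zs))" and ?Y = "%z. dif F z (second (r, zs))"
 have "dif carre (y, k) (r, zs) = (LINT z|L. dif F z (second (r, (y, k) # zs)) * dif F z (first (r, (y, k) # zs)) - ?Y z * ?X z)"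
  unfolding dif_def[of carre] carre_def fst_conv snd_conv by (rule Bdiff[OF i1 i0, symmetric])
 also have "... = (LINT z|L. ?X z * dY z + ?Y z * dX z + dX z * dY z)"
  unfolding dif_first_Cons dif_second_Cons dX_def[symmetric] dY_def[symmetric]
  by (intro Bcong) (simp add: algebra_simps)
 finally have eq: "dif carre (y, k) (r, zs) = (LINT z|L. ?X z * dY z + ?Y z * dX z + dX z * dY z)" .
 have "integrable L (%z. dif F z (second (r, (y, k) # zs)) * dif F z (first (r, (y, k) # zs)) - ?Y z * ?X z)"
  by (rule Bidiff[OF i1 i0])
 then have int: "integrable L (%z. ?X z * dY z + ?Y z * dX z + dX z * dY z)"
  unfolding dif_first_Cons dif_second_Cons dX_def[symmetric] dY_def[symmetric] by (simp add: algebra_simps)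
 have "eabs (dif carre (y, k) (r, zs)) <= (NINT z|L. eabs (?X z * dY z + ?Y z * dX z + dX z * dY z))"
  unfolding eq real_norm_def[symmetric] by (rule integral_norm_bound_ennreal[OF int])
 also have "... <= (NINT z|L. eabs (?X z * dY z) + eabs (?Y z * dX z) + eabs (dX z * dY z))"
  by (intro nn_integral_mono) (simp add: ennreal_plus[symmetric] del: ennreal_plus)
 also have "... = (NINT z|L. eabs (?X z * dY z)) + (NINT z|L. eabs (?Y z * dX z)) + (NINT z|L. eabs (dX z * dY z))"
  by (simp add: nn_integral_add)
 also have "... <= (if k \<noteq> First then cross1 y (r, zs) else 0)
  + (if k \<noteq> Second then cross2 y (r, zs) else 0) + (if k = Both then cross3 y (r, zs) else 0)"
  using k by (auto simp: dX_def dY_def cross1_def cross2_def cross3_def)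
 finally show ?thesis .
qed

text \<open>A point with mark \<open>Both\<close> contributes with weight \<open>s\<close> and produces all three terms; the two private marks have weight
 \<open>1 - s\<close> and produce one term each. Together they are dominated by the case \<open>s = 1\<close>.\<close>

lemma mark_average_le:
 fixes a b c :: ennreal
 shows "ennreal s * (a + b + c)^2 + ennreal (1 - s) * b^2 + ennreal (1 - s) * a^2 <= (a + b + c)^2"
proof -
 have "b^2 + a^2 <= (a + b + c)^2"
  by (simp add: power2_eq_square algebra_simps add_increasing2 add_left_mono)
 then have "ennreal (1 - s) * (b^2 + a^2) <= ennreal (1 - s) * (a + b + c)^2" by (rule mult_left_mono) simp
 then have "ennreal s * (a + b + c)^2 + ennreal (1 - s) * (b^2 + a^2) <= (ennreal s + ennreal (1 - s)) * (a + b + c)^2"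
  unfolding distrib_right by (rule add_left_mono)
 also have "ennreal s + ennreal (1 - s) = 1" using s by (simp add: ennreal_plus[symmetric] del: ennreal_plus)
 finally show ?thesis by (simp add: distrib_left add.assoc)
qed

text \<open>The integrals defining \<open>carre\<close> exist almost surely for the process, and by \<open>AE_add_point\<close> still after adding
 almost any point.\<close>

lemma energy_carre_le:
 "energy R (marked L s marks) carre <= (NINT p|Qsp R L s. NINT y|L. (cross1 y p + cross2 y p + cross3 y p)^2)"
proof -
 let ?c = "%y r zs. (cross1 y (r, zs) + cross2 y (r, zs) + cross3 y (r, zs))"
 note [measurable] = functional_meas[OF carre_functional]
 let ?Q = "%p. integrable L (%z. dif F z (second p) * dif F z (first p))"
 have "AE p in Qsp R L s. ?Q p"
  using KL.AE_integrable_fst'[OF integrable_carre_kernel] by simp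
 then have ae: "AE r in R. AE zs in pair_lists L s. ?Q (r, zs)"
  unfolding Qsp_def Psp_def by (rule RPL.AE_pair)
 have "energy R (marked L s marks) carre
   = (NINT r|R. NINT zs|pair_lists L s. NINT \<zeta>|marked L s marks. ennreal ((dif carre \<zeta> (r, zs))^2))"
  unfolding energy_def by (subst nn_integral_Psp[OF finite_all_marked]) measurable
 also have "... <= (NINT r|R. NINT zs|pair_lists L s. NINT y|L. ?c y r zs^2)"
 proof (rule nn_integral_mono_AE)
  show "AE r in R. (NINT zs|pair_lists L s. NINT \<zeta>|marked L s marks. ennreal ((dif carre \<zeta> (r, zs))^2))
   <= (NINT zs|pair_lists L s. NINT y|L. ?c y r zs^2)"
   using ae AE_space
  proof eventually_elim
   case (elim r)
   note r[measurable] = elim(2)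
   have Qm: "Measurable.pred (seqs (marked L s marks)) (%zs. ?Q (r, zs))" by measurable
   have Qi: "perm_inv (%zs. ?Q (r, zs))"
   proof (rule perm_invI)
    fix xs ys :: "('x \<times> mark) list" assume "mset xs = mset ys"
    note m = mset_proj_cong[OF this]
    have "(%z. dif F z (second (r, xs)) * dif F z (first (r, xs))) = (%z. dif F z (second (r, ys)) * dif F z (first (r, ys)))"
     unfolding first_Pair second_Pair by (intro ext arg_cong2[where f = "(*)"] dif_invariant[OF F] m)
    then show "?Q (r, xs) = ?Q (r, ys)" by (rule arg_cong)
   qed
   show ?case
   proof (rule nn_integral_mono_AE)
    show "AE zs in pair_lists L s. (NINT \<zeta>|marked L s marks. ennreal ((dif carre \<zeta> (r, zs))^2))
     <= (NINT y|L. ?c y r zs^2)"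
     using elim(1) AE_add_point[OF finite_all_marked Qm Qi elim(1)] AE_space[of "pair_lists L s"]
    proof eventually_elim
     case (elim zs)
     then have zs[measurable]: "zs : space (seqs (marked L s marks))" by simp
     define b where "b \<zeta> = (if snd \<zeta> \<noteq> First then cross1 (fst \<zeta>) (r, zs) else 0)
      + (if snd \<zeta> \<noteq> Second then cross2 (fst \<zeta>) (r, zs) else 0) + (if snd \<zeta> = Both then cross3 (fst \<zeta>) (r, zs) else 0)" for \<zeta>
     have bm: "(%\<zeta>. (b \<zeta>)^2) : bmeas (L >< count_space marks)"
      unfolding b_def by measurable
     have "(NINT \<zeta>|marked L s marks. ennreal ((dif carre \<zeta> (r, zs))^2)) <= (NINT \<zeta>|marked L s marks. (b \<zeta>)^2)"
     proof (rule nn_integral_mono_AE)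
      show "AE \<zeta> in marked L s marks. ennreal ((dif carre \<zeta> (r, zs))^2) <= (b \<zeta>)^2"
       using elim(2) AE_space
      proof eventually_elim
       case (elim \<zeta>)
       obtain y k where \<zeta>: "\<zeta> = (y, k)" by (cases \<zeta>)
       have "eabs (dif carre \<zeta> (r, zs)) <= b \<zeta>"
        unfolding \<zeta> b_def fst_conv snd_conv
        by (rule dif_carre_le[OF r zs]) (use elim \<open>?Q (r, zs)\<close> in \<open>simp_all add: \<zeta> space_marked\<close>)
       then have "(eabs (dif carre \<zeta> (r, zs)))^2 <= (b \<zeta>)^2" by (intro power_mono) simp_all
       then show ?case by (simp add: ennreal_power)
      qed
     qed
     also have "... = (NINT y|L. ennreal s * (b (y, Both))^2 + ennreal (1 - s) * (b (y, First))^2 + ennreal (1 - s) * (b (y, Second))^2)"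
      by (rule nn_integral_all_marks[OF bm])
     also have "... <= (NINT y|L. ?c y r zs^2)"
      using mark_average_le by (intro nn_integral_mono) (simp add: b_def)
     finally show ?case .
    qed
   qed
  qed
 qed
 also have "... = (NINT p|Qsp R L s. NINT y|L. (cross1 y p + cross2 y p + cross3 y p)^2)"
  unfolding Qsp_def by (rule nn_integral_Psp[OF finite_all_marked, symmetric]) measurable
 finally show ?thesis .
qed

lemma nnE_marginal2:
 assumes T1: "functional R L T1" and T2: "functional R L T2"
 shows "nnE (Qsp R L s) (%p. (T1 (first p))^2 * (T2 (first p))^2) = nnE (Psp R L) (%p. (T1 p)^2 * (T2 p)^2)"
  and "nnE (Qsp R L s) (%p. (T1 (second p))^2 * (T2 (second p))^2) = nnE (Psp R L) (%p. (T1 p)^2 * (T2 p)^2)"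
proof -
 have "functional R L (%p. (T1 p)^2 * (T2 p)^2)" by (rule functional_comp2[OF T1 T2]) measurable
 from nnE_first_second[OF L s this]
 show "nnE (Qsp R L s) (%p. (T1 (first p))^2 * (T2 (first p))^2) = nnE (Psp R L) (%p. (T1 p)^2 * (T2 p)^2)"
  and "nnE (Qsp R L s) (%p. (T1 (second p))^2 * (T2 (second p))^2) = nnE (Psp R L) (%p. (T1 p)^2 * (T2 p)^2)"
  by simp_all
qed

text \<open>Minkowski's inequality separates the three terms: the two cross terms give half of the first quantity each, the
 term with two second-order differences gives the second one. The members of the pair have been separated by
 Cauchy-Schwarz, so that only moments of a single process remain.\<close>

lemma energy_carre_le_gamma:
 "rt (energy R (marked L s marks) carre) <= list_gamma1 R L F + list_gamma2 R L F"
proof -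
 define J where "J = (NINT z1|L. NINT z2|L. NINT z3|L. rt (nnE (Psp R L) (%p. (dif F z1 p)^2 * (dif F z2 p)^2)) *
   rt (nnE (Psp R L) (%p. (dif (dif F z3) z1 p)^2 * (dif (dif F z3) z2 p)^2)))"
 define J2 where "J2 = (NINT z1|L. NINT z2|L. NINT z3|L. nnE (Psp R L) (%p. (dif (dif F z3) z1 p)^2 * (dif (dif F z3) z2 p)^2))"
 have sL: "sigma_finite_measure L" and sK: "sigma_finite_measure (Qsp R L s)" by unfold_locales
 have d1: "functional R L (dif F z)" if "z : space L" for z by (rule dif_functional[OF F that])
 have d2: "functional R L (dif (dif F z) y)" if "z : space L" "y : space L" for z y
  by (rule dif_functional[OF d1[OF that(1)] that(2)])
 have c1: "(NINT p|Qsp R L s. NINT y|L. (cross1 y p)^2) <= J"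
 proof -
  have "(NINT p|Qsp R L s. NINT y|L. (cross1 y p)^2) <= (NINT z1|L. NINT z2|L. NINT y|L. rt (nnE (Qsp R L s) (%p. (dif F z1 (first p))^2 * (dif F z2 (first p))^2)) *
    rt (nnE (Qsp R L s) (%p. (dif (dif F z1) y (second p))^2 * (dif (dif F z2) y (second p))^2)))"
   unfolding cross1_def
   by (rule square_of_integral_le[OF sL sK, of "%(z, y, p). dif F z (first p)" "%(z, y, p). dif (dif F z) y (second p)", unfolded prod.case]) measurable
  also have "... = J"
   unfolding J_def by (intro nn_integral_cong) (simp only: nnE_marginal2 d1 d2 dif_commute[OF F])
  finally show ?thesis .
 qed
 have c2: "(NINT p|Qsp R L s. NINT y|L. (cross2 y p)^2) <= J"
 proof -
  have "(NINT p|Qsp R L s. NINT y|L. (cross2 y p)^2) <= (NINT z1|L. NINT z2|L. NINT y|L. rt (nnE (Qsp R L s) (%p. (dif F z1 (second p))^2 * (dif F z2 (second p))^2)) *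
    rt (nnE (Qsp R L s) (%p. (dif (dif F z1) y (first p))^2 * (dif (dif F z2) y (first p))^2)))"
   unfolding cross2_def
   by (rule square_of_integral_le[OF sL sK, of "%(z, y, p). dif F z (second p)" "%(z, y, p). dif (dif F z) y (first p)", unfolded prod.case]) measurable
  also have "... = J"
   unfolding J_def by (intro nn_integral_cong) (simp only: nnE_marginal2 d1 d2 dif_commute[OF F])
  finally show ?thesis .
 qed
 have c3: "(NINT p|Qsp R L s. NINT y|L. (cross3 y p)^2) <= J2"
 proof -
  have "(NINT p|Qsp R L s. NINT y|L. (cross3 y p)^2) <= (NINT z1|L. NINT z2|L. NINT y|L. rt (nnE (Qsp R L s) (%p. (dif (dif F z1) y (first p))^2 * (dif (dif F z2) y (first p))^2)) *
    rt (nnE (Qsp R L s) (%p. (dif (dif F z1) y (second p))^2 * (dif (dif F z2) y (second p))^2)))"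
   unfolding cross3_def
   by (rule square_of_integral_le[OF sL sK, of "%(z, y, p). dif (dif F z) y (first p)" "%(z, y, p). dif (dif F z) y (second p)", unfolded prod.case]) measurable
  also have "... = J2"
   unfolding J2_def by (intro nn_integral_cong) (simp only: nnE_marginal2 d1 d2 dif_commute[OF F] epowr_half_mult_self)
  finally show ?thesis .
 qed
 let ?M = "Qsp R L s >< L"
 have fst: "(NINT x|?M. (f (snd x) (fst x))^2) = (NINT p|Qsp R L s. NINT y|L. (f y p)^2)"
  if [measurable]: "(%x. f (snd x) (fst x)) : bmeas ?M" for f :: "'x => 'r \<times> ('x \<times> mark) list => ennreal"
  by (subst L.nn_integral_fst[symmetric]) simp_all
 have "rt (energy R (marked L s marks) carre)
   <= rt (NINT x|?M. (cross1 (snd x) (fst x) + cross2 (snd x) (fst x) + cross3 (snd x) (fst x))^2)"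
  by (subst fst, measurable) (intro epowr_mono energy_carre_le, simp)
 also have "... <= rt (NINT x|?M. (cross1 (snd x) (fst x) + cross2 (snd x) (fst x))^2)
   + rt (NINT x|?M. (cross3 (snd x) (fst x))^2)"
  by (rule nn_integral_Minkowski) measurable
 also have "... <= rt (NINT x|?M. (cross1 (snd x) (fst x))^2) + rt (NINT x|?M. (cross2 (snd x) (fst x))^2)
   + rt (NINT x|?M. (cross3 (snd x) (fst x))^2)"
  by (intro add_right_mono nn_integral_Minkowski) measurable
 also have "... <= rt J + rt J + rt J2"
  by (subst (1 2 3) fst, measurable) (intro add_mono epowr_mono c1 c2 c3, simp_all)
 also have "rt J + rt J = list_gamma1 R L F"
  unfolding list_gamma1_def J_def[symmetric] epowr_half_4 by (simp only: mult_2)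
 also have "rt J2 = list_gamma2 R L F" unfolding list_gamma2_def J2_def ..
 finally show ?thesis .
qed

end

declare F_meas [measurable del] dif_carre_measurable [measurable del] cross_measurable [measurable del]

section \<open>The remainder terms\<close>

definition damped_dif where
 "damped_dif u F z p = u (dif F z p) * dif F z p"

lemma damped_dif_measurable [measurable]:
 assumes [measurable]: "u : bmeas borel" "F : bmeas (R >< seqs L)"
  and [measurable]: "f : N ->M L" "h : N ->M R >< seqs L"
 shows "(%w. damped_dif u F (f w) (h w)) : bmeas N"
 unfolding damped_dif_def by measurable

lemma dif_damped_measurable [measurable]:
 assumes [measurable]: "u : bmeas borel" "F : bmeas (R >< seqs L)"
  and [measurable]: "f : N ->M L" "g : N ->M L" "h : N ->M R >< seqs L"
 shows "(%w. dif (damped_dif u F (f w)) (g w) (h w)) : bmeas N"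
 unfolding dif_def[of "damped_dif u F _"] by measurable

lemma damped_dif_functional:
 assumes u: "u : bmeas borel" and F: "functional R L F" and z: "z : space L"
 shows "functional R L (damped_dif u F z)"
proof -
 note [measurable] = u
 have "functional R L (%p. u (dif F z p) * dif F z p)"
  by (rule functional_comp[OF dif_functional[OF F z], of "%d. u d * d"]) measurable
 then show ?thesis by (simp only: damped_dif_def [abs_def])
qed

text \<open>\<open>F\<close> and the indicator of \<open>{x <..}\<close> at \<open>F\<close> move in the same direction.\<close>

lemma damped_jump_nonneg:
 assumes "\<And>d. 0 <= u d" shows "0 <= damped_dif u F z q * dif (%q. of_bool (x < F q)) z q"
proof -
 have "0 <= w * (b - a) * (of_bool (x < b) - of_bool (x < a))" if "0 <= w" for w a b :: real
  using that by (cases "a <= b") (auto simp: of_bool_def mult_nonneg_nonpos)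
 then show ?thesis unfolding damped_dif_def dif_def by this (rule assms)
qed

lemma nnE_product_square:
 assumes [measurable]: "f : bmeas N" "g : bmeas N"
 shows "nnE N (%p. (f p * g p)^2) <= rt (nnE N (%p. (f p)^4)) * rt (nnE N (%p. (g p)^4))"
 using nnE_Cauchy_Schwarz[of "%p. (f p)^2" N "%p. (g p)^2"]
 by (simp add: nn_expect_def power_mult_distrib power_mult[symmetric])

lemma nnE_mono: "(\<And>p. f p <= g p) ==> nnE N f <= nnE N g"
 unfolding nn_expect_def by (intro nn_integral_mono ennreal_leI)

definition list_gamma3 where
 "list_gamma3 R L F u = 2 * (NINT z|L. rt (nnE (Psp R L) (%p. (dif F z p)^2 * (1 - u (dif F z p))^2)) *
   rt (nnE (Psp R L) (%p. \<bar>dif F z p\<bar>^2)))"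

definition list_gamma4 where
 "list_gamma4 R L F u =
   (ennreal (1/2) * epowr (nnE (Psp R L) (%p. (F p)^4)) (1/4) + ennreal (sqrt (2 * pi) / 8)) *
   (NINT z|L. rt (nnE (Psp R L) (%p. (dif F z p)^4 * (u (dif F z p))^2)) *
    epowr (nnE (Psp R L) (%p. \<bar>dif F z p\<bar>^4)) (1/4))"

definition list_gamma5 where
 "list_gamma5 R L F u = rt (NINT z|L. rt (nnE (Psp R L) (%p. (u (dif F z p))^2 * (dif F z p)^4)) *
   rt (nnE (Psp R L) (%p. (dif F z p)^4)))"

definition list_gamma6 where
 "list_gamma6 R L F u = rt (3 * (NINT z1|L. NINT z2|L. rt (nnE (Psp R L) (%p. (dif (damped_dif u F z1) z2 p)^4)) *
   rt (nnE (Psp R L) (%p. \<bar>dif F z1 p\<bar>^4))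
  + rt (nnE (Psp R L) (%p. (u (dif F z1 p))^2 * (dif F z1 p)^4)) *
   rt (nnE (Psp R L) (%p. \<bar>dif (dif F z1) z2 p\<bar>^4))
  + rt (nnE (Psp R L) (%p. (dif (damped_dif u F z1) z2 p)^4)) *
   rt (nnE (Psp R L) (%p. \<bar>dif (dif F z1) z2 p\<bar>^4))))"

context
 fixes R :: "'r measure" and L :: "'x measure" and F :: "'r * 'x list => real" and u :: "real => real" and s x :: real
 assumes R: "prob_space R" and L: "finite_measure L" and F: "functional R L F" and s: "0 <= s" "s <= 1"
  and eF: "energy R L F < \<infinity>" and u_meas [measurable]: "u : bmeas borel" and u: "\<And>d. 0 <= u d \<and> u d <= 1"
begin

interpretation L: finite_measure L by (rule L)
interpretation LL: pair_sigma_finite L L by unfold_locales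
interpretation R: prob_space R by (rule R)
interpretation K: prob_space "Qsp R L s" by (rule prob_space_Qsp[OF R L])
interpretation KL: pair_sigma_finite "Qsp R L s" L by unfold_locales
interpretation A: finite_measure "marked L s marks" by (rule finite_all_marked[OF R L F s eF])
interpretation KA: pair_sigma_finite "Qsp R L s" "marked L s marks" by unfold_locales

lemmas F_measurable [measurable] = functional_meas[OF F]

lemma mixed_le:
 fixes T1 T2 :: "'i * 'r * 'x list => real"
 assumes I: "sigma_finite_measure I"
  and T_meas [measurable]: "T1 : bmeas (I >< R >< seqs L)" "T2 : bmeas (I >< R >< seqs L)"
  and T1: "\<And>i. i : space I ==> functional R L (%p. T1 (i, p))" and T2: "\<And>i. i : space I ==> functional R L (%p. T2 (i, p))"
 shows "(NINT p|Qsp R L s. NINT i|I. eabs (T1 (i, first p) * T2 (i, second p))) \<le>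
  (NINT i|I. rt (nnE (Psp R L) (%p. (T1 (i, p))^2)) * rt (nnE (Psp R L) (%p. (T2 (i, p))^2)))"
proof -
 interpret I: sigma_finite_measure I by fact
 interpret KI: pair_sigma_finite I "Qsp R L s" by unfold_locales
 have "(NINT p|Qsp R L s. NINT i|I. eabs (T1 (i, first p) * T2 (i, second p)))
   = (NINT i|I. NINT p|Qsp R L s. eabs (T1 (i, first p) * T2 (i, second p)))"
  by (rule KI.Fubini') measurable
 also have "... <= (NINT i|I. rt (nnE (Psp R L) (%p. (T1 (i, p))^2)) * rt (nnE (Psp R L) (%p. (T2 (i, p))^2)))"
 proof (rule nn_integral_mono)
  fix i assume i[measurable]: "i : space I"
  have "(NINT p|Qsp R L s. eabs (T1 (i, first p) * T2 (i, second p))) \<le>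
   rt (nnE (Qsp R L s) (%p. (T1 (i, first p))^2)) * rt (nnE (Qsp R L s) (%p. (T2 (i, second p))^2))"
   by (rule nnE_Cauchy_Schwarz) measurable
  then show "(NINT p|Qsp R L s. eabs (T1 (i, first p) * T2 (i, second p))) \<le>
   rt (nnE (Psp R L) (%p. (T1 (i, p))^2)) * rt (nnE (Psp R L) (%p. (T2 (i, p))^2))"
   by (simp only: nnE_first_second[OF L s functional_comp[OF T1[OF i], of "%d. d^2"]]
    nnE_first_second[OF L s functional_comp[OF T2[OF i], of "%d. d^2"]] borel_measurable_power measurable_ident_sets[OF refl] borel_measurable_const)
 qed
 finally show ?thesis .
qed

lemma remainder3: "2 * (NINT p|Qsp R L s. NINT z|L. eabs ((dif F z (first p) * (1 - u (dif F z (first p)))) * dif F z (second p))) <= list_gamma3 R L F u"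
proof -
 have "(NINT p|Qsp R L s. NINT z|L. eabs ((dif F z (first p) * (1 - u (dif F z (first p)))) * dif F z (second p)))
  <= (NINT z|L. rt (nnE (Psp R L) (%p. (dif F z p * (1 - u (dif F z p)))^2)) * rt (nnE (Psp R L) (%p. (dif F z p)^2)))"
  by (rule mixed_le[where ?T1.0 = "%(z, p). dif F z p * (1 - u (dif F z p))" and ?T2.0 = "%(z, p). dif F z p", unfolded prod.case])
   (unfold_locales, measurable, rule functional_comp[OF dif_functional[OF F], of _ "%d. d * (1 - u d)"], assumption, measurable, rule dif_functional[OF F])
 then show ?thesis
  unfolding list_gamma3_def by (intro mult_left_mono) (simp_all add: power_mult_distrib)
qed

text \<open>Cauchy-Schwarz once for the terms at the first member, and once more to separate \<open>F\<close> from the difference at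
 the second member; the fourth moment of that difference controls its second moment. The two constants come
 from \<open>\<bar>F\<bar>\<close> and from \<open>stein_bound\<close>.\<close>

lemma remainder4:
 "(NINT p|Qsp R L s. NINT z|L. ennreal ((\<bar>F (first p)\<bar> + stein_bound) / 2 * (u (dif F z (first p)) * (dif F z (first p))^2) * \<bar>dif F z (second p)\<bar>))
  <= list_gamma4 R L F u"
proof -
 let ?N = "Psp R L" and ?K = "Qsp R L s"
 let ?w = "%z p. (u (dif F z (first p)) * (dif F z (first p))^2)"
 let ?T = "%z p. ((\<bar>F (first p)\<bar> + stein_bound) / 2 * ?w z p * \<bar>dif F z (second p)\<bar>)"
 let ?A = "%z p. eabs (?w z p * (F (first p) * dif F z (second p)))"
 let ?B = "%z p. eabs (?w z p * dif F z (second p))"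
 define a where "a z = rt (nnE ?N (%p. (dif F z p)^4 * (u (dif F z p))^2))" for z
 define b where "b z = epowr (nnE ?N (%p. (dif F z p)^4)) (1/4)" for z
 define c where "c = epowr (nnE ?N (%p. (F p)^4)) (1/4)"
 let ?c = "(ennreal (1/2) * c + ennreal (sqrt (2 * pi) / 8))"
 interpret N: prob_space ?N by (rule prob_space_Psp[OF R L])
 have ab[measurable]: "a : bmeas L" "b : bmeas L"
  unfolding a_def [abs_def] b_def [abs_def] nn_expect_def by measurable
 have "(NINT p|?K. NINT z|L. ennreal (?T z p))
  = (NINT z|L. NINT p|?K. ennreal (?T z p))"
  by (rule KL.Fubini'[symmetric]) measurable
 also have "... <= (NINT z|L. ?c * (a z * b z))"
 proof (rule nn_integral_mono)
  fix z assume z[measurable]: "z : space L"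
  note D = dif_functional[OF F z]
  have X: "nnE ?K (%p. ?w z p^2) = nnE ?N (%p. (dif F z p)^4 * (u (dif F z p))^2)"
  proof -
   have "functional R L (%p. (u (dif F z p) * (dif F z p)^2)^2)" by (rule functional_comp[OF D, of "%d. (u d * d^2)^2"]) measurable
   from nnE_first_second(1)[OF L s this] show ?thesis by (simp add: power_mult_distrib power_mult[symmetric] mult.commute)
  qed
  have Y4: "nnE ?K (%p. (dif F z (second p))^4) = nnE ?N (%p. (dif F z p)^4)"
   by (rule nnE_first_second(2)[OF L s]) (rule functional_comp[OF D], measurable)
  have F4: "nnE ?K (%p. (F (first p))^4) = nnE ?N (%p. (F p)^4)"
   by (rule nnE_first_second(1)[OF L s]) (rule functional_comp[OF F], measurable)
  have 1: "(NINT p|?K. ?A z p) <= a z * (c * b z)"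
  proof -
   have "(NINT p|?K. ?A z p)
    <= a z * rt (nnE ?K (%p. (F (first p) * dif F z (second p))^2))"
    unfolding a_def X[symmetric] by (rule nnE_Cauchy_Schwarz) measurable
   also have "... <= a z * rt (rt (nnE ?K (%p. (F (first p))^4)) * rt (nnE ?K (%p. (dif F z (second p))^4)))"
    by (intro mult_left_mono epowr_mono nnE_product_square) simp_all
   also have "... = a z * (c * b z)"
    by (simp add: Y4 F4 epowr_mult c_def b_def epowr_quarter)
   finally show ?thesis .
  qed
  have 2: "(NINT p|?K. ?B z p) <= a z * b z"
  proof -
   have "(NINT p|?K. ?B z p)
    <= a z * rt (nnE ?K (%p. (dif F z (second p))^2))"
    unfolding a_def X[symmetric] by (rule nnE_Cauchy_Schwarz) measurable
   also have "nnE ?K (%p. (dif F z (second p))^2) <= rt (nnE ?K (%p. (dif F z (second p))^4))"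
    using K.nn_integral_le_sqrt[of "%p. ennreal ((dif F z (second p))^2)"]
    by (simp add: nn_expect_def ennreal_power power_mult[symmetric])
   finally show ?thesis by (simp add: Y4 b_def epowr_quarter mult_left_mono epowr_mono)
  qed
  have "(NINT p|?K. ennreal (?T z p))
   = (NINT p|?K. ennreal (1/2) * ?A z p
     + ennreal (sqrt (2 * pi) / 8) * ?B z p)"
  proof (rule nn_integral_cong)
   fix p
   have split: "ennreal ((\<bar>f\<bar> + stein_bound) / 2 * w * \<bar>y\<bar>) = ennreal (1/2) * eabs (w * (f * y)) + ennreal (sqrt (2 * pi) / 8) * eabs (w * y)"
    if "0 <= w" for f w y :: real
   proof -
    have eq: "(\<bar>f\<bar> + stein_bound) / 2 * w * \<bar>y\<bar> = 1/2 * \<bar>w * (f * y)\<bar> + sqrt (2 * pi) / 8 * \<bar>w * y\<bar>"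
     using that by (simp add: abs_mult stein_bound_def field_simps)
    have "ennreal (\<alpha> * A + \<beta> * B) = ennreal \<alpha> * ennreal A + ennreal \<beta> * ennreal B"
     if "0 <= \<alpha>" "0 <= \<beta>" "0 <= A" "0 <= B" for \<alpha> \<beta> A B using that by (simp add: ennreal_plus ennreal_mult)
    then show ?thesis unfolding eq by this simp_all
   qed
   show "ennreal (?T z p)
    = ennreal (1/2) * ?A z p
     + ennreal (sqrt (2 * pi) / 8) * ?B z p"
    by (rule split) (simp add: u)
  qed
  also have "... = ennreal (1/2) * (NINT p|?K. ?A z p)
    + ennreal (sqrt (2 * pi) / 8) * (NINT p|?K. ?B z p)"
   by (simp add: nn_integral_add nn_integral_cmult)
  also have "... <= ennreal (1/2) * (a z * (c * b z)) + ennreal (sqrt (2 * pi) / 8) * (a z * b z)"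
   by (intro add_mono mult_left_mono 1 2) simp_all
  also have "... = ?c * (a z * b z)"
  proof -
   have "\<alpha> * (a z * (c * b z)) + \<beta> * (a z * b z) = (\<alpha> * c + \<beta>) * (a z * b z)" for \<alpha> \<beta> by (simp add: algebra_simps)
   then show ?thesis .
  qed
  finally show "(NINT p|?K. ennreal (?T z p))
   <= ?c * (a z * b z)" .
 qed
 also have "... = list_gamma4 R L F u"
 proof -
  have "(NINT z|L. ?c * (a z * b z)) = ?c * (NINT z|L. a z * b z)"
   by (rule nn_integral_cmult) measurable
  then show ?thesis by (simp add: list_gamma4_def a_def b_def c_def)
 qed
 finally show ?thesis .
qed

lemma nn_integral_marks_first:
 assumes f: "f : bmeas (L >< count_space marks)"
  and f0: "\<And>z. f (z, Second) = 0" and f1: "\<And>z. f (z, Both) = h z" "\<And>z. f (z, First) = h z"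
 shows "(NINT \<zeta>|marked L s marks. f \<zeta>) = (NINT z|L. h z)"
proof -
 have "ennreal s + ennreal (1 - s) = 1" using s by (simp add: ennreal_plus[symmetric] del: ennreal_plus)
 then show ?thesis
  unfolding nn_integral_all_marks[OF R L F s eF f] f0 f1 by (simp add: distrib_right[symmetric])
qed

text \<open>The kernel of the Skorohod estimate on the marked space. It is carried by the marks of the first member,
 because only the gradient at the first member occurs; these marks have total weight \<open>1\<close>.\<close>

definition tail_kernel where
 "tail_kernel q = (if snd (fst q) = Second then 0 else \<bar>dif F (fst (fst q)) (second (snd q))\<bar> * damped_dif u F (fst (fst q)) (first (snd q)))"

lemma tail_kernel_measurable:
 "tail_kernel : bmeas (marked L s marks >< R >< seqs (marked L s marks))"
 unfolding tail_kernel_def [abs_def] by measurable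

lemma tail_kernel_inv: "perm_inv (%xs. tail_kernel (\<zeta>, r, xs))"
proof (rule perm_invI)
 fix xs ys :: "('x \<times> mark) list" assume "mset xs = mset ys"
 note m = mset_proj_cong[OF this]
 show "tail_kernel (\<zeta>, r, xs) = tail_kernel (\<zeta>, r, ys)"
  unfolding tail_kernel_def damped_dif_def fst_conv snd_conv first_Pair second_Pair dif_invariant[OF F m(1)] dif_invariant[OF F m(2)] ..
qed

lemma integrable_tail_kernel: "integrable (Qsp R L s >< marked L s marks) (%(p, \<zeta>). tail_kernel (\<zeta>, p))"
proof (rule integrableI_bounded)
 note [measurable] = tail_kernel_measurable
 show m: "(%(p, \<zeta>). tail_kernel (\<zeta>, p)) : bmeas (Qsp R L s >< marked L s marks)" by measurable
 have "(NINT x|(Qsp R L s >< marked L s marks). ennreal (norm (case x of (p, \<zeta>) => tail_kernel (\<zeta>, p))))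
  = (NINT p|Qsp R L s. NINT \<zeta>|marked L s marks. eabs (tail_kernel (\<zeta>, p)))"
  by (subst A.nn_integral_fst[symmetric]) (simp_all add: split_beta)
 also have "... = (NINT p|Qsp R L s. NINT z|L. eabs (dif F z (second p) * damped_dif u F z (first p)))"
 proof (rule nn_integral_cong)
  fix p assume "p : space (Qsp R L s)"
  then have [measurable]: "p : space (R >< seqs (marked L s marks))" by (simp add: Qsp_def space_Psp space_pair_measure)
  show "(NINT \<zeta>|marked L s marks. eabs (tail_kernel (\<zeta>, p))) = (NINT z|L. eabs (dif F z (second p) * damped_dif u F z (first p)))"
   by (rule nn_integral_marks_first) (measurable, simp_all add: tail_kernel_def abs_mult)
 qed
 also have "... <= (NINT p|Qsp R L s. NINT z|L. eabs (dif F z (second p) * dif F z (first p)))"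
  using u by (intro nn_integral_mono ennreal_leI) (simp add: damped_dif_def abs_mult mult_left_mono mult_left_le_one_le)
 also have "... <= rt (energy R L F) * rt (energy R L F)"
  by (rule gamma_integrand_le[OF R L s F F])
 also have "... < \<infinity>" using eF by (simp add: epowr_half_mult_self)
 finally show "(NINT x|(Qsp R L s >< marked L s marks). ennreal (norm (case x of (p, \<zeta>) => tail_kernel (\<zeta>, p)))) < \<infinity>" .
qed

lemma dif_tail_kernel_first: "k \<noteq> Second ==> dif (%q. tail_kernel ((z, k), q)) (y, j) (r, zs) =
  \<bar>dif F z (second (r, zs)) + (if j \<noteq> First then dif (dif F z) y (second (r, zs)) else 0)\<bar> *
   (damped_dif u F z (first (r, zs)) + (if j \<noteq> Second then dif (damped_dif u F z) y (first (r, zs)) else 0))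
  - \<bar>dif F z (second (r, zs))\<bar> * damped_dif u F z (first (r, zs))"
proof -
 have "damped_dif u F z (first (r, (y, j) # zs)) = damped_dif u F z (first (r, zs)) + (if j \<noteq> Second then dif (damped_dif u F z) y (first (r, zs)) else 0)"
  by (simp add: first_Pair proj_Cons dif_def[of "damped_dif u F z"])
 then show "k \<noteq> Second ==> ?thesis"
  unfolding dif_def[of "%q. tail_kernel ((z, k), q)"] fst_conv snd_conv by (simp add: tail_kernel_def dif_second_Cons[OF R L F s eF])
qed

lemma mark_average_squares_le:
 fixes a b c :: ennreal
 shows "ennreal s * (3 * (a + b + c)) + ennreal (1 - s) * a + ennreal (1 - s) * b <= 3 * (a + b + c)"
proof -
 have "a + b <= 3 * (a + b + c)"
 proof -
  have "a + b <= 1 * (a + b + c)" by simp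
  also have "... <= 3 * (a + b + c)" by (rule mult_right_mono) simp_all
  finally show ?thesis .
 qed
 then have "ennreal (1 - s) * (a + b) <= ennreal (1 - s) * (3 * (a + b + c))" by (rule mult_left_mono) simp
 then have "ennreal s * (3 * (a + b + c)) + ennreal (1 - s) * (a + b) <= (ennreal s + ennreal (1 - s)) * (3 * (a + b + c))"
  unfolding distrib_right by (rule add_left_mono)
 also have "ennreal s + ennreal (1 - s) = 1" using s by (simp add: ennreal_plus[symmetric] del: ennreal_plus)
 finally show ?thesis by (simp add: distrib_left add.assoc)
qed

lemma square_increment_le:
 fixes a b c d :: real
 shows "(\<bar>a + b\<bar> * (c + d) - \<bar>a\<bar> * c)^2 <= 3 * ((a * d)^2 + (b * c)^2 + (b * d)^2)"
proof -
 let ?d = "(\<bar>a + b\<bar> - \<bar>a\<bar>)"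
 have "\<bar>a + b\<bar> * (c + d) - \<bar>a\<bar> * c = \<bar>a\<bar> * d + ?d * c + ?d * d"
  by (simp add: algebra_simps)
 then have "(\<bar>a + b\<bar> * (c + d) - \<bar>a\<bar> * c)^2 = (\<bar>a\<bar> * d + ?d * c + ?d * d)^2" by simp
 also have "... <= 3 * ((\<bar>a\<bar> * d)^2 + (?d * c)^2 + (?d * d)^2)"
 proof -
  have "(p + q + r)^2 <= 3 * (p^2 + q^2 + r^2)" for p q r :: real
  proof -
   have "3 * (p^2 + q^2 + r^2) - (p + q + r)^2 = (p - q)^2 + (q - r)^2 + (p - r)^2" by (simp add: power2_eq_square algebra_simps)
   moreover have "0 <= (p - q)^2 + (q - r)^2 + (p - r)^2" by simp
   ultimately show ?thesis by linarith
  qed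
  then show ?thesis .
 qed
 also have "... <= 3 * ((a * d)^2 + (b * c)^2 + (b * d)^2)"
 proof -
  have "?d^2 <= b^2"
   using power_mono[of "\<bar>\<bar>a + b\<bar> - \<bar>a\<bar>\<bar>" "\<bar>b\<bar>" 2] by simp
  then show ?thesis unfolding power_mult_distrib by (intro mult_left_mono add_mono mult_right_mono) simp_all
 qed
 finally show ?thesis .
qed

text \<open>The three squares in the increment of the kernel are the three terms of the last quantity in the bound. Its factor
 \<open>3\<close> comes from points with mark \<open>Both\<close>, which increment both factors of the kernel.\<close>

lemma dif_tail_kernel_le:
 assumes p[measurable]: "p : space (R >< seqs (marked L s marks))" and z[measurable]: "z : space L" and k: "k \<noteq> Second"
 shows "(NINT \<eta>|marked L s marks. ennreal ((dif (%q. tail_kernel ((z, k), q)) \<eta> p)^2)) \<le>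
  (NINT y|L. 3 * (ennreal ((dif F z (second p) * dif (damped_dif u F z) y (first p))^2)
   + ennreal ((dif (dif F z) y (second p) * damped_dif u F z (first p))^2)
   + ennreal ((dif (dif F z) y (second p) * dif (damped_dif u F z) y (first p))^2)))"
proof -
 let ?S = "%y. (ennreal ((dif F z (second p) * dif (damped_dif u F z) y (first p))^2) + ennreal ((dif (dif F z) y (second p) * damped_dif u F z (first p))^2) + ennreal ((dif (dif F z) y (second p) * dif (damped_dif u F z) y (first p))^2))"
 obtain r zs where rz: "p = (r, zs)" by (cases p)
 define h where "h \<eta> = ennreal ((dif (%q. tail_kernel ((z, k), q)) \<eta> p)^2)" for \<eta>
 have "h (y, j) = ennreal ((\<bar>dif F z (second p) + (if j \<noteq> First then dif (dif F z) y (second p) else 0)\<bar> *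
   (damped_dif u F z (first p) + (if j \<noteq> Second then dif (damped_dif u F z) y (first p) else 0))
  - \<bar>dif F z (second p)\<bar> * damped_dif u F z (first p))^2)" for y j
  unfolding h_def rz dif_tail_kernel_first[OF k] ..
 note h = this
 have h': "h = (%\<eta>. ennreal ((\<bar>dif F z (second p) + (if snd \<eta> \<noteq> First then dif (dif F z) (fst \<eta>) (second p) else 0)\<bar> *
   (damped_dif u F z (first p) + (if snd \<eta> \<noteq> Second then dif (damped_dif u F z) (fst \<eta>) (first p) else 0))
  - \<bar>dif F z (second p)\<bar> * damped_dif u F z (first p))^2))"
  using h by (intro ext) (metis prod.collapse)
 have hm: "h : bmeas (L >< count_space marks)" unfolding h' by measurable
 have "(NINT \<eta>|marked L s marks. h \<eta>) = (NINT y|L. ennreal s * h (y, Both) + ennreal (1 - s) * h (y, First) + ennreal (1 - s) * h (y, Second))"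
  by (rule nn_integral_all_marks[OF R L F s eF hm])
 also have "... <= (NINT y|L. 3 * ?S y)"
 proof (rule nn_integral_mono)
  fix y
  define a b c where "a = (dif F z (second p) * dif (damped_dif u F z) y (first p))^2"
   and "b = (dif (dif F z) y (second p) * damped_dif u F z (first p))^2"
   and "c = (dif (dif F z) y (second p) * dif (damped_dif u F z) y (first p))^2"
  have "h (y, Both) <= ennreal (3 * (a + b + c))"
  proof -
   have e: "h (y, Both) = ennreal ((\<bar>dif F z (second p) + dif (dif F z) y (second p)\<bar> *
    (damped_dif u F z (first p) + dif (damped_dif u F z) y (first p)) - \<bar>dif F z (second p)\<bar> * damped_dif u F z (first p))^2)"
    by (simp add: h)
   show ?thesis unfolding e a_def b_def c_def by (intro ennreal_leI square_increment_le)
  qed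
  then have B: "h (y, Both) <= 3 * (ennreal a + ennreal b + ennreal c)"
   by (simp add: ennreal_mult a_def b_def c_def)
  have "h (y, First) = ennreal a"
   unfolding h a_def by (simp add: distrib_left power_mult_distrib)
  moreover have "h (y, Second) <= ennreal b"
  proof -
   have "\<bar>\<bar>dif F z (second p) + dif (dif F z) y (second p)\<bar> - \<bar>dif F z (second p)\<bar>\<bar> <= \<bar>dif (dif F z) y (second p)\<bar>" by linarith
   from power_mono[OF this, of 2]
   have "(\<bar>dif F z (second p) + dif (dif F z) y (second p)\<bar> - \<bar>dif F z (second p)\<bar>)^2 <= (dif (dif F z) y (second p))^2" by simp
   then show ?thesis
    unfolding h b_def by (simp add: left_diff_distrib[symmetric] power_mult_distrib mult_right_mono ennreal_leI)
  qed
  ultimately have "ennreal s * h (y, Both) + ennreal (1 - s) * h (y, First) + ennreal (1 - s) * h (y, Second)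
   <= ennreal s * (3 * (ennreal a + ennreal b + ennreal c)) + ennreal (1 - s) * ennreal a + ennreal (1 - s) * ennreal b"
   using B by (intro add_mono mult_left_mono) simp_all
  also have "... <= 3 * (ennreal a + ennreal b + ennreal c)" by (rule mark_average_squares_le)
  finally show "ennreal s * h (y, Both) + ennreal (1 - s) * h (y, First) + ennreal (1 - s) * h (y, Second)
   <= 3 * ?S y"
   by (simp only: a_def b_def c_def)
 qed
 finally show ?thesis by (simp only: h_def)
qed

lemma mixed_square_le:
 fixes T1 T2 :: "'i * 'r * 'x list => real"
 assumes I: "sigma_finite_measure I"
  and T_meas [measurable]: "T1 : bmeas (I >< R >< seqs L)" "T2 : bmeas (I >< R >< seqs L)"
  and T1: "\<And>i. i : space I ==> functional R L (%p. T1 (i, p))" and T2: "\<And>i. i : space I ==> functional R L (%p. T2 (i, p))"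
 shows "(NINT p|Qsp R L s. NINT i|I. ennreal ((T2 (i, second p) * T1 (i, first p))^2)) \<le>
  (NINT i|I. rt (nnE (Psp R L) (%p. (T1 (i, p))^4)) * rt (nnE (Psp R L) (%p. (T2 (i, p))^4)))"
proof -
 have "(NINT p|Qsp R L s. NINT i|I. eabs ((T1 (i, first p))^2 * (T2 (i, second p))^2)) \<le>
  (NINT i|I. rt (nnE (Psp R L) (%p. ((T1 (i, p))^2)^2)) * rt (nnE (Psp R L) (%p. ((T2 (i, p))^2)^2)))"
  by (rule mixed_le[OF I, where ?T1.0 = "%q. (T1 q)^2" and ?T2.0 = "%q. (T2 q)^2"]; (rule functional_comp[OF T1] functional_comp[OF T2])?) measurable
 then show ?thesis by (simp add: power_mult_distrib power_mult[symmetric] mult.commute)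
qed

lemma damped_fourth_moment_le:
 "nnE N (%p. (damped_dif u F z p)^4) <= nnE N (%p. (u (dif F z p))^2 * (dif F z p)^4)"
proof (rule nnE_mono)
 fix p
 have "(u (dif F z p))^4 <= (u (dif F z p))^2" using u[of "dif F z p"] by (intro power_decreasing) auto
 then show "(damped_dif u F z p)^4 <= (u (dif F z p))^2 * (dif F z p)^4"
  unfolding damped_dif_def power_mult_distrib by (rule mult_right_mono) simp
qed

text \<open>Since the integrand is nonnegative, its integral equals that of \<open>tail_kernel\<close> against the gradient of the
 indicator of \<open>{x <..}\<close> at the first member, to which \<open>skorohod_estimate\<close> applies with the marked process.\<close>

lemma remainder56:
 "(NINT p|Qsp R L s. NINT z|L. ennreal (\<bar>dif F z (second p)\<bar> * damped_dif u F z (first p) * dif (%q. of_bool (x < F q)) z (first p)))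
  <= list_gamma5 R L F u + list_gamma6 R L F u"
proof -
 let ?N = "Psp R L" and ?K = "Qsp R L s" and ?A = "marked L s marks"
 let ?J = "%z p. (\<bar>dif F z (second p)\<bar> * damped_dif u F z (first p) * dif (%q. of_bool (x < F q)) z (first p))"
 let ?V = "(NINT p|?K. NINT \<zeta>|?A. ennreal ((tail_kernel (\<zeta>, p))^2))"
 let ?D = "(NINT p|?K. NINT \<zeta>|?A. NINT \<eta>|?A. ennreal ((dif (%q. tail_kernel (\<zeta>, q)) \<eta> p)^2))"
 have sL: "sigma_finite_measure L" and sLL: "sigma_finite_measure (L >< L)" by unfold_locales
 note fin = finite_all_marked[OF R L F s eF]
 note [measurable] = tail_kernel_measurable
 have Kspace[measurable]: "p : space (R >< seqs ?A)" if "p : space ?K" for p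
  using that by (simp add: Qsp_def space_Psp space_pair_measure)
 define H :: "'r \<times> ('x \<times> mark) list => real" where "H p = of_bool (x < F (first p))" for p
 have Hm[measurable]: "H : bmeas (R >< seqs ?A)" unfolding H_def [abs_def] by measurable
 have H: "functional R ?A H"
 proof (rule functionalI[OF Hm])
  fix r and xs ys :: "('x \<times> mark) list" assume "mset xs = mset ys"
  from functionalD[OF F mset_proj_cong(1)[OF this]] show "H (r, xs) = H (r, ys)"
   unfolding H_def first_Pair by (rule arg_cong)
 qed
 have H1: "\<bar>H p\<bar> <= 1" for p by (simp add: H_def)
 define D where "D \<zeta> p = tail_kernel (\<zeta>, p) * dif H \<zeta> p" for \<zeta> p
 have [measurable]: "(%(p, \<zeta>). D \<zeta> p) : bmeas (?K >< ?A)" unfolding D_def dif_def by measurable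
 have D: "D (z, k) p = (if k = Second then 0 else \<bar>dif F z (second p)\<bar> * damped_dif u F z (first p) * dif (%q. of_bool (x < F q)) z (first p))" for z k p
  by (cases p) (simp add: D_def tail_kernel_def dif_def[of H] dif_def[of "%q. of_bool (x < F q)"] H_def first_Pair proj_Cons)
 have D0: "0 <= D \<zeta> p" for \<zeta> p
 proof -
  have "0 <= damped_dif u F z q * dif (%q. of_bool (x < F q)) z q" for z q
   by (rule damped_jump_nonneg) (simp add: u)
  then have "0 <= \<bar>dif F z (second p)\<bar> * (damped_dif u F z q * dif (%q. of_bool (x < F q)) z q)" for z q by simp
  then show ?thesis by (cases \<zeta>) (simp add: D mult.assoc)
 qed
 have "(NINT p|?K. NINT z|L. ennreal (?J z p))
  = (NINT p|?K. NINT \<zeta>|?A. ennreal (D \<zeta> p))"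
 proof (rule nn_integral_cong)
  fix p assume [measurable]: "p : space ?K"
  show "(NINT z|L. ennreal (?J z p)) = (NINT \<zeta>|?A. ennreal (D \<zeta> p))"
  proof (rule nn_integral_marks_first[symmetric])
   have "(%\<zeta>. ennreal (D \<zeta> p)) : bmeas ?A" by measurable
   then show "(%\<zeta>. ennreal (D \<zeta> p)) : bmeas (L >< count_space marks)" by (simp cong: measurable_cong_sets)
  qed (simp_all add: D)
 qed
 also have "... = (NINT x|(?K >< ?A). ennreal (case x of (p, \<zeta>) => D \<zeta> p))"
  by (subst A.nn_integral_fst[symmetric]) simp_all
 also have "... = ennreal (LINT (p, \<zeta>)|(?K >< ?A). D \<zeta> p)"
 proof (rule nn_integral_eq_integral)
  show "integrable (?K >< ?A) (%(p, \<zeta>). D \<zeta> p)"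
  proof (rule Bbound[OF integrable_tail_kernel])
   have "\<bar>dif H \<zeta> p\<bar> <= 1" for \<zeta> p by (simp add: dif_def H_def of_bool_def)
   then have "\<bar>D \<zeta> p\<bar> <= \<bar>tail_kernel (\<zeta>, p)\<bar>" for \<zeta> p by (simp add: D_def abs_mult mult_left_le)
   then show "AE x in ?K >< ?A. norm (case x of (p, \<zeta>) => D \<zeta> p) <= norm (case x of (p, \<zeta>) => tail_kernel (\<zeta>, p))"
    by (intro AE_I2) (simp add: split_def)
  qed measurable
  show "AE x in ?K >< ?A. 0 <= (case x of (p, \<zeta>) => D \<zeta> p)" by (intro AE_I2) (simp add: split_def D0)
 qed
 also have "... <= eabs ((LINT (p, \<zeta>)|(?K >< ?A). D \<zeta> p))" by (intro ennreal_leI abs_ge_self)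
 also have "... <= rt (?V
   + ?D)"
  unfolding D_def Qsp_def
  by (rule skorohod_estimate[OF R fin H H1 tail_kernel_measurable tail_kernel_inv integrable_tail_kernel[unfolded Qsp_def]])
 also have "... <= rt ?V
   + rt ?D"
  by (rule epowr_half_add_le)
 also have "... <= list_gamma5 R L F u + list_gamma6 R L F u"
 proof (rule add_mono)
  show "rt ?V <= list_gamma5 R L F u"
   unfolding list_gamma5_def
  proof (rule epowr_mono)
   have "?V = (NINT p|?K. NINT z|L. ennreal ((dif F z (second p) * damped_dif u F z (first p))^2))"
   proof (rule nn_integral_cong)
    fix p assume [measurable]: "p : space ?K"
    show "(NINT \<zeta>|?A. ennreal ((tail_kernel (\<zeta>, p))^2)) = (NINT z|L. ennreal ((dif F z (second p) * damped_dif u F z (first p))^2))"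
     by (rule nn_integral_marks_first) (measurable, simp_all add: tail_kernel_def power_mult_distrib)
   qed
   also have "... <= (NINT z|L. rt (nnE ?N (%p. (damped_dif u F z p)^4)) * rt (nnE ?N (%p. (dif F z p)^4)))"
    by (rule mixed_square_le[OF sL, where ?T1.0 = "%(z, p). damped_dif u F z p" and ?T2.0 = "%(z, p). dif F z p", unfolded prod.case])
     (measurable, rule damped_dif_functional[OF u_meas F], assumption, rule dif_functional[OF F])
   also have "... <= (NINT z|L. rt (nnE ?N (%p. (u (dif F z p))^2 * (dif F z p)^4)) * rt (nnE ?N (%p. (dif F z p)^4)))"
    by (intro nn_integral_mono mult_right_mono epowr_mono damped_fourth_moment_le) simp_all
   finally show "?V <= ..." .
  qed simp
  show "rt ?D <= list_gamma6 R L F u"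
   unfolding list_gamma6_def
  proof (rule epowr_mono)
   define a1 where "a1 i = rt (nnE ?N (%p. (dif (damped_dif u F (fst i)) (snd i) p)^4))" for i
   define a2 where "a2 i = rt (nnE ?N (%p. (u (dif F (fst i) p))^2 * (dif F (fst i) p)^4))" for i :: "'x * 'x"
   define b1 where "b1 i = rt (nnE ?N (%p. (dif F (fst i) p)^4))" for i :: "'x * 'x"
   define b2 where "b2 i = rt (nnE ?N (%p. (dif (dif F (fst i)) (snd i) p)^4))" for i
   interpret N: prob_space ?N by (rule prob_space_Psp[OF R L])
   have [measurable]: "a1 : bmeas (L >< L)" "a2 : bmeas (L >< L)" "b1 : bmeas (L >< L)" "b2 : bmeas (L >< L)"
    unfolding a1_def [abs_def] a2_def [abs_def] b1_def [abs_def] b2_def [abs_def] nn_expect_def by measurable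
   define T1 where "T1 p i = ennreal ((dif F (fst i) (second p) * dif (damped_dif u F (fst i)) (snd i) (first p))^2)" for p :: "'r \<times> ('x \<times> mark) list" and i
   define T2 where "T2 p i = ennreal ((dif (dif F (fst i)) (snd i) (second p) * damped_dif u F (fst i) (first p))^2)" for p :: "'r \<times> ('x \<times> mark) list" and i
   define T3 where "T3 p i = ennreal ((dif (dif F (fst i)) (snd i) (second p) * dif (damped_dif u F (fst i)) (snd i) (first p))^2)" for p :: "'r \<times> ('x \<times> mark) list" and i
   have [measurable]: "(%w. T1 (f w) (g w)) : bmeas M" "(%w. T2 (f w) (g w)) : bmeas M" "(%w. T3 (f w) (g w)) : bmeas M"
    if [measurable]: "f : M ->M R >< seqs ?A" "g : M ->M L >< L" for f g and M :: "'n measure"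
    unfolding T1_def T2_def T3_def by measurable
   have t1: "(NINT p|?K. NINT i|(L >< L). T1 p i) <= (NINT i|(L >< L). a1 i * b1 i)"
    unfolding T1_def a1_def b1_def
    by (rule mixed_square_le[OF sLL, where ?T1.0 = "%(i, p). dif (damped_dif u F (fst i)) (snd i) p" and ?T2.0 = "%(i, p). dif F (fst i) p", unfolded prod.case])
     (measurable, auto simp: space_pair_measure intro!: dif_functional damped_dif_functional u_meas F)
   have t2: "(NINT p|?K. NINT i|(L >< L). T2 p i) <= (NINT i|(L >< L). a2 i * b2 i)"
   proof -
    have "(NINT p|?K. NINT i|(L >< L). T2 p i) <= (NINT i|(L >< L). rt (nnE ?N (%p. (damped_dif u F (fst i) p)^4)) * b2 i)"
     unfolding T2_def b2_def
     by (rule mixed_square_le[OF sLL, where ?T1.0 = "%(i, p). damped_dif u F (fst i) p" and ?T2.0 = "%(i, p). dif (dif F (fst i)) (snd i) p", unfolded prod.case])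
     (measurable, auto simp: space_pair_measure intro!: dif_functional damped_dif_functional u_meas F)
    also have "... <= (NINT i|(L >< L). a2 i * b2 i)"
     unfolding a2_def by (intro nn_integral_mono mult_right_mono epowr_mono damped_fourth_moment_le) simp_all
    finally show ?thesis .
   qed
   have t3: "(NINT p|?K. NINT i|(L >< L). T3 p i) <= (NINT i|(L >< L). a1 i * b2 i)"
    unfolding T3_def a1_def b2_def
    by (rule mixed_square_le[OF sLL, where ?T1.0 = "%(i, p). dif (damped_dif u F (fst i)) (snd i) p" and ?T2.0 = "%(i, p). dif (dif F (fst i)) (snd i) p", unfolded prod.case])
     (measurable, auto simp: space_pair_measure intro!: dif_functional damped_dif_functional u_meas F)
   have "?D
    <= (NINT p|?K. NINT i|(L >< L). 3 * (T1 p i + T2 p i + T3 p i))"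
   proof (rule nn_integral_mono)
    fix p assume [measurable]: "p : space ?K"
    define h where "h z = (NINT y|L. 3 * (T1 p (z, y) + T2 p (z, y) + T3 p (z, y)))" for z
    have [measurable]: "h : bmeas L" unfolding h_def [abs_def] by measurable
    have "(NINT \<zeta>|?A. NINT \<eta>|?A. ennreal ((dif (%q. tail_kernel (\<zeta>, q)) \<eta> p)^2)) <= (NINT \<zeta>|?A. (if snd \<zeta> = Second then 0 else h (fst \<zeta>)))"
    proof (rule nn_integral_mono)
     fix \<zeta> assume "\<zeta> : space ?A"
     then obtain z k where \<zeta>: "\<zeta> = (z, k)" "z : space L" by (auto simp: space_marked)
     show "(NINT \<eta>|?A. ennreal ((dif (%q. tail_kernel (\<zeta>, q)) \<eta> p)^2)) <= (if snd \<zeta> = Second then 0 else h (fst \<zeta>))"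
     proof (cases "k = Second")
      case True
      then show ?thesis by (simp add: \<zeta> tail_kernel_def dif_def)
     next
      case False
      from dif_tail_kernel_le[OF Kspace \<zeta>(2) this, of p] \<open>p : space ?K\<close> show ?thesis
       using False by (simp add: \<zeta> h_def T1_def T2_def T3_def)
     qed
    qed
    also have "... = (NINT z|L. h z)"
    proof (rule nn_integral_marks_first)
     have [measurable]: "Measurable.pred (L >< count_space marks) (%\<zeta>. snd \<zeta> = Second)"
      by (rule measurable_compose[OF measurable_snd]) simp
     show "(%\<zeta>. if snd \<zeta> = Second then 0 else h (fst \<zeta>)) : bmeas (L >< count_space marks)" by measurable
    qed simp_all
    also have "... = (NINT i|(L >< L). 3 * (T1 p i + T2 p i + T3 p i))"
     unfolding h_def by (rule L.nn_integral_fst) measurable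
    finally show "(NINT \<zeta>|?A. NINT \<eta>|?A. ennreal ((dif (%q. tail_kernel (\<zeta>, q)) \<eta> p)^2)) <= ..." .
   qed
   also have "... = 3 * ((NINT p|?K. NINT i|(L >< L). T1 p i) + (NINT p|?K. NINT i|(L >< L). T2 p i) + (NINT p|?K. NINT i|(L >< L). T3 p i))"
   proof -
    have "(NINT i|(L >< L). 3 * (T1 p i + T2 p i + T3 p i))
     = 3 * ((NINT i|(L >< L). T1 p i) + (NINT i|(L >< L). T2 p i) + (NINT i|(L >< L). T3 p i))" if [measurable]: "p : space ?K" for p
     by (simp add: nn_integral_cmult nn_integral_add)
    then show ?thesis by (simp add: nn_integral_cmult nn_integral_add cong: nn_integral_cong)
   qed
   also have "... <= 3 * ((NINT i|(L >< L). a1 i * b1 i) + (NINT i|(L >< L). a2 i * b2 i) + (NINT i|(L >< L). a1 i * b2 i))"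
    by (intro mult_left_mono add_mono t1 t2 t3) simp
   also have "... = 3 * (NINT i|(L >< L). a1 i * b1 i + a2 i * b2 i + a1 i * b2 i)"
    by (simp add: nn_integral_add)
   also have "(NINT i|(L >< L). a1 i * b1 i + a2 i * b2 i + a1 i * b2 i) = (NINT z1|L. NINT z2|L. a1 (z1, z2) * b1 (z1, z2) + a2 (z1, z2) * b2 (z1, z2) + a1 (z1, z2) * b2 (z1, z2))"
    by (rule L.nn_integral_fst[symmetric]) measurable
   finally show "?D \<le>
    3 * (NINT z1|L. NINT z2|L. rt (nnE (Psp R L) (%p. (dif (damped_dif u F z1) z2 p)^4)) *
   rt (nnE (Psp R L) (%p. \<bar>dif F z1 p\<bar>^4))
  + rt (nnE (Psp R L) (%p. (u (dif F z1 p))^2 * (dif F z1 p)^4)) *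
   rt (nnE (Psp R L) (%p. \<bar>dif (dif F z1) z2 p\<bar>^4))
  + rt (nnE (Psp R L) (%p. (dif (damped_dif u F z1) z2 p)^4)) *
   rt (nnE (Psp R L) (%p. \<bar>dif (dif F z1) z2 p\<bar>^4)))"
    by (simp add: a1_def a2_def b1_def b2_def)
  qed simp
 qed
 finally show ?thesis .
qed

end

declare F_measurable [measurable del]

section \<open>Stein's equation and the covariance\<close>

definition list_gamma :: "'r measure => 'x measure => ('r * 'x list => real) => (real => real) => ennreal" where
 "list_gamma R L F u = list_gamma1 R L F + list_gamma2 R L F + list_gamma3 R L F u
   + list_gamma4 R L F u + list_gamma5 R L F u + list_gamma6 R L F u"

context
 fixes R :: "'r measure" and L :: "'x measure" and F :: "'r * 'x list => real" and u :: "real => real" and x :: real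
 assumes R: "prob_space R" and L: "finite_measure L" and F: "functional R L F"
  and eF: "energy R L F < \<infinity>" and u_meas [measurable]: "u : bmeas borel" and u: "\<And>d. 0 <= u d \<and> u d <= 1"
begin

interpretation L: finite_measure L by (rule L)
interpretation R: prob_space R by (rule R)
interpretation P: prob_space "Poi L" by (rule prob_space_Poi[OF L])

lemmas F_measurable' [measurable] = functional_meas[OF F]

definition mean_slope where "mean_slope r = (LINT xs|Poi L. stein_g x (F (r, xs)))"

lemma mean_slope_measurable [measurable]: "mean_slope : bmeas R"
 unfolding mean_slope_def [abs_def] by measurable

lemma abs_mean_slope_le: "\<bar>mean_slope r\<bar> <= 1"
proof -
 have "\<bar>(LINT xs|Poi L. stein_g x (F (r, xs)))\<bar> <= 1 * P.prob (space (Poi L))"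
  by (rule abs_integral_le_mass[OF P.finite_measure_axioms abs_stein_g_le])
 then show ?thesis by (simp only: mean_slope_def P.prob_space mult_1)
qed

text \<open>With \<open>G\<close> this functional, \<open>F * G + (stein_g x F - a * F^2)\<close> is the Stein discrepancy, where \<open>a\<close> is the mean slope. The
 bracket is centred if \<open>F\<close> is standardized given the parameter.\<close>

definition stein_functional where "stein_functional p = mean_slope (fst p) * F p - stein_f x (F p)"

lemma stein_functional: "functional R L stein_functional"
proof (rule functionalI)
 show "stein_functional : bmeas (R >< seqs L)" unfolding stein_functional_def [abs_def] by measurable
 fix r and xs ys :: "'x list" assume "mset xs = mset ys"
 from functionalD[OF F this] show "stein_functional (r, xs) = stein_functional (r, ys)"
  unfolding stein_functional_def fst_conv by (simp only:)
qed

lemma dif_stein_functional: "dif stein_functional z p = mean_slope (fst p) * dif F z p - (stein_f x (F p + dif F z p) - stein_f x (F p))"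
 by (simp add: dif_def stein_functional_def algebra_simps)

lemma abs_dif_stein_functional_le: "\<bar>dif stein_functional z p\<bar> <= 2 * \<bar>dif F z p\<bar>"
proof -
 have "\<bar>mean_slope (fst p) * dif F z p\<bar> <= 1 * \<bar>dif F z p\<bar>"
  unfolding abs_mult by (rule mult_right_mono[OF abs_mean_slope_le]) simp
 with stein_f_Lipschitz[of x "F p + dif F z p" "F p"] show ?thesis
  unfolding dif_stein_functional by linarith
qed

lemma energy_stein_functional: "energy R L stein_functional < \<infinity>"
 by (rule energy_finite_mono[OF R L eF abs_dif_stein_functional_le]; rule F stein_functional)

lemma integrable_stein_functional_square:
 assumes F2: "integrable (Psp R L) (%p. (F p)^2)"
 shows "integrable (Psp R L) (%p. (stein_functional p)^2)"
proof -
 interpret N: prob_space "Psp R L" by (rule prob_space_Psp[OF R L])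
 note [measurable] = functional_meas[OF stein_functional]
 show ?thesis
 proof (rule Bbound)
  show "integrable (Psp R L) (%p. 2 * (F p)^2 + 2 * stein_bound^2)" using F2 by simp
  have "(stein_functional p)^2 <= 2 * (F p)^2 + 2 * stein_bound^2" for p
  proof -
   have "(mean_slope (fst p) * F p)^2 <= (F p)^2"
    unfolding power_mult_distrib using power_mono[OF abs_mean_slope_le abs_ge_zero, of "fst p" 2] by (intro mult_left_le_one_le) simp_all
   moreover have "(stein_f x (F p))^2 <= stein_bound^2" by (rule power_mono[OF stein_f_le stein_f_nonneg])
   moreover have "(a - b)^2 <= 2 * a^2 + 2 * b^2" for a b :: real
    using zero_le_power2[of "a + b"] by (simp add: power2_eq_square algebra_simps)
   ultimately show ?thesis unfolding stein_functional_def by (smt (verit))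
  qed
  then show "AE p in Psp R L. norm ((stein_functional p)^2) <= norm (2 * (F p)^2 + 2 * stein_bound^2)"
   by (intro AE_I2) simp
 qed measurable
qed

context
 fixes s :: real
 assumes s: "0 <= s" "s <= 1"
begin

interpretation K: prob_space "Qsp R L s" by (rule prob_space_Qsp[OF R L])
interpretation KL: pair_sigma_finite "Qsp R L s" L by unfold_locales
interpretation PL: prob_space "pair_lists L s" by (rule prob_space_pair_lists[OF L])
interpretation RPL: pair_sigma_finite R "pair_lists L s" by unfold_locales

definition remainder where
 "remainder z q = stein_f x (F q + dif F z q) - stein_f x (F q) - stein_g x (F q) * dif F z q"

lemma remainder_measurable [measurable]:
 assumes [measurable]: "f : N ->M L" "g : N ->M R >< seqs L"
 shows "(%w. remainder (f w) (g w)) : bmeas N"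
 unfolding remainder_def by measurable

text \<open>The remainder is split with the weights \<open>1 - u\<close> and \<open>u\<close>: the first part is treated by the Lipschitz bound, the
 second by the second-order bound with its jump term.\<close>

lemma abs_remainder_le:
 "\<bar>remainder z q * y\<bar> <= 2 * \<bar>dif F z q * (1 - u (dif F z q)) * y\<bar>
   + (\<bar>F q\<bar> + stein_bound) / 2 * (u (dif F z q) * (dif F z q)^2) * \<bar>y\<bar>
   + \<bar>y\<bar> * damped_dif u F z q * dif (%q. of_bool (x < F q)) z q"
proof -
 define d where "d = dif F z q"
 have Fd: "F (fst q, z # snd q) = F q + d" by (simp add: d_def dif_def)
 have "\<bar>remainder z q\<bar> = (1 - u d) * \<bar>remainder z q\<bar> + u d * \<bar>remainder z q\<bar>" by (simp add: algebra_simps)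
 also have "... <= (1 - u d) * (2 * \<bar>d\<bar>) + u d * ((\<bar>F q\<bar> + stein_bound) * d^2 / 2 + d * (of_bool (x < F q + d) - of_bool (x < F q)))"
  unfolding remainder_def d_def[symmetric] using u[of d]
  by (intro add_mono mult_left_mono stein_remainder stein_remainder_linear) simp_all
 finally have "\<bar>remainder z q\<bar> * \<bar>y\<bar> <= ... * \<bar>y\<bar>" by (rule mult_right_mono) simp
 also have "... = 2 * \<bar>d * (1 - u d) * y\<bar> + (\<bar>F q\<bar> + stein_bound) / 2 * (u d * d^2) * \<bar>y\<bar>
   + \<bar>y\<bar> * damped_dif u F z q * dif (%q. of_bool (x < F q)) z q"
 proof -
  define e :: real where "e = of_bool (x < F q + d) - of_bool (x < F q)"
  have 1: "dif (%q. of_bool (x < F q)) z q = e"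
   unfolding dif_def[of "%q. of_bool (x < F q)"] Fd e_def ..
  have 2: "\<bar>d * (1 - u d) * y\<bar> = \<bar>d\<bar> * (1 - u d) * \<bar>y\<bar>" using u[of d] by (simp add: abs_mult)
  show ?thesis unfolding 1 2 damped_dif_def d_def[symmetric] e_def[symmetric] by (simp add: field_simps)
 qed
 finally show ?thesis by (simp only: abs_mult d_def)
qed

lemma nn_integral_remainder_le:
 "(NINT p|Qsp R L s. NINT z|L. eabs (remainder z (first p) * dif F z (second p)))
  <= list_gamma3 R L F u + list_gamma4 R L F u + (list_gamma5 R L F u + list_gamma6 R L F u)"
proof -
 define A where "A z p = eabs (dif F z (first p) * (1 - u (dif F z (first p))) * dif F z (second p))" for z p
 define B where "B z p = ennreal ((\<bar>F (first p)\<bar> + stein_bound) / 2 * (u (dif F z (first p)) * (dif F z (first p))^2) * \<bar>dif F z (second p)\<bar>)" for z p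
 define C where "C z p = ennreal (\<bar>dif F z (second p)\<bar> * damped_dif u F z (first p) * dif (%q. of_bool (x < F q)) z (first p))" for z p
 have Hm[measurable]: "(%q. of_bool (x < F q) :: real) : bmeas (R >< seqs L)" by measurable
 have [measurable]: "(%w. A (f w) (g w)) : bmeas N" "(%w. B (f w) (g w)) : bmeas N" "(%w. C (f w) (g w)) : bmeas N"
  if [measurable]: "f : N ->M L" "g : N ->M R >< seqs (marked L s marks)" for f g and N :: "'n measure"
  unfolding A_def B_def C_def by measurable
 have "(NINT p|Qsp R L s. NINT z|L. eabs (remainder z (first p) * dif F z (second p)))
   <= (NINT p|Qsp R L s. NINT z|L. 2 * A z p + B z p + C z p)"
 proof (intro nn_integral_mono)
  fix p z
  define a b c where "a = \<bar>dif F z (first p) * (1 - u (dif F z (first p))) * dif F z (second p)\<bar>"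
   and "b = (\<bar>F (first p)\<bar> + stein_bound) / 2 * (u (dif F z (first p)) * (dif F z (first p))^2) * \<bar>dif F z (second p)\<bar>"
   and "c = \<bar>dif F z (second p)\<bar> * damped_dif u F z (first p) * dif (%q. of_bool (x < F q)) z (first p)"
  have "0 <= stein_bound" by (simp add: stein_bound_def)
  then have nn: "0 <= a" "0 <= b" "0 <= c"
   using u mult_nonneg_nonneg[OF abs_ge_zero damped_jump_nonneg[of u F z "first p" x], of "dif F z (second p)"] by (simp_all add: a_def b_def c_def mult.assoc)
  have "\<bar>remainder z (first p) * dif F z (second p)\<bar> <= 2 * a + b + c"
   unfolding a_def b_def c_def by (rule abs_remainder_le)
  then have "eabs (remainder z (first p) * dif F z (second p)) <= ennreal (2 * a + b + c)" by (rule ennreal_leI)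
  also have "... = 2 * ennreal a + ennreal b + ennreal c" using nn by (simp add: ennreal_plus ennreal_mult)
  finally show "eabs (remainder z (first p) * dif F z (second p)) <= 2 * A z p + B z p + C z p"
   by (simp only: A_def B_def C_def a_def b_def c_def)
 qed
 also have "... = (NINT p|Qsp R L s. 2 * (NINT z|L. A z p) + (NINT z|L. B z p) + (NINT z|L. C z p))"
 proof (rule nn_integral_cong)
  fix p assume "p : space (Qsp R L s)"
  then have [measurable]: "p : space (R >< seqs (marked L s marks))"
   by (simp add: Qsp_def space_Psp space_pair_measure)
  show "(NINT z|L. 2 * A z p + B z p + C z p) = 2 * (NINT z|L. A z p) + (NINT z|L. B z p) + (NINT z|L. C z p)"
   by (simp add: nn_integral_add nn_integral_cmult)
 qed
 also have "... = 2 * (NINT p|Qsp R L s. NINT z|L. A z p) + (NINT p|Qsp R L s. NINT z|L. B z p) + (NINT p|Qsp R L s. NINT z|L. C z p)"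
  by (simp add: nn_integral_add nn_integral_cmult)
 also have "... <= list_gamma3 R L F u + list_gamma4 R L F u + (list_gamma5 R L F u + list_gamma6 R L F u)"
  unfolding A_def B_def C_def
  by (intro add_mono remainder3[OF R L F s eF u_meas u] remainder4[OF R L F s eF u_meas u] remainder56[OF R L F s eF u_meas u])
 finally show ?thesis .
qed

text \<open>The law of the first member does not depend on \<open>s\<close>, hence the conditional mean of \<open>stein_g x\<close> at it is \<open>mean_slope\<close>. Therefore
 \<open>carre\<close> may be replaced by its deviation from the conditional mean, to which the Poincare inequality applies.\<close>

lemma slope_deviation:
 "eabs ((LINT p|Qsp R L s. (mean_slope (fst p) - stein_g x (F (first p))) * carre L F p))
  <= list_gamma1 R L F + list_gamma2 R L F"
proof -
 let ?K = "Qsp R L s" and ?c = "carre L F" and ?g = "%p. stein_g x (F (first p))"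
 note cf = carre_functional[OF R L F s eF]
 note cm[measurable] = functional_meas[OF cf]
 note ci = integrable_carre[OF R L F s eF]
 define e where "e r = (LINT zs|pair_lists L s. ?c (r, zs))" for r
 have [measurable]: "e : bmeas R" unfolding e_def [abs_def] by measurable
 have K: "?K = R >< pair_lists L s" by (simp only: Qsp_def Psp_def)
 have int1: "integrable ?K (%p. mean_slope (fst p) * ?c p)"
  by (rule Bbound[OF ci])
   (measurable, intro AE_I2, simp add: abs_mult mult_left_le_one_le abs_mean_slope_le)
 have int2: "integrable ?K (%p. ?g p * ?c p)"
  by (rule Bbound[OF ci])
   (measurable, intro AE_I2, simp add: abs_mult mult_left_le_one_le abs_stein_g_le)
 have ei: "integrable R e"
  using RPL.integrable_fst'[OF ci[unfolded K]] by (simp add: e_def [abs_def])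
 have int3: "integrable ?K (%p. ?g p * e (fst p))"
 proof (rule integrableI_bounded)
  have "(NINT p|?K. ennreal (norm (?g p * e (fst p)))) <= (NINT p|?K. eabs (e (fst p)))"
   by (intro nn_integral_mono ennreal_leI) (simp add: abs_mult mult_left_le_one_le abs_stein_g_le)
  also have "... = (NINT r|R. eabs (e r))"
   unfolding K using PL.emeasure_space_1 by (subst PL.nn_integral_fst[symmetric]) simp_all
  also have "... < \<infinity>" using ei by (simp add: integrable_iff_bounded)
  finally show "(NINT p|?K. ennreal (norm (?g p * e (fst p)))) < \<infinity>" .
 qed measurable
 have marginal: "(LINT zs|pair_lists L s. stein_g x (F (r, proj1 zs))) = mean_slope r" if r[measurable]: "r : space R" for r
 proof -
  define h where "h xs = stein_g x (F (r, xs)) + 1" for xs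
  have [measurable]: "h : bmeas (seqs L)" unfolding h_def [abs_def] by measurable
  have b: "0 <= h xs \<and> h xs <= 2" for xs using abs_stein_g_le[of x "F (r, xs)"] by (simp add: h_def abs_le_iff)
  have inv: "perm_inv (%xs. ennreal (h xs))"
  proof (rule perm_invI)
   fix xs ys :: "'x list" assume "mset xs = mset ys"
   from functionalD[OF F this, of r] show "ennreal (h xs) = ennreal (h ys)" by (simp only: h_def)
  qed
  have "ennreal (LINT zs|pair_lists L s. h (proj1 zs)) = (NINT zs|pair_lists L s. ennreal (h (proj1 zs)))"
   by (rule PL.ennreal_integral_bounded[OF _ b]) measurable
  also have "... = (NINT xs|Poi L. ennreal (h xs))"
   by (rule nn_integral_proj(1)[OF L s _ inv]) measurable
  also have "... = ennreal (LINT xs|Poi L. h xs)"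
   by (rule P.ennreal_integral_bounded[OF _ b, symmetric]) measurable
  finally have "(LINT zs|pair_lists L s. h (proj1 zs)) = (LINT xs|Poi L. h xs)"
   using b by (simp add: Bnonneg)
  moreover have "integrable (pair_lists L s) (%zs. stein_g x (F (r, proj1 zs)))"
   by (rule PL.integrable_bounded[OF _ abs_stein_g_le]) measurable
  moreover have "integrable (Poi L) (%xs. stein_g x (F (r, xs)))"
   by (rule P.integrable_bounded[OF _ abs_stein_g_le]) measurable
  ultimately show ?thesis
   unfolding h_def mean_slope_def by (simp add: PL.prob_space P.prob_space del: space_Poi)
 qed
 have "(LINT p|?K. mean_slope (fst p) * ?c p) = (LINT r|R. mean_slope r * e r)"
  unfolding K e_def using RPL.integral_fst'[OF int1[unfolded K]] by simp
 also have "... = (LINT r|R. LINT zs|pair_lists L s. ?g (r, zs) * e r)"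
  by (rule Bcong) (simp add: first_Pair marginal)
 also have "... = (LINT p|?K. ?g p * e (fst p))"
  unfolding K using RPL.integral_fst'[OF int3[unfolded K]] by simp
 finally have "(LINT p|?K. (mean_slope (fst p) - ?g p) * ?c p) = (LINT p|?K. ?g p * e (fst p)) - (LINT p|?K. ?g p * ?c p)"
  unfolding left_diff_distrib Bdiff[OF int1 int2] by simp
 also have "... = (LINT p|?K. ?g p * (e (fst p) - ?c p))"
  unfolding right_diff_distrib by (rule Bdiff[OF int3 int2, symmetric])
 finally have "eabs ((LINT p|?K. (mean_slope (fst p) - ?g p) * ?c p)) = ennreal (norm (LINT p|?K. ?g p * (e (fst p) - ?c p)))"
  by simp
 also have "... <= (NINT p|?K. ennreal (norm (?g p * (e (fst p) - ?c p))))"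
 proof (rule integral_norm_bound_ennreal)
  show "integrable ?K (%p. ?g p * (e (fst p) - ?c p))"
   unfolding right_diff_distrib by (rule Bidiff[OF int3 int2])
 qed
 also have "... <= (NINT p|?K. eabs (?c p - e (fst p)))"
 proof (intro nn_integral_mono ennreal_leI)
  fix p
  have "\<bar>?g p\<bar> * \<bar>e (fst p) - ?c p\<bar> <= 1 * \<bar>e (fst p) - ?c p\<bar>" by (rule mult_right_mono[OF abs_stein_g_le]) simp
  then show "norm (?g p * (e (fst p) - ?c p)) <= \<bar>?c p - e (fst p)\<bar>" by (simp add: abs_mult abs_minus_commute)
 qed
 also have "... <= rt (energy R (marked L s marks) ?c)"
  unfolding e_def Qsp_def
  by (rule poincare[OF R finite_all_marked[OF R L F s eF] cf ci[unfolded Qsp_def]])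
 also have "... <= list_gamma1 R L F + list_gamma2 R L F" by (rule energy_carre_le_gamma[OF R L F s eF])
 finally show ?thesis .
qed

text \<open>The difference of \<open>stein_functional\<close> is \<open>(mean_slope - stein_g x F) * D\<^sub>z F\<close> minus the remainder of the expansion.\<close>

lemma gamma_form_stein_le: "eabs (gamma_form R L F stein_functional s) <= list_gamma R L F u"
proof -
 let ?K = "Qsp R L s" and ?c = "carre L F" and ?M = "Qsp R L s >< L"
 define Y where "Y q = dif F (snd q) (second (fst q))" for q :: "('r \<times> ('x \<times> mark) list) * 'x"
 define X where "X q = dif F (snd q) (first (fst q))" for q :: "('r \<times> ('x \<times> mark) list) * 'x"
 define a where "a q = mean_slope (fst (fst q)) - stein_g x (F (first (fst q)))" for q :: "('r \<times> ('x \<times> mark) list) * 'x"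
 define \<rho> where "\<rho> q = remainder (snd q) (first (fst q))" for q :: "('r \<times> ('x \<times> mark) list) * 'x"
 have [measurable]: "Y : bmeas ?M" "X : bmeas ?M" "a : bmeas ?M" "\<rho> : bmeas ?M"
  unfolding Y_def [abs_def] X_def [abs_def] a_def [abs_def] \<rho>_def [abs_def] by measurable
 have YX: "integrable ?M (%q. Y q * X q)"
  using integrable_carre_kernel[OF R L F s eF] by (simp add: Y_def X_def split_def)
 then have dom: "integrable ?M (%q. 2 * (Y q * X q))" by simp
 have a2: "\<bar>a q\<bar> <= 2" for q
  using abs_mean_slope_le[of "fst (fst q)"] abs_stein_g_le[of x "F (first (fst q))"] unfolding a_def by linarith
 have \<rho>2: "\<bar>\<rho> q\<bar> <= 2 * \<bar>X q\<bar>" for q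
  unfolding \<rho>_def X_def remainder_def by (rule stein_remainder_linear)
 have int1: "integrable ?M (%q. a q * (Y q * X q))"
 proof (rule Bbound[OF dom])
  have "\<bar>a q\<bar> * \<bar>Y q * X q\<bar> <= 2 * \<bar>Y q * X q\<bar>" for q by (rule mult_right_mono[OF a2]) simp
  then show "AE q in ?M. norm (a q * (Y q * X q)) <= norm (2 * (Y q * X q))" by (intro AE_I2) (simp add: abs_mult)
 qed measurable
 have int2: "integrable ?M (%q. \<rho> q * Y q)"
 proof (rule Bbound[OF dom])
  have "\<bar>\<rho> q\<bar> * \<bar>Y q\<bar> <= 2 * \<bar>X q\<bar> * \<bar>Y q\<bar>" for q by (rule mult_right_mono[OF \<rho>2]) simp
  then show "AE q in ?M. norm (\<rho> q * Y q) <= norm (2 * (Y q * X q))" by (intro AE_I2) (simp add: abs_mult mult_ac)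
 qed measurable
 have "gamma_form R L F stein_functional s = (LINT (p, z)|?M. dif F z (second p) * dif stein_functional z (first p))"
  by (rule integrable_gamma(2)[OF R L s F stein_functional eF energy_stein_functional])
 also have "... = (LINT q|?M. a q * (Y q * X q) - \<rho> q * Y q)"
 proof (rule Bcong)
  fix q :: "('r \<times> ('x \<times> mark) list) * 'x"
  have "fst (first (fst q)) = fst (fst q)" by (simp add: first_def)
  then show "(case q of (p, z) => dif F z (second p) * dif stein_functional z (first p)) = a q * (Y q * X q) - \<rho> q * Y q"
   by (simp add: split_def dif_stein_functional a_def Y_def X_def \<rho>_def remainder_def algebra_simps)
 qed
 also have "... = (LINT q|?M. a q * (Y q * X q)) - (LINT q|?M. \<rho> q * Y q)" by (rule Bdiff[OF int1 int2])
 also have "(LINT q|?M. a q * (Y q * X q)) = (LINT p|?K. (mean_slope (fst p) - stein_g x (F (first p))) * ?c p)"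
  using KL.integral_fst'[OF int1] by (simp add: a_def Y_def X_def carre_def[OF R L F s eF])
 finally have "eabs (gamma_form R L F stein_functional s) \<le>
   eabs ((LINT p|?K. (mean_slope (fst p) - stein_g x (F (first p))) * ?c p)) + eabs ((LINT q|?M. \<rho> q * Y q))"
  by (simp add: ennreal_plus[symmetric] ennreal_leI del: ennreal_plus)
 also have "... <= (list_gamma1 R L F + list_gamma2 R L F) + (list_gamma3 R L F u + list_gamma4 R L F u + (list_gamma5 R L F u + list_gamma6 R L F u))"
 proof (rule add_mono[OF slope_deviation])
  have "eabs ((LINT q|?M. \<rho> q * Y q)) <= (NINT q|?M. ennreal (norm (\<rho> q * Y q)))"
   unfolding real_norm_def[symmetric] by (rule integral_norm_bound_ennreal[OF int2])
  also have "... = (NINT p|?K. NINT z|L. eabs (remainder z (first p) * dif F z (second p)))"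
   by (subst L.nn_integral_fst[symmetric]) (simp_all add: \<rho>_def Y_def)
  also note nn_integral_remainder_le
  finally show "eabs ((LINT q|?M. \<rho> q * Y q)) <= list_gamma3 R L F u + list_gamma4 R L F u + (list_gamma5 R L F u + list_gamma6 R L F u)" .
 qed
 finally show ?thesis by (simp add: list_gamma_def add.assoc)
qed

end

theorem stein_covariance:
 assumes F2: "integrable (Psp R L) (%p. (F p)^2)"
 shows "eabs ((LINT p|Psp R L. F p * stein_functional p)
   - (LINT r|R. (LINT xs|Poi L. F (r, xs)) * (LINT xs|Poi L. stein_functional (r, xs))))
  <= list_gamma R L F u"
proof (cases "list_gamma R L F u")
 case (real b)
 show ?thesis
  unfolding real(2)
 proof (rule ennreal_leI, rule covariance_bound[OF R L F stein_functional F2 integrable_stein_functional_square[OF F2] eF energy_stein_functional])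
  fix s :: real assume s: "0 <= s" "s <= 1"
  from gamma_form_stein_le[OF s] show "\<bar>gamma_form R L F stein_functional s\<bar> <= b"
   using real by (simp add: ennreal_le_iff)
 qed
qed simp

end

declare F_measurable' [measurable del] mean_slope_measurable [measurable del] remainder_measurable [measurable del]

section \<open>Counting measures\<close>

lemma space_CM:
 "space (CM M) = {\<mu>. sets \<mu> = sets M \<and> sigma_finite_measure \<mu> \<and> integer_valued_measure \<mu>}"
 by (auto simp add: counting_measures_def space_Sup_eq_UN)

lemma measurable_evaluation: "A : sets M ==> (%\<mu>. emeasure \<mu> A) : bmeas (CM M)"
 by (auto intro!: measurable_SUP1 measurable_vimage_algebra1 simp: counting_measures_def)

lemma measurable_CM:
 assumes "\<And>a. a : space N ==> K a : space (CM M)"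
  and "\<And>A. A : sets M ==> (%a. emeasure (K a) A) : bmeas N"
 shows "K : N ->M CM M"
 using assms unfolding space_CM
 by (auto intro!: measurable_SUP2 measurable_vimage_algebra2 simp: counting_measures_def)

lemma sets_add_point [simp]: "sets (add_point \<mu> z) = sets \<mu>" and space_add_point [simp]: "space (add_point \<mu> z) = space \<mu>"
 by (simp_all add: add_point_def)

lemma emeasure_add_point:
 assumes A: "A : sets \<mu>" shows "emeasure (add_point \<mu> z) A = emeasure \<mu> A + indicator A z"
proof -
 have "emeasure (add_point \<mu> z) A = emeasure \<mu> A + emeasure (return \<mu> z) A"
 proof (rule emeasure_measure_of[OF add_point_def])
  show "sets \<mu> \<subseteq> Pow (space \<mu>)" by (rule sets.space_closed)
  show "positive (sets (add_point \<mu> z)) (%A. emeasure \<mu> A + emeasure (return \<mu> z) A)" by (simp add: positive_def)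
  show "countably_additive (sets (add_point \<mu> z)) (%A. emeasure \<mu> A + emeasure (return \<mu> z) A)"
  proof (rule countably_additiveI)
   fix B :: "nat => _" assume B: "range B \<subseteq> sets (add_point \<mu> z)" "disjoint_family B" "(\<Union>i. B i) : sets (add_point \<mu> z)"
   have "(\<Sum>i. emeasure \<mu> (B i) + emeasure (return \<mu> z) (B i)) = (\<Sum>i. emeasure \<mu> (B i)) + (\<Sum>i. emeasure (return \<mu> z) (B i))"
    by (rule suminf_add[symmetric]) (rule summableI)+
   also have "(\<Sum>i. emeasure \<mu> (B i)) = emeasure \<mu> (\<Union>i. B i)" using B by (intro suminf_emeasure) auto
   also have "(\<Sum>i. emeasure (return \<mu> z) (B i)) = emeasure (return \<mu> z) (\<Union>i. B i)" using B by (intro suminf_emeasure) auto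
   finally show "(\<Sum>i. emeasure \<mu> (B i) + emeasure (return \<mu> z) (B i)) = emeasure \<mu> (\<Union>i. B i) + emeasure (return \<mu> z) (\<Union>i. B i)" .
  qed
 qed (use A in simp)
 with A show ?thesis by simp
qed

lemma add_point_in_space:
 assumes "\<mu> : space (CM M)" shows "add_point \<mu> z : space (CM M)"
proof -
 from assms have \<mu>: "sets \<mu> = sets M" "integer_valued_measure \<mu>" and sf: "sigma_finite_measure \<mu>" by (auto simp: space_CM)
 interpret sigma_finite_measure \<mu> by (rule sf)
 obtain C :: "nat => _" where C: "range C \<subseteq> sets \<mu>" "(\<Union>i. C i) = space \<mu>" "\<And>i. emeasure \<mu> (C i) \<noteq> \<infinity>"
  using sigma_finite by metis
 have "sigma_finite_measure (add_point \<mu> z)"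
  by (rule sigma_finite_measure.intro, rule exI[of _ "range C"]) (insert C, auto simp: emeasure_add_point indicator_def)
 moreover have "integer_valued_measure (add_point \<mu> z)"
  unfolding integer_valued_measure_def
 proof
  fix A assume "A : sets (add_point \<mu> z)"
  then have A: "A : sets \<mu>" by simp
  with \<mu>(2) consider "emeasure \<mu> A : \<nat>" | "emeasure \<mu> A = \<infinity>" unfolding integer_valued_measure_def by blast
  then show "emeasure (add_point \<mu> z) A : \<nat> \<union> {\<infinity>}"
  proof cases
   case 1
   moreover have "indicator A z : (\<nat> :: ennreal set)" by (simp add: indicator_def)
   ultimately show ?thesis unfolding emeasure_add_point[OF A] by (intro UnI1 Nats_add)
  qed (simp add: emeasure_add_point[OF A])
 qed
 ultimately show ?thesis using \<mu> by (simp add: space_CM)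
qed

lemma measurable_add_point [measurable]:
 assumes [measurable]: "f : N ->M M" "h : N ->M CM M"
 shows "(%w. add_point (h w) (f w)) : N ->M CM M"
proof (rule measurable_CM)
 have h: "h w : space (CM M)" if "w : space N" for w using measurable_space[OF assms(2) that] .
 then show "add_point (h w) (f w) : space (CM M)" if "w : space N" for w
  using that by (intro add_point_in_space)
 fix A assume A[measurable]: "A : sets M"
 have [measurable]: "(%w. emeasure (h w) A) : bmeas N"
  by (rule measurable_compose[OF assms(2) measurable_evaluation[OF A]])
 have "(%w. emeasure (h w) A + indicator A (f w)) : bmeas N" by measurable
 moreover have "emeasure (add_point (h w) (f w)) A = emeasure (h w) A + indicator A (f w)" if "w : space N" for w
  using h[OF that] A by (intro emeasure_add_point) (simp add: space_CM)
 ultimately show "(%w. emeasure (add_point (h w) (f w)) A) : bmeas N"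
  by (simp cong: measurable_cong)
qed

lemma measurable_diff_op [measurable]:
 assumes [measurable]: "\<phi> : bmeas (CM M)" "f : N ->M M" "h : N ->M CM M"
 shows "(%w. diff_op (f w) \<phi> (h w)) : bmeas N"
 unfolding diff_op_def by measurable

text \<open>The configuration in which the points inside \<open>B\<close> have been replaced by those of a list.\<close>

definition config :: "'x set => 'x measure => 'x list => 'x measure" where
 "config B \<mu> xs = foldr (%z \<mu>. add_point \<mu> z) xs (density \<mu> (indicator (space \<mu> - B)))"

definition count_in where
 "count_in A xs = length (filter (%x. x : A) xs)"

lemma config_Cons: "config B \<mu> (z # xs) = add_point (config B \<mu> xs) z"
 by (simp add: config_def)

lemma sets_config [simp]: "sets (config B \<mu> xs) = sets \<mu>"
 by (induction xs) (simp_all add: config_def)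

lemma emeasure_config_Nil: "A : sets \<mu> ==> emeasure (config B \<mu> xs) A = emeasure (config B \<mu> []) A + of_nat (count_in A xs)"
 by (induction xs) (simp_all add: config_Cons emeasure_add_point count_in_def indicator_def add_ac)

lemma emeasure_config:
 assumes "A : sets \<mu>" "B : sets \<mu>" shows "emeasure (config B \<mu> xs) A = emeasure \<mu> (A - B) + of_nat (count_in A xs)"
proof -
 have "(space \<mu> - B) \<inter> A = A - B" using sets.sets_into_space[OF assms(1)] by auto
 then show ?thesis unfolding emeasure_config_Nil[OF assms(1), of B xs] using assms by (simp add: config_def emeasure_restricted)
qed

lemma count_in_mset: "mset xs = mset ys ==> count_in A xs = count_in A ys"
 unfolding count_in_def by (metis mset_filter size_mset)

lemma config_mset:
 assumes "mset xs = mset ys" shows "config B \<mu> xs = config B \<mu> ys"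
proof (rule measure_eqI)
 fix A assume "A : sets (config B \<mu> xs)"
 then have A: "A : sets \<mu>" by simp
 show "emeasure (config B \<mu> xs) A = emeasure (config B \<mu> ys) A"
  unfolding emeasure_config_Nil[OF A, of _ xs] emeasure_config_Nil[OF A, of _ ys] count_in_mset[OF assms] ..
qed simp

lemma config_in_space:
 assumes "\<mu> : space (CM M)" and B: "B : sets M" shows "config B \<mu> xs : space (CM M)"
proof (induction xs)
 case Nil
 from assms have \<mu>: "sets \<mu> = sets M" "integer_valued_measure \<mu>" and sf: "sigma_finite_measure \<mu>" by (auto simp: space_CM)
 interpret sigma_finite_measure \<mu> by (rule sf)
 have e: "emeasure (config B \<mu> []) A = emeasure \<mu> (A - B)" if "A : sets \<mu>" for A
  using emeasure_config[OF that, of B "[]"] B \<mu>(1) by (simp add: count_in_def)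
 obtain C :: "nat => _" where C: "range C \<subseteq> sets \<mu>" "(\<Union>i. C i) = space \<mu>" "\<And>i. emeasure \<mu> (C i) \<noteq> \<infinity>"
  using sigma_finite by metis
 have "emeasure \<mu> (C i - B) \<noteq> \<infinity>" for i
  using C(3)[of i] emeasure_mono[of "C i - B" "C i" \<mu>] C(1) by (auto simp: top_unique)
 then have "sigma_finite_measure (config B \<mu> [])"
  by (intro sigma_finite_measure.intro exI[of _ "range C"]) (use C e sets_eq_imp_space_eq[OF sets_config[of B \<mu> "[]"]] in auto)
 moreover have "integer_valued_measure (config B \<mu> [])"
  using \<mu> B unfolding integer_valued_measure_def by (auto simp: e)
 ultimately show ?case using \<mu> by (simp add: space_CM)
qed (simp add: config_Cons add_point_in_space)

lemma measurable_count_in [measurable]: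
 assumes [measurable]: "A : sets L" shows "count_in A : seqs L ->M count_space UNIV"
 unfolding count_in_def [abs_def] by measurable

lemma measurable_config [measurable]:
 assumes B: "B : sets M" and LM: "sets L = sets M" and f: "f : N ->M CM M" and g[measurable]: "g : N ->M seqs L"
 shows "(%w. config B (f w) (g w)) : N ->M CM M"
proof (rule measurable_CM)
 have fs: "f w : space (CM M)" if "w : space N" for w using measurable_space[OF f that] .
 then show "config B (f w) (g w) : space (CM M)" if "w : space N" for w using that B by (intro config_in_space)
 fix A assume A: "A : sets M"
 then have [measurable]: "A : sets L" by (simp add: LM)
 have [measurable]: "(%w. emeasure (f w) (A - B)) : bmeas N"
  using A B by (intro measurable_compose[OF f measurable_evaluation]) auto
 have "(%w. emeasure (f w) (A - B) + of_nat (count_in A (g w))) : bmeas N" by measurable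
 moreover have "emeasure (config B (f w) (g w)) A = emeasure (f w) (A - B) + of_nat (count_in A (g w))" if "w : space N" for w
  using fs[OF that] A B by (intro emeasure_config) (simp_all add: space_CM)
 ultimately show "(%w. emeasure (config B (f w) (g w)) A) : bmeas N" by (simp cong: measurable_cong)
qed

section \<open>Laws of random counting measures\<close>

definition cell where
 "cell M K = {\<mu> : space (CM M). \<forall>(A, k)\<in>K. emeasure \<mu> A = of_nat k}"

context
 fixes M :: "'x measure" and E :: "nat => 'x set"
 assumes E: "range E \<subseteq> sets M" "incseq E" "(\<Union>i. E i) = space M"
begin

definition local_sets where "local_sets = {A : sets M. \<exists>i. A \<subseteq> E i}"
definition cells where "cells = {cell M K |K. finite K \<and> fst ` K \<subseteq> local_sets}"

lemma cell_measurable: "finite K ==> fst ` K \<subseteq> sets M ==> cell M K : sets (CM M)"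
proof (induction K rule: finite_induct)
 case (insert p K)
 obtain A k where p: "p = (A, k)" by (cases p)
 with insert have [measurable]: "(%\<mu>. emeasure \<mu> A) : bmeas (CM M)" by (intro measurable_evaluation) simp
 have "cell M (insert p K) = {\<mu> : space (CM M). emeasure \<mu> A = of_nat k} \<inter> cell M K"
  by (auto simp: cell_def p)
 moreover have "{\<mu> : space (CM M). emeasure \<mu> A = of_nat k} : sets (CM M)" by measurable
 ultimately show ?case using insert by auto
qed (simp add: cell_def)

lemma Int_stable_cells: "Int_stable cells"
proof (rule Int_stableI)
 fix a b assume "a : cells" "b : cells"
 then obtain K1 K2 where K: "a = cell M K1" "b = cell M K2" "finite K1" "finite K2" "fst ` K1 \<subseteq> local_sets" "fst ` K2 \<subseteq> local_sets"
  unfolding cells_def by blast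
 moreover have "cell M K1 \<inter> cell M K2 = cell M (K1 \<union> K2)" by (auto simp: cell_def)
 ultimately show "a \<inter> b : cells" unfolding cells_def by (auto intro!: exI[of _ "K1 \<union> K2"])
qed

text \<open>Finite counts of local sets determine the sigma-algebra, because the process is the monotone limit of its
 restrictions. An infinite count is the complement of all finite ones.\<close>

lemma sets_CM: "sets (CM M) = sigma_sets (space (CM M)) cells"
proof
 let ?ev = "%A. (%\<mu>. emeasure \<mu> A)"
 let ?\<Omega> = "space (CM M)"
 have sub: "cells \<subseteq> Pow ?\<Omega>" by (auto simp: cells_def cell_def)
 have "cells \<subseteq> sets (CM M)"
  unfolding cells_def local_sets_def by (auto intro!: cell_measurable)
 then show "sigma_sets ?\<Omega> cells \<subseteq> sets (CM M)" by (rule sets.sigma_sets_subset)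
 define S where "S = sigma ?\<Omega> cells"
 have S: "space S = ?\<Omega>" "sets S = sigma_sets ?\<Omega> cells" unfolding S_def using sub by (simp_all add: space_measure_of sets_measure_of)
 have loc: "?ev A : bmeas S" if A: "A : local_sets" for A
 proof -
  let ?N = "insert \<infinity> (range of_nat) :: ennreal set"
  have fib: "?ev A -` {of_nat k} \<inter> space S : sets S" for k
  proof -
   have "?ev A -` {of_nat k} \<inter> space S = cell M {(A, k)}" by (auto simp: cell_def S)
   then show ?thesis using A by (auto simp: S cells_def intro!: sigma_sets.Basic exI[of _ "{(A, k)}"])
  qed
  have "?ev A : S ->M count_space ?N"
  proof (rule iffD2[OF measurable_count_space_eq_countable], simp, intro conjI ballI)
   show f: "?ev A : space S \<rightarrow> ?N"
    using A by (auto simp: S space_CM integer_valued_measure_def local_sets_def Nats_def)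
   fix a assume "a : ?N"
   then consider "a = \<infinity>" | k where "a = of_nat k" by blast
   then show "?ev A -` {a} \<inter> space S : sets S"
   proof cases
    case 1
    have "?ev A -` {\<infinity>} \<inter> space S = space S - (\<Union>k. ?ev A -` {of_nat k} \<inter> space S)"
     using f by auto
    also have "... : sets S" using fib by (intro sets.Diff sets.top sets.countable_UN) auto
    finally show ?thesis unfolding 1 .
   qed (simp add: fib)
  qed
  then show ?thesis by (rule measurable_compose[where g = "%x. x"]) simp
 qed
 have "(%\<mu>. \<mu>) : S ->M CM M"
 proof (rule measurable_CM)
  fix A assume A: "A : sets M"
  have l: "A \<inter> E i : local_sets" for i using A E(1) by (auto simp: local_sets_def)
  have "emeasure \<mu> A = (SUP i. emeasure \<mu> (A \<inter> E i))" if "\<mu> : space S" for \<mu>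
  proof -
   have \<mu>: "sets \<mu> = sets M" using that by (simp add: S space_CM)
   have "(SUP i. emeasure \<mu> (A \<inter> E i)) = emeasure \<mu> (\<Union>i. A \<inter> E i)"
   proof (rule SUP_emeasure_incseq)
    show "range (%i. A \<inter> E i) \<subseteq> sets \<mu>" using l by (auto simp: \<mu> local_sets_def)
    show "incseq (%i. A \<inter> E i)" using E(2) unfolding incseq_def by blast
   qed
   also have "(\<Union>i. A \<inter> E i) = A" using E(3) sets.sets_into_space[OF A] by auto
   finally show ?thesis by simp
  qed
  moreover have "(%\<mu>. SUP i. emeasure \<mu> (A \<inter> E i)) : bmeas S" using loc[OF l] by measurable
  ultimately show "?ev A : bmeas S" by (simp cong: measurable_cong)
 qed (simp add: S)
 from measurable_sets[OF this] show "sets (CM M) \<subseteq> sigma_sets ?\<Omega> cells"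
  using sets.sets_into_space[of _ "CM M"] by (auto simp: S Int_absorb2)
qed

text \<open>Counts of overlapping sets are sums of counts of the atoms of the algebra they generate, and the cells for
 the possible counts of the atoms are disjoint. Including \<open>B\<close> among the generators makes every atom lie inside or outside
 \<open>B\<close>. Atoms outside all sets of the cell need not be local and are left out.\<close>

lemma counting_law_unique:
 assumes N: "prob_space N1" "prob_space N2" "sets N1 = sets (CM M)" "sets N2 = sets (CM M)"
  and B: "B : local_sets"
  and cells: "\<And>(n::nat) D k. disjoint_family_on D {..<n} ==> (\<And>i. i < n ==> D i : local_sets \<and> (D i \<subseteq> B \<or> D i \<inter> B = {})) ==>
   emeasure N1 {\<mu> : space (CM M). \<forall>i<n. emeasure \<mu> (D i) = of_nat (k i)}
   = emeasure N2 {\<mu> : space (CM M). \<forall>i<n. emeasure \<mu> (D i) = of_nat (k i)}"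
 shows "N1 = N2"
proof (rule measure_eqI_generator_eq[OF Int_stable_cells, of "space (CM M)" N1 N2 "%_. space (CM M)"])
 let ?\<Omega> = "space (CM M)"
 interpret N1: prob_space N1 by fact
 show "cells \<subseteq> Pow ?\<Omega>" by (auto simp: cells_def cell_def)
 show "sets N1 = sigma_sets ?\<Omega> cells" "sets N2 = sigma_sets ?\<Omega> cells" by (simp_all only: N sets_CM)
 have "cell M {} = ?\<Omega>" by (simp add: cell_def)
 then show "range (%_::nat. ?\<Omega>) \<subseteq> cells" unfolding cells_def by auto
 show "(\<Union>i::nat. ?\<Omega>) = ?\<Omega>" "emeasure N1 ?\<Omega> \<noteq> \<infinity>" by simp_all
 fix X assume "X : cells"
 then obtain K where K: "X = cell M K" "finite K" "fst ` K \<subseteq> local_sets" by (auto simp: cells_def)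
 define AA where "AA = insert B (fst ` K)"
 have AA: "finite AA" "AA \<subseteq> local_sets" using K B by (simp_all add: AA_def)
 define \<tau> where "\<tau> x = {A : AA. x : A}" for x
 \<comment> \<open>\<open>\<tau> x\<close> is the pattern of the point \<open>x\<close>; the atoms are the fibres of \<open>\<tau>\<close>, indexed by the patterns that meet the cell.\<close>
 define J where "J = {S. S \<subseteq> AA \<and> S \<inter> fst ` K \<noteq> {}}"
 have "finite J" using AA(1) by (auto simp: J_def intro: finite_subset[of _ "Pow AA"])
 define n e where "n = card J" and "e = from_nat_into J"
 have e: "bij_betw e {..<n} J" unfolding n_def e_def by (rule bij_betw_from_nat_into_finite) fact
 define D where "D i = {x : space M. \<tau> x = e i}" for i
 let ?s = "%A \<mu>. (\<Sum>i | i < n \<and> A : e i. emeasure \<mu> (D i))"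
 have eJ: "e i : J" if "i < n" for i using bij_betwE[OF e] that by auto
 have disj: "disjoint_family_on D {..<n}"
  using bij_betw_imp_inj_on[OF e] by (auto simp: disjoint_family_on_def D_def inj_on_def)
 have AAm: "A : sets M" if "A : AA" for A using AA(2) that by (auto simp: local_sets_def)
 have Dm: "D i : sets M" for i
 proof -
  have "D i = {x : space M. e i \<subseteq> AA \<and> (\<forall>A\<in>AA. x : A \<longleftrightarrow> A : e i)}" unfolding D_def \<tau>_def by blast
  also have "... : sets M" using AA(1) AAm by measurable
  finally show ?thesis .
 qed
 have Dsub: "D i \<subseteq> A \<or> D i \<inter> A = {}" if "A : AA" for i A using that by (auto simp: D_def \<tau>_def)
 have Dloc: "D i : local_sets" if i: "i < n" for i
 proof -
  from eJ[OF i] obtain A where A: "A : e i" "A : fst ` K" "A : AA" by (auto simp: J_def)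
  then have "D i \<subseteq> A" by (auto simp: D_def \<tau>_def)
  moreover obtain j where "A \<subseteq> E j" using A(3) AA(2) by (auto simp: local_sets_def)
  ultimately have "D i \<subseteq> E j" by blast
  then show ?thesis using Dm by (auto simp: local_sets_def)
 qed
 have sum: "emeasure \<mu> A = ?s A \<mu>" if A: "A : fst ` K" and \<mu>: "\<mu> : ?\<Omega>" for A \<mu>
 proof -
  have sm: "sets \<mu> = sets M" using \<mu> by (simp add: space_CM)
  have "A = (\<Union>i\<in>{i. i < n \<and> A : e i}. D i)"
  proof (intro equalityI subsetI)
   fix x assume x: "x : A"
   have AAA: "A : AA" using A by (simp add: AA_def)
   then have "x : space M" using x sets.sets_into_space[OF AAm] by auto
   moreover have "\<tau> x : J" using x A AAA by (auto simp: J_def \<tau>_def)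
   then obtain i where "i < n" "e i = \<tau> x" using bij_betw_imp_surj_on[OF e] by auto
   ultimately show "x : (\<Union>i\<in>{i. i < n \<and> A : e i}. D i)" using x AAA by (auto simp: D_def \<tau>_def)
  next
   fix x assume "x : (\<Union>i\<in>{i. i < n \<and> A : e i}. D i)"
   then show "x : A" by (auto simp: D_def \<tau>_def)
  qed
  moreover have "?s A \<mu> = emeasure \<mu> (\<Union>i\<in>{i. i < n \<and> A : e i}. D i)"
   using disj by (intro sum_emeasure) (auto simp: sm Dm intro: disjoint_family_on_mono[of _ "{..<n}"])
  ultimately show ?thesis by simp
 qed
 define b where "b = (\<Sum>p\<in>K. snd p)"
 \<comment> \<open>The counts of the atoms that are compatible with the cell; all of them are at most \<open>b\<close>.\<close>
 define MM where "MM = {m : {..<n} \<rightarrow>\<^sub>E {..b}. \<forall>(A, k)\<in>K. (\<Sum>i | i < n \<and> A : e i. m i) = k}"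
 define Y where "Y m = {\<mu> : ?\<Omega>. \<forall>i<n. emeasure \<mu> (D i) = of_nat (m i)}" for m :: "nat => nat"
 have MM: "finite MM" by (rule finite_subset[of _ "{..<n} \<rightarrow>\<^sub>E {..b}"]) (auto simp: MM_def intro!: finite_PiE)
 have X: "X = (\<Union>m\<in>MM. Y m)"
 proof (intro equalityI subsetI)
  fix \<mu> assume "\<mu> : X"
  then have \<mu>: "\<mu> : ?\<Omega>" and K\<mu>: "\<And>A k. (A, k) : K ==> emeasure \<mu> A = of_nat k" by (auto simp: K cell_def)
  have "\<exists>m\<le>b. emeasure \<mu> (D i) = of_nat m" if i: "i < n" for i
  proof -
   from eJ[OF i] obtain A k where Ak: "A : e i" "(A, k) : K" by (auto simp: J_def)
   have "emeasure \<mu> (D i) <= ?s A \<mu>"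
    using i Ak by (intro member_le_sum) auto
   also have "... = of_nat k" using sum[OF _ \<mu>, of A] Ak K\<mu> by force
   finally have le: "emeasure \<mu> (D i) <= of_nat k" .
   moreover have "emeasure \<mu> (D i) : \<nat> \<union> {\<infinity>}"
    using \<mu> Dm by (auto simp: space_CM integer_valued_measure_def)
   ultimately obtain m where m: "emeasure \<mu> (D i) = of_nat m" by (auto simp: Nats_def top_unique)
   have "k <= b" unfolding b_def using member_le_sum[of "(A, k)" K snd] Ak K(2) by simp
   then show ?thesis using le m by (intro exI[of _ m]) simp
  qed
  then obtain m where m: "\<And>i. i < n ==> m i <= b \<and> emeasure \<mu> (D i) = of_nat (m i)" by metis
  define m' where "m' = restrict m {..<n}"
  have "m' : MM"
   unfolding MM_def
  proof (intro CollectI conjI ballI)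
   show "m' : {..<n} \<rightarrow>\<^sub>E {..b}" using m by (auto simp: m'_def)
   fix p assume "p : K"
   then obtain A k where p: "p = (A, k)" "(A, k) : K" by (cases p) auto
   have "of_nat (\<Sum>i | i < n \<and> A : e i. m' i) = ?s A \<mu>"
    using m by (auto simp: m'_def intro!: sum.cong)
   also have "... = of_nat k" using sum[OF _ \<mu>, of A] K\<mu>[OF p(2)] p by force
   finally show "case p of (A, k) => (\<Sum>i | i < n \<and> A : e i. m' i) = k" by (simp add: p del: of_nat_sum)
  qed
  moreover have "\<mu> : Y m'" using \<mu> m by (auto simp: Y_def m'_def)
  ultimately show "\<mu> : (\<Union>m\<in>MM. Y m)" by blast
 next
  fix \<mu> assume "\<mu> : (\<Union>m\<in>MM. Y m)"
  then obtain m where m: "m : MM" "\<mu> : Y m" by blast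
  then have \<mu>: "\<mu> : ?\<Omega>" by (simp add: Y_def)
  have "emeasure \<mu> A = of_nat k" if Ak: "(A, k) : K" for A k
  proof -
   have "A : fst ` K" using Ak by force
   from sum[OF this \<mu>] have "emeasure \<mu> A = ?s A \<mu>" .
   also have "... = (\<Sum>i | i < n \<and> A : e i. of_nat (m i))"
    using m(2) by (intro sum.cong) (auto simp: Y_def)
   also have "... = of_nat k" using m(1) Ak by (auto simp: MM_def simp flip: of_nat_sum)
   finally show ?thesis .
  qed
  then show "\<mu> : X" using \<mu> by (auto simp: K cell_def)
 qed
 have dY: "disjoint_family_on Y MM"
  unfolding disjoint_family_on_def
 proof (intro ballI impI)
  fix m m' assume m: "m : MM" "m' : MM" "m \<noteq> m'"
  then have "\<exists>i<n. m i \<noteq> m' i" unfolding MM_def by (auto simp: PiE_eq_iff[symmetric] fun_eq_iff PiE_def extensional_def) metis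
  then obtain i where "i < n" "m i \<noteq> m' i" by blast
  then show "Y m \<inter> Y m' = {}" by (auto simp: Y_def)
 qed
 have Ym: "Y m : sets (CM M)" for m
 proof -
  have "Y m = cell M ((%i. (D i, m i)) ` {..<n})" by (auto simp: Y_def cell_def)
  then show ?thesis using Dm by (auto intro!: cell_measurable)
 qed
 have "emeasure N X = (\<Sum>m\<in>MM. emeasure N (Y m))" if "sets N = sets (CM M)" for N
  unfolding X using Ym MM dY by (intro sum_emeasure[symmetric]) (auto simp: that)
 moreover have "emeasure N1 (Y m) = emeasure N2 (Y m)" for m
  unfolding Y_def by (rule cells[OF disj]) (insert Dloc Dsub[of B], auto simp: AA_def)
 ultimately show "emeasure N1 X = emeasure N2 X" using N by simp
qed

end

section \<open>The counts of a Poisson process\<close>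

lemma Poi_void:
 assumes L: "finite_measure L" and D: "D : sets L"
 shows "emeasure (Poi L) {xs : space (seqs L). count_in D xs = 0} = ennreal (exp (- measure L D))"
proof -
 interpret L: finite_measure L by fact
 note [measurable] = D
 define S where "S = {xs : space (seqs L). count_in D xs = 0}"
 have [measurable]: "S : sets (seqs L)" unfolding S_def by measurable
 define a where "a = measure L (space L - D)"
 have n: "emeasure (lpow L n) S = ennreal (a ^ n)" for n
 proof (induction n)
  case 0
  show ?case by (simp add: S_def count_in_def nn_integral_lpow_0 indicator_def)
 next
  case (Suc n)
  have "emeasure (lpow L (Suc n)) S = (NINT xs|lpow L (Suc n). indicator S xs)" by (simp del: lpow.simps)
  also have "... = (NINT x|L. NINT xs|lpow L n. indicator (space L - D) x * indicator S xs)"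
   by (subst nn_integral_lpow_Suc[OF L], simp, intro nn_integral_cong) (auto simp: S_def count_in_def indicator_def)
  also have "... = (NINT x|L. indicator (space L - D) x * ennreal (a ^ n))"
   by (intro nn_integral_cong) (simp add: nn_integral_cmult Suc)
  also have "... = ennreal a * ennreal (a ^ n)"
   by (simp add: nn_integral_multc a_def L.emeasure_eq_measure)
  finally show ?case by (simp add: ennreal_mult[symmetric] a_def)
 qed
 have a: "a = measure L (space L) - measure L D" unfolding a_def by (rule L.finite_measure_compl[OF D])
 have "emeasure (Poi L) S = (\<Sum>n. ennreal (exp (- measure L (space L)) * (a ^ n /\<^sub>R fact n)))"
  by (simp add: emeasure_Poi poisson_weight_def n a_def ennreal_mult[symmetric] divide_inverse_commute mult_ac)
 also have "... = ennreal (\<Sum>n. exp (- measure L (space L)) * (a ^ n /\<^sub>R fact n))"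
  by (intro suminf_ennreal2 summable_mult summable_exp_generic) (simp add: a_def)
 also have "(\<Sum>n. exp (- measure L (space L)) * (a ^ n /\<^sub>R fact n)) = exp (- measure L (space L)) * exp a"
  using suminf_mult[OF summable_exp_generic[of a], of "exp (- measure L (space L))"] by (simp add: exp_def)
 also have "... = exp (- measure L D)" by (simp add: exp_add[symmetric] a)
 finally show ?thesis by (simp only: S_def)
qed

lemma point_sum_indicator: "point_sum (%p. indicat_real D (fst p)) xs = real (count_in D xs)"
proof (induction xs)
 case (Cons z xs)
 have "kernel_inv (%p :: 'a * 'a list. indicat_real D (fst p))" by (rule kernel_invI) simp
 moreover have "shift_kernel z (%p. indicat_real D (fst p)) = (%p. indicat_real D (fst p))" by (simp add: shift_kernel_def fun_eq_iff)
 ultimately show ?case using Cons by (simp add: point_sum_Cons count_in_def indicator_def)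
qed (simp add: count_in_def)

definition poisson_mass where
 "poisson_mass l k = l ^ k / fact k * exp (- l)"

text \<open>Mecke's formula is the recursion \<open>(k j + 1) p (k + e j) = l j * p k\<close> for the joint probabilities, which leads back
 to the void probability.\<close>

lemma Poi_counts:
 assumes L: "finite_measure L" and I: "finite I" and D: "\<And>i. i : I ==> D i : sets L" and disj: "disjoint_family_on D I"
 shows "emeasure (Poi L) {xs : space (seqs L). \<forall>i\<in>I. count_in (D i) xs = k i} = (\<Prod>i\<in>I. ennreal (poisson_mass (measure L (D i)) (k i)))"
proof (induction "\<Sum>i\<in>I. k i" arbitrary: k)
 case 0
 then have k0: "k i = 0" if "i : I" for i using that I by simp
 have "{xs : space (seqs L). \<forall>i\<in>I. count_in (D i) xs = k i} = {xs : space (seqs L). count_in (\<Union>i\<in>I. D i) xs = 0}"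
  using k0 by (auto simp: count_in_def filter_empty_conv)
 moreover have "measure L (\<Union>i\<in>I. D i) = (\<Sum>i\<in>I. measure L (D i))"
 proof -
  interpret L: finite_measure L by fact
  show ?thesis using I D disj by (intro L.finite_measure_finite_Union) auto
 qed
 ultimately show ?case
  using Poi_void[OF L, of "\<Union>i\<in>I. D i"] I D k0
  by (simp add: sets.finite_UN poisson_mass_def prod_ennreal exp_sum[OF I, symmetric] sum_negf)
next
 case (Suc b)
 interpret L: finite_measure L by fact
 define S where "S k = {xs : space (seqs L). \<forall>i\<in>I. count_in (D i) xs = k i}" for k
 have Sm[measurable]: "S k : sets (seqs L)" for k
  unfolding S_def using I D by (intro sets.sets_Collect_finite_All) measurable
 from Suc(2) obtain j where j: "j : I" "k j \<noteq> 0" by (metis sum.neutral nat.distinct(1))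
 note [measurable] = D[OF j(1)]
 define k' where "k' = k(j := k j - 1)"
 have sum: "(\<Sum>i\<in>I. k i) = Suc (\<Sum>i\<in>I. k' i)"
  unfolding sum.remove[OF I j(1)] using j by (simp add: k'_def)
 define l where "l = measure L (D j)"
 have IH: "emeasure (Poi L) (S k') = (\<Prod>i\<in>I. ennreal (poisson_mass (measure L (D i)) (k' i)))"
  unfolding S_def by (rule Suc(1)) (use Suc(2) sum in simp)
 define G where "G xs = indicat_real {xs. \<forall>i\<in>I. count_in (D i) xs = k i} xs" for xs
 have [measurable]: "G : bmeas (seqs L)"
 proof -
  have "(%xs. indicat_real (S k) xs) : bmeas (seqs L)" by measurable
  then show ?thesis by (rule iffD1[OF measurable_cong, rotated]) (auto simp: G_def S_def indicator_def)
 qed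
 have Ginv: "perm_inv G"
 proof (rule perm_invI)
  fix xs ys :: "'a list" assume "mset xs = mset ys"
  from count_in_mset[OF this] show "G xs = G ys" by (simp only: G_def indicator_def mem_Collect_eq)
 qed
 have vinv: "kernel_inv (%p :: 'a * 'a list. indicat_real (D j) (fst p))" by (rule kernel_invI) simp
 define f where "f p = indicat_real (D j) (fst p) * G (fst p # snd p)" for p
 have f0: "0 <= f p" for p by (simp add: f_def G_def)
 have finv: "kernel_inv f"
 proof (rule kernel_invI)
  fix x and xs ys :: "'a list" assume "mset xs = mset ys"
  then have "G (x # xs) = G (x # ys)" by (intro perm_invD[OF Ginv]) simp
  then show "f (x, xs) = f (x, ys)" by (simp only: f_def fst_conv snd_conv)
 qed
 have [measurable]: "f : bmeas (L >< seqs L)" unfolding f_def [abs_def] by measurable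
 have GS: "G (x # xs) = indicator (S k') xs" if "x : D j" "xs : space (seqs L)" for x xs
 proof -
  have "count_in (D i) (x # xs) = k i \<longleftrightarrow> count_in (D i) xs = k' i" if i: "i : I" for i
  proof (cases "i = j")
   case True
   then show ?thesis using \<open>x : D j\<close> j by (auto simp: count_in_def k'_def)
  next
   case False
   then have "x \<notin> D i" using disj i j \<open>x : D j\<close> by (auto simp: disjoint_family_on_def)
   then show ?thesis using False by (simp add: count_in_def k'_def)
  qed
  then show ?thesis using that by (simp add: G_def S_def indicator_def)
 qed
 have "of_nat (k j) * emeasure (Poi L) (S k) = (NINT xs|Poi L. of_nat (k j) * indicator (S k) xs)"
  by (simp add: nn_integral_cmult)
 also have "... = (NINT xs|Poi L. point_sum (%p. ennreal (f p)) xs)"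
 proof (rule nn_integral_cong)
  fix xs assume xs: "xs : space (Poi L)"
  have "point_sum (%p. ennreal (f p)) xs = ennreal (point_sum f xs)" using point_sum_nonneg_ennreal[OF finv f0] by simp
  also have "point_sum f xs = real (count_in (D j) xs) * G xs"
   unfolding f_def point_sum_mult[OF vinv Ginv] point_sum_indicator ..
  also have "ennreal ... = of_nat (k j) * indicator (S k) xs"
   using xs j by (auto simp: G_def S_def indicator_def ennreal_of_nat_eq_real_of_nat)
  finally show "of_nat (k j) * indicator (S k) xs = point_sum (%p. ennreal (f p)) xs" by simp
 qed
 also have "... = (NINT xs|Poi L. NINT x|L. ennreal (f (x, xs)))"
  by (rule nn_integral_point_sum[OF L _ kernel_inv_comp[OF finv]]) measurable
 also have "... = (NINT xs|Poi L. NINT x|L. indicator (D j) x * indicator (S k') xs)"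
  using GS by (intro nn_integral_cong) (auto simp: f_def indicator_def)
 also have "... = ennreal l * emeasure (Poi L) (S k')"
  by (simp add: nn_integral_multc nn_integral_cmult l_def L.emeasure_eq_measure)
 also have "... = ennreal l * (\<Prod>i\<in>I. ennreal (poisson_mass (measure L (D i)) (k' i)))" by (simp only: IH)
 also have "... = of_nat (k j) * (\<Prod>i\<in>I. ennreal (poisson_mass (measure L (D i)) (k i)))"
 proof -
  have m0: "0 <= poisson_mass (measure L A) m" for A m by (simp add: poisson_mass_def)
  have "l * poisson_mass l (k j - 1) = real (k j) * poisson_mass l (k j)"
   using j(2) by (cases "k j") (simp_all add: poisson_mass_def del: of_nat_Suc)
  moreover have "(\<Prod>i\<in>I - {j}. poisson_mass (measure L (D i)) (k' i)) = (\<Prod>i\<in>I - {j}. poisson_mass (measure L (D i)) (k i))"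
   by (rule prod.cong) (auto simp: k'_def)
  ultimately have "l * (\<Prod>i\<in>I. poisson_mass (measure L (D i)) (k' i)) = real (k j) * (\<Prod>i\<in>I. poisson_mass (measure L (D i)) (k i))"
   unfolding prod.remove[OF I j(1)] by (simp add: k'_def l_def mult.assoc[symmetric])
  then have "ennreal (l * (\<Prod>i\<in>I. poisson_mass (measure L (D i)) (k' i))) = ennreal (real (k j) * (\<Prod>i\<in>I. poisson_mass (measure L (D i)) (k i)))" by simp
  then show ?thesis
   by (simp add: ennreal_mult prod_nonneg m0 l_def prod_ennreal ennreal_of_nat_eq_real_of_nat)
 qed
 finally have "of_nat (k j) * emeasure (Poi L) (S k) = of_nat (k j) * (\<Prod>i\<in>I. ennreal (poisson_mass (measure L (D i)) (k i)))" .
 then show ?case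
  unfolding S_def using j(2) by (subst (asm) ennreal_mult_cancel_left) (auto simp: of_nat_eq_0_iff)
qed

section \<open>Resampling a Poisson process inside a set of finite intensity\<close>

context
 fixes P :: "'w measure" and M :: "'x measure" and \<eta> :: "'w => 'x measure" and E :: "nat => 'x set"
 assumes P: "prob_space P" and E: "range E \<subseteq> sets M" "incseq E" "(\<Union>i. E i) = space M" and E_fin: "\<And>i. emeasure M (E i) < \<infinity>"
  and \<eta>: "poisson_process P M \<eta>"
begin

interpretation P: prob_space P by (rule P)

abbreviation "local_intensity k \<equiv> density M (indicator (E k))"

lemma \<eta>_measurable [measurable]: "\<eta> : P ->M CM M"
 using \<eta> by (simp add: poisson_process_def)

lemma E_sets: "E k : sets M" using E(1) by auto

lemma emeasure_local: "A : sets M ==> emeasure (local_intensity k) A = emeasure M (E k \<inter> A)"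
 by (rule emeasure_restricted[OF E_sets])

lemma finite_local: "finite_measure (local_intensity k)"
proof
 have "E k \<inter> space M = E k" using sets.sets_into_space[OF E_sets] by auto
 then show "emeasure (local_intensity k) (space (local_intensity k)) \<noteq> \<infinity>"
  using emeasure_local[of "space M" k] E_fin[of k] by (simp add: less_top)
qed

lemma process_count:
 assumes "A : sets M" "emeasure M A < \<infinity>"
 shows "measure P {w : space P. emeasure (\<eta> w) A = of_nat k} = poisson_mass (measure M A) k"
 using \<eta> assms unfolding poisson_process_def poisson_mass_def by (elim conjE) (drule (1) bspec, drule (1) mp, erule spec)

lemma process_independent:
 fixes n :: nat
 assumes "D ` {..<n} \<subseteq> sets M" "disjoint_family_on D {..<n}"
 shows "P.indep_vars (%_. borel) (%i w. emeasure (\<eta> w) (D i)) {..<n}"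
 using \<eta> assms unfolding poisson_process_def by (elim conjE) (erule allE, erule allE, erule mp, rule conjI)

lemma process_counts:
 fixes n :: nat
 assumes I: "finite I" "I \<subseteq> {..<n}" and D: "disjoint_family_on D {..<n}" "\<And>i. i < n ==> D i : sets M \<and> emeasure M (D i) < \<infinity>"
 shows "emeasure P {w : space P. \<forall>i\<in>I. emeasure (\<eta> w) (D i) = of_nat (k i)} = (\<Prod>i\<in>I. ennreal (poisson_mass (measure M (D i)) (k i)))"
proof (cases "I = {}")
 case False
 let ?v = "%i. (%w. emeasure (\<eta> w) (D i))"
 have "P.indep_vars (%_. borel) (%i w. emeasure (\<eta> w) (D i)) {..<n}"
  by (rule process_independent[OF _ D(1)]) (use D(2) in auto)
 from P.indep_varsD[OF this False I, of "%i. {of_nat (k i)}"]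
 have "P.prob (\<Inter>i\<in>I. ?v i -` {of_nat (k i)} \<inter> space P)
  = (\<Prod>i\<in>I. P.prob (?v i -` {of_nat (k i)} \<inter> space P))" by simp
 also have "... = (\<Prod>i\<in>I. poisson_mass (measure M (D i)) (k i))"
 proof (rule prod.cong[OF refl])
  fix i assume "i : I"
  then have "D i : sets M" "emeasure M (D i) < \<infinity>" using I D(2)[of i] by auto
  note process_count[OF this, of "k i"]
  moreover have "?v i -` {of_nat (k i)} \<inter> space P = {w : space P. emeasure (\<eta> w) (D i) = of_nat (k i)}" by auto
  ultimately show "P.prob (?v i -` {of_nat (k i)} \<inter> space P) = poisson_mass (measure M (D i)) (k i)"
   by simp
 qed
 also have "(\<Inter>i\<in>I. ?v i -` {of_nat (k i)} \<inter> space P) = {w : space P. \<forall>i\<in>I. emeasure (\<eta> w) (D i) = of_nat (k i)}"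
  using False by auto
 finally show ?thesis
  by (simp add: P.emeasure_eq_measure prod_ennreal poisson_mass_def)
qed (simp add: P.emeasure_space_1)

text \<open>By \<open>counting_law_unique\<close> it suffices to compare the counts of disjoint sets each of which lies inside or outside
 \<open>E k\<close>: the former are given by the new points, the latter by the old ones, and the two groups are independent with Poisson counts.\<close>

lemma resampling:
 "distr P (CM M) \<eta> = distr (P >< Poi (local_intensity k)) (CM M) (%(w, xs). config (E k) (\<eta> w) xs)"
proof (rule counting_law_unique[OF E, of _ _ "E k"])
 let ?L = "local_intensity k"
 let ?g = "(%(w, xs). config (E k) (\<eta> w) xs)"
 interpret L: finite_measure ?L by (rule finite_local)
 interpret Q: prob_space "Poi ?L" by (rule prob_space_Poi[OF finite_local])
 interpret PQ: pair_prob_space P "Poi ?L" ..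
 note [measurable] = E_sets
 have cm[measurable]: "?g : P >< Poi ?L ->M CM M"
  unfolding split_def by (rule measurable_config[OF E_sets, of ?L]) simp_all
 show "prob_space (distr P (CM M) \<eta>)" by (rule P.prob_space_distr) measurable
 show "prob_space (distr (P >< Poi ?L) (CM M) ?g)"
  by (rule PQ.prob_space_distr) measurable
 show "E k : local_sets M E" using E_sets by (auto simp: local_sets_def[OF E])
 fix n :: nat and D c
 assume disj: "disjoint_family_on D {..<n}" and D: "\<And>i. i < n ==> D i : local_sets M E \<and> (D i \<subseteq> E k \<or> D i \<inter> E k = {})"
 have Dm: "D i : sets M" and Df: "emeasure M (D i) < \<infinity>" if i: "i < n" for i
 proof -
  from D[OF i] obtain j where j: "D i : sets M" "D i \<subseteq> E j" by (auto simp: local_sets_def[OF E])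
  then show "D i : sets M" "emeasure M (D i) < \<infinity>"
   using emeasure_mono[OF j(2) E_sets] E_fin[of j] by (auto intro: le_less_trans)
 qed
 define In where "In = {i. i < n \<and> D i \<subseteq> E k}"
 let ?m = "%i. (poisson_mass (measure M (D i)) (c i))"
 define Out where "Out = {..<n} - In"
 define X where "X = {\<mu> : space (CM M). \<forall>i<n. emeasure \<mu> (D i) = of_nat (c i)}"
 define A where "A = {w : space P. \<forall>i\<in>Out. emeasure (\<eta> w) (D i) = of_nat (c i)}"
 define C where "C = {xs : space (seqs ?L). \<forall>i\<in>In. count_in (D i) xs = c i}"
 have fin: "finite In" "finite Out" "In \<subseteq> {..<n}" "Out \<subseteq> {..<n}" "In \<inter> Out = {}" "In \<union> Out = {..<n}" by (auto simp: In_def Out_def)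
 have out: "D i \<inter> E k = {}" if "i : Out" for i using D[of i] that by (auto simp: Out_def In_def)
 have ev[measurable]: "(%\<mu>. emeasure \<mu> (D i)) : bmeas (CM M)" if "i < n" for i
  using Dm[OF that] by (rule measurable_evaluation)
 have Xm[measurable]: "X : sets (CM M)"
 proof -
  have "X = cell M ((%i. (D i, c i)) ` {..<n})" by (auto simp: X_def cell_def)
  then show ?thesis using Dm by (auto intro!: cell_measurable[OF E])
 qed
 have Am[measurable]: "A : sets P"
  unfolding A_def using fin by (intro sets.sets_Collect_finite_All) (auto intro!: measurable_compose[OF \<eta>_measurable ev] borel_measurable_eq)
 have Cm[measurable]: "C : sets (seqs ?L)"
  unfolding C_def using fin Dm by (intro sets.sets_Collect_finite_All) (auto intro!: pred_sets2 measurable_count_in simp: In_def)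
 have 1: "emeasure (distr P (CM M) \<eta>) X = (\<Prod>i<n. ennreal (?m i))"
 proof -
  have "\<eta> -` X \<inter> space P = {w : space P. \<forall>i\<in>{..<n}. emeasure (\<eta> w) (D i) = of_nat (c i)}"
   using measurable_space[OF \<eta>_measurable] by (auto simp: X_def)
  then show ?thesis
   using process_counts[OF finite_lessThan order_refl disj, of c] Dm Df by (simp add: emeasure_distr)
 qed
 have null: "AE xs in Poi ?L. count_in (D i) xs = 0" if "i : Out" for i
 proof -
  have i: "D i : sets M" "E k \<inter> D i = {}" using out[OF that] Dm that fin by auto
  have "emeasure (Poi ?L) {xs : space (seqs ?L). count_in (D i) xs = 0} = 1"
   using Poi_void[OF finite_local, of "D i" k] emeasure_local[OF i(1), of k] i by (simp add: measure_def)
  then show ?thesis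
   using Q.prob_Collect_eq_1[of "%xs. count_in (D i) xs = 0"] i by (simp add: Q.emeasure_eq_measure)
 qed
 have "emeasure (distr (P >< Poi ?L) (CM M) ?g) X
   = (NINT q|(P >< Poi ?L). indicator X (case q of (w, xs) => config (E k) (\<eta> w) xs))"
  by (subst nn_integral_distr[OF cm, symmetric]) simp_all
 also have "... = (NINT w|P. NINT xs|Poi ?L. indicator X (config (E k) (\<eta> w) xs))"
 proof (subst Q.nn_integral_fst[symmetric])
  show "(%q. indicator X (case q of (w, xs) => config (E k) (\<eta> w) xs) :: ennreal) : bmeas (P >< Poi ?L)"
   by (rule measurable_compose[OF cm]) measurable
 qed simp
 also have "... = (NINT w|P. NINT xs|Poi ?L. indicator A w * indicator C xs)"
 proof (rule nn_integral_cong, rule nn_integral_cong_AE)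
  fix w assume w: "w : space P"
  then have \<mu>: "\<eta> w : space (CM M)" by (rule measurable_space[OF \<eta>_measurable])
  then have s: "sets (\<eta> w) = sets M" by (simp add: space_CM)
  have "AE xs in Poi ?L. \<forall>i\<in>Out. count_in (D i) xs = 0"
   using null fin by (intro AE_finite_allI) auto
  then show "AE xs in Poi ?L. indicator X (config (E k) (\<eta> w) xs) = (indicator A w * indicator C xs :: ennreal)"
   using AE_space
  proof eventually_elim
   case (elim xs)
   have e: "emeasure (config (E k) (\<eta> w) xs) (D i) = emeasure (\<eta> w) (D i - E k) + of_nat (count_in (D i) xs)" if "i < n" for i
    using Dm[OF that] E_sets s by (intro emeasure_config) simp_all
   have "emeasure (config (E k) (\<eta> w) xs) (D i) = emeasure (\<eta> w) (D i)" if "i : Out" for i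
    using e[of i] out[OF that] elim(1) that fin by (auto simp: Diff_triv)
   moreover have "emeasure (config (E k) (\<eta> w) xs) (D i) = of_nat (count_in (D i) xs)" if "i : In" for i
   proof -
    have "D i - E k = {}" using that by (auto simp: In_def)
    then have "emeasure (\<eta> w) (D i - E k) = 0" by (simp only: emeasure_empty)
    then show ?thesis using e[of i] that by (simp add: In_def)
   qed
   ultimately have "config (E k) (\<eta> w) xs : X \<longleftrightarrow> w : A \<and> xs : C"
   proof -
    have "(\<forall>i<n. p i) \<longleftrightarrow> (\<forall>i\<in>Out. p i) \<and> (\<forall>i\<in>In. p i)" for p using fin(6) by auto
    moreover assume "\<And>i. i : Out ==> emeasure (config (E k) (\<eta> w) xs) (D i) = emeasure (\<eta> w) (D i)"
     "\<And>i. i : In ==> emeasure (config (E k) (\<eta> w) xs) (D i) = of_nat (count_in (D i) xs)"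
    ultimately show ?thesis
     using config_in_space[OF \<mu> E_sets] w elim(2) by (simp add: X_def A_def C_def)
   qed
   then show ?case by (auto simp: indicator_def)
  qed
 qed
 also have "... = emeasure P A * emeasure (Poi ?L) C"
  by (simp add: nn_integral_cmult nn_integral_multc)
 also have "emeasure P A = (\<Prod>i\<in>Out. ennreal (?m i))"
  unfolding A_def by (rule process_counts[OF fin(2,4) disj]) (use Dm Df in auto)
 also have "emeasure (Poi ?L) C = (\<Prod>i\<in>In. ennreal (poisson_mass (measure ?L (D i)) (c i)))"
  unfolding C_def by (rule Poi_counts[OF finite_local fin(1)]) (insert Dm disj fin, auto simp: In_def intro: disjoint_family_on_mono)
 also have "... = (\<Prod>i\<in>In. ennreal (?m i))"
 proof (rule prod.cong[OF refl])
  fix i assume "i : In"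
  then have "E k \<inter> D i = D i" "D i : sets M" using Dm by (auto simp: In_def)
  then show "ennreal (poisson_mass (measure ?L (D i)) (c i)) = ennreal (?m i)"
   using emeasure_local[of "D i" k] by (simp add: measure_def)
 qed
 also have "(\<Prod>i\<in>Out. ennreal (?m i)) * ... = (\<Prod>i<n. ennreal (?m i))"
  using prod.union_disjoint[OF fin(1,2,5), of "%i. ennreal (?m i)"] fin(6) by (simp add: mult.commute)
 finally show "emeasure (distr P (CM M) \<eta>) {\<mu> : space (CM M). \<forall>i<n. emeasure \<mu> (D i) = of_nat (c i)}
  = emeasure (distr (P >< Poi ?L) (CM M) ?g) {\<mu> : space (CM M). \<forall>i<n. emeasure \<mu> (D i) = of_nat (c i)}"
  using 1 by (simp only: X_def)
qed simp_all

lemma nn_integral_resampling: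
 assumes T[measurable]: "T : bmeas (CM M)"
 shows "(NINT w|P. T (\<eta> w)) = (NINT p|Psp P (local_intensity k). T (config (E k) (\<eta> (fst p)) (snd p)))"
proof -
 have cm: "(%(w, xs). config (E k) (\<eta> w) xs) : P >< Poi (local_intensity k) ->M CM M"
  unfolding split_def by (rule measurable_config[OF E_sets, of "local_intensity k"]) simp_all
 have "(NINT w|P. T (\<eta> w)) = (NINT \<mu>|distr P (CM M) \<eta>. T \<mu>)"
  by (rule nn_integral_distr[symmetric]) measurable
 also have "... = (NINT q|(P >< Poi (local_intensity k)). T (case q of (w, xs) => config (E k) (\<eta> w) xs))"
  unfolding resampling[of k] by (rule nn_integral_distr[OF cm]) (simp add: T)
 finally show ?thesis by (simp add: Psp_def split_def)
qed

end

declare \<eta>_measurable [measurable del]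

section \<open>A zero-one law\<close>

context
 fixes P :: "'w measure" and M :: "'x measure" and \<eta> :: "'w => 'x measure" and E :: "nat => 'x set"
 assumes P: "prob_space P" and E: "range E \<subseteq> sets M" "incseq E" "(\<Union>i. E i) = space M" and E_fin: "\<And>i. emeasure M (E i) < \<infinity>"
  and \<eta>: "poisson_process P M \<eta>"
begin

abbreviation "local_part k \<equiv> density M (indicator (E k))"
abbreviation "resampled k p \<equiv> config (E k) (\<eta> (fst p)) (snd p)"

interpretation P: prob_space P by (rule P)

lemmas process_measurable [measurable] = \<eta>_measurable[OF P E E_fin \<eta>]
lemmas finite_part = finite_local[OF P E E_fin \<eta>]
lemmas nn_integral_resampled = nn_integral_resampling[OF P E E_fin \<eta>]

lemma resampled_measurable [measurable]: "resampled k : P >< seqs (local_part k) ->M CM M"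
 by (rule measurable_config[of _ _ "local_part k"]) (use E(1) in auto)

text \<open>The conditional expectation of \<open>T \<eta>\<close> given the points outside \<open>E k\<close>.\<close>

definition cmean where "cmean k T w = (LINT xs|Poi (local_part k). T (config (E k) (\<eta> w) xs))"

definition deviation where "deviation k T = (NINT w|P. eabs (cmean k T w - (LINT w|P. T (\<eta> w))))"

context
 fixes k :: nat
begin

interpretation Q: prob_space "Poi (local_part k)" by (rule prob_space_Poi[OF finite_part])
interpretation PQ: pair_prob_space P "Poi (local_part k)" ..

lemma resampled_slice [measurable]: "w : space P ==> config (E k) (\<eta> w) : seqs (local_part k) ->M CM M"
 using measurable_compose[OF measurable_Pair1' resampled_measurable[of k]] by simp

lemma cmean_measurable [measurable]:
 fixes T :: "'x measure => real"
 assumes [measurable]: "T : bmeas (CM M)" shows "cmean k T : bmeas P"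
proof -
 have "(%p. T (resampled k p)) : bmeas (P >< Poi (local_part k))" by measurable
 then have "(%w. LINT xs|Poi (local_part k). T (resampled k (w, xs))) : bmeas P" by measurable
 then show ?thesis by (simp add: cmean_def [abs_def])
qed

lemma integrable_resampled:
 fixes T :: "'x measure => real"
 assumes T[measurable]: "T : bmeas (CM M)" and int: "integrable P (%w. T (\<eta> w))"
 shows "integrable (Psp P (local_part k)) (%p. T (resampled k p))"
proof (rule integrableI_bounded)
 show "(%p. T (resampled k p)) : bmeas (Psp P (local_part k))" by measurable
 have "(NINT p|Psp P (local_part k). ennreal (norm (T (resampled k p)))) = (NINT w|P. ennreal (norm (T (\<eta> w))))"
  by (rule nn_integral_resampled[symmetric]) measurable
 then show "(NINT p|Psp P (local_part k). ennreal (norm (T (resampled k p)))) < \<infinity>"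
  using int by (simp add: integrable_iff_bounded)
qed

lemma AE_integrable_resampled:
 fixes T :: "'x measure => real"
 assumes "T : bmeas (CM M)" "integrable P (%w. T (\<eta> w))"
 shows "AE w in P. integrable (Poi (local_part k)) (%xs. T (config (E k) (\<eta> w) xs))"
 using PQ.AE_integrable_fst'[OF integrable_resampled[OF assms, unfolded Psp_def]] by simp

lemma integral_resampled:
 fixes T :: "'x measure => real"
 assumes T[measurable]: "T : bmeas (CM M)" and int: "integrable P (%w. T (\<eta> w))"
 shows "(LINT p|Psp P (local_part k). T (resampled k p)) = (LINT w|P. T (\<eta> w))"
  and "(LINT w|P. cmean k T w) = (LINT w|P. T (\<eta> w))" and "integrable P (cmean k T)"
proof -
 have "(LINT w|P. T (\<eta> w)) = (LINT \<mu>|distr P (CM M) \<eta>. T \<mu>)" by (rule integral_distr[symmetric]) measurable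
 also have "... = (LINT q|(P >< Poi (local_part k)). T (case q of (w, xs) => config (E k) (\<eta> w) xs))"
  unfolding resampling[OF P E E_fin \<eta>, of k] split_def by (rule integral_distr) measurable
 finally show 1: "(LINT p|Psp P (local_part k). T (resampled k p)) = (LINT w|P. T (\<eta> w))"
  by (simp add: Psp_def split_def)
 note i = integrable_resampled[OF T int, unfolded Psp_def]
 show "(LINT w|P. cmean k T w) = (LINT w|P. T (\<eta> w))"
  unfolding 1[symmetric] Psp_def using PQ.integral_fst'[OF i] by (simp add: cmean_def)
 show "integrable P (cmean k T)" using PQ.integrable_fst'[OF i] by (simp add: cmean_def [abs_def])
qed

lemma cmean_diff_le:
 fixes T S :: "'x measure => real"
 assumes T: "T : bmeas (CM M)" "integrable P (%w. T (\<eta> w))"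
  and S: "S : bmeas (CM M)" "integrable P (%w. S (\<eta> w))"
 shows "(NINT w|P. eabs (cmean k T w - cmean k S w)) <= (NINT w|P. eabs (T (\<eta> w) - S (\<eta> w)))"
proof -
 note [measurable] = T(1) S(1)
 have "(NINT w|P. eabs (cmean k T w - cmean k S w))
   <= (NINT w|P. NINT xs|Poi (local_part k). eabs (T (config (E k) (\<eta> w) xs) - S (config (E k) (\<eta> w) xs)))"
 proof (rule nn_integral_mono_AE)
  show "AE w in P. eabs (cmean k T w - cmean k S w)
   <= (NINT xs|Poi (local_part k). eabs (T (config (E k) (\<eta> w) xs) - S (config (E k) (\<eta> w) xs)))"
   using AE_integrable_resampled[OF T] AE_integrable_resampled[OF S]
  proof eventually_elim
   case (elim w)
   then show ?case
    unfolding cmean_def Bdiff[OF elim, symmetric] real_norm_def[symmetric]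
    by (intro integral_norm_bound_ennreal Bidiff)
  qed
 qed
 also have "... = (NINT p|Psp P (local_part k). eabs (T (resampled k p) - S (resampled k p)))"
  by (subst nn_integral_Psp[OF finite_part]) simp_all
 also have "... = (NINT w|P. eabs (T (\<eta> w) - S (\<eta> w)))"
  by (rule nn_integral_resampled[symmetric]) measurable
 finally show ?thesis .
qed

lemma deviation_le:
 fixes T S :: "'x measure => real"
 assumes T: "T : bmeas (CM M)" "integrable P (%w. T (\<eta> w))"
  and S: "S : bmeas (CM M)" "integrable P (%w. S (\<eta> w))"
 shows "deviation k T <= deviation k S + 2 * (NINT w|P. eabs (T (\<eta> w) - S (\<eta> w)))"
proof -
 note [measurable] = T(1) S(1)
 let ?d = "NINT w|P. eabs (T (\<eta> w) - S (\<eta> w))" and ?t = "LINT w|P. T (\<eta> w)" and ?s = "LINT w|P. S (\<eta> w)"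
 have d: "eabs (?t - ?s) <= ?d"
  unfolding Bdiff[OF T(2) S(2), symmetric] real_norm_def[symmetric]
  by (intro integral_norm_bound_ennreal Bidiff T S)
 have "deviation k T <= (NINT w|P. eabs (cmean k T w - cmean k S w) + eabs (cmean k S w - ?s) + eabs (?t - ?s))"
  unfolding deviation_def by (intro nn_integral_mono) (simp add: ennreal_plus[symmetric] ennreal_leI del: ennreal_plus)
 also have "... = (NINT w|P. eabs (cmean k T w - cmean k S w)) + deviation k S + eabs (?t - ?s)"
  by (simp add: nn_integral_add deviation_def P.emeasure_space_1)
 also have "... <= ?d + deviation k S + ?d"
  by (intro add_mono cmean_diff_le[OF T S] d order_refl)
 finally show ?thesis by (simp add: mult_2 add_ac)
qed

end

text \<open>The functionals whose conditional expectation given the points outside \<open>E k\<close> converges to the expectation.\<close>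

definition forgotten where
 "forgotten T \<longleftrightarrow> T : bmeas (CM M) \<and> integrable P (%w. T (\<eta> w)) \<and> (%k. deviation k T) \<longlonglongrightarrow> 0"

lemma forgotten_limit:
 assumes s: "\<And>i. forgotten (s i)" and T[measurable]: "T : bmeas (CM M)" and int: "integrable P (%w. T (\<eta> w))"
  and lim: "\<And>\<mu>. \<mu> : space (CM M) ==> (%i. s i \<mu>) \<longlonglongrightarrow> T \<mu>"
  and b: "\<And>i \<mu>. \<mu> : space (CM M) ==> \<bar>s i \<mu>\<bar> <= 2 * \<bar>T \<mu>\<bar>"
 shows "forgotten T"
proof -
 have sm[measurable]: "s i : bmeas (CM M)" and si: "integrable P (%w. s i (\<eta> w))" and sd: "(%k. deviation k (s i)) \<longlonglongrightarrow> 0" for i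
  using s[of i] by (simp_all add: forgotten_def)
 note \<eta>s = measurable_space[OF process_measurable]
 define e where "e i = 2 * (NINT w|P. eabs (T (\<eta> w) - s i (\<eta> w)))" for i
 have "(%i. NINT w|P. eabs (T (\<eta> w) - s i (\<eta> w))) \<longlonglongrightarrow> (NINT w|P. 0)"
 proof (rule nn_integral_dominated_convergence[where w = "%w. ennreal (3 * \<bar>T (\<eta> w)\<bar>)"])
  show "AE w in P. eabs (T (\<eta> w) - s i (\<eta> w)) <= ennreal (3 * \<bar>T (\<eta> w)\<bar>)" for i
  proof (intro AE_I2 ennreal_leI)
   fix w assume "w : space P"
   from b[OF \<eta>s[OF this], of i] show "\<bar>T (\<eta> w) - s i (\<eta> w)\<bar> <= 3 * \<bar>T (\<eta> w)\<bar>" by linarith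
  qed
  have "integrable P (%w. 3 * T (\<eta> w))" using int by simp
  then show "(NINT w|P. ennreal (3 * \<bar>T (\<eta> w)\<bar>)) < \<infinity>" unfolding integrable_iff_bounded by (simp add: abs_mult)
  show "AE w in P. (%i. eabs (T (\<eta> w) - s i (\<eta> w))) \<longlonglongrightarrow> 0"
  proof (rule AE_I2)
   fix w assume "w : space P"
   from lim[OF \<eta>s[OF this]] have "(%i. T (\<eta> w) - s i (\<eta> w)) \<longlonglongrightarrow> T (\<eta> w) - T (\<eta> w)" by (intro tendsto_intros)
   then have "(%i. eabs (T (\<eta> w) - s i (\<eta> w))) \<longlonglongrightarrow> eabs (T (\<eta> w) - T (\<eta> w))" by (intro tendsto_ennrealI tendsto_rabs)
   then show "(%i. eabs (T (\<eta> w) - s i (\<eta> w))) \<longlonglongrightarrow> 0" by simp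
  qed
 qed measurable
 then have "e \<longlonglongrightarrow> 2 * 0" unfolding e_def by (intro ennreal_tendsto_cmult) simp_all
 moreover have "Limsup sequentially (%k. deviation k T) <= e i" for i
 proof -
  have "Limsup sequentially (%k. deviation k T) <= Limsup sequentially (%k. deviation k (s i) + e i)"
   unfolding e_def by (intro Limsup_mono always_eventually allI deviation_le T int sm si)
  also have "... = 0 + e i"
   by (rule lim_imp_Limsup) (simp, intro tendsto_add sd tendsto_const)
  finally show ?thesis by simp
 qed
 ultimately have "Limsup sequentially (%k. deviation k T) <= 0"
  by (intro LIMSEQ_le_const[of e]) auto
 then have "(%k. deviation k T) \<longlonglongrightarrow> 0" by (intro tendsto_0_if_Limsup_eq_0_ennreal) simp
 then show ?thesis using T int by (simp add: forgotten_def)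
qed

lemma forgotten_linear:
 assumes T: "forgotten T" and S: "forgotten S" shows "forgotten (%\<mu>. a * T \<mu> + b * S \<mu>)"
proof -
 let ?U = "(%\<mu>. a * T \<mu> + b * S \<mu>)"
 from T S have m[measurable]: "T : bmeas (CM M)" "S : bmeas (CM M)"
  and i: "integrable P (%w. T (\<eta> w))" "integrable P (%w. S (\<eta> w))"
  and d: "(%k. deviation k T) \<longlonglongrightarrow> 0" "(%k. deviation k S) \<longlonglongrightarrow> 0" by (simp_all add: forgotten_def)
 have le: "deviation k ?U <= eabs a * deviation k T + eabs b * deviation k S" for k
 proof -
  have "deviation k ?U <= (NINT w|P. eabs a * eabs (cmean k T w - (LINT w|P. T (\<eta> w)))
   + eabs b * eabs (cmean k S w - (LINT w|P. S (\<eta> w))))"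
   unfolding deviation_def
  proof (rule nn_integral_mono_AE)
   show "AE w in P. eabs (cmean k ?U w - (LINT w|P. a * T (\<eta> w) + b * S (\<eta> w)))
    <= eabs a * eabs (cmean k T w - (LINT w|P. T (\<eta> w))) + eabs b * eabs (cmean k S w - (LINT w|P. S (\<eta> w)))"
    using AE_integrable_resampled[OF m(1) i(1), of k] AE_integrable_resampled[OF m(2) i(2), of k]
   proof eventually_elim
    case (elim w)
    have "cmean k ?U w - (LINT w|P. a * T (\<eta> w) + b * S (\<eta> w))
     = a * (cmean k T w - (LINT w|P. T (\<eta> w))) + b * (cmean k S w - (LINT w|P. S (\<eta> w)))"
    proof -
     have 1: "cmean k ?U w = a * cmean k T w + b * cmean k S w" unfolding cmean_def using elim by simp
     have 2: "(LINT w|P. a * T (\<eta> w) + b * S (\<eta> w)) = a * (LINT w|P. T (\<eta> w)) + b * (LINT w|P. S (\<eta> w))" using i by simp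
     show ?thesis unfolding 1 2 by (simp add: algebra_simps)
    qed
    also have "ennreal \<bar>...\<bar> <= ennreal (\<bar>a\<bar> * \<bar>cmean k T w - (LINT w|P. T (\<eta> w))\<bar> + \<bar>b\<bar> * \<bar>cmean k S w - (LINT w|P. S (\<eta> w))\<bar>)"
     unfolding abs_mult[symmetric] by (intro ennreal_leI abs_triangle_ineq)
    finally show ?case by (simp add: ennreal_plus ennreal_mult)
   qed
  qed
  then show ?thesis by (simp add: nn_integral_add nn_integral_cmult deviation_def)
 qed
 have lim: "(%k. eabs a * deviation k T + eabs b * deviation k S) \<longlonglongrightarrow> eabs a * 0 + eabs b * 0"
  by (intro tendsto_add ennreal_tendsto_cmult d) simp_all
 have "(%k. deviation k ?U) \<longlonglongrightarrow> 0"
 proof (rule tendsto_sandwich)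
  show "\<forall>\<^sub>F k in sequentially. 0 <= deviation k ?U" by (intro always_eventually allI zero_le)
  show "\<forall>\<^sub>F k in sequentially. deviation k ?U <= eabs a * deviation k T + eabs b * deviation k S"
   by (intro always_eventually allI le)
  show "(%k. eabs a * deviation k T + eabs b * deviation k S) \<longlonglongrightarrow> 0" using lim by (simp only: mult_zero_right add_0)
 qed (rule tendsto_const)
 then show ?thesis using i by (simp add: forgotten_def)
qed

lemma forgotten_const: "forgotten (%\<mu>. c)"
proof -
 have "deviation k (%\<mu>. c) = 0" for k
 proof -
  interpret Q: prob_space "Poi (local_part k)" by (rule prob_space_Poi[OF finite_part])
  show ?thesis using Q.prob_space by (simp add: deviation_def cmean_def P.prob_space)
 qed
 then show ?thesis by (simp add: forgotten_def)
qed

text \<open>As soon as \<open>E k\<close> contains the sets of the cell, their counts only involve the resampled points, and the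
 conditional mean is constant.\<close>

lemma forgotten_cell:
 assumes K: "finite K" "fst ` K \<subseteq> local_sets M E" shows "forgotten (indicat_real (cell M K))"
proof -
 have Km: "fst ` K \<subseteq> sets M" using K(2) by (auto simp: local_sets_def[OF E])
 have m[measurable]: "cell M K : sets (CM M)" by (rule cell_measurable[OF E K(1) Km])
 have i: "integrable P (%w. indicat_real (cell M K) (\<eta> w))"
  by (rule P.integrable_bounded[where C = 1, OF measurable_compose[OF process_measurable borel_measurable_indicator[OF m]]]) (simp add: indicator_def)
 have "\<forall>p\<in>K. \<exists>j. fst p \<subseteq> E j" using K(2) by (auto simp: local_sets_def[OF E])
 then obtain j where j: "\<And>p. p : K ==> fst p \<subseteq> E (j p)" by metis
 define n where "n = Max (insert 0 (j ` K))"
 have n: "fst p \<subseteq> E k" if "p : K" "n <= k" for p k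
 proof -
  have "j p <= n" unfolding n_def using K(1) that by (intro Max_ge) auto
  then show ?thesis using j[OF that(1)] incseqD[OF E(2), of "j p" k] that(2) by auto
 qed
 have "deviation k (indicat_real (cell M K)) = 0" if k: "n <= k" for k
 proof -
  define c where "c = (LINT xs|Poi (local_part k). (of_bool (\<forall>(A, l)\<in>K. count_in A xs = l) :: real))"
  have c: "cmean k (indicat_real (cell M K)) w = c" if w: "w : space P" for w
  proof -
   note \<mu> = measurable_space[OF process_measurable w]
   have s: "sets (\<eta> w) = sets M" using \<mu> by (simp add: space_CM)
   have Ek: "E k : sets M" using E(1) by auto
   have "emeasure (config (E k) (\<eta> w) xs) A = of_nat (count_in A xs)" if "(A, l) : K" for A l xs
   proof -
    have "A : sets M" "A - E k = {}" using Km n[OF that k] that by auto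
    moreover from this(2) have "emeasure (\<eta> w) (A - E k) = 0" by (simp only: emeasure_empty)
    ultimately show ?thesis using emeasure_config[of A "\<eta> w" "E k" xs] s Ek by simp
   qed
   then have "config (E k) (\<eta> w) xs : cell M K \<longleftrightarrow> (\<forall>(A, l)\<in>K. count_in A xs = l)" for xs
    using config_in_space[OF \<mu> Ek] by (auto simp: cell_def)
   then show ?thesis by (simp add: cmean_def c_def indicator_def of_bool_def)
  qed
  have "(LINT w|P. indicat_real (cell M K) (\<eta> w)) = (LINT w|P. cmean k (indicat_real (cell M K)) w)"
   by (rule integral_resampled(2)[OF _ i, symmetric]) measurable
  also have "... = (LINT w|P. c)" by (rule Bcong[OF c])
  finally show ?thesis unfolding deviation_def by (subst nn_integral_cong[where v = "%_. 0"]) (simp_all add: c P.prob_space)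
 qed
 then have "(%k. deviation k (indicat_real (cell M K))) \<longlonglongrightarrow> 0"
  by (intro tendsto_eventually eventually_sequentiallyI[of n])
 then show ?thesis using i by (simp add: forgotten_def)
qed

lemma forgotten_indicator:
 assumes A: "A : sets (CM M)" shows "forgotten (indicat_real A)"
proof -
 let ?\<Omega> = "space (CM M)"
 have i: "integrable P (%w. indicat_real B (\<eta> w))" if "B : sets (CM M)" for B
  by (rule P.integrable_bounded[where C = 1, OF measurable_compose[OF process_measurable borel_measurable_indicator[OF that]]]) (simp add: indicator_def)
 have "A : sigma_sets ?\<Omega> (cells M E)" using A by (simp only: sets_CM[OF E])
 moreover have "cells M E \<subseteq> Pow ?\<Omega>" by (auto simp: cells_def[OF E] cell_def)
 moreover note Int_stable_cells[OF E]
 ultimately have "A : sigma_sets ?\<Omega> (cells M E)" "cells M E \<subseteq> Pow ?\<Omega>" "Int_stable (cells M E)" by blast+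
 from this(3,2,1) show ?thesis
 proof (induction rule: sigma_sets_induct_disjoint)
  case (basic A)
  then show ?case by (auto simp: cells_def[OF E] intro!: forgotten_cell)
 next
  case empty
  show ?case using forgotten_const[of 0] by simp
 next
  case (compl A)
  then have [measurable]: "A : sets (CM M)" by (simp only: sets_CM[OF E])
  have c: "?\<Omega> - A : sets (CM M)" by measurable
  show ?case
  proof (rule forgotten_limit[of "%_ \<mu>. 1 * 1 + (- 1) * indicat_real A \<mu>"])
   show "forgotten (%\<mu>. 1 * 1 + (- 1) * indicat_real A \<mu>)" by (rule forgotten_linear[OF forgotten_const compl(2)])
   show "integrable P (%w. indicat_real (?\<Omega> - A) (\<eta> w))" by (rule i[OF c])
  qed (insert c, auto simp: indicator_def)
 next
  case (union A)
  then have Am[measurable]: "A n : sets (CM M)" for n by (auto simp: sets_CM[OF E])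
  show ?case
  proof (rule forgotten_limit[of "%n. indicat_real (\<Union>i<n. A i)"])
   fix n
   show "forgotten (indicat_real (\<Union>i<n. A i))"
   proof (induction n)
    case 0
    show ?case using forgotten_const[of 0] by simp
   next
    case (Suc n)
    have "A i \<inter> A n = {}" if "i < n" for i
     using union(1)[unfolded disjoint_family_on_def, rule_format, of i n] that by simp
    then have "(\<Union>i<n. A i) \<inter> A n = {}" by blast
    then have "indicat_real (\<Union>i<Suc n. A i) = (%\<mu>. 1 * indicat_real (\<Union>i<n. A i) \<mu> + 1 * indicat_real (A n) \<mu>)"
     by (auto simp: indicator_def lessThan_Suc fun_eq_iff)
    then show ?case using forgotten_linear[OF Suc union(3)[of n], of 1 1] by (simp only:)
   qed
   show "integrable P (%w. indicat_real (\<Union> (range A)) (\<eta> w))" by (rule i) measurable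
   show "(%n. indicat_real (\<Union>i<n. A i) \<mu>) \<longlonglongrightarrow> indicat_real (\<Union> (range A)) \<mu>" for \<mu>
    by (rule LIMSEQ_indicator_UN)
   show "\<bar>indicat_real (\<Union>i<n. A i) \<mu>\<bar> <= 2 * \<bar>indicat_real (\<Union> (range A)) \<mu>\<bar>" for n \<mu> by (auto simp: indicator_def)
  qed measurable
 qed
qed

text \<open>The class of forgotten functionals is closed under linear combinations and dominated limits, and contains the
 indicators of the cells, which are stable under intersection.\<close>

theorem zero_one_law:
 fixes T :: "'x measure => real"
 assumes T: "T : bmeas (CM M)" and int: "integrable P (%w. T (\<eta> w))"
 shows "(%k. deviation k T) \<longlonglongrightarrow> 0"
proof -
 let ?N = "distr P (CM M) \<eta>"
 have eq: "integrable ?N f \<longleftrightarrow> integrable P (%w. f (\<eta> w))" if "f : bmeas (CM M)" for f :: "'x measure => real"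
  using that by (intro integrable_distr_eq) measurable
 have "integrable ?N T" using eq[OF T] int by simp
 then have "forgotten T"
 proof (induction rule: integrable_induct)
  case (base A c)
  then show ?case using forgotten_linear[OF forgotten_indicator[of A] forgotten_const[of 0], of c 1] by (simp add: mult.commute)
 next
  case (add f g)
  then show ?case using forgotten_linear[of f g 1 1] by simp
 next
  case (lim f s)
  have fm: "f : bmeas (CM M)" using borel_measurable_integrable[OF lim(4)] by simp
  show ?case by (rule forgotten_limit[of s]) (use lim fm eq[OF fm] in auto)
 qed
 then show ?thesis by (simp add: forgotten_def)
qed

end

declare process_measurable [measurable del] resampled_measurable [measurable del]
 resampled_slice [measurable del] cmean_measurable [measurable del]

section \<open>Comparison with the functionals of the process\<close>

lemma measurable_diff_op2 [measurable]:
 assumes [measurable]: "\<phi> : bmeas (CM M)" "f : N ->M M" "g : N ->M M" "h : N ->M CM M"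
 shows "(%w. diff_op (f w) (diff_op (g w) \<phi>) (h w)) : bmeas N"
 unfolding diff_op_def[of _ "diff_op _ _"] by measurable

lemma measurable_diff_op_cut [measurable]:
 assumes [measurable]: "\<phi> : bmeas (CM M)" "u : bmeas borel" "f : N ->M M" "g : N ->M M" "h : N ->M CM M"
 shows "(%w. diff_op (f w) (%\<mu>. u (diff_op (g w) \<phi> \<mu>) * diff_op (g w) \<phi> \<mu>) (h w)) : bmeas N"
proof -
 have "(%w. u (diff_op (g w) \<phi> (add_point (h w) (f w))) * diff_op (g w) \<phi> (add_point (h w) (f w))
  - u (diff_op (g w) \<phi> (h w)) * diff_op (g w) \<phi> (h w)) : bmeas N" by measurable
 then show ?thesis unfolding diff_op_def .
qed

lemma nn_integral_local_le:
 assumes [measurable]: "f : bmeas M" "A : sets M"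
 shows "(NINT z|density M (indicator A). f z) <= (NINT z|M. f z)"
 by (subst nn_integral_density) (auto intro!: nn_integral_mono simp: indicator_def)

context
 fixes P :: "'w measure" and M :: "'x measure" and \<eta> :: "'w => 'x measure" and E :: "nat => 'x set"
  and F :: "'w => real" and \<phi> :: "'x measure => real" and u :: "real => real"
 assumes P: "prob_space P" and E: "range E \<subseteq> sets M" "incseq E" "(\<Union>i. E i) = space M" and E_fin: "\<And>i. emeasure M (E i) < \<infinity>"
  and \<eta>: "poisson_process P M \<eta>" and M: "sigma_finite_measure M"
  and F: "poisson_functional_rep P M \<eta> \<phi> F" and F2: "integrable P (%w. (F w)^2)"
  and DF: "integrable (P >< M) (%(w, z). (diff_op z \<phi> (\<eta> w))^2)"
  and u_meas [measurable]: "u : bmeas borel" and u: "\<And>x. 0 <= u x \<and> u x <= 1"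
begin

interpretation P: prob_space P by (rule P)
interpretation M: sigma_finite_measure M by (rule M)

lemmas eta_measurable [measurable] = \<eta>_measurable[OF P E E_fin \<eta>]
lemmas slice_measurable [measurable] = resampled_measurable[OF P E E_fin \<eta>] resampled_slice[OF P E E_fin \<eta>]

lemma phi_measurable [measurable]: "\<phi> : bmeas (CM M)"
 and F_measurable_P [measurable]: "F : bmeas P" and F_eq: "AE w in P. F w = \<phi> (\<eta> w)"
 using F by (simp_all add: poisson_functional_rep_def)

lemma E_measurable [measurable]: "E k : sets M" using E(1) by auto

abbreviation "J k \<equiv> density M (indicator (E k))"
abbreviation "conf k p \<equiv> config (E k) (\<eta> (fst p)) (snd p)"

text \<open>The representative \<open>\<phi>\<close> as a functional of the points inside \<open>E k\<close>, with the original process as parameter.\<close>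

definition res_fun where "res_fun k p = \<phi> (conf k p)"

lemmas finite_intensity = finite_local[OF P E E_fin \<eta>]

lemma res_fun: "functional P (J k) (res_fun k)"
proof (rule functionalI)
 show "res_fun k : bmeas (P >< seqs (J k))" unfolding res_fun_def [abs_def] by measurable
 fix r and xs ys :: "'x list" assume "mset xs = mset ys"
 from config_mset[OF this] show "res_fun k (r, xs) = res_fun k (r, ys)"
  unfolding res_fun_def fst_conv snd_conv by (simp only:)
qed

lemma dif_resampled: "dif (res_fun k) z p = diff_op z \<phi> (conf k p)"
 by (simp add: dif_def res_fun_def diff_op_def config_Cons)

lemma dif2_resampled: "dif (dif (res_fun k) y) z p = diff_op z (diff_op y \<phi>) (conf k p)"
 unfolding dif_def[of "dif _ _"] dif_resampled by (simp add: diff_op_def[of z] config_Cons)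

lemma damped_resampled: "damped_dif u (res_fun k) z p = u (diff_op z \<phi> (conf k p)) * diff_op z \<phi> (conf k p)"
 by (simp only: damped_dif_def dif_resampled)

lemma dif_damped_resampled: "dif (damped_dif u (res_fun k) y) z p
  = diff_op z (%\<mu>. u (diff_op y \<phi> \<mu>) * diff_op y \<phi> \<mu>) (conf k p)"
 unfolding dif_def[of "damped_dif _ _ _"] damped_resampled by (simp add: diff_op_def config_Cons)

lemma nnE_resampled:
 assumes [measurable]: "S : bmeas (CM M)"
 shows "nnE (Psp P (J k)) (%p. S (conf k p)) = nnE P (%w. S (\<eta> w))"
 unfolding nn_expect_def by (rule nn_integral_resampling[OF P E E_fin \<eta>, symmetric]) measurable

lemma energy_resampled: "energy P (J k) (res_fun k) < \<infinity>"
proof -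
 interpret L: finite_measure "J k" by (rule finite_intensity)
 have "energy P (J k) (res_fun k)
   = (NINT p|Psp P (J k). NINT z|J k. ennreal ((diff_op z \<phi> (conf k p))^2))"
  unfolding energy_def dif_resampled ..
 also have "... = (NINT w|P. NINT z|J k. ennreal ((diff_op z \<phi> (\<eta> w))^2))"
  by (rule nn_integral_resampling[OF P E E_fin \<eta>, symmetric]) measurable
 also have "... <= (NINT w|P. NINT z|M. ennreal ((diff_op z \<phi> (\<eta> w))^2))"
  by (intro nn_integral_mono nn_integral_local_le) measurable
 also have "... = (NINT q|(P >< M). ennreal (norm (case q of (w, z) => (diff_op z \<phi> (\<eta> w))^2)))"
  by (subst M.nn_integral_fst[symmetric]) simp_all
 also have "... < \<infinity>" using DF by (simp add: integrable_iff_bounded)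
 finally show ?thesis .
qed

lemma triple_le:
 assumes [measurable]: "h : bmeas (M >< M >< M)"
 shows "(NINT z1|J k. NINT z2|J k. NINT z3|J k. h (z1, z2, z3)) <= (NINT q|(M >< M >< M). h q)"
proof -
 interpret L: finite_measure "J k" by (rule finite_intensity)
 interpret MM: pair_sigma_finite M M by unfold_locales
 have "(NINT z1|J k. NINT z2|J k. NINT z3|J k. h (z1, z2, z3)) <= (NINT z1|J k. NINT z2|J k. NINT z3|M. h (z1, z2, z3))"
  by (intro nn_integral_mono nn_integral_local_le) measurable
 also have "... <= (NINT z1|J k. NINT z2|M. NINT z3|M. h (z1, z2, z3))"
  by (intro nn_integral_mono nn_integral_local_le) measurable
 also have "... <= (NINT z1|M. NINT z2|M. NINT z3|M. h (z1, z2, z3))"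
  by (intro nn_integral_local_le) measurable
 also have "... = (NINT z1|M. NINT q|(M >< M). h (z1, q))"
  by (intro nn_integral_cong M.nn_integral_fst) measurable
 also have "... = (NINT q|(M >< M >< M). h q)"
  by (rule sigma_finite_measure.nn_integral_fst) (unfold_locales, measurable)
 finally show ?thesis .
qed

lemma pair_le:
 assumes [measurable]: "h : bmeas (M >< M)"
 shows "(NINT z1|J k. NINT z2|J k. h (z1, z2)) <= (NINT q|(M >< M). h q)"
proof -
 interpret L: finite_measure "J k" by (rule finite_intensity)
 have "(NINT z1|J k. NINT z2|J k. h (z1, z2)) <= (NINT z1|J k. NINT z2|M. h (z1, z2))"
  by (intro nn_integral_mono nn_integral_local_le) measurable
 also have "... <= (NINT z1|M. NINT z2|M. h (z1, z2))" by (intro nn_integral_local_le) measurable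
 also have "... = (NINT q|(M >< M). h q)" by (rule M.nn_integral_fst) measurable
 finally show ?thesis .
qed

abbreviation "list_mean k \<equiv> nnE (Psp P (J k))"

text \<open>Each quantity for lists is the corresponding quantity of the theorem, integrated over \<open>E k\<close> only.\<close>

lemma list_gamma1_le: "list_gamma1 P (J k) (res_fun k) <= gamma1 P M \<eta> \<phi>"
 and list_gamma2_le: "list_gamma2 P (J k) (res_fun k) <= gamma2 P M \<eta> \<phi>"
proof -
 define g where "g z1 z2 = rt (nnE P (%w. (diff_op z1 \<phi> (\<eta> w))^2 * (diff_op z2 \<phi> (\<eta> w))^2))" for z1 z2
 define h where "h z1 z2 z3 = nnE P (%w. (diff2_op z1 z3 \<phi> (\<eta> w))^2 * (diff2_op z2 z3 \<phi> (\<eta> w))^2)" for z1 z2 z3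
 have [measurable]: "(%(z1, z2, z3). g z1 z2 * rt (h z1 z2 z3)) : bmeas (M >< M >< M)"
  "(%(z1, z2, z3). h z1 z2 z3) : bmeas (M >< M >< M)"
  unfolding g_def h_def nn_expect_def diff2_op_def split_def by measurable
 have g: "list_mean k (%p. (dif (res_fun k) z1 p)^2 * (dif (res_fun k) z2 p)^2) = nnE P (%w. (diff_op z1 \<phi> (\<eta> w))^2 * (diff_op z2 \<phi> (\<eta> w))^2)"
  if [measurable]: "z1 : space M" "z2 : space M" for z1 z2
  unfolding dif_resampled by (rule nnE_resampled[of "%\<mu>. (diff_op z1 \<phi> \<mu>)^2 * (diff_op z2 \<phi> \<mu>)^2"]) measurable
 have h: "list_mean k (%p. (dif (dif (res_fun k) z3) z1 p)^2 * (dif (dif (res_fun k) z3) z2 p)^2) = h z1 z2 z3"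
  if [measurable]: "z1 : space M" "z2 : space M" "z3 : space M" for z1 z2 z3
  unfolding dif2_resampled h_def diff2_op_def
  by (rule nnE_resampled[of "%\<mu>. (diff_op z1 (diff_op z3 \<phi>) \<mu>)^2 * (diff_op z2 (diff_op z3 \<phi>) \<mu>)^2"]) measurable
 have "list_gamma1 P (J k) (res_fun k)
   = rt (4 * (NINT z1|J k. NINT z2|J k. NINT z3|J k. g z1 z2 * rt (h z1 z2 z3)))"
  unfolding list_gamma1_def g_def by (intro arg_cong2[where f = epowr] arg_cong2[where f = "(*)"] nn_integral_cong refl) (simp_all add: g h)
 also have "... <= gamma1 P M \<eta> \<phi>"
  unfolding gamma1_def g_def[symmetric] h_def[symmetric]
  using triple_le[of "%(z1, z2, z3). g z1 z2 * rt (h z1 z2 z3)" k] by (intro epowr_mono mult_left_mono) simp_all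
 finally show "list_gamma1 P (J k) (res_fun k) <= gamma1 P M \<eta> \<phi>" .
 have "list_gamma2 P (J k) (res_fun k) = rt (NINT z1|J k. NINT z2|J k. NINT z3|J k. h z1 z2 z3)"
  unfolding list_gamma2_def by (intro arg_cong2[where f = epowr] nn_integral_cong refl) (simp add: h)
 also have "... <= gamma2 P M \<eta> \<phi>"
  unfolding gamma2_def h_def[symmetric] using triple_le[of "%(z1, z2, z3). h z1 z2 z3" k] by (intro epowr_mono) simp_all
 finally show "list_gamma2 P (J k) (res_fun k) <= gamma2 P M \<eta> \<phi>" .
qed

lemma list_gamma3_le: "list_gamma3 P (J k) (res_fun k) u <= gamma3_bar P M \<eta> \<phi> u"
proof -
 define g where "g z = rt (nnE P (%w. (diff_op z \<phi> (\<eta> w))^2 * (1 - u (diff_op z \<phi> (\<eta> w)))^2))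
  * rt (nnE P (%w. \<bar>diff_op z \<phi> (\<eta> w)\<bar>^2))" for z
 have [measurable]: "g : bmeas M" unfolding g_def [abs_def] nn_expect_def by measurable
 have "list_gamma3 P (J k) (res_fun k) u = 2 * (NINT z|J k. g z)"
  unfolding list_gamma3_def g_def dif_resampled
 proof (intro arg_cong2[where f = "(*)"] nn_integral_cong arg_cong2[where f = epowr] refl)
  fix z assume "z : space (J k)"
  then have [measurable]: "z : space M" by simp
  show "list_mean k (%p. (diff_op z \<phi> (conf k p))^2 * (1 - u (diff_op z \<phi> (conf k p)))^2)
   = nnE P (%w. (diff_op z \<phi> (\<eta> w))^2 * (1 - u (diff_op z \<phi> (\<eta> w)))^2)"
   by (rule nnE_resampled[of "%\<mu>. (diff_op z \<phi> \<mu>)^2 * (1 - u (diff_op z \<phi> \<mu>))^2"]) measurable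
  show "list_mean k (%p. \<bar>diff_op z \<phi> (conf k p)\<bar>^2) = nnE P (%w. \<bar>diff_op z \<phi> (\<eta> w)\<bar>^2)"
   by (rule nnE_resampled[of "%\<mu>. \<bar>diff_op z \<phi> \<mu>\<bar>^2"]) measurable
 qed
 also have "... <= 2 * (NINT z|M. g z)" by (intro mult_left_mono nn_integral_local_le) simp_all
 finally show ?thesis unfolding gamma3_bar_def g_def .
qed

lemma fourth_moments_resampled:
 assumes [measurable]: "z : space M"
 shows "list_mean k (%p. (dif (res_fun k) z p)^4) = nnE P (%w. (diff_op z \<phi> (\<eta> w))^4)"
  and "list_mean k (%p. (u (dif (res_fun k) z p))^2 * (dif (res_fun k) z p)^4) = nnE P (%w. (u (diff_op z \<phi> (\<eta> w)))^2 * (diff_op z \<phi> (\<eta> w))^4)"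
  and "list_mean k (%p. (dif (res_fun k) z p)^4 * (u (dif (res_fun k) z p))^2) = nnE P (%w. (diff_op z \<phi> (\<eta> w))^4 * (u (diff_op z \<phi> (\<eta> w)))^2)"
 unfolding dif_resampled
 by (rule nnE_resampled[of "%\<mu>. (diff_op z \<phi> \<mu>)^4 * (u (diff_op z \<phi> \<mu>))^2"] nnE_resampled[of "%\<mu>. (diff_op z \<phi> \<mu>)^4"] nnE_resampled[of "%\<mu>. (u (diff_op z \<phi> \<mu>))^2 * (diff_op z \<phi> \<mu>)^4"], measurable)+

lemma list_gamma4_le: "list_gamma4 P (J k) (res_fun k) u <= gamma4 P M \<eta> \<phi> F u"
proof -
 define g where "g z = rt (nnE P (%w. (diff_op z \<phi> (\<eta> w))^4 * (u (diff_op z \<phi> (\<eta> w)))^2))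
  * epowr (nnE P (%w. \<bar>diff_op z \<phi> (\<eta> w)\<bar>^4)) (1/4)" for z
 define c where "c = ennreal (1/2) * epowr (nnE P (%w. (F w)^4)) (1/4) + ennreal (sqrt (2 * pi) / 8)"
 have [measurable]: "g : bmeas M" unfolding g_def [abs_def] nn_expect_def by measurable
 have "nnE P (%w. (F w)^4) = nnE P (%w. (\<phi> (\<eta> w))^4)"
  unfolding nn_expect_def by (rule nn_integral_cong_AE) (use F_eq in eventually_elim, simp)
 also have "... = list_mean k (%p. (res_fun k p)^4)"
  unfolding res_fun_def by (rule nnE_resampled[of "%\<mu>. (\<phi> \<mu>)^4", symmetric]) measurable
 finally have "list_gamma4 P (J k) (res_fun k) u = c * (NINT z|J k. g z)"
  unfolding list_gamma4_def g_def c_def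
  by (intro arg_cong2[where f = "(*)"] nn_integral_cong) (simp_all add: fourth_moments_resampled)
 also have "... <= c * (NINT z|M. g z)" by (intro mult_left_mono nn_integral_local_le) simp_all
 finally show ?thesis unfolding gamma4_def g_def c_def .
qed

lemma list_gamma5_le: "list_gamma5 P (J k) (res_fun k) u <= gamma5 P M \<eta> \<phi> u"
proof -
 define g where "g z = rt (nnE P (%w. (u (diff_op z \<phi> (\<eta> w)))^2 * (diff_op z \<phi> (\<eta> w))^4))
  * rt (nnE P (%w. (diff_op z \<phi> (\<eta> w))^4))" for z
 have [measurable]: "g : bmeas M" unfolding g_def [abs_def] nn_expect_def by measurable
 have "list_gamma5 P (J k) (res_fun k) u = rt (NINT z|J k. g z)"
  unfolding list_gamma5_def g_def by (intro arg_cong2[where f = epowr] nn_integral_cong) (simp_all add: fourth_moments_resampled)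
 also have "... <= rt (NINT z|M. g z)" by (intro epowr_mono nn_integral_local_le) simp_all
 finally show ?thesis unfolding gamma5_def g_def .
qed

lemma list_gamma6_le: "list_gamma6 P (J k) (res_fun k) u <= gamma6 P M \<eta> \<phi> u"
proof -
 let ?c = "%z1. (%\<mu>. u (diff_op z1 \<phi> \<mu>) * diff_op z1 \<phi> \<mu>)"
 define a where "a z = rt (nnE P (%w. \<bar>diff_op z \<phi> (\<eta> w)\<bar>^4))" for z
 define b where "b z = rt (nnE P (%w. (u (diff_op z \<phi> (\<eta> w)))^2 * (diff_op z \<phi> (\<eta> w))^4))" for z
 define c where "c z1 z2 = rt (nnE P (%w. (diff_op z2 (?c z1) (\<eta> w))^4))" for z1 z2
 define d where "d z1 z2 = rt (nnE P (%w. \<bar>diff2_op z2 z1 \<phi> (\<eta> w)\<bar>^4))" for z1 z2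
 define h where "h = (%(z1, z2). c z1 z2 * a z1 + b z1 * d z1 z2 + c z1 z2 * d z1 z2)"
 have [measurable]: "h : bmeas (M >< M)"
  unfolding h_def a_def b_def c_def d_def nn_expect_def diff2_op_def split_def by measurable
 have c: "list_mean k (%p. (dif (damped_dif u (res_fun k) z1) z2 p)^4) = nnE P (%w. (diff_op z2 (?c z1) (\<eta> w))^4)"
  if [measurable]: "z1 : space M" "z2 : space M" for z1 z2
  unfolding dif_damped_resampled by (rule nnE_resampled[of "%\<mu>. (diff_op z2 (?c z1) \<mu>)^4"]) measurable
 have d: "list_mean k (%p. (dif (dif (res_fun k) z1) z2 p)^4) = nnE P (%w. (diff2_op z2 z1 \<phi> (\<eta> w))^4)"
  if [measurable]: "z1 : space M" "z2 : space M" for z1 z2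
  unfolding dif2_resampled diff2_op_def by (rule nnE_resampled[of "%\<mu>. (diff_op z2 (diff_op z1 \<phi>) \<mu>)^4"]) measurable
 have "list_gamma6 P (J k) (res_fun k) u = rt (3 * (NINT z1|J k. NINT z2|J k. h (z1, z2)))"
  unfolding list_gamma6_def h_def a_def b_def c_def d_def
  by (intro arg_cong2[where f = epowr] arg_cong2[where f = "(*)"] nn_integral_cong refl) (simp_all add: fourth_moments_resampled c d)
 also have "... <= rt (3 * (NINT q|(M >< M). h q))"
  by (intro epowr_mono mult_left_mono pair_le) simp_all
 finally show ?thesis unfolding gamma6_def h_def a_def b_def c_def d_def by (simp add: Let_def split_def)
qed

lemma list_gamma_le: "list_gamma P (J k) (res_fun k) u \<le>
  gamma1 P M \<eta> \<phi> + gamma2 P M \<eta> \<phi> + gamma3_bar P M \<eta> \<phi> u + gamma4 P M \<eta> \<phi> F u + gamma5 P M \<eta> \<phi> u + gamma6 P M \<eta> \<phi> u"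
 unfolding list_gamma_def
 by (intro add_mono list_gamma1_le list_gamma2_le list_gamma3_le list_gamma4_le list_gamma5_le list_gamma6_le)

section \<open>The bound for each half-line\<close>

lemma square_integrable_phi: "integrable P (%w. (\<phi> (\<eta> w))^2)" and integrable_phi: "integrable P (%w. \<phi> (\<eta> w))"
proof -
 show 2: "integrable P (%w. (\<phi> (\<eta> w))^2)"
  by (rule iffD1[OF integrable_cong_AE F2]) (measurable, use F_eq in eventually_elim, simp)
 show "integrable P (%w. \<phi> (\<eta> w))" by (rule P.square_integrable_imp_integrable[OF _ 2]) measurable
qed

definition target where "target = gamma1 P M \<eta> \<phi> + gamma2 P M \<eta> \<phi> + gamma3_bar P M \<eta> \<phi> u
 + gamma4 P M \<eta> \<phi> F u + gamma5 P M \<eta> \<phi> u + gamma6 P M \<eta> \<phi> u"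

text \<open>Conditionally on the points outside \<open>E k\<close> the functional need not be standardized. With \<open>c1\<close> and \<open>c2\<close> its first
 two conditional moments, the bracket left over by \<open>stein_functional\<close> has conditional mean \<open>a * (1 - c2)\<close>, and the product of the
 conditional means is controlled by \<open>c1\<close>.\<close>

lemma half_line_resampled:
 assumes mean: "(LINT w|P. \<phi> (\<eta> w)) = 0" and var: "(LINT w|P. (\<phi> (\<eta> w))^2) = 1"
 shows "eabs ((LINT w|P. of_bool (\<phi> (\<eta> w) <= x) - std_cdf x)) <= target
  + (3 * deviation P M \<eta> E k (%\<mu>. (\<phi> \<mu>)^2) + ennreal (2 + stein_bound) * deviation P M \<eta> E k \<phi>)"
proof -
 let ?h = "(LINT w|P. of_bool (\<phi> (\<eta> w) <= x) - std_cdf x)"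
 let ?L = "J k" and ?N = "Psp P (J k)"
 interpret Q: prob_space "Poi ?L" by (rule prob_space_Poi[OF finite_intensity])
 interpret PQ: pair_prob_space P "Poi ?L" ..
 interpret N: prob_space ?N by (rule prob_space_Psp[OF P finite_intensity])
 define Y where "Y = res_fun k"
 have Yf: "functional P ?L Y" unfolding Y_def by (rule res_fun)
 note [measurable] = functional_meas[OF Yf]
 have Y: "Y p = \<phi> (conf k p)" for p by (simp add: Y_def res_fun_def)
 note ctx = P finite_intensity[of k] Yf energy_resampled[of k, folded Y_def] u_meas u
 define a where "a = mean_slope ?L Y x"
 define G where "G = stein_functional ?L Y x"
 have G: "G p = a (fst p) * Y p - stein_f x (Y p)" for p
  unfolding G_def a_def by (rule stein_functional_def[OF ctx])
 have a1: "\<bar>a w\<bar> <= 1" for w unfolding a_def by (rule abs_mean_slope_le[OF ctx])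
 have am[measurable]: "a : bmeas P" unfolding a_def by (rule mean_slope_measurable[OF ctx])
 have a: "a w = (LINT xs|Poi ?L. stein_g x (Y (w, xs)))" for w
  unfolding a_def by (rule mean_slope_def[OF ctx])
 have Y2: "integrable ?N (%p. (Y p)^2)"
  unfolding Y by (rule integrable_resampled[OF P E E_fin \<eta> _ square_integrable_phi]) measurable
 have Y1: "integrable ?N Y"
  by (rule N.square_integrable_imp_integrable[OF _ Y2]) measurable
 have fb: "\<bar>stein_f x w\<bar> <= stein_bound" for w using stein_f_nonneg[of x w] stein_f_le[of x w] by simp
 have k0: "0 <= stein_bound" by (simp add: stein_bound_def)
 have gi: "integrable ?N (%p. stein_g x (Y p))" by (rule N.integrable_bounded[OF _ abs_stein_g_le]) measurable
 have fi: "integrable ?N (%p. stein_f x (Y p))" by (rule N.integrable_bounded[OF _ fb]) measurable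
 have yf: "integrable ?N (%p. Y p * stein_f x (Y p))"
 proof (rule Bbound)
  show "integrable ?N (%p. Y p * stein_bound)" using Y1 by simp
  show "AE p in ?N. norm (Y p * stein_f x (Y p)) <= norm (Y p * stein_bound)"
   using fb k0 by (intro AE_I2) (simp add: abs_mult mult_left_mono)
 qed measurable
 have ay: "integrable ?N (%p. a (fst p) * (Y p)^2)"
  by (rule Bbound[OF Y2]) (measurable, intro AE_I2, simp add: abs_mult mult_left_le_one_le a1)
 have yG: "integrable ?N (%p. Y p * G p)"
  using Bidiff[OF ay yf] by (simp add: G algebra_simps power2_eq_square)
 define c1 where "c1 = cmean M \<eta> E k \<phi>"
 define c2 where "c2 = cmean M \<eta> E k (%\<mu>. (\<phi> \<mu>)^2)"
 have c1: "c1 w = (LINT xs|Poi ?L. Y (w, xs))" and c2: "c2 w = (LINT xs|Poi ?L. (Y (w, xs))^2)" for w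
  by (simp_all add: c1_def c2_def cmean_def[OF P E E_fin \<eta>] Y)
 have [measurable]: "c1 : bmeas P" "c2 : bmeas P"
  unfolding c1_def c2_def by (rule cmean_measurable[OF P E E_fin \<eta>], measurable)+
 define B where "B w = c1 w * (LINT xs|Poi ?L. G (w, xs))" for w
 have Gf[measurable]: "G : bmeas (P >< seqs ?L)" unfolding G [abs_def] by measurable
 have slices: "AE w in P. integrable (Poi ?L) (%xs. Y (w, xs)) \<and> integrable (Poi ?L) (%xs. (Y (w, xs))^2)
  \<and> integrable (Poi ?L) (%xs. stein_g x (Y (w, xs))) \<and> integrable (Poi ?L) (%xs. stein_f x (Y (w, xs)))
  \<and> integrable (Poi ?L) (%xs. Y (w, xs) * stein_f x (Y (w, xs)))"
  using PQ.AE_integrable_fst'[OF Y1[unfolded Psp_def]] PQ.AE_integrable_fst'[OF Y2[unfolded Psp_def]]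
   PQ.AE_integrable_fst'[OF gi[unfolded Psp_def]] PQ.AE_integrable_fst'[OF fi[unfolded Psp_def]]
   PQ.AE_integrable_fst'[OF yf[unfolded Psp_def]]
  by eventually_elim simp
 have jensen: "AE w in P. (c1 w)^2 <= c2 w"
  using slices
 proof eventually_elim
  case (elim w)
  then show ?case
   using Q.variance_eq[of "%xs. Y (w, xs)"] Q.variance_positive[of "%xs. Y (w, xs)"] by (simp add: c1 c2)
 qed
 define m where "m w = (LINT xs|Poi ?L. stein_f x (Y (w, xs)))" for w
 have Beq: "AE w in P. B w = a w * (c1 w)^2 - c1 w * m w"
  using slices by eventually_elim (simp add: B_def G c1 m_def power2_eq_square algebra_simps)
 have fm: "\<bar>m w\<bar> <= stein_bound" for w
  using abs_integral_le_mass[OF Q.finite_measure_axioms fb, of "%xs. Y (w, xs)"] Q.prob_space by (simp add: m_def mult.commute)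
 have ac: "\<bar>a w * (c1 w)^2\<bar> <= 1 * (c1 w)^2" for w unfolding abs_mult using a1 by (intro mult_mono) simp_all
 have cm: "\<bar>c1 w * m w\<bar> <= stein_bound * \<bar>c1 w\<bar>" for w
  unfolding abs_mult by (subst mult.commute) (rule mult_right_mono[OF fm], simp)
 have dev: "(NINT w|P. eabs (c1 w)) = deviation P M \<eta> E k \<phi>" "(NINT w|P. eabs (c2 w - 1)) = deviation P M \<eta> E k (%\<mu>. (\<phi> \<mu>)^2)"
  by (simp_all add: deviation_def[OF P E E_fin \<eta>] c1_def c2_def mean var)
 have c1i: "integrable P c1"
  using PQ.integrable_fst'[OF Y1[unfolded Psp_def]] by (simp add: c1 [abs_def])
 have c2i: "integrable P c2"
  using PQ.integrable_fst'[OF Y2[unfolded Psp_def]] by (simp add: c2 [abs_def])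
 have Bm[measurable]: "B : bmeas P" unfolding B_def [abs_def] by measurable
 have Bi: "integrable P B"
 proof (rule Bbound)
  show "integrable P (%w. c2 w + stein_bound * \<bar>c1 w\<bar>)" using c1i c2i by simp
  show "AE w in P. norm (B w) <= norm (c2 w + stein_bound * \<bar>c1 w\<bar>)"
   using jensen Beq
  proof eventually_elim
   case (elim w)
   then have "\<bar>B w\<bar> <= c2 w + stein_bound * \<bar>c1 w\<bar>" using ac[of w] cm[of w] by linarith
   then show ?case by simp
  qed
 qed measurable
 have gay: "integrable ?N (%p. stein_g x (Y p) - a (fst p) * (Y p)^2)" by (rule Bidiff[OF gi ay])
 define D where "D w = (LINT xs|Poi ?L. stein_g x (Y (w, xs)) - a w * (Y (w, xs))^2)" for w
 have Di: "integrable P D"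
  using PQ.integrable_fst'[OF gay[unfolded Psp_def]] by (simp add: D_def [abs_def])
 have Deq: "AE w in P. D w = a w - a w * c2 w"
  using slices by eventually_elim (simp add: D_def a[symmetric] c2)
 define q where "q = (LINT p|?N. Y p * G p) - (LINT w|P. B w)"
 have q: "eabs q <= target"
 proof -
  have "eabs q <= list_gamma P ?L Y u"
   unfolding q_def B_def c1 G_def by (rule stein_covariance[OF ctx Y2])
  also have "... <= target" unfolding target_def Y_def by (rule list_gamma_le)
  finally show ?thesis .
 qed
 have "?h = (LINT p|?N. of_bool (Y p <= x) - std_cdf x)"
  unfolding Y by (rule integral_resampled(1)[OF P E E_fin \<eta>, symmetric])
   (measurable, rule P.integrable_bounded[where C = 1], measurable, use std_cdf_nonneg[of x] std_cdf_le_1[of x] in \<open>auto simp: of_bool_def\<close>)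
 also have "... = (LINT p|?N. Y p * G p + (stein_g x (Y p) - a (fst p) * (Y p)^2))"
  by (rule Bcong) (simp add: G stein_g_def power2_eq_square algebra_simps of_bool_def)
 also have "... = (LINT p|?N. Y p * G p) + (LINT p|?N. stein_g x (Y p) - a (fst p) * (Y p)^2)"
  by (rule Badd[OF yG gay])
 also have "(LINT p|?N. stein_g x (Y p) - a (fst p) * (Y p)^2) = (LINT w|P. D w)"
  unfolding Psp_def using PQ.integral_fst'[OF gay[unfolded Psp_def]] by (simp add: D_def)
 also have "(LINT p|?N. Y p * G p) + (LINT w|P. D w) = q + (LINT w|P. D w + B w)"
  using Badd[OF Di Bi] by (simp add: q_def)
 finally have "eabs (?h) <= eabs q + eabs ((LINT w|P. D w + B w))"
  by (simp add: ennreal_plus[symmetric] ennreal_leI del: ennreal_plus)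
 also have "eabs ((LINT w|P. D w + B w)) <= (NINT w|P. eabs (D w + B w))"
  unfolding real_norm_def[symmetric] by (rule integral_norm_bound_ennreal[OF Biadd[OF Di Bi]])
 also have "... <= (NINT w|P. 3 * eabs (c2 w - 1) + ennreal (2 + stein_bound) * eabs (c1 w))"
 proof (rule nn_integral_mono_AE)
  show "AE w in P. eabs (D w + B w) <= 3 * eabs (c2 w - 1) + ennreal (2 + stein_bound) * eabs (c1 w)"
   using jensen Beq Deq
  proof eventually_elim
   case (elim w)
   have 1: "\<bar>a w * (1 - c2 w)\<bar> <= 1 * \<bar>c2 w - 1\<bar>" unfolding abs_mult using a1 by (intro mult_mono) simp_all
   \<comment> \<open>If \<open>c1\<close> is large then so is \<open>c2\<close>, because \<open>c1^2 \<le> c2\<close>; this avoids any bound on the second moment of \<open>c1\<close>.\<close>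
   have 4: "(c1 w)^2 <= 2 * \<bar>c1 w\<bar> + 2 * \<bar>c2 w - 1\<bar>"
   proof (cases "\<bar>c1 w\<bar> <= 2")
    case True
    then have "\<bar>c1 w\<bar> * \<bar>c1 w\<bar> <= 2 * \<bar>c1 w\<bar>" by (intro mult_right_mono) simp_all
    moreover have "v <= 2 * C + 2 * A" if "v <= 2 * C" "0 <= A" for v C A :: real using that by simp
    ultimately show ?thesis by (simp only: power2_eq_square abs_mult_self_eq abs_ge_zero)
   next
    case False
    then have "2^2 <= \<bar>c1 w\<bar>^2" by (intro power_mono) simp_all
    then have "4 <= (c1 w)^2" by simp
    moreover have "v <= 2 * C + 2 * A" if "v <= w" "w - 1 <= A" "4 <= v" "0 <= C" for v w C A :: real using that by linarith
    ultimately show ?thesis using elim(1) abs_ge_self abs_ge_zero by blast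
   qed
   have "D w + B w = a w * (1 - c2 w) + a w * (c1 w)^2 - c1 w * m w"
    unfolding elim by (simp add: algebra_simps)
   then have "\<bar>D w + B w\<bar> <= 3 * \<bar>c2 w - 1\<bar> + (2 + stein_bound) * \<bar>c1 w\<bar>"
    using 1 ac[of w] cm[of w] 4 unfolding distrib_right by linarith
   then have "eabs (D w + B w) <= ennreal (3 * \<bar>c2 w - 1\<bar> + (2 + stein_bound) * \<bar>c1 w\<bar>)" by (rule ennreal_leI)
   also have "... = 3 * eabs (c2 w - 1) + ennreal (2 + stein_bound) * eabs (c1 w)"
    using k0 by (simp add: ennreal_plus ennreal_mult)
   finally show ?case .
  qed
 qed
 also have "... = 3 * (NINT w|P. eabs (c2 w - 1)) + ennreal (2 + stein_bound) * (NINT w|P. eabs (c1 w))"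
  by (simp add: nn_integral_add nn_integral_cmult)
 finally have "eabs (?h) <= eabs q
  + (3 * deviation P M \<eta> E k (%\<mu>. (\<phi> \<mu>)^2) + ennreal (2 + stein_bound) * deviation P M \<eta> E k \<phi>)"
  unfolding dev by this (rule add_left_mono, assumption)+
 then show ?thesis by (rule order_trans) (rule add_right_mono[OF q])
qed

lemma half_line:
 assumes mean: "(LINT w|P. \<phi> (\<eta> w)) = 0" and var: "(LINT w|P. (\<phi> (\<eta> w))^2) = 1"
 shows "eabs (measure P {w : space P. F w <= x} - std_cdf x) <= target"
proof -
 let ?h = "(LINT w|P. of_bool (\<phi> (\<eta> w) <= x) - std_cdf x)"
 have "(%k. target + (3 * deviation P M \<eta> E k (%\<mu>. (\<phi> \<mu>)^2) + ennreal (2 + stein_bound) * deviation P M \<eta> E k \<phi>))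
  \<longlonglongrightarrow> target + (3 * 0 + ennreal (2 + stein_bound) * 0)"
  by (intro tendsto_add tendsto_const ennreal_tendsto_cmult zero_one_law[OF P E E_fin \<eta>] square_integrable_phi integrable_phi) simp_all
 then have "eabs (?h) <= target + (3 * 0 + ennreal (2 + stein_bound) * 0)"
  by (rule LIMSEQ_le_const) (intro exI allI impI half_line_resampled[OF mean var])
 moreover have "?h = measure P {w : space P. F w <= x} - std_cdf x"
 proof -
  have "?h = (LINT w|P. indicat_real {w : space P. F w <= x} w - std_cdf x)"
  proof (rule integral_cong_AE)
   show "AE w in P. of_bool (\<phi> (\<eta> w) <= x) - std_cdf x = indicat_real {w : space P. F w <= x} w - std_cdf x"
    using F_eq AE_space by eventually_elim (simp add: indicator_def)
  qed measurable
  also have "... = measure P {w : space P. F w <= x} - std_cdf x"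
  proof (subst Bdiff)
   show "integrable P (indicat_real {w : space P. F w <= x})"
    by (rule integrable_real_indicator) (measurable, simp add: P.emeasure_eq_measure)
  qed (simp_all add: P.prob_space)
  finally show ?thesis .
 qed
 ultimately show ?thesis by simp
qed

end

lemma normal_distribution_function:
 assumes "distributed Q lborel Z (%x. ennreal (std_normal_density x))"
 shows "measure Q {w : space Q. Z w <= x} = std_cdf x"
proof -
 have Z: "Z : Q ->M lborel" and d: "distr Q lborel Z = density lborel (%x. ennreal (std_normal_density x))"
  using assms by (simp_all add: distributed_def)
 have "measure (distr Q lborel Z) {..x} = measure Q (Z -` {..x} \<inter> space Q)" by (rule measure_distr[OF Z]) simp
 moreover have "Z -` {..x} \<inter> space Q = {w : space Q. Z w <= x}" by auto
 ultimately show ?thesis by (simp add: d std_cdf_def)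
qed

theorem theorem3p3:
  fixes P :: "'w measure" and M :: "'x measure" and \<eta> :: "'w \<Rightarrow> 'x measure"
    and F :: "'w \<Rightarrow> real" and \<phi> :: "'x measure \<Rightarrow> real"
    and Q :: "'v measure" and Z :: "'v \<Rightarrow> real"
    and u :: "real \<Rightarrow> real"
  assumes "prob_space P"
    and "sigma_finite_measure M"
    and "poisson_process P M \<eta>"
    and "poisson_functional_rep P M \<eta> \<phi> F"
    and "integrable P (\<lambda>\<omega>. (F \<omega>)^2)"
    and "integrable (P \<Otimes>\<^sub>M M) (\<lambda>(\<omega>, z). (diff_op z \<phi> (\<eta> \<omega>))^2)"
    and "prob_space.expectation P F = 0"
    and "prob_space.expectation P (\<lambda>\<omega>. (F \<omega>)^2) = 1"
    and "prob_space Q"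
    and "distributed Q lborel Z (\<lambda>x. ennreal (std_normal_density x))"
    and "u \<in> borel_measurable borel"
    and "\<And>x. 0 \<le> u x \<and> u x \<le> 1"
  shows "ennreal (kolmogorov_dist P F Q Z) \<le>
    gamma1 P M \<eta> \<phi> + gamma2 P M \<eta> \<phi> + gamma3_bar P M \<eta> \<phi> u
      + gamma4 P M \<eta> \<phi> F u + gamma5 P M \<eta> \<phi> u + gamma6 P M \<eta> \<phi> u"
proof -
 interpret M: sigma_finite_measure M by fact
 obtain E :: "nat => 'x set" where E: "range E \<subseteq> sets M" "incseq E" "(\<Union>i. E i) = space M" "\<And>i. emeasure M (E i) \<noteq> \<infinity>"
  using M.sigma_finite_incseq by metis
 then have E_fin: "emeasure M (E i) < \<infinity>" for i by (simp add: less_top)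
 note ctx = assms(1) E(1-3) E_fin assms(3,2,4,5,6,11,12)
 note [measurable] = eta_measurable[OF ctx] phi_measurable[OF ctx] F_measurable_P[OF ctx]
 have "(LINT w|P. \<phi> (\<eta> w)) = (LINT w|P. F w)"
 proof (rule integral_cong_AE)
  show "AE w in P. \<phi> (\<eta> w) = F w" using F_eq[OF ctx] by eventually_elim simp
 qed measurable
 then have mean: "(LINT w|P. \<phi> (\<eta> w)) = 0" using assms(7) by simp
 have "(LINT w|P. (\<phi> (\<eta> w))^2) = (LINT w|P. (F w)^2)"
 proof (rule integral_cong_AE)
  show "AE w in P. (\<phi> (\<eta> w))^2 = (F w)^2" using F_eq[OF ctx] by eventually_elim simp
 qed measurable
 then have var: "(LINT w|P. (\<phi> (\<eta> w))^2) = 1" using assms(8) by simp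
 let ?t = "target P M \<eta> F \<phi> u"
 have "ennreal (kolmogorov_dist P F Q Z) <= ?t"
 proof (cases ?t)
  case (real b)
  have "\<bar>measure P {w : space P. F w <= x} - measure Q {w : space Q. Z w <= x}\<bar> <= b" for x
   using half_line[OF ctx mean var, of x] real unfolding normal_distribution_function[OF assms(10)] by (simp add: ennreal_le_iff)
  then have "kolmogorov_dist P F Q Z <= b" unfolding kolmogorov_dist_def by (intro cSUP_least) simp_all
  then show ?thesis using real by (simp add: ennreal_leI)
 qed simp
 then show ?thesis by (simp only: target_def[OF ctx])
qed

end
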